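(* Let $\omega_1,\omega_2\in\mathscr P_E(\mathbf R^{2d})$ and $\omega_0\in\mathscr P_E(\mathbf R^{4d})$ be such that $$\frac{\omega_2(x,\xi+\eta)}{\omega_1(x+y,\xi)}\lesssim\omega_0(x,\xi,\eta,y),\qquad x,y,\xi,\eta\in\mathbf R^d,$$ let $p,q\in[1,\infty]$, and let $a\in W^{p,q}_{(\omega_0)}(\mathbf R^{2d})$. Then $\operatorname{Op}(a)=\operatorname{Op}_0(a)$ from $\Sigma_1(\mathbf R^d)$ to $\Sigma_1'(\mathbf R^d)$ is uniquely extendable to a continuous mapping from $M^{q',p'}_{(\omega_1)}(\mathbf R^d)$ to $W^{p,q}_{(\omega_2)}(\mathbf R^d)$, and $$\|\operatorname{Op}(a)f\|_{W^{p,q}_{(\omega_2)}}\lesssim\|a\|_{W^{p,q}_{(\omega_0)}}\|f\|_{M^{q',p'}_{(\omega_1)}},\qquad f\in M^{q',p'}_{(\omega_1)}(\mathbf R^d).$$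
   Context: General: $f\lesssim g$ means $f\le Cg$ for a constant $C>0$ (in the last estimate, independent of $a$ and $f$). $p'$ is the conjugate exponent of $p$. Weights: a weight on $\mathbf R^n$ is a positive $\omega\in L^\infty_{loc}(\mathbf R^n)$ with $1/\omega\in L^\infty_{loc}(\mathbf R^n)$; it is moderate if there are a positive locally bounded $v$ and $C\ge1$ with $\omega(x+y)\le C\omega(x)v(y)$ for all $x,y$. $\mathscr P_E(\mathbf R^n)$ is the set of all moderate weights on $\mathbf R^n$. Gelfand–Shilov space: $\Sigma_1(\mathbf R^n)$ is the Fréchet space of all $f\in C^\infty(\mathbf R^n)$ with $\sup_{\alpha,\beta,x}\frac{|x^\alpha\partial^\beta f(x)|}{h^{|\alpha+\beta|}\alpha!\,\beta!}<\infty$ for every $h>0$; $\Sigma_1'(\mathbf R^n)$ is its dual. Fourier and short-time Fourier transform: $\widehat f(\xi)=(2\pi)^{-n/2}\int f(x)e^{-i\langle x,\xi\rangle}dx$ on $\mathbf R^n$, and $V_\phi f(x,\xi)=\mathscr F(f\,\overline{\phi(\cdot-x)})(\xi)$, $x,\xi\in\mathbf R^n$, with the Gaussian window $\phi(x)=\pi^{-n/4}e^{-|x|^2/2}$. Spaces (moderate weight $\omega$ on $\mathbf R^{2n}$, $p,q\in[1,\infty]$): $M^{p,q}_{(\omega)}(\mathbf R^n)$ is the space of all $f\in\Sigma_1'(\mathbf R^n)$ with finite norm obtained by taking first the $L^p(\mathbf R^n)$ norm of $V_\phi f(x,\xi)\,\omega(x,\xi)$ in $x$ and then the $L^q(\mathbf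 R^n)$ norm in $\xi$. $W^{p,q}_{(\omega)}(\mathbf R^n)$ is the space of all $f\in\Sigma_1'(\mathbf R^n)$ with finite norm obtained by taking first the $L^q(\mathbf R^n)$ norm of $V_\phi f(x,\xi)\,\omega(x,\xi)$ in $\xi$ and then the $L^p(\mathbf R^n)$ norm in $x$. For symbols $a$ on $\mathbf R^{2d}$ ($n=2d$), the variables of $V_\phi a$ and $\omega_0$ are written $(x,\xi,\eta,y)$ with position variable $(x,\xi)$ and frequency variable $(\eta,y)$. (For moderate weights these coincide with the paper's definition, which lets $f$ range over a larger space.) Pseudo-differential operators: for $a\in\Sigma_1(\mathbf R^{2d})$, $(\operatorname{Op}(a)f)(x)=(2\pi)^{-d}\iint a(x,\xi)f(y)e^{i\langle x-y,\xi\rangle}\,dy\,d\xi$; for $a\in\Sigma_1'(\mathbf R^{2d})$, $\operatorname{Op}(a)$ is the continuous operator from $\Sigma_1(\mathbf R^d)$ to $\Sigma_1'(\mathbf R^d)$ with distribution kernel $(2\pi)^{-d/2}(\mathscr F_2^{-1}a)(x,x-y)$, with $\mathscr F_2$ the partial Fourier transform in the second variable.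
   Formalization: Uniqueness among norm-continuous extensions is stated for p,q>1 only, as it fails if p=1 or q=1 (Σ_1 is not norm dense in M^{q',p'}); for all p,q uniqueness is stated among maps continuous from the weak topology given by M^{q,p}_{(1/ω_1)} to the weak* topology of Σ_1'. *)

theory Defs
  imports "HOL-Analysis.Analysis"
begin

text \<open>
  Everything is developed over an arbitrary Euclidean space \<open>'a\<close> in the role of \<open>R^n\<close>,
  \<open>n = DIM('a)\<close>, with coordinates taken with respect to \<open>Basis\<close>.  In particular \<open>'a \<times> 'a\<close>
  and \<open>('a \<times> 'a) \<times> ('a \<times> 'a)\<close> are \<open>R^(2n)\<close> and \<open>R^(4n)\<close>.
\<close>

section \<open>Weights\<close>

definition Linf_loc :: "('a::euclidean_space \<Rightarrow> real) \<Rightarrow> bool" where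
  "Linf_loc f \<longleftrightarrow> f \<in> borel_measurable lebesgue \<and>
     (\<forall>K. compact K \<longrightarrow> (\<exists>C. AE x in lebesgue. x \<in> K \<longrightarrow> \<bar>f x\<bar> \<le> C))"

definition weight :: "('a::euclidean_space \<Rightarrow> real) \<Rightarrow> bool" where
  "weight \<omega> \<longleftrightarrow> (\<forall>x. 0 < \<omega> x) \<and> Linf_loc \<omega> \<and> Linf_loc (\<lambda>x. 1 / \<omega> x)"

definition moderate_weight :: "('a::euclidean_space \<Rightarrow> real) \<Rightarrow> bool" where
  "moderate_weight \<omega> \<longleftrightarrow> weight \<omega> \<and>
     (\<exists>v C. (\<forall>x. 0 < v x) \<and> (\<forall>K. compact K \<longrightarrow> bounded (v ` K)) \<and> 1 \<le> (C::real) \<and>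
        (\<forall>x y. \<omega> (x + y) \<le> C * \<omega> x * v y))"

section \<open>The Gelfand--Shilov space and its dual\<close>

definition partial :: "'a::euclidean_space \<Rightarrow> ('a \<Rightarrow> complex) \<Rightarrow> 'a \<Rightarrow> complex" where
  "partial b f = (\<lambda>x. frechet_derivative f (at x) b)"

definition partials :: "'a::euclidean_space list \<Rightarrow> ('a \<Rightarrow> complex) \<Rightarrow> 'a \<Rightarrow> complex" where
  "partials bs f = foldr partial bs f"

definition smooth :: "('a::euclidean_space \<Rightarrow> complex) \<Rightarrow> bool" where
  "smooth f \<longleftrightarrow> (\<forall>bs\<in>lists Basis. \<forall>x. partials bs f differentiable (at x))"

definition mi_abs :: "('a::euclidean_space \<Rightarrow> nat) \<Rightarrow> nat" where
  "mi_abs \<alpha> = (\<Sum>b\<in>Basis. \<alpha> b)"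

definition mi_fact :: "('a::euclidean_space \<Rightarrow> nat) \<Rightarrow> real" where
  "mi_fact \<alpha> = (\<Prod>b\<in>Basis. fact (\<alpha> b))"

definition mi_power :: "'a::euclidean_space \<Rightarrow> ('a \<Rightarrow> nat) \<Rightarrow> real" where
  "mi_power x \<alpha> = (\<Prod>b\<in>Basis. (x \<bullet> b) ^ \<alpha> b)"

text \<open>
  A multi-index \<open>\<alpha>\<close> is a function on \<open>Basis\<close>.  For the derivatives, the multi-index \<open>\<beta>\<close> is
  given by a list \<open>bs\<close> of basis vectors in which \<open>b\<close> occurs \<open>\<beta> b\<close> times, that is,
  \<open>\<beta> = count_list bs\<close>; partial derivatives of smooth functions commute, so the order in
  \<open>bs\<close> is immaterial and the supremum is the one over all pairs \<open>(\<alpha>, \<beta>)\<close>.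
\<close>

definition gs_norm :: "real \<Rightarrow> ('a::euclidean_space \<Rightarrow> complex) \<Rightarrow> ennreal" where
  "gs_norm h f = (SUP \<alpha>. SUP bs\<in>lists Basis. SUP x.
     ennreal (cmod (of_real (mi_power x \<alpha>) * partials bs f x) /
       (h ^ (mi_abs \<alpha> + mi_abs (count_list bs)) * mi_fact \<alpha> * mi_fact (count_list bs))))"

definition Sigma1 :: "('a::euclidean_space \<Rightarrow> complex) set" where
  "Sigma1 = {f. smooth f \<and> (\<forall>h>0. gs_norm h f < top)}"

text \<open>
  \<open>gs_norm h\<close> increases as \<open>h\<close> decreases, so a linear functional on \<open>Sigma1\<close> is continuous
  iff it is bounded by a multiple of a single \<open>gs_norm h\<close>.  Functionals are total functions in
  HOL; they are put to \<open>0\<close> outside \<open>Sigma1\<close>, so that equality of distributions is equality.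
  The pairing of distributions and test functions is bilinear.
\<close>

type_synonym 'a dual = "('a \<Rightarrow> complex) \<Rightarrow> complex"

definition Sigma1' :: "'a::euclidean_space dual set" where
  "Sigma1' = {u.
     (\<forall>f\<in>Sigma1. \<forall>g\<in>Sigma1. u (\<lambda>x. f x + g x) = u f + u g) \<and>
     (\<forall>c. \<forall>f\<in>Sigma1. u (\<lambda>x. c * f x) = c * u f) \<and>
     (\<exists>h>0. \<exists>C::real. \<forall>f\<in>Sigma1. ennreal (cmod (u f)) \<le> ennreal C * gs_norm h f) \<and>
     (\<forall>f. f \<notin> Sigma1 \<longrightarrow> u f = 0)}"

definition dist_of :: "('a::euclidean_space \<Rightarrow> complex) \<Rightarrow> 'a dual" where
  "dist_of f = (\<lambda>g. if g \<in> Sigma1 then (LINT x|lborel. f x * g x) else 0)"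

section \<open>Short-time Fourier transform, modulation spaces\<close>

definition gauss :: "'a::euclidean_space \<Rightarrow> complex" where
  "gauss x = of_real (pi powr (- real DIM('a) / 4) * exp (- (norm x)\<^sup>2 / 2))"

text \<open>
  The Fourier transform of the distribution \<open>u\<close> times the conjugate of \<open>gauss(. - x)\<close>, evaluated at \<open>\<xi>\<close>.
\<close>

definition stft :: "'a::euclidean_space dual \<Rightarrow> 'a \<Rightarrow> 'a \<Rightarrow> complex" where
  "stft u x \<xi> = of_real ((2 * pi) powr (- real DIM('a) / 2)) *
     u (\<lambda>y. cnj (gauss (y - x)) * exp (- \<i> * of_real (y \<bullet> \<xi>)))"

text \<open>\<open>enn_powr\<close> is used for positive exponents only.\<close>

definition enn_powr :: "ennreal \<Rightarrow> real \<Rightarrow> ennreal" where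
  "enn_powr t r = (if t = top then top else ennreal (enn2real t powr r))"

definition Lp_norm :: "ennreal \<Rightarrow> ('a::euclidean_space \<Rightarrow> ennreal) \<Rightarrow> ennreal" where
  "Lp_norm p g = (if p = top then Inf {c. AE x in lebesgue. g x \<le> c}
     else enn_powr (\<integral>\<^sup>+ x. enn_powr (g x) (enn2real p) \<partial>lebesgue) (1 / enn2real p))"

definition M_norm ::
  "ennreal \<Rightarrow> ennreal \<Rightarrow> ('a::euclidean_space \<times> 'a \<Rightarrow> real) \<Rightarrow> 'a dual \<Rightarrow> ennreal" where
  "M_norm p q \<omega> u =
     Lp_norm q (\<lambda>\<xi>. Lp_norm p (\<lambda>x. ennreal (cmod (stft u x \<xi>) * \<omega> (x, \<xi>))))"

definition W_norm ::
  "ennreal \<Rightarrow> ennreal \<Rightarrow> ('a::euclidean_space \<times> 'a \<Rightarrow> real) \<Rightarrow> 'a dual \<Rightarrow> ennreal" where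
  "W_norm p q \<omega> u =
     Lp_norm p (\<lambda>x. Lp_norm q (\<lambda>\<xi>. ennreal (cmod (stft u x \<xi>) * \<omega> (x, \<xi>))))"

definition M_space ::
  "ennreal \<Rightarrow> ennreal \<Rightarrow> ('a::euclidean_space \<times> 'a \<Rightarrow> real) \<Rightarrow> 'a dual set" where
  "M_space p q \<omega> = {u\<in>Sigma1'. M_norm p q \<omega> u < top}"

definition W_space ::
  "ennreal \<Rightarrow> ennreal \<Rightarrow> ('a::euclidean_space \<times> 'a \<Rightarrow> real) \<Rightarrow> 'a dual set" where
  "W_space p q \<omega> = {u\<in>Sigma1'. W_norm p q \<omega> u < top}"

section \<open>Pseudo-differential operators\<close>

definition pft2_inv ::
  "('a::euclidean_space \<times> 'a \<Rightarrow> complex) \<Rightarrow> 'a \<times> 'a \<Rightarrow> complex" where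
  "pft2_inv \<Psi> = (\<lambda>(x, z). of_real ((2 * pi) powr (- real DIM('a) / 2)) *
     (LINT \<xi>|lborel. \<Psi> (x, \<xi>) * exp (\<i> * of_real (z \<bullet> \<xi>))))"

text \<open>
  On distributions, \<open>F\<^sub>2\<close> inverse is the transpose of itself, and the substitution
  \<open>(x, y) \<mapsto> (x, x - y)\<close> (an involution with Jacobian \<open>1\<close> in absolute value) is transposed to
  the same substitution in the test function.
\<close>

definition dist_pft2_inv :: "('a::euclidean_space \<times> 'a) dual \<Rightarrow> ('a \<times> 'a) dual" where
  "dist_pft2_inv a = (\<lambda>\<Psi>. if \<Psi> \<in> Sigma1 then a (pft2_inv \<Psi>) else 0)"

definition Op_kernel :: "('a::euclidean_space \<times> 'a) dual \<Rightarrow> ('a \<times> 'a) dual" where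
  "Op_kernel a = (\<lambda>\<Psi>. of_real ((2 * pi) powr (- real DIM('a) / 2)) *
     dist_pft2_inv a (\<lambda>(x, y). \<Psi> (x, x - y)))"

definition Op ::
  "('a::euclidean_space \<times> 'a) dual \<Rightarrow> ('a \<Rightarrow> complex) \<Rightarrow> 'a dual" where
  "Op a f = (\<lambda>g. if g \<in> Sigma1 then Op_kernel a (\<lambda>(x, y). g x * f y) else 0)"

section \<open>Extensions\<close>

definition linear_op :: "'a::euclidean_space dual set \<Rightarrow> ('a dual \<Rightarrow> 'b::euclidean_space dual) \<Rightarrow> bool" where
  "linear_op X T \<longleftrightarrow>
     (\<forall>u\<in>X. \<forall>w\<in>X. T (\<lambda>g. u g + w g) = (\<lambda>g. T u g + T w g)) \<and>
     (\<forall>c. \<forall>u\<in>X. T (\<lambda>g. c * u g) = (\<lambda>g. c * T u g))"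

definition extends_Sigma1 ::
  "'a::euclidean_space dual set \<Rightarrow> (('a \<Rightarrow> complex) \<Rightarrow> 'b::euclidean_space dual) \<Rightarrow>
   ('a dual \<Rightarrow> 'b dual) \<Rightarrow> bool" where
  "extends_Sigma1 X A T \<longleftrightarrow> (\<forall>f\<in>Sigma1. dist_of f \<in> X \<and> T (dist_of f) = A f)"

text \<open>Continuity of \<open>T\<close> from \<open>X\<close> to \<open>Y\<close>, normed by \<open>NX\<close> and \<open>NY\<close>.\<close>

definition norm_continuous ::
  "'a::euclidean_space dual set \<Rightarrow> ('a dual \<Rightarrow> ennreal) \<Rightarrow>
   'b::euclidean_space dual set \<Rightarrow> ('b dual \<Rightarrow> ennreal) \<Rightarrow> ('a dual \<Rightarrow> 'b dual) \<Rightarrow> bool" where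
  "norm_continuous X NX Y NY T \<longleftrightarrow> T ` X \<subseteq> Y \<and>
     (\<forall>u\<in>X. \<forall>\<epsilon>>0::real. \<exists>\<delta>>0::real. \<forall>w\<in>X.
        NX (\<lambda>g. w g - u g) < ennreal \<delta> \<longrightarrow> NY (\<lambda>g. T w g - T u g) < ennreal \<epsilon>)"

text \<open>
  If \<open>q' = \<infinity>\<close> or \<open>p' = \<infinity>\<close>, \<open>Sigma1\<close> is not norm dense in \<open>M_space q' p' \<omega>\<close>, and norm
  continuous extensions from \<open>Sigma1\<close> are not unique.  Uniqueness then refers to the coarsest
  topology on \<open>M_space q' p' \<omega>\<close> for which the (extended) \<open>L\<^sup>2\<close> form with every element of
  \<open>M_space q p (1 / \<omega>)\<close> is continuous, in which \<open>Sigma1\<close> is always dense.  The \<open>L\<^sup>2\<close> form is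
  expressed through Moyal's identity; \<open>gauss\<close> has \<open>L\<^sup>2\<close> norm \<open>1\<close>.
\<close>

definition L2_form :: "'a::euclidean_space dual \<Rightarrow> 'a dual \<Rightarrow> complex" where
  "L2_form u w = (LINT (x, \<xi>)|lborel. stft u x \<xi> * cnj (stft w x \<xi>))"

definition weak_topology :: "'u set \<Rightarrow> 'w set \<Rightarrow> ('u \<Rightarrow> 'w \<Rightarrow> complex) \<Rightarrow> 'u topology" where
  "weak_topology X Y B =
     pullback_topology X (\<lambda>u. \<lambda>w\<in>Y. B u w) (product_topology (\<lambda>_. euclidean) Y)"

end

theory Submission
  imports Defs "HOL-Probability.Probability" "HOL-Complex_Analysis.Complex_Analysis"
begin

text \<open>
  Everything happens on the side of the short-time Fourier transform.  Test functions are synthesized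
  from time-frequency shifts of the Gaussian, and a continuous functional \<open>u\<close> commutes with the
  synthesis, so \<open>u\<close> is determined by its transform \<open>U\<close>, and \<open>U\<close> is reproduced by a kernel with
  Gaussian decay.  In this representation \<open>Op(a)\<close> is the integral operator
  \<open>(HU)(z) = \<integral> K(z, w) U(w) dw\<close>, where \<open>K(z, w)\<close> pairs \<open>a\<close> with the Rihaczek distribution of two
  shifted Gaussians.  That distribution is itself a shift of a fixed test function, whence
  \<open>|K(z, w)|\<close> is at most a convolution of \<open>|V a|\<close> with a decaying exponential, evaluated at
  \<open>((x, \<xi>), (\<eta>, y))\<close> when \<open>z = (x, \<xi> + \<eta>)\<close> and \<open>w = (x + y, \<xi>)\<close>.  With the weights inserted, the norm
  bound is Hoelder's and Minkowski's inequality for mixed norms, and the same estimates for the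
  transposed kernel give weak continuity.  Uniqueness follows by truncating \<open>U\<close> to balls and
  synthesizing: the resulting test functions converge weakly always, and in norm for finite exponents.
\<close>

section \<open>Integration on Euclidean spaces\<close>

text \<open>The factorial-weighted seminorms are awkward for estimates and are met in two places
  only: they dominate the decay of a test function and of its Fourier transform at every exponential
  rate, and those of \<open>atom z\<close> grow at most exponentially in \<open>z\<close>. All else
  is a balance of rates: a functional or a weight costs some rate, and a kernel that decays at every
  rate pays for it and keeps one unit for integrability. This is the origin of the many
  \<open>r + 1\<close> and \<open>2 * r\<close>. Conversely, decay of \<open>f\<close> and of
  \<open>ft f\<close> at all rates already puts \<open>f\<close> in \<open>Sigma1\<close>, so that
  sheared products and Rihaczek distributions need not be differentiated.

  Infinite exponents shape the second half. Test functions may fail to be norm dense, so the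
  extension cannot be built as a limit: it is defined at once by an absolutely convergent double
  integral, and its agreement with \<open>Op a\<close> on test functions is a separate identity.
  Uniformity in \<open>a\<close> forces each constant of the operator bound to be fixed before the
  symbol.\<close>

lemma lborel_integral_affine:
  fixes f :: "'a::euclidean_space \<Rightarrow> 'b::{banach, second_countable_topology}"
  assumes [measurable]: "f \<in> borel_measurable borel" and c: "c \<noteq> 0"
  shows "(LINT x|lborel. f x) = \<bar>c\<bar> ^ DIM('a) *\<^sub>R (LINT x|lborel. f (t + c *\<^sub>R x))"
  by (subst lborel_affine[OF c, of t], subst integral_density) (simp_all add: integral_distr)

lemma lborel_integrable_affine:
  fixes f :: "'a::euclidean_space \<Rightarrow> 'b::{banach, second_countable_topology}"
  assumes [measurable]: "f \<in> borel_measurable borel" and c: "c \<noteq> 0"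
  shows "integrable lborel f \<longleftrightarrow> integrable lborel (\<lambda>x. f (t + c *\<^sub>R x))"
proof -
  have "integrable lborel (\<lambda>x. \<bar>c\<bar> ^ DIM('a) *\<^sub>R g x) \<longleftrightarrow> integrable lborel g" for g :: "'a \<Rightarrow> 'b"
    using c integrable_scaleR_right[of "inverse (\<bar>c\<bar> ^ DIM('a))" lborel "\<lambda>x. \<bar>c\<bar> ^ DIM('a) *\<^sub>R g x"]
    by (auto intro: integrable_scaleR_right)
  then show ?thesis
    by (subst lborel_affine[OF c, of t], subst integrable_density) (simp_all add: integrable_distr_eq)
qed

lemma lborel_nn_integral_affine:
  fixes f :: "'a::euclidean_space \<Rightarrow> ennreal"
  assumes [measurable]: "f \<in> borel_measurable borel" and c: "c \<noteq> 0"
  shows "(\<integral>\<^sup>+x. f x \<partial>lborel) = ennreal (\<bar>c\<bar> ^ DIM('a)) * (\<integral>\<^sup>+x. f (t + c *\<^sub>R x) \<partial>lborel)"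
  by (subst lborel_affine[OF c, of t], subst nn_integral_density)
     (simp_all add: nn_integral_distr nn_integral_cmult)

lemma
  fixes f :: "'a::euclidean_space \<Rightarrow> real \<Rightarrow> 'b::{real_normed_field, banach, second_countable_topology}"
  assumes f: "\<And>b. b \<in> Basis \<Longrightarrow> integrable lborel (f b)"
  shows lborel_integral_prod: "(LINT x|lborel. (\<Prod>b\<in>Basis. f b (x \<bullet> b))) = (\<Prod>b\<in>Basis. LINT t|lborel. f b t)"
    and lborel_integrable_prod: "integrable lborel (\<lambda>x. \<Prod>b\<in>Basis. f b (x \<bullet> b))"
proof -
  interpret product_sigma_finite "\<lambda>_::'a. lborel :: real measure" ..
  have [measurable]: "b \<in> Basis \<Longrightarrow> f b \<in> borel_measurable borel" for b
    using f[of b] by (auto dest: borel_measurable_integrable)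
  have m[measurable]: "(\<lambda>x::'a. \<Prod>b\<in>Basis. f b (x \<bullet> b)) \<in> borel_measurable borel"
    by (intro borel_measurable_prod) measurable
  show "(LINT x|lborel. (\<Prod>b\<in>Basis. f b (x \<bullet> b))) = (\<Prod>b\<in>Basis. LINT t|lborel. f b t)"
    by (subst lborel_eq, subst integral_distr)
       (auto simp: product_integral_prod[OF finite_Basis f, symmetric] inner_sum_left_Basis)
  show "integrable lborel (\<lambda>x. \<Prod>b\<in>Basis. f b (x \<bullet> b))"
    by (subst lborel_eq, subst integrable_distr_eq)
       (auto intro!: product_integrable_prod[OF finite_Basis f] simp: inner_sum_left_Basis)
qed

text \<open>Comparison with 1 / (1 + t^2). The quadratic Taylor bound for exp (r |t|) dominates both
  1 and t^2; the summands 1 and 2 / r^2 of the constant are the two costs.\<close>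

lemma integrable_exp_neg_abs:
  assumes "r > (0::real)"
  shows "integrable lborel (\<lambda>t::real. exp (- r * \<bar>t\<bar>))"
proof (rule Bochner_Integration.integrable_bound)
  show "integrable lborel (\<lambda>t::real. (1 + 2 / r\<^sup>2) * inverse (1 + t\<^sup>2))"
    using integrable_inverse_1_plus_square
    by (intro integrable_mult_right) (simp add: set_integrable_def einterval_eq_UNIV)
  show "AE t in lborel. norm (exp (- r * \<bar>t\<bar>)) \<le> norm ((1 + 2 / r\<^sup>2) * inverse (1 + t\<^sup>2))"
  proof (rule AE_I2)
    fix t :: real
    have "1 + r * \<bar>t\<bar> + (r * \<bar>t\<bar>)\<^sup>2 / 2 \<le> exp (r * \<bar>t\<bar>)"
      using assms by (intro exp_lower_Taylor_quadratic) auto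
    moreover have "0 \<le> r * \<bar>t\<bar>" using assms by simp
    moreover have "0 \<le> (r * \<bar>t\<bar>)\<^sup>2 / 2" by simp
    ultimately have 1: "1 \<le> exp (r * \<bar>t\<bar>)" and "(r * \<bar>t\<bar>)\<^sup>2 / 2 \<le> exp (r * \<bar>t\<bar>)"
      by linarith+
    from this(2) have "t\<^sup>2 \<le> 2 / r\<^sup>2 * exp (r * \<bar>t\<bar>)"
      using assms by (simp add: field_simps power2_eq_square)
    with 1 have "1 + t\<^sup>2 \<le> (1 + 2 / r\<^sup>2) * exp (r * \<bar>t\<bar>)"
      unfolding distrib_right by linarith
    then show "norm (exp (- r * \<bar>t\<bar>)) \<le> norm ((1 + 2 / r\<^sup>2) * inverse (1 + t\<^sup>2))"
      by (simp add: exp_minus field_simps abs_of_pos add_pos_nonneg)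
  qed
qed simp

text \<open>Each coordinate is bounded by the norm, so the norm dominates the mean of the
  coordinates. The rate \<open>r / DIM('a)\<close> per coordinate then gives a product
  majorant.\<close>

lemma integrable_exp_neg_norm:
  assumes "r > (0::real)"
  shows "integrable lborel (\<lambda>x::'a::euclidean_space. exp (- r * norm x))"
proof (rule Bochner_Integration.integrable_bound)
  let ?s = "r / DIM('a)"
  show "integrable lborel (\<lambda>x::'a. \<Prod>b\<in>Basis. exp (- ?s * \<bar>x \<bullet> b\<bar>))"
    using assms by (intro lborel_integrable_prod integrable_exp_neg_abs) auto
  show "AE x in lborel. norm (exp (- r * norm x)) \<le> norm (\<Prod>b\<in>Basis. exp (- ?s * \<bar>(x::'a) \<bullet> b\<bar>))"
  proof (rule AE_I2)
    fix x :: 'a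
    have "(\<Sum>b\<in>(Basis::'a set). \<bar>x \<bullet> b\<bar>) \<le> (\<Sum>b\<in>(Basis::'a set). norm x)"
      by (intro sum_mono Basis_le_norm)
    then have "(\<Sum>b\<in>(Basis::'a set). \<bar>x \<bullet> b\<bar>) \<le> DIM('a) * norm x" by simp
    then have "?s * (\<Sum>b\<in>(Basis::'a set). \<bar>x \<bullet> b\<bar>) \<le> r * norm x"
      using assms mult_left_mono[of _ _ ?s] by fastforce
    then show "norm (exp (- r * norm x)) \<le> norm (\<Prod>b\<in>Basis. exp (- ?s * \<bar>x \<bullet> b\<bar>))"
      by (simp add: exp_sum[symmetric] sum_negf sum_divide_distrib sum_distrib_left)
  qed
qed simp

text \<open>This is the characteristic function of the standard normal distribution, rescaled by
  \<open>sqrt a\<close>.\<close>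

lemma gaussian_fourier_real:
  assumes a: "a > (0::real)"
  shows "integrable lborel (\<lambda>t. of_real (exp (- a * t\<^sup>2 / 2)) * cis (- (t * s)))"
    and "(LINT t|lborel. of_real (exp (- a * t\<^sup>2 / 2)) * cis (- (t * s))) =
      of_real (sqrt (2 * pi / a) * exp (- s\<^sup>2 / (2 * a)))"
proof -
  define g where "g t = complex_of_real (exp (- a * t\<^sup>2 / 2)) * cis (- (t * s))" for t
  have [measurable]: "cis \<in> borel_measurable borel"
    by (intro borel_measurable_continuous_onI continuous_intros)
  have [measurable]: "g \<in> borel_measurable borel"
    unfolding g_def by measurable
  have sq: "sqrt a > 0" using a by simp
  define h where "h t = std_normal_density t *\<^sub>R cis (- s / sqrt a * t)" for t
  have [measurable]: "h \<in> borel_measurable borel"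
    unfolding h_def by measurable
  have h: "g (0 + inverse (sqrt a) *\<^sub>R t) = sqrt (2 * pi) *\<^sub>R h t" for t
    using a by (simp add: g_def h_def std_normal_density_def power_mult_distrib field_simps scaleR_conv_of_real)
  have "integrable lborel std_normal_density" by simp
  then have ih: "integrable lborel h"
    by (rule Bochner_Integration.integrable_bound) (auto simp: h_def)
  have "(LINT t|lborel. h t) = char std_normal_distribution (- s / sqrt a)"
    unfolding char_def h_def by (subst integral_density) (auto simp: cis_conv_exp)
  also have "\<dots> = of_real (exp (- s\<^sup>2 / (2 * a)))"
    using a by (simp add: char_std_normal_distribution power_divide)
  finally have ch: "(LINT t|lborel. h t) = of_real (exp (- s\<^sup>2 / (2 * a)))" .
  show "integrable lborel g"
    using sq by (subst lborel_integrable_affine[where c="inverse (sqrt a)" and t=0])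
      (simp_all only: h, use ih in auto)
  have "(LINT t|lborel. g t) = \<bar>inverse (sqrt a)\<bar> *\<^sub>R (LINT t|lborel. g (0 + inverse (sqrt a) *\<^sub>R t))"
    using sq by (subst lborel_integral_affine[where c="inverse (sqrt a)" and t=0]) auto
  also have "\<dots> = of_real (sqrt (2 * pi / a) * exp (- s\<^sup>2 / (2 * a)))"
    unfolding h using a sq by (simp add: ch real_sqrt_divide scaleR_conv_of_real field_simps)
  finally show "(LINT t|lborel. g t) = of_real (sqrt (2 * pi / a) * exp (- s\<^sup>2 / (2 * a)))" .
qed

lemma measurable_cis [measurable]: "cis \<in> borel_measurable borel"
  by (intro borel_measurable_continuous_onI continuous_intros)

lemma cis_sum: "finite A \<Longrightarrow> cis (\<Sum>i\<in>A. f i) = (\<Prod>i\<in>A. cis (f i))"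
  by (induction A rule: finite_induct) (auto simp: cis_mult[symmetric])

lemma gaussian_fourier:
  fixes \<xi> :: "'a::euclidean_space"
  assumes a: "a > (0::real)"
  shows "integrable lborel (\<lambda>y::'a. of_real (exp (- a * (norm y)\<^sup>2 / 2)) * cis (- (y \<bullet> \<xi>)))"
    and "(LINT y|lborel. of_real (exp (- a * (norm y)\<^sup>2 / 2)) * cis (- (y \<bullet> \<xi>))) =
      of_real ((2 * pi / a) powr (DIM('a) / 2) * exp (- (norm \<xi>)\<^sup>2 / (2 * a)))"
proof -
  have n: "(norm y)\<^sup>2 = (\<Sum>b\<in>Basis. (y \<bullet> b)\<^sup>2)" for y :: 'a
    unfolding power2_norm_eq_inner by (subst euclidean_inner) (simp add: power2_eq_square)
  have eq: "(\<lambda>y::'a. of_real (exp (- a * (norm y)\<^sup>2 / 2)) * cis (- (y \<bullet> \<xi>))) =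
    (\<lambda>y. \<Prod>b\<in>Basis. of_real (exp (- a * (y \<bullet> b)\<^sup>2 / 2)) * cis (- ((y \<bullet> b) * (\<xi> \<bullet> b))))"
    by (simp add: n euclidean_inner[of _ \<xi>] sum_distrib_left sum_divide_distrib sum_negf[symmetric]
        exp_sum cis_sum prod.distrib fun_eq_iff)
  show "integrable lborel (\<lambda>y::'a. of_real (exp (- a * (norm y)\<^sup>2 / 2)) * cis (- (y \<bullet> \<xi>)))"
    unfolding eq by (intro lborel_integrable_prod gaussian_fourier_real a)
  have "(sqrt (2 * pi / a)) ^ DIM('a) = (2 * pi / a) powr (DIM('a) / 2)"
    using a by (simp add: powr_half_sqrt[symmetric] powr_realpow[symmetric] powr_powr)
  then show "(LINT y|lborel. of_real (exp (- a * (norm y)\<^sup>2 / 2)) * cis (- (y \<bullet> \<xi>))) =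
      of_real ((2 * pi / a) powr (DIM('a) / 2) * exp (- (norm \<xi>)\<^sup>2 / (2 * a)))"
    unfolding eq gaussian_fourier_real(2)[OF a]
    by (subst lborel_integral_prod, intro gaussian_fourier_real a)
      (subst gaussian_fourier_real(2)[OF a], simp add: prod.distrib n exp_sum sum_negf[symmetric] sum_divide_distrib
        flip: of_real_prod of_real_power)
qed

lemma lborel_integrable_mult_pair:
  fixes g :: "'a::euclidean_space \<Rightarrow> 'c::{real_normed_field, banach, second_countable_topology}"
    and h :: "'b::euclidean_space \<Rightarrow> 'c"
  assumes "integrable lborel g" "integrable lborel h"
  shows "integrable lborel (\<lambda>(x, y). g x * h y)"
proof -
  have [measurable]: "g \<in> borel_measurable borel" "h \<in> borel_measurable borel"
    using assms by (auto dest: borel_measurable_integrable)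
  have "integrable (lborel \<Otimes>\<^sub>M lborel) (\<lambda>(x, y). g x * h y)"
    using assms by (intro lborel_pair.Fubini_integrable) (auto simp: norm_mult)
  then show ?thesis by (simp add: lborel_prod)
qed

lemma
  fixes f :: "'a::euclidean_space \<Rightarrow> 'b::euclidean_space \<Rightarrow> 'c::{banach, second_countable_topology}"
  assumes "integrable lborel (\<lambda>(x, y). f x y)"
  shows lborel_integral_fst: "(LINT x|lborel. LINT y|lborel. f x y) = (LINT (x, y)|lborel. f x y)"
    and lborel_integral_snd: "(LINT y|lborel. LINT x|lborel. f x y) = (LINT (x, y)|lborel. f x y)"
  using assms lborel_pair.integral_fst[of f] lborel_pair.integral_snd[of f]
  by (simp_all add: lborel_prod)

lemma measurable_fst_borel [measurable (raw)]:
  fixes f :: "'c \<Rightarrow> 'a::second_countable_topology \<times> 'b::second_countable_topology"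
  shows "f \<in> borel_measurable M \<Longrightarrow> (\<lambda>x. fst (f x)) \<in> borel_measurable M"
  unfolding borel_prod[symmetric] by (rule measurable_fst')

lemma measurable_snd_borel [measurable (raw)]:
  fixes f :: "'c \<Rightarrow> 'a::second_countable_topology \<times> 'b::second_countable_topology"
  shows "f \<in> borel_measurable M \<Longrightarrow> (\<lambda>x. snd (f x)) \<in> borel_measurable M"
  unfolding borel_prod[symmetric] by (rule measurable_snd')

section \<open>The Fourier transform\<close>

text \<open>Taking the dimension as an argument lets \<open>fc_double\<close> split the constant of
  a product space into those of its factors.\<close>

definition fc :: "nat \<Rightarrow> real" where
  "fc n = (2 * pi) powr (- real n / 2)"

lemma fc_pos [simp]: "fc n > 0" and fc_nonneg [simp]: "0 \<le> fc n"
  by (simp_all add: fc_def)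

lemma fc_double: "fc (n + n) = fc n * fc n"
  by (simp add: fc_def powr_add[symmetric])

definition ft :: "('a::euclidean_space \<Rightarrow> complex) \<Rightarrow> 'a \<Rightarrow> complex" where
  "ft f \<xi> = of_real (fc DIM('a)) * (LINT x|lborel. f x * cis (- (x \<bullet> \<xi>)))"

lemma measurable_ft [measurable]:
  assumes [measurable]: "f \<in> borel_measurable borel"
  shows "ft f \<in> borel_measurable borel"
  unfolding ft_def by measurable

lemma integrable_mult_cis:
  assumes "integrable lborel f" and [measurable]: "g \<in> borel_measurable lborel"
  shows "integrable lborel (\<lambda>x. f x * cis (g x))"
  using assms(1) by (rule Bochner_Integration.integrable_bound)
    (use assms(1) in \<open>auto simp: norm_mult dest: borel_measurable_integrable\<close>)

lemma norm_ft_le: "cmod (ft f \<xi>) \<le> fc DIM('a) * (LINT x|lborel. cmod (f x))"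
  for f :: "'a::euclidean_space \<Rightarrow> complex"
  unfolding ft_def norm_mult
  by (intro mult_mono order_trans[OF integral_norm_bound]) (simp_all add: norm_mult)

lemma ft_duality:
  fixes f g :: "'a::euclidean_space \<Rightarrow> complex"
  assumes f: "integrable lborel f" and g: "integrable lborel g"
  shows "(LINT x|lborel. ft f x * g x) = (LINT x|lborel. f x * ft g x)"
proof -
  have [measurable]: "f \<in> borel_measurable borel" "g \<in> borel_measurable borel"
    using f g by (auto dest: borel_measurable_integrable)
  define F where "F x y = f x * g y * cis (- (x \<bullet> y))" for x y
  have "integrable lborel (\<lambda>z. (case z of (x, y) \<Rightarrow> f x * g y) * cis (- (fst z \<bullet> snd z)))"
    by (intro integrable_mult_cis lborel_integrable_mult_pair f g) measurable
  then have "integrable lborel (\<lambda>(x, y). F x y)"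
    by (simp add: F_def case_prod_beta')
  from lborel_integral_fst[OF this] lborel_integral_snd[OF this]
  have "(LINT x|lborel. LINT y|lborel. F x y) = (LINT y|lborel. LINT x|lborel. F x y)"
    by simp
  moreover have "(LINT y|lborel. F x y) = f x * (LINT y|lborel. g y * cis (- (y \<bullet> x)))" for x
    unfolding integral_mult_right_zero[symmetric] by (simp add: F_def inner_commute mult.assoc)
  moreover have "(LINT x|lborel. F x y) = (LINT x|lborel. f x * cis (- (x \<bullet> y))) * g y" for y
    unfolding integral_mult_left_zero[symmetric] by (simp add: F_def algebra_simps)
  ultimately show ?thesis
    unfolding ft_def by (simp add: mult.assoc mult.left_commute[of "f _"])
qed

text \<open>Gauss summability. The inversion integral is damped by a wide Gaussian, and its limit is
  computed twice: directly, by integrability of \<open>ft f\<close>, and after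
  \<open>ft_duality\<close>, as an average of \<open>f\<close> over a shrinking neighbourhood of
  \<open>t\<close>.\<close>

lemma fourier_inversion:
  fixes f :: "'a::euclidean_space \<Rightarrow> complex"
  assumes cont: "continuous_on UNIV f" and bdd: "\<And>x. cmod (f x) \<le> M"
    and f: "integrable lborel f" and ftf: "integrable lborel (ft f)"
  shows "f t = of_real (fc DIM('a)) * (LINT \<xi>|lborel. ft f \<xi> * cis (t \<bullet> \<xi>))"
proof -
  let ?n = "DIM('a)"
  have [measurable]: "f \<in> borel_measurable borel"
    using f by (auto dest: borel_measurable_integrable)
  define G where "G a y = complex_of_real (exp (- a * (norm y)\<^sup>2 / 2))" for a and y :: 'a
  have G_meas[measurable]: "G a \<in> borel_measurable borel" for a
    unfolding G_def by measurable
  have iG: "integrable lborel (G a)" if "a > 0" for a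
    using gaussian_fourier(1)[OF that, of 0] by (simp add: G_def[abs_def])
  define I where "I k = (LINT \<xi>|lborel. ft f \<xi> * (G (1 / (real (Suc k))\<^sup>2) \<xi> * cis (t \<bullet> \<xi>)))" for k
  \<comment> \<open>Duality moves the transform onto the damped character, which becomes a Gaussian
    of width 1 / (k + 1) around \<open>t\<close>; rescaling makes the Gaussian independent of
    \<open>k\<close>.\<close>
  have "I k = (LINT y|lborel. f (t + (1 / real (Suc k)) *\<^sub>R y) * G 1 y)" for k
  proof -
    define s where "s = 1 / real (Suc k)"
    have s: "s > 0" by (simp add: s_def)
    let ?a = "s\<^sup>2"
    have a: "?a > 0" using s by simp
    have A: "ft (\<lambda>\<xi>. G ?a \<xi> * cis (t \<bullet> \<xi>)) y = of_real (fc ?n) * of_real ((2 * pi / ?a) powr (?n / 2) * exp (- (norm (y - t))\<^sup>2 / (2 * ?a)))" for y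
    proof -
      have "ft (\<lambda>\<xi>. G ?a \<xi> * cis (t \<bullet> \<xi>)) y = of_real (fc ?n) * (LINT \<xi>|lborel. G ?a \<xi> * cis (- (\<xi> \<bullet> (y - t))))"
        unfolding ft_def by (simp only: mult.assoc cis_mult) (simp add: inner_diff_right inner_commute)
      then show ?thesis
        unfolding G_def gaussian_fourier(2)[OF a] .
    qed
    have "(2 * pi / ?a) powr (?n / 2) = (2 * pi) powr (?n / 2) / s ^ ?n"
      using s by (simp add: powr_divide powr_powr powr_realpow[symmetric] flip: powr_numeral)
    then have B: "fc ?n * (2 * pi / ?a) powr (?n / 2) = 1 / s ^ ?n"
      by (simp add: fc_def powr_minus)
    have ftG: "ft (\<lambda>\<xi>. G ?a \<xi> * cis (t \<bullet> \<xi>)) y = of_real (exp (- (norm (y - t))\<^sup>2 / (2 * ?a)) / s ^ ?n)" for y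
      unfolding A of_real_mult[symmetric] mult.assoc[symmetric] B by simp
    have "I k = (LINT \<xi>|lborel. ft f \<xi> * (G ?a \<xi> * cis (t \<bullet> \<xi>)))"
      by (simp add: I_def s_def power_divide)
    also have "\<dots> = (LINT y|lborel. f y * of_real (exp (- (norm (y - t))\<^sup>2 / (2 * ?a)) / s ^ ?n))"
      by (subst ft_duality[OF f]) (auto intro!: integrable_mult_cis iG a simp: ftG)
    also have "\<dots> = \<bar>s\<bar> ^ ?n *\<^sub>R (LINT y|lborel. f (t + s *\<^sub>R y) * of_real (exp (- (norm (t + s *\<^sub>R y - t))\<^sup>2 / (2 * ?a)) / s ^ ?n))"
      using s by (subst lborel_integral_affine[where c=s and t=t]) auto
    also have "\<dots> = (LINT y|lborel. s ^ ?n *\<^sub>R (f (t + s *\<^sub>R y) * of_real (exp (- (norm (t + s *\<^sub>R y - t))\<^sup>2 / (2 * ?a)) / s ^ ?n)))"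
      using s by (subst integral_scaleR_right[symmetric]) simp
    also have "\<dots> = (LINT y|lborel. f (t + s *\<^sub>R y) * G 1 y)"
      using s by (intro Bochner_Integration.integral_cong)
        (simp_all add: G_def power_mult_distrib scaleR_conv_of_real)
    finally show ?thesis by (simp add: s_def)
  qed
  then have I_eq: "I = (\<lambda>k. LINT y|lborel. f (t + (1 / real (Suc k)) *\<^sub>R y) * G 1 y)" by auto
  have M: "M \<ge> 0" using bdd[of 0] norm_ge_zero order_trans by blast
  \<comment> \<open>First value of the limit: continuity of \<open>f\<close> at \<open>t\<close>,
    dominated by the bound \<open>M\<close>.\<close>
  have "I \<longlonglongrightarrow> (LINT y|lborel. f t * G 1 y)"
    unfolding I_eq
  proof (rule integral_dominated_convergence[where w="\<lambda>y. M * cmod (G 1 y)"])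
    show "AE y in lborel. (\<lambda>k. f (t + (1 / real (Suc k)) *\<^sub>R y) * G 1 y) \<longlonglongrightarrow> f t * G 1 y"
    proof (intro AE_I2 tendsto_intros)
      fix y
      have "(\<lambda>k. t + (1 / real (Suc k)) *\<^sub>R y) \<longlonglongrightarrow> t + 0 *\<^sub>R y"
        by (intro tendsto_intros LIMSEQ_Suc[OF lim_1_over_n])
      moreover have "isCont f t" using cont by (simp add: continuous_on_eq_continuous_at)
      ultimately show "(\<lambda>k. f (t + (1 / real (Suc k)) *\<^sub>R y)) \<longlonglongrightarrow> f t"
        by (auto intro: isCont_tendsto_compose)
    qed
  qed (auto simp: norm_mult intro!: mult_right_mono bdd integrable_mult_right integrable_norm iG)
  moreover have "(LINT y|lborel. f t * G 1 y) = f t / of_real (fc ?n)"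
  proof -
    have "1 / fc ?n = (2 * pi) powr (?n / 2)" by (simp add: fc_def powr_minus_divide)
    moreover have "(LINT y|lborel. G 1 y) = of_real ((2 * pi) powr (?n / 2))"
      using gaussian_fourier(2)[of 1 "0::'a"] by (simp add: G_def)
    ultimately show ?thesis
      by (metis integral_mult_right_zero of_real_1 of_real_divide times_divide_eq_right mult.right_neutral)
  qed
  \<comment> \<open>Second value: the damping factor tends to 1 and \<open>ft f\<close> itself is
    the majorant.\<close>
  moreover have "I \<longlonglongrightarrow> (LINT \<xi>|lborel. ft f \<xi> * (1 * cis (t \<bullet> \<xi>)))"
    unfolding I_def
  proof (rule integral_dominated_convergence[where w="\<lambda>\<xi>. cmod (ft f \<xi>)"])
    show "AE \<xi> in lborel. (\<lambda>k. ft f \<xi> * (G (1 / (real (Suc k))\<^sup>2) \<xi> * cis (t \<bullet> \<xi>))) \<longlonglongrightarrow> ft f \<xi> * (1 * cis (t \<bullet> \<xi>))"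
    proof (intro AE_I2 tendsto_intros)
      fix \<xi> :: 'a
      have "(\<lambda>k. complex_of_real (exp (- (1 / real (Suc k))\<^sup>2 * (norm \<xi>)\<^sup>2 / 2))) \<longlonglongrightarrow> of_real (exp (- 0\<^sup>2 * (norm \<xi>)\<^sup>2 / 2))"
        by (intro tendsto_intros LIMSEQ_Suc[OF lim_1_over_n]) auto
      then show "(\<lambda>k. G (1 / (real (Suc k))\<^sup>2) \<xi>) \<longlonglongrightarrow> 1"
        by (simp add: G_def power_divide)
    qed
    show "AE \<xi> in lborel. cmod (ft f \<xi> * (G (1 / (real (Suc k))\<^sup>2) \<xi> * cis (t \<bullet> \<xi>))) \<le> cmod (ft f \<xi>)" for k
      by (auto simp: norm_mult G_def intro!: mult_left_le)
  qed (use ftf in auto)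
  ultimately have "f t / of_real (fc ?n) = (LINT \<xi>|lborel. ft f \<xi> * cis (t \<bullet> \<xi>))"
    using LIMSEQ_unique by fastforce
  moreover have "complex_of_real (fc ?n) \<noteq> 0" using fc_pos[of ?n] by (metis of_real_eq_0_iff less_irrefl)
  ultimately show ?thesis by (simp add: field_simps)
qed

section \<open>Exponential decay of test functions and of their Fourier transforms\<close>

text \<open>A single term of the series for exp (2 u) already captures exp u. Otherwise every (2
  u)^k / k! is below exp u / 3, and summing with the weights 2^(-k) gives exp u <= (2 / 3) exp
  u.\<close>

lemma exp_le_power_over_fact:
  fixes u :: real
  assumes "u \<ge> 0"
  obtains k where "exp u \<le> 3 * ((2 * u) ^ k / fact k)"
proof -
  have "\<exists>k. exp u \<le> 3 * ((2 * u) ^ k / fact k)"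
  proof (rule ccontr)
    assume "\<nexists>k. exp u \<le> 3 * ((2 * u) ^ k / fact k)"
    then have "3 * ((2 * u) ^ k / fact k) < exp u" for k
      unfolding not_ex not_le by blast
    then have *: "(2 * u) ^ k / fact k \<le> exp u / 3" for k
      by (simp add: less_imp_le field_simps)
    have s: "(\<lambda>k. u ^ k / fact k) sums exp u"
      using exp_converges[of u] by (simp add: divide_inverse mult.commute)
    have g: "(\<lambda>k. (1 / 2) ^ k * (exp u / 3)) sums (2 * (exp u / 3))"
      using sums_mult2[OF geometric_sums[of "1 / 2 :: real"], of "exp u / 3"] by simp
    have "exp u \<le> 2 * (exp u / 3)"
    proof (rule sums_le[OF _ s g])
      fix k
      have "u ^ k / fact k = (1 / 2) ^ k * ((2 * u) ^ k / fact k)"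
        by (simp add: power_mult_distrib power_divide)
      also have "\<dots> \<le> (1 / 2) ^ k * (exp u / 3)"
        by (intro mult_left_mono *) auto
      finally show "u ^ k / fact k \<le> (1 / 2) ^ k * (exp u / 3)" .
    qed
    then show False using exp_gt_zero[of u] by simp
  qed
  then show thesis using that by blast
qed

text \<open>The bridge from monomials to exponentials. The multi-index depends on \<open>x\<close>,
  which is harmless because \<open>gs_norm\<close> takes the supremum over all
  multi-indices.\<close>

lemma norm_exp_le_monomial:
  fixes x :: "'a::euclidean_space"
  assumes h: "h > 0"
  obtains \<alpha> :: "'a \<Rightarrow> nat" where
    "exp (norm x / (2 * h)) \<le> 3 ^ DIM('a) * ((\<Prod>b\<in>Basis. \<bar>x \<bullet> b\<bar> ^ \<alpha> b) / (h ^ mi_abs \<alpha> * mi_fact \<alpha>))"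
proof -
  have "\<exists>k. exp (\<bar>x \<bullet> b\<bar> / (2 * h)) \<le> 3 * ((2 * (\<bar>x \<bullet> b\<bar> / (2 * h))) ^ k / fact k)" for b
    by (rule exp_le_power_over_fact[of "\<bar>x \<bullet> b\<bar> / (2 * h)"]) (use h in auto)
  then obtain \<alpha> where \<alpha>: "exp (\<bar>x \<bullet> b\<bar> / (2 * h)) \<le> 3 * ((\<bar>x \<bullet> b\<bar> / h) ^ \<alpha> b / fact (\<alpha> b))" for b :: 'a
    by simp metis
  have "norm x / (2 * h) \<le> (\<Sum>b\<in>Basis. \<bar>x \<bullet> b\<bar> / (2 * h))"
    using h norm_le_l1[of x] by (simp flip: sum_divide_distrib add: divide_right_mono)
  then have "exp (norm x / (2 * h)) \<le> (\<Prod>b\<in>Basis. exp (\<bar>x \<bullet> b\<bar> / (2 * h)))"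
    by (simp flip: exp_sum)
  also have "\<dots> \<le> (\<Prod>b\<in>(Basis::'a set). 3 * ((\<bar>x \<bullet> b\<bar> / h) ^ \<alpha> b / fact (\<alpha> b)))"
    by (intro prod_mono conjI \<alpha>) auto
  also have "\<dots> = 3 ^ DIM('a) * ((\<Prod>b\<in>Basis. \<bar>x \<bullet> b\<bar> ^ \<alpha> b) / (h ^ mi_abs \<alpha> * mi_fact \<alpha>))"
    by (simp only: prod.distrib prod_constant prod_dividef power_divide mi_abs_def mi_fact_def power_sum divide_divide_eq_left)
  finally show thesis by (rule that)
qed

text \<open>Real arithmetic with the seminorm. An infinite \<open>gs_norm\<close> would be sent to
  0, so the value is meaningful only on \<open>Sigma1\<close>, where \<open>Sigma1_gs_norm\<close>
  applies.\<close>

abbreviation gs_val :: "real \<Rightarrow> ('a::euclidean_space \<Rightarrow> complex) \<Rightarrow> real" where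
  "gs_val h f \<equiv> enn2real (gs_norm h f)"

lemma Sigma1_smooth: "f \<in> Sigma1 \<Longrightarrow> smooth f"
  and Sigma1_gs_norm: "f \<in> Sigma1 \<Longrightarrow> h > 0 \<Longrightarrow> gs_norm h f = ennreal (gs_val h f)"
  unfolding Sigma1_def by (auto simp: less_top)

lemma smooth_partials:
  assumes "smooth f" "bs \<in> lists Basis"
  shows "partials bs f differentiable (at x)" "continuous_on UNIV (partials bs f)"
proof -
  show *: "partials bs f differentiable (at x)" for x
    using assms unfolding smooth_def by blast
  show "continuous_on UNIV (partials bs f)"
    by (intro differentiable_imp_continuous_on) (simp add: differentiable_on_def *)
qed

lemma mi_fact_pos [simp]: "mi_fact \<alpha> > 0"
  by (simp add: mi_fact_def prod_pos)

lemma mi_abs_count_list: "bs \<in> lists Basis \<Longrightarrow> mi_abs (count_list bs) = length bs"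
  unfolding mi_abs_def by (subst sum_count_set) auto

lemma Sigma1_bound:
  assumes f: "f \<in> Sigma1" and h: "h > 0" and bs: "bs \<in> lists Basis"
  shows "\<bar>mi_power x \<alpha>\<bar> * cmod (partials bs f x) \<le>
    gs_val h f * (h ^ (mi_abs \<alpha> + length bs) * mi_fact \<alpha> * mi_fact (count_list bs))"
proof -
  let ?D = "h ^ (mi_abs \<alpha> + mi_abs (count_list bs)) * mi_fact \<alpha> * mi_fact (count_list bs)"
  have D: "?D > 0" using h by simp
  have "ennreal (cmod (of_real (mi_power x \<alpha>) * partials bs f x) / ?D) \<le> gs_norm h f"
    unfolding gs_norm_def by (rule SUP_upper2[of \<alpha>], simp, rule SUP_upper2[OF bs], rule SUP_upper2[of x]) auto
  then have "cmod (of_real (mi_power x \<alpha>) * partials bs f x) / ?D \<le> gs_val h f"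
    by (rule ennreal_le_iff[THEN iffD1, OF enn2real_nonneg, OF ord_le_eq_trans[OF _ Sigma1_gs_norm[OF f h]]])
  then show ?thesis
    unfolding pos_divide_le_eq[OF D] unfolding norm_mult mi_abs_count_list[OF bs] norm_of_real .
qed

lemma le_mult_exp_negI:
  fixes a :: real
  assumes "a * exp (u / (2 * h)) \<le> K"
  shows "a \<le> K * exp (- (1 / (2 * h)) * u)"
proof -
  have "a = a * exp (u / (2 * h)) * exp (- (1 / (2 * h)) * u)"
    by (simp add: mult.assoc flip: exp_add)
  also have "\<dots> \<le> K * exp (- (1 / (2 * h)) * u)"
    using assms by (rule mult_right_mono) simp
  finally show ?thesis .
qed

text \<open>With \<alpha> adapted to the point, the factors h^|\<alpha>| and \<alpha>! of
  \<open>norm_exp_le_monomial\<close> cancel against those in \<open>Sigma1_bound\<close>, leaving a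
  bound free of \<alpha>.\<close>

lemma Sigma1_partials_decay:
  fixes f :: "'a::euclidean_space \<Rightarrow> complex"
  assumes f: "f \<in> Sigma1" and h: "h > 0" and bs: "bs \<in> lists Basis"
  shows "cmod (partials bs f x) \<le>
    3 ^ DIM('a) * h ^ length bs * mi_fact (count_list bs) * gs_val h f * exp (- (1 / (2 * h)) * norm x)"
proof -
  obtain \<alpha> :: "'a \<Rightarrow> nat" where
    \<alpha>: "exp (norm x / (2 * h)) \<le> 3 ^ DIM('a) * ((\<Prod>b\<in>Basis. \<bar>x \<bullet> b\<bar> ^ \<alpha> b) / (h ^ mi_abs \<alpha> * mi_fact \<alpha>))"
    using norm_exp_le_monomial[OF h] by blast
  have m: "(\<Prod>b\<in>Basis. \<bar>x \<bullet> b\<bar> ^ \<alpha> b) = \<bar>mi_power x \<alpha>\<bar>"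
    by (simp add: mi_power_def abs_prod power_abs)
  have p: "h ^ mi_abs \<alpha> * mi_fact \<alpha> > 0" using h by simp
  have "cmod (partials bs f x) * exp (norm x / (2 * h)) \<le>
    cmod (partials bs f x) * (3 ^ DIM('a) * (\<bar>mi_power x \<alpha>\<bar> / (h ^ mi_abs \<alpha> * mi_fact \<alpha>)))"
    using \<alpha> unfolding m by (rule mult_left_mono) simp
  also have "\<dots> = 3 ^ DIM('a) * ((\<bar>mi_power x \<alpha>\<bar> * cmod (partials bs f x)) / (h ^ mi_abs \<alpha> * mi_fact \<alpha>))"
    by simp
  also have "\<dots> \<le> 3 ^ DIM('a) * ((gs_val h f * (h ^ (mi_abs \<alpha> + length bs) * mi_fact \<alpha> * mi_fact (count_list bs))) / (h ^ mi_abs \<alpha> * mi_fact \<alpha>))"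
    using p by (intro mult_left_mono divide_right_mono Sigma1_bound[OF f h bs]) auto
  also have "\<dots> = 3 ^ DIM('a) * h ^ length bs * mi_fact (count_list bs) * gs_val h f"
    using h mi_fact_pos[of \<alpha>] by (simp add: power_add field_simps del: mi_fact_pos)
  finally show ?thesis
    by (rule le_mult_exp_negI)
qed

text \<open>Derivatives as limits of sequences, the form in which dominated convergence and
  measurability of limits can be applied to them.\<close>

lemma directional_difference_quotient:
  fixes f :: "'a::real_normed_vector \<Rightarrow> 'b::real_normed_vector"
  assumes "(f has_derivative D) (at x)"
  shows "(\<lambda>k. real (Suc k) *\<^sub>R (f (x + (1 / real (Suc k)) *\<^sub>R b) - f x)) \<longlonglongrightarrow> D b"
proof -
  have "((\<lambda>s. f (x + s *\<^sub>R b)) has_derivative (\<lambda>s. D (s *\<^sub>R b))) (at 0)"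
    using assms by (intro has_derivative_compose[of "\<lambda>s. x + s *\<^sub>R b" "\<lambda>s. s *\<^sub>R b" _ _ f, simplified])
      (auto intro!: derivative_eq_intros)
  then have "((\<lambda>s. norm (f (x + s *\<^sub>R b) - f x - D (s *\<^sub>R b)) / norm s) \<longlongrightarrow> 0) (at (0::real))"
    by (simp add: has_derivative_at)
  moreover have "filterlim (\<lambda>k. 1 / real (Suc k)) (at 0) sequentially"
    using LIMSEQ_Suc[OF lim_1_over_n[where 'a=real]] by (auto simp: filterlim_at)
  ultimately have "(\<lambda>k. norm (f (x + (1 / real (Suc k)) *\<^sub>R b) - f x - D ((1 / real (Suc k)) *\<^sub>R b)) / norm (1 / real (Suc k))) \<longlonglongrightarrow> 0"
    by (rule filterlim_compose)
  moreover have "norm (f (x + (1 / real (Suc k)) *\<^sub>R b) - f x - D ((1 / real (Suc k)) *\<^sub>R b)) / norm (1 / real (Suc k)) =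
    norm (real (Suc k) *\<^sub>R (f (x + (1 / real (Suc k)) *\<^sub>R b) - f x) - D b)" for k
  proof -
    have D: "D (s *\<^sub>R b) = s *\<^sub>R D b" for s
      using assms by (simp add: linear_scale has_derivative_linear)
    have "real (Suc k) *\<^sub>R (f (x + (1 / real (Suc k)) *\<^sub>R b) - f x) - D b =
      real (Suc k) *\<^sub>R (f (x + (1 / real (Suc k)) *\<^sub>R b) - f x - (1 / real (Suc k)) *\<^sub>R D b)"
      by (simp add: scaleR_diff_right)
    then show ?thesis unfolding D by (simp add: mult.commute)
  qed
  ultimately show ?thesis
    by (simp add: tendsto_norm_zero_iff Lim_null[symmetric])
qed

lemma exp_neg_norm_translate:
  fixes x y :: "'a::real_normed_vector"
  assumes "r \<ge> (0::real)"
  shows "exp (- r * norm (x + y)) \<le> exp (r * norm y) * exp (- r * norm x)"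
proof -
  have "norm x \<le> norm (x + y) + norm y"
    using norm_triangle_ineq4[of "x + y" y] by simp
  then have "r * norm x \<le> r * (norm (x + y) + norm y)" using assms by (rule mult_left_mono)
  then show ?thesis by (simp add: exp_add[symmetric] algebra_simps)
qed

text \<open>Integration by parts without boundary terms: the Fourier integral of a difference
  quotient is that of \<open>g\<close> times a difference quotient of a character, and both sides
  pass to the limit.\<close>

lemma ft_partial:
  fixes g :: "'a::euclidean_space \<Rightarrow> complex"
  assumes diff: "\<And>x. g differentiable (at x)" and r: "r > 0"
    and cont: "continuous_on UNIV (partial b g)"
    and g: "\<And>x. cmod (g x) \<le> M * exp (- r * norm x)"
    and g': "\<And>x. cmod (partial b g x) \<le> M * exp (- r * norm x)"
  shows "ft (partial b g) \<xi> = \<i> * of_real (\<xi> \<bullet> b) * ft g \<xi>"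
proof -
  have D: "(g has_derivative frechet_derivative g (at x)) (at x)" for x
    using diff frechet_derivative_works by blast
  have cg: "continuous_on UNIV g"
    using diff by (auto intro!: differentiable_imp_continuous_on simp: differentiable_on_def)
  have [measurable]: "g \<in> borel_measurable borel" "partial b g \<in> borel_measurable borel"
    using cg cont by (auto intro: borel_measurable_continuous_onI)
  have M: "M \<ge> 0" using order_trans[OF norm_ge_zero g[of 0]] by simp
  have ig: "integrable lborel g"
    by (rule Bochner_Integration.integrable_bound[where f="\<lambda>x. M * exp (- r * norm x)"])
      (use M g integrable_exp_neg_norm[OF r] in auto)
  define t where "t k = 1 / real (Suc k)" for k
  have t: "0 < t k" "t k \<le> 1" for k by (auto simp: t_def)
  define Q where "Q k y = real (Suc k) *\<^sub>R (g (y + t k *\<^sub>R b) - g y) * cis (- (y \<bullet> \<xi>))" for k y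
  \<comment> \<open>The mean value theorem along the segment from \<open>y\<close> in direction
    \<open>b\<close>; moving the argument by at most \<open>norm b\<close> costs the factor exp (r
    |b|).\<close>
  have Q_bound: "cmod (Q k y) \<le> M * exp (r * norm b) * exp (- r * norm y)" for k y
  proof -
    have "norm (g (y + t k *\<^sub>R b) - g (y + 0 *\<^sub>R b)) \<le> M * exp (r * norm b) * exp (- r * norm y) * norm (t k - 0)"
    proof (rule differentiable_bound[where S="{0..t k}"])
      fix s assume s: "s \<in> {0..t k}"
      have "((\<lambda>s. g (y + s *\<^sub>R b)) has_derivative (\<lambda>h. frechet_derivative g (at (y + s *\<^sub>R b)) (h *\<^sub>R b))) (at s within {0..t k})"
        by (rule has_derivative_compose[OF _ D]) (auto intro!: derivative_eq_intros)
      then show "((\<lambda>s. g (y + s *\<^sub>R b)) has_derivative (\<lambda>h. h *\<^sub>R partial b g (y + s *\<^sub>R b))) (at s within {0..t k})"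
        by (simp add: partial_def linear_scale[OF linear_frechet_derivative[OF diff]])
      have "norm (s *\<^sub>R b) \<le> norm b" using s t(2)[of k] by (auto intro: mult_left_le_one_le)
      then have "exp (r * norm (s *\<^sub>R b)) \<le> exp (r * norm b)" using r by simp
      then have "exp (- r * norm (y + s *\<^sub>R b)) \<le> exp (r * norm b) * exp (- r * norm y)"
        using exp_neg_norm_translate[of r y "s *\<^sub>R b"] r
        by (meson mult_right_mono exp_ge_zero less_imp_le order_trans)
      then have "cmod (partial b g (y + s *\<^sub>R b)) \<le> M * (exp (r * norm b) * exp (- r * norm y))"
        using g'[of "y + s *\<^sub>R b"] M by (meson mult_left_mono order_trans)
      then show "onorm (\<lambda>h. h *\<^sub>R partial b g (y + s *\<^sub>R b)) \<le> M * exp (r * norm b) * exp (- r * norm y)"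
        unfolding mult.assoc[symmetric]
        by (intro onorm_bound) (use M in \<open>auto intro!: mult_right_mono simp: mult.commute[of _ "\<bar>_\<bar>"] mult.assoc mult_left_mono\<close>)
    qed (use t(1)[of k] in simp_all)
    then have "norm (g (y + t k *\<^sub>R b) - g y) \<le> M * exp (r * norm b) * exp (- r * norm y) * t k"
      using t(1)[of k] by simp
    then have "norm (g (y + t k *\<^sub>R b) - g y) \<le> M * exp (r * norm b) * exp (- r * norm y) / real (Suc k)"
      unfolding t_def by (simp only: times_divide_eq_right mult_1_right)
    then have "real (Suc k) * norm (g (y + t k *\<^sub>R b) - g y) \<le> M * exp (r * norm b) * exp (- r * norm y)"
      using pos_le_divide_eq[of "real (Suc k)"] by (metis mult.commute of_nat_0_less_iff zero_less_Suc)
    then show ?thesis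
      by (simp add: Q_def norm_mult)
  qed
  have lim: "(\<lambda>k. Q k y) \<longlonglongrightarrow> partial b g y * cis (- (y \<bullet> \<xi>))" for y
    unfolding Q_def partial_def t_def by (intro tendsto_intros directional_difference_quotient D)
  have 1: "(\<lambda>k. LINT y|lborel. Q k y) \<longlonglongrightarrow> (LINT y|lborel. partial b g y * cis (- (y \<bullet> \<xi>)))"
  proof (rule integral_dominated_convergence[where w="\<lambda>y. M * exp (r * norm b) * exp (- r * norm y)"])
    show "Q k \<in> borel_measurable lborel" for k unfolding Q_def[abs_def] by measurable
    show "integrable lborel (\<lambda>y::'a. M * exp (r * norm b) * exp (- r * norm y))"
      using integrable_exp_neg_norm[OF r] by (rule integrable_mult_right)
  qed (use lim Q_bound in \<open>auto simp del: of_nat_Suc\<close>)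
  define c where "c = (LINT y|lborel. g y * cis (- (y \<bullet> \<xi>)))"
  \<comment> \<open>Translating the first term of the quotient turns the shift of \<open>g\<close>
    into a phase, so only a quotient of \<open>cis\<close> at 0 remains.\<close>
  have "(LINT y|lborel. Q k y) = real (Suc k) *\<^sub>R (cis (t k * (b \<bullet> \<xi>)) - 1) * c" for k
  proof -
    let ?F = "\<lambda>x. g x * cis (- ((x - t k *\<^sub>R b) \<bullet> \<xi>))"
    have F: "?F x = cis (t k * (b \<bullet> \<xi>)) * (g x * cis (- (x \<bullet> \<xi>)))" for x
    proof -
      have "- ((x - t k *\<^sub>R b) \<bullet> \<xi>) = t k * (b \<bullet> \<xi>) + - (x \<bullet> \<xi>)"
        by (simp add: inner_diff_left)
      then show ?thesis by (simp only: cis_mult[symmetric] mult.left_commute)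
    qed
    have i1: "integrable lborel (\<lambda>x. g x * cis (- (x \<bullet> \<xi>)))"
      by (intro integrable_mult_cis ig) measurable
    then have "integrable lborel ?F" unfolding F by (rule integrable_mult_right)
    then have i2: "integrable lborel (\<lambda>x. ?F (t k *\<^sub>R b + 1 *\<^sub>R x))"
      using lborel_integrable_affine[where f="?F" and c=1 and t="t k *\<^sub>R b"] by simp
    have Q: "Q k = (\<lambda>x. real (Suc k) *\<^sub>R (?F (t k *\<^sub>R b + 1 *\<^sub>R x) - g x * cis (- (x \<bullet> \<xi>))))"
      by (simp add: Q_def fun_eq_iff left_diff_distrib add.commute)
    have "(LINT y|lborel. Q k y) = real (Suc k) *\<^sub>R ((LINT x|lborel. ?F (t k *\<^sub>R b + 1 *\<^sub>R x)) - c)"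
      unfolding Q c_def integral_scaleR_right Bochner_Integration.integral_diff[OF i2 i1] ..
    also have "(LINT x|lborel. ?F (t k *\<^sub>R b + 1 *\<^sub>R x)) = (LINT x|lborel. ?F x)"
      using lborel_integral_affine[where c=1 and t="t k *\<^sub>R b" and f="?F"] by simp
    also have "\<dots> = cis (t k * (b \<bullet> \<xi>)) * c"
      unfolding F c_def by simp
    finally show ?thesis by (simp add: left_diff_distrib)
  qed
  moreover have "(\<lambda>k. real (Suc k) *\<^sub>R (cis (t k * (b \<bullet> \<xi>)) - 1) * c) \<longlonglongrightarrow> (\<i> * of_real (b \<bullet> \<xi>)) * c"
  proof (intro tendsto_mult tendsto_const)
    have "((\<lambda>s. cis (s * (b \<bullet> \<xi>))) has_derivative (\<lambda>h. h *\<^sub>R (\<i> * of_real (b \<bullet> \<xi>)))) (at 0)"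
    proof -
      from exp_scaleR_has_vector_derivative_right[of "\<i> * of_real (b \<bullet> \<xi>)" 0 UNIV]
      show ?thesis
        by (simp add: has_vector_derivative_def cis_conv_exp scaleR_conv_of_real mult_ac)
    qed
    from directional_difference_quotient[OF this, of 1]
    show "(\<lambda>k. real (Suc k) *\<^sub>R (cis (t k * (b \<bullet> \<xi>)) - 1)) \<longlonglongrightarrow> \<i> * of_real (b \<bullet> \<xi>)"
      by (simp add: t_def)
  qed
  ultimately have "(LINT y|lborel. partial b g y * cis (- (y \<bullet> \<xi>))) = (\<i> * of_real (b \<bullet> \<xi>)) * c"
    using 1 LIMSEQ_unique by simp
  then show ?thesis
    unfolding ft_def c_def by (simp add: inner_commute)
qed


lemma ft_partials:
  fixes f :: "'a::euclidean_space \<Rightarrow> complex"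
  assumes f: "f \<in> Sigma1" and bs: "bs \<in> lists Basis"
  shows "cmod (ft (partials bs f) \<xi>) = (\<Prod>b\<in>Basis. \<bar>\<xi> \<bullet> b\<bar> ^ count_list bs b) * cmod (ft f \<xi>)"
  using bs
proof (induction bs)
  case Nil
  then show ?case by (simp add: partials_def)
next
  case (Cons b bs)
  then have b: "b \<in> Basis" and bs: "bs \<in> lists Basis" "b # bs \<in> lists Basis" by auto
  define M where "M = max (3 ^ DIM('a) * 1 ^ length bs * mi_fact (count_list bs) * gs_val 1 f)
    (3 ^ DIM('a) * 1 ^ length (b # bs) * mi_fact (count_list (b # bs)) * gs_val 1 f)"
  have p: "partials (b # bs) f = partial b (partials bs f)" by (simp add: partials_def)
  have M: "cmod (partials bs f x) \<le> M * exp (- (1 / 2) * norm x)"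
    "cmod (partial b (partials bs f) x) \<le> M * exp (- (1 / 2) * norm x)" for x
    using Sigma1_partials_decay[OF f zero_less_one bs(1), of x] Sigma1_partials_decay[OF f zero_less_one bs(2), of x]
    unfolding M_def p by (auto intro: order_trans[OF _ mult_right_mono])
  have "ft (partial b (partials bs f)) \<xi> = \<i> * of_real (\<xi> \<bullet> b) * ft (partials bs f) \<xi>"
    using smooth_partials[OF Sigma1_smooth[OF f] bs(1)] smooth_partials(2)[OF Sigma1_smooth[OF f] bs(2)] M
    unfolding p by (intro ft_partial[where r="1 / 2" and M=M]) (simp_all only: half_gt_zero zero_less_one)
  then have "cmod (ft (partials (b # bs) f) \<xi>) =
    \<bar>\<xi> \<bullet> b\<bar> * (\<Prod>b\<in>Basis. \<bar>\<xi> \<bullet> b\<bar> ^ count_list bs b) * cmod (ft f \<xi>)"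
    by (simp add: p norm_mult Cons.IH)
  also have "\<bar>\<xi> \<bullet> b\<bar> * (\<Prod>b\<in>Basis. \<bar>\<xi> \<bullet> b\<bar> ^ count_list bs b) = (\<Prod>c\<in>Basis. \<bar>\<xi> \<bullet> c\<bar> ^ count_list (b # bs) c)"
  proof -
    have "(\<Prod>c\<in>Basis. \<bar>\<xi> \<bullet> c\<bar> ^ count_list (b # bs) c) =
      (\<Prod>c\<in>Basis. (if c = b then \<bar>\<xi> \<bullet> c\<bar> else 1) * \<bar>\<xi> \<bullet> c\<bar> ^ count_list bs c)"
      by (intro prod.cong) auto
    then show ?thesis using b by (simp add: prod.distrib)
  qed
  finally show ?case by (simp add: mult.assoc)
qed

lemma ex_list_count:
  fixes \<alpha> :: "'a::euclidean_space \<Rightarrow> nat"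
  obtains bs where "bs \<in> lists Basis" "\<And>b. b \<in> Basis \<Longrightarrow> count_list bs b = \<alpha> b"
proof -
  obtain xs :: "'a list" where xs: "set xs = Basis" "distinct xs"
    using finite_distinct_list[OF finite_Basis] by blast
  have "count_list (concat (map (\<lambda>b. replicate (\<alpha> b) b) ys)) b = (if b \<in> set ys then \<alpha> b else 0)"
    if "distinct ys" for ys b
    using that
  proof (induction ys)
    case (Cons y ys)
    have "count_list (replicate k y) b = (if y = b then k else 0)" for k
      by (induction k) auto
    with Cons show ?case by auto
  qed simp
  with xs show thesis
    by (intro that[of "concat (map (\<lambda>b. replicate (\<alpha> b) b) xs)"]) (auto simp: in_lists_conv_set)
qed

lemma Sigma1_borel [measurable (raw)]:
  assumes "f \<in> Sigma1" shows "f \<in> borel_measurable borel"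
  using smooth_partials(2)[OF Sigma1_smooth[OF assms], of "[]"]
  by (intro borel_measurable_continuous_onI) (simp add: partials_def)

text \<open>By \<open>ft_partials\<close> a monomial in \<xi> becomes a derivative of
  \<open>f\<close>. The list \<open>bs\<close> realises the multi-index adapted to \<xi>, and its
  factorial cancels against the one in the decay of that derivative.\<close>

lemma ft_Sigma1_decay:
  fixes f :: "'a::euclidean_space \<Rightarrow> complex"
  assumes f: "f \<in> Sigma1" and h: "h > 0"
  shows "cmod (ft f \<xi>) \<le> (9 ^ DIM('a) * fc DIM('a) * (LINT x|lborel. exp (- (1 / (2 * h)) * norm (x::'a)))) * gs_val h f * exp (- (1 / (2 * h)) * norm \<xi>)"
proof -
  let ?I = "LINT x|lborel. exp (- (1 / (2 * h)) * norm (x::'a))"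
  obtain \<alpha> :: "'a \<Rightarrow> nat" where
    \<alpha>: "exp (norm \<xi> / (2 * h)) \<le> 3 ^ DIM('a) * ((\<Prod>b\<in>Basis. \<bar>\<xi> \<bullet> b\<bar> ^ \<alpha> b) / (h ^ mi_abs \<alpha> * mi_fact \<alpha>))"
    using norm_exp_le_monomial[OF h] by blast
  obtain bs :: "'a list" where bs: "bs \<in> lists Basis" and c: "\<And>b. b \<in> Basis \<Longrightarrow> count_list bs b = \<alpha> b"
    using ex_list_count by blast
  have c1: "mi_abs \<alpha> = length bs" "mi_fact \<alpha> = mi_fact (count_list bs)"
    "(\<Prod>b\<in>Basis. \<bar>\<xi> \<bullet> b\<bar> ^ \<alpha> b) = (\<Prod>b\<in>Basis. \<bar>\<xi> \<bullet> b\<bar> ^ count_list bs b)"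
    using c mi_abs_count_list[OF bs] by (simp_all add: mi_abs_def mi_fact_def)
  define D where "D = h ^ length bs * mi_fact (count_list bs)"
  have D: "D > 0" using h by (simp add: D_def)
  have "cmod (ft (partials bs f) \<xi>) \<le> fc DIM('a) * (LINT x|lborel. cmod (partials bs f x))"
    by (rule norm_ft_le)
  also have "(LINT x|lborel. cmod (partials bs f x)) \<le> (LINT x|lborel. 3 ^ DIM('a) * D * gs_val h f * exp (- (1 / (2 * h)) * norm (x::'a)))"
  proof (rule integral_mono)
    show i: "integrable lborel (\<lambda>x::'a. 3 ^ DIM('a) * D * gs_val h f * exp (- (1 / (2 * h)) * norm x))"
      by (rule integrable_mult_right, rule integrable_exp_neg_norm) (use h in simp)
    show b: "cmod (partials bs f x) \<le> 3 ^ DIM('a) * D * gs_val h f * exp (- (1 / (2 * h)) * norm x)" for x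
      using Sigma1_partials_decay[OF f h bs, of x] by (simp add: D_def mult_ac)
    have [measurable]: "partials bs f \<in> borel_measurable borel"
      by (intro borel_measurable_continuous_onI smooth_partials Sigma1_smooth f bs)
    have "norm (cmod (partials bs f x)) \<le> norm (3 ^ DIM('a) * D * gs_val h f * exp (- (1 / (2 * h)) * norm x))" for x
      using b[of x] unfolding real_norm_def abs_norm_cancel by linarith
    then show "integrable lborel (\<lambda>x. cmod (partials bs f x))"
      by (intro Bochner_Integration.integrable_bound[OF i]) auto
  qed
  also have "\<dots> = 3 ^ DIM('a) * D * gs_val h f * ?I" by simp
  finally have F: "cmod (ft (partials bs f) \<xi>) \<le> fc DIM('a) * (3 ^ DIM('a) * D * gs_val h f * ?I)"
    by (simp add: mult_left_mono)
  have "cmod (ft f \<xi>) * exp (norm \<xi> / (2 * h)) \<le> cmod (ft f \<xi>) * (3 ^ DIM('a) * ((\<Prod>b\<in>Basis. \<bar>\<xi> \<bullet> b\<bar> ^ count_list bs b) / D))"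
    using \<alpha> unfolding c1 D_def by (rule mult_left_mono) simp
  also have "\<dots> = 3 ^ DIM('a) * (cmod (ft (partials bs f) \<xi>) / D)"
    by (simp add: ft_partials[OF f bs])
  also have "\<dots> \<le> 3 ^ DIM('a) * ((fc DIM('a) * (3 ^ DIM('a) * D * gs_val h f * ?I)) / D)"
    using F D by (intro mult_left_mono divide_right_mono) auto
  \<comment> \<open>One factor 3^n stems from the monomial chosen for \<xi>, the other from the
    decay of the derivative in \<open>x\<close>.\<close>
  also have "\<dots> = 9 ^ DIM('a) * fc DIM('a) * ?I * gs_val h f"
    using D by (simp flip: power_mult_distrib)
  finally show ?thesis
    by (rule le_mult_exp_negI)
qed

text \<open>\<open>h\<close> and \<open>C\<close> depend on the rate only. This uniformity in
  \<open>f\<close> is what later turns decay estimates into continuity of functionals.\<close>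

lemma Sigma1_decay:
  assumes "r > (0::real)"
  obtains h C where "h > 0" "C > 0"
    "\<And>f x. f \<in> (Sigma1 :: ('a::euclidean_space \<Rightarrow> complex) set) \<Longrightarrow> cmod (f x) \<le> C * gs_val h f * exp (- r * norm x)"
    "\<And>f x. f \<in> (Sigma1 :: ('a::euclidean_space \<Rightarrow> complex) set) \<Longrightarrow> cmod (ft f x) \<le> C * gs_val h f * exp (- r * norm x)"
proof -
  define h where "h = 1 / (2 * r)"
  have h: "h > 0" "1 / (2 * h) = r" using assms by (auto simp: h_def)
  define C where "C = max (3 ^ DIM('a)) (9 ^ DIM('a) * fc DIM('a) * (LINT x|lborel. exp (- r * norm (x::'a))))"
  have C: "3 ^ DIM('a) \<le> C" "9 ^ DIM('a) * fc DIM('a) * (LINT x|lborel. exp (- r * norm (x::'a))) \<le> C"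
    by (auto simp: C_def)
  show thesis
  proof (rule that[of h C])
    show "C > 0" using C(1) by (rule less_le_trans[rotated]) simp
    fix f :: "'a \<Rightarrow> complex" and x assume f: "f \<in> Sigma1"
    show "cmod (f x) \<le> C * gs_val h f * exp (- r * norm x)"
    proof -
      have "cmod (f x) \<le> 3 ^ DIM('a) * gs_val h f * exp (- r * norm x)"
        using Sigma1_partials_decay[OF f h(1), of "[]" x] unfolding h(2) by (simp add: partials_def mi_fact_def)
      also have "\<dots> \<le> C * gs_val h f * exp (- r * norm x)"
        by (intro mult_right_mono C(1)) auto
      finally show ?thesis .
    qed
    show "cmod (ft f x) \<le> C * gs_val h f * exp (- r * norm x)"
    proof -
      have "cmod (ft f x) \<le> 9 ^ DIM('a) * fc DIM('a) * (LINT x|lborel. exp (- r * norm (x::'a))) * gs_val h f * exp (- r * norm x)"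
        using ft_Sigma1_decay[OF f h(1), of x] unfolding h(2) .
      also have "\<dots> \<le> C * gs_val h f * exp (- r * norm x)"
        by (intro mult_right_mono C(2)) auto
      finally show ?thesis .
    qed
  qed (fact h)
qed

section \<open>The short-time Fourier transform of functions\<close>

definition atom :: "'a::euclidean_space \<times> 'a \<Rightarrow> 'a \<Rightarrow> complex" where
  "atom z y = gauss (y - fst z) * cis (y \<bullet> snd z)"

text \<open>Since \<open>gauss\<close> is real, \<open>atom (flip z)\<close> is the complex
  conjugate of \<open>atom z\<close>. The reflection therefore replaces conjugation and keeps all
  pairings bilinear.\<close>

definition flip :: "'a::euclidean_space \<times> 'a \<Rightarrow> 'a \<times> 'a" where
  "flip z = (fst z, - snd z)"

definition stf :: "('a::euclidean_space \<Rightarrow> complex) \<Rightarrow> 'a \<times> 'a \<Rightarrow> complex" where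
  "stf f z = of_real (fc DIM('a)) * (LINT y|lborel. f y * atom (flip z) y)"

lemma fst_flip [simp]: "fst (flip z) = fst z" and snd_flip [simp]: "snd (flip z) = - snd z"
  and flip_flip [simp]: "flip (flip z) = z"
  by (simp_all add: flip_def)

lemma flip_measurable [measurable (raw)]:
  assumes [measurable]: "f \<in> borel_measurable M"
  shows "(\<lambda>x. flip (f x)) \<in> borel_measurable M"
  unfolding flip_def by measurable

lemma norm_flip [simp]: "norm (flip z) = norm z"
  by (simp add: flip_def norm_Pair norm_prod_def)

lemma gauss_measurable [measurable]: "gauss \<in> borel_measurable borel"
  unfolding gauss_def[abs_def] by measurable

lemma atom_measurable [measurable (raw)]:
  assumes [measurable]: "f \<in> borel_measurable M" "g \<in> borel_measurable M"
  shows "(\<lambda>x. atom (f x) (g x)) \<in> borel_measurable M"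
  unfolding atom_def by measurable

lemma stf_measurable [measurable]:
  assumes [measurable]: "f \<in> borel_measurable borel"
  shows "stf f \<in> borel_measurable borel"
  unfolding stf_def by measurable

lemma norm_atom: "cmod (atom z y) = cmod (gauss (y - fst z))"
  by (simp add: atom_def norm_mult)

lemma exp_neg_square_le: "exp (- u\<^sup>2 / 2) \<le> exp (r\<^sup>2 / 2) * exp (- r * u)" for u r :: real
proof -
  have "0 \<le> (u - r)\<^sup>2" by simp
  then have "- u\<^sup>2 / 2 \<le> r\<^sup>2 / 2 + - r * u" by (simp add: power2_diff field_simps)
  then show ?thesis by (simp flip: exp_add)
qed

lemma norm_gauss_eq: "cmod (gauss (x::'a::euclidean_space)) = pi powr (- real DIM('a) / 4) * exp (- (norm x)\<^sup>2 / 2)"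
  by (simp add: gauss_def norm_mult)

text \<open>Completing the square: every exponential rate is available, at the price of exp (r^2 /
  2). The normalising constant is at most 1 because pi >= 1.\<close>

lemma norm_gauss_le:
  "cmod (gauss (x::'a::euclidean_space)) \<le> exp (r\<^sup>2 / 2) * exp (- r * norm x)"
proof -
  have "pi powr (- real DIM('a) / 4) \<le> pi powr 0"
    using pi_gt3 by (intro powr_mono) auto
  then have "cmod (gauss x) \<le> 1 * exp (- (norm x)\<^sup>2 / 2)"
    unfolding norm_gauss_eq by (intro mult_right_mono) auto
  also have "\<dots> \<le> exp (r\<^sup>2 / 2) * exp (- r * norm x)"
    using exp_neg_square_le by simp
  finally show ?thesis .
qed

lemma norm_gauss_le_1: "cmod (gauss x) \<le> 1"
  using norm_gauss_le[of x 0] by simp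

lemma continuous_gauss [continuous_intros]:
  "continuous_on S f \<Longrightarrow> continuous_on S (\<lambda>x. gauss (f x))"
  unfolding gauss_def by (intro continuous_intros) auto

lemma integrable_exp_gauss: "integrable lborel (\<lambda>s::'a::euclidean_space. exp (r * norm s) * cmod (gauss s))"
proof (rule Bochner_Integration.integrable_bound)
  show "integrable lborel (\<lambda>s::'a. exp ((r + 1)\<^sup>2 / 2) * exp (- 1 * norm s))"
    by (rule integrable_mult_right, rule integrable_exp_neg_norm) simp
  show "AE s in lborel. norm (exp (r * norm s) * cmod (gauss s)) \<le> norm (exp ((r + 1)\<^sup>2 / 2) * exp (- 1 * norm (s::'a)))"
  proof (rule AE_I2)
    fix s :: 'a
    have "exp (r * norm s) * cmod (gauss s) \<le> exp (r * norm s) * (exp ((r + 1)\<^sup>2 / 2) * exp (- (r + 1) * norm s))"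
      by (intro mult_left_mono norm_gauss_le) auto
    also have "\<dots> = exp ((r + 1)\<^sup>2 / 2) * exp (- 1 * norm s)"
      by (simp only: exp_add[symmetric] mult.left_commute) (simp add: algebra_simps)
    finally show "norm (exp (r * norm s) * cmod (gauss s)) \<le> norm (exp ((r + 1)\<^sup>2 / 2) * exp (- 1 * norm s))"
      by simp
  qed
qed simp

lemma integrable_atom: "integrable lborel (atom (z :: 'a::euclidean_space \<times> 'a))"
proof (rule Bochner_Integration.integrable_bound)
  show "integrable lborel (\<lambda>y. cmod (gauss (y - fst z)))"
    using integrable_exp_gauss[of 0, where 'a='a] lborel_integrable_affine[of "\<lambda>s. cmod (gauss s)" 1 "- fst z"]
    by simp
qed (auto simp: norm_atom)

text \<open>The Gaussian is its own Fourier transform, so up to a phase the transform of an atom is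
  the atom with position and frequency exchanged.\<close>

lemma ft_atom:
  fixes z :: "'a::euclidean_space \<times> 'a"
  shows "ft (atom z) \<eta> = cis (fst z \<bullet> (snd z - \<eta>)) * gauss (\<eta> - snd z)"
proof -
  let ?g = "pi powr (- real DIM('a) / 4)"
  have "(LINT y|lborel. atom z y * cis (- (y \<bullet> \<eta>))) =
    (LINT s|lborel. atom z (fst z + 1 *\<^sub>R s) * cis (- ((fst z + 1 *\<^sub>R s) \<bullet> \<eta>)))"
    by (subst lborel_integral_affine[where c=1 and t="fst z"]) auto
  also have "(\<lambda>s. atom z (fst z + 1 *\<^sub>R s) * cis (- ((fst z + 1 *\<^sub>R s) \<bullet> \<eta>))) =
    (\<lambda>s. (cis (fst z \<bullet> (snd z - \<eta>)) * of_real ?g) *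
      (of_real (exp (- 1 * (norm s)\<^sup>2 / 2)) * cis (- (s \<bullet> (\<eta> - snd z)))))"
  proof
    fix s
    have "cis ((fst z + 1 *\<^sub>R s) \<bullet> snd z) * cis (- ((fst z + 1 *\<^sub>R s) \<bullet> \<eta>)) =
      cis (fst z \<bullet> (snd z - \<eta>)) * cis (- (s \<bullet> (\<eta> - snd z)))"
      unfolding cis_mult by (simp add: inner_diff_right inner_add_left algebra_simps)
    then show "atom z (fst z + 1 *\<^sub>R s) * cis (- ((fst z + 1 *\<^sub>R s) \<bullet> \<eta>)) =
      (cis (fst z \<bullet> (snd z - \<eta>)) * of_real ?g) *
      (of_real (exp (- 1 * (norm s)\<^sup>2 / 2)) * cis (- (s \<bullet> (\<eta> - snd z))))"
      unfolding atom_def gauss_def by (simp add: mult.assoc mult.left_commute)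
  qed
  also have "(LINT s|lborel. (cis (fst z \<bullet> (snd z - \<eta>)) * of_real ?g) *
      (of_real (exp (- 1 * (norm s)\<^sup>2 / 2)) * cis (- (s \<bullet> (\<eta> - snd z))))) =
    (cis (fst z \<bullet> (snd z - \<eta>)) * of_real ?g) * of_real ((2 * pi / 1) powr (DIM('a) / 2) * exp (- (norm (\<eta> - snd z))\<^sup>2 / (2 * 1)))"
    unfolding integral_mult_right_zero gaussian_fourier(2)[OF zero_less_one] ..
  finally have "ft (atom z) \<eta> = of_real (fc DIM('a) * (2 * pi) powr (DIM('a) / 2)) *
    (cis (fst z \<bullet> (snd z - \<eta>)) * gauss (\<eta> - snd z))"
    unfolding ft_def gauss_def by (simp add: mult_ac)
  also have "fc DIM('a) * (2 * pi) powr (DIM('a) / 2) = 1"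
    unfolding fc_def by (subst powr_add[symmetric]) simp
  finally show ?thesis by simp
qed

lemma gauss_L2: "(LINT x|lborel. gauss (t - x) * gauss (t - x)) = (1::complex)"
  for t :: "'a::euclidean_space"
proof -
  let ?g = "pi powr (- real DIM('a) / 4)"
  have "(LINT x|lborel. gauss (t - x) * gauss (t - x)) = (LINT s|lborel. gauss (t - (t + (- 1) *\<^sub>R s)) * gauss (t - (t + (- 1) *\<^sub>R s)))"
    by (subst lborel_integral_affine[where c="-1" and t=t]) auto
  also have "\<dots> = (LINT s|lborel. of_real (?g * ?g) * (of_real (exp (- 2 * (norm (s::'a))\<^sup>2 / 2)) * cis (- (s \<bullet> 0))))"
    by (intro Bochner_Integration.integral_cong refl) (simp add: gauss_def flip: of_real_mult exp_add)
  also have "\<dots> = of_real (?g * ?g) * of_real ((2 * pi / 2) powr (DIM('a) / 2) * exp (- (norm (0::'a))\<^sup>2 / (2 * 2)))"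
    unfolding integral_mult_right_zero gaussian_fourier(2)[OF zero_less_numeral] ..
  also have "\<dots> = of_real (?g * ?g * pi powr (DIM('a) / 2))" by simp
  also have "?g * ?g * pi powr (DIM('a) / 2) = 1"
    unfolding powr_add[symmetric] by simp
  finally show ?thesis by simp
qed

lemma atom_flip_eq_ft: "atom (flip z) y = cis (- (fst z \<bullet> snd z)) * ft (atom (snd z, fst z)) y"
proof -
  have "cis (- (fst z \<bullet> snd z)) * cis (snd z \<bullet> (fst z - y)) = cis (- (y \<bullet> snd z))"
    unfolding cis_mult by (simp add: inner_diff_right inner_commute)
  then show ?thesis
    by (simp only: ft_atom atom_def fst_flip snd_flip fst_conv snd_conv inner_minus_right mult.assoc[symmetric])
      (simp only: mult.commute)
qed

text \<open>The fundamental identity of time-frequency analysis: up to a phase, the short-time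
  Fourier transform of \<open>f\<close> is that of \<open>ft f\<close> at the rotated point. It
  converts decay of \<open>ft f\<close> into decay in the frequency variable.\<close>

lemma stf_eq_ft:
  fixes f :: "'a::euclidean_space \<Rightarrow> complex"
  assumes "integrable lborel f"
  shows "stf f z = cis (- (fst z \<bullet> snd z)) * (of_real (fc DIM('a)) * (LINT y|lborel. ft f y * atom (snd z, fst z) y))"
proof -
  have "stf f z = of_real (fc DIM('a)) * (LINT y|lborel. cis (- (fst z \<bullet> snd z)) * (f y * ft (atom (snd z, fst z)) y))"
    unfolding stf_def atom_flip_eq_ft by (simp add: mult.left_commute)
  then show ?thesis
    unfolding integral_mult_right_zero ft_duality[OF assms integrable_atom] by (simp add: mult.left_commute)
qed

text \<open>Moving the exponential from \<open>y\<close> to the centre of the atom costs exp (r |y -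
  fst z|), which the Gaussian absorbs.\<close>

lemma norm_integral_atom_le:
  fixes f :: "'a::euclidean_space \<Rightarrow> complex"
  assumes f: "\<And>y. cmod (f y) \<le> M * exp (- r * norm y)" and r: "r \<ge> 0"
  shows "cmod (LINT y|lborel. f y * atom z y) \<le> M * (LINT s|lborel. exp (r * norm (s::'a)) * cmod (gauss s)) * exp (- r * norm (fst z))"
proof -
  have M: "M \<ge> 0" using order_trans[OF norm_ge_zero f[of 0]] by simp
  let ?h = "\<lambda>s. M * exp (- r * norm (fst z)) * (exp (r * norm (s::'a)) * cmod (gauss s))"
  have ih: "integrable lborel ?h"
    by (rule integrable_mult_right, rule integrable_exp_gauss)
  then have ih': "integrable lborel (\<lambda>y. ?h (- fst z + 1 *\<^sub>R y))"
    by (subst (asm) lborel_integrable_affine[where c=1 and t="- fst z"]) auto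
  have "cmod (f y * atom z y) \<le> ?h (- fst z + 1 *\<^sub>R y)" for y
  proof -
    have "cmod (f y) \<le> M * (exp (r * norm (y - fst z)) * exp (- r * norm (fst z)))"
      using order_trans[OF f mult_left_mono[OF exp_neg_norm_translate[OF r, of "fst z" "y - fst z"] M]] by simp
    then have "cmod (f y) * cmod (gauss (y - fst z)) \<le> M * (exp (r * norm (y - fst z)) * exp (- r * norm (fst z))) * cmod (gauss (y - fst z))"
      by (rule mult_right_mono) simp
    then show ?thesis
      unfolding norm_mult norm_atom by (simp add: mult_ac)
  qed
  then have "(LINT y|lborel. cmod (f y * atom z y)) \<le> (LINT y|lborel. ?h (- fst z + 1 *\<^sub>R y))"
    using M by (intro integral_mono_AE'[OF ih']) auto
  then have "cmod (LINT y|lborel. f y * atom z y) \<le> (LINT y|lborel. ?h (- fst z + 1 *\<^sub>R y))"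
    by (rule order_trans[OF integral_norm_bound])
  also have "\<dots> = (LINT s|lborel. ?h s)"
    by (rule sym) (subst lborel_integral_affine[where c=1 and t="- fst z" and f="?h"], simp_all)
  finally show ?thesis unfolding integral_mult_right_zero by (simp add: mult_ac)
qed


lemma integrable_exp_bound:
  fixes f :: "'a::euclidean_space \<Rightarrow> 'b::{banach, second_countable_topology}"
  assumes [measurable]: "f \<in> borel_measurable borel" and f: "\<And>y. norm (f y) \<le> M * exp (- r * norm y)" and r: "r > 0"
  shows "integrable lborel f"
proof (rule Bochner_Integration.integrable_bound)
  show "integrable lborel (\<lambda>y::'a. M * exp (- r * norm y))"
    using integrable_exp_neg_norm[OF r] by (rule integrable_mult_right)
  show "AE x in lborel. norm (f x) \<le> norm (M * exp (- r * norm x))"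
    using f by (auto intro: order_trans abs_ge_self)
qed simp

text \<open>The decay of \<open>f\<close> controls the position variable, that of
  \<open>ft f\<close> the frequency variable. The larger of the two components is at least half of
  \<open>norm z\<close>, which halves the rate.\<close>

lemma stf_decay:
  assumes "r > (0::real)"
  obtains C where "C > 0" "\<And>f M z. f \<in> borel_measurable borel \<Longrightarrow>
    (\<And>y::'a::euclidean_space. cmod (f y) \<le> M * exp (- (2 * r) * norm y)) \<Longrightarrow>
    (\<And>y. cmod (ft f y) \<le> M * exp (- (2 * r) * norm y)) \<Longrightarrow> cmod (stf f z) \<le> C * M * exp (- r * norm z)"
proof -
  define K where "K = fc DIM('a) * (LINT s|lborel. exp ((2 * r) * norm (s::'a)) * cmod (gauss s))"
  have K: "K \<ge> 0" unfolding K_def by (intro mult_nonneg_nonneg Bochner_Integration.integral_nonneg) auto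
  show thesis
  proof (rule that[of "K + 1"])
    fix f :: "'a \<Rightarrow> complex" and M z
    assume [measurable]: "f \<in> borel_measurable borel"
      and f: "\<And>y. cmod (f y) \<le> M * exp (- (2 * r) * norm y)"
      and g: "\<And>y. cmod (ft f y) \<le> M * exp (- (2 * r) * norm y)"
    have M: "M \<ge> 0" using order_trans[OF norm_ge_zero f[of 0]] by simp
    have i: "integrable lborel f" using assms by (intro integrable_exp_bound[OF _ f]) auto
    have r2: "2 * r \<ge> 0" using assms by simp
    have "cmod (stf f z) \<le> K * M * exp (- (2 * r) * norm (fst z))"
      using mult_left_mono[OF norm_integral_atom_le[OF f r2, of "flip z"] fc_nonneg[of "DIM('a)"]]
      by (simp add: stf_def norm_mult K_def mult_ac)
    moreover have "cmod (stf f z) \<le> K * M * exp (- (2 * r) * norm (snd z))"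
      using mult_left_mono[OF norm_integral_atom_le[OF g r2, of "(snd z, fst z)"] fc_nonneg[of "DIM('a)"]]
      by (simp add: stf_eq_ft[OF i] norm_mult K_def mult_ac)
    moreover have "norm z \<le> norm (fst z) + norm (snd z)"
      using norm_Pair_le[of "fst z" "snd z"] by simp
    then have "norm z \<le> 2 * norm (fst z) \<or> norm z \<le> 2 * norm (snd z)" by linarith
    then have "exp (- (2 * r) * norm (fst z)) \<le> exp (- r * norm z) \<or> exp (- (2 * r) * norm (snd z)) \<le> exp (- r * norm z)"
      using assms by (auto simp: mult.commute)
    ultimately have "cmod (stf f z) \<le> K * M * exp (- r * norm z)"
      using K M by (meson mult_left_mono mult_nonneg_nonneg order_trans)
    also have "\<dots> \<le> (K + 1) * M * exp (- r * norm z)"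
      using M by (intro mult_right_mono) auto
    finally show "cmod (stf f z) \<le> (K + 1) * M * exp (- r * norm z)" .
  qed (use K in simp)
qed

text \<open>For fixed position \<open>x\<close>, Fourier inversion recovers f times the shifted
  Gaussian at \<open>t\<close>. Multiplying by the Gaussian once more and integrating in
  \<open>x\<close> uses only that \<open>gauss\<close> has L2 norm 1.\<close>

lemma stf_inversion:
  fixes f :: "'a::euclidean_space \<Rightarrow> complex"
  assumes cont: "continuous_on UNIV f" and r: "r > 0"
    and f: "\<And>y. cmod (f y) \<le> M * exp (- (2 * r) * norm y)"
    and g: "\<And>y. cmod (ft f y) \<le> M * exp (- (2 * r) * norm y)"
  shows "f t = of_real (fc DIM('a)) * (LINT z|lborel. stf f z * atom z t)"
    and "integrable lborel (\<lambda>z. stf f z * atom z t)"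
proof -
  have [measurable]: "f \<in> borel_measurable borel"
    using cont by (rule borel_measurable_continuous_onI)
  have M: "M \<ge> 0" using order_trans[OF norm_ge_zero f[of 0]] by simp
  have i: "integrable lborel f" using r by (intro integrable_exp_bound[OF _ f]) auto
  obtain C where "C > 0" and C: "\<And>z. cmod (stf f z) \<le> C * M * exp (- r * norm z)"
    using stf_decay[OF r] f g by (metis (no_types, lifting) \<open>f \<in> borel_measurable borel\<close>)
  have B: "cmod (stf f z * atom z t) \<le> C * M * exp (- r * norm z)" for z
    using mult_mono[OF C[of z] norm_gauss_le_1[of "t - fst z"]] M \<open>C > 0\<close>
    by (simp add: norm_mult norm_atom)
  show int: "integrable lborel (\<lambda>z. stf f z * atom z t)"
    by (rule integrable_exp_bound[OF _ B r]) measurable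
  have x: "f t * (gauss (t - x) * gauss (t - x)) = of_real (fc DIM('a)) * (LINT \<xi>|lborel. stf f (x, \<xi>) * atom (x, \<xi>) t)" for x
  proof -
    define u where "u y = f y * gauss (y - x)" for y
    have u: "cmod (u y) \<le> cmod (f y)" for y
      unfolding u_def norm_mult by (intro mult_left_le norm_gauss_le_1) auto
    have ftu: "ft u = (\<lambda>\<xi>. stf f (x, \<xi>))"
      by (rule ext) (simp add: ft_def stf_def u_def atom_def mult.assoc)
    have "u t = of_real (fc DIM('a)) * (LINT \<xi>|lborel. ft u \<xi> * cis (t \<bullet> \<xi>))"
    proof (rule fourier_inversion)
      show "continuous_on UNIV u" unfolding u_def by (intro continuous_intros cont)
      show "cmod (u y) \<le> M" for y
      proof -
        have "M * exp (- (2 * r) * norm y) \<le> M * 1" using M r by (intro mult_left_mono) auto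
        then show ?thesis using order_trans[OF u f, of y] by linarith
      qed
      show "integrable lborel u"
        by (rule Bochner_Integration.integrable_bound[OF i]) (use u in \<open>auto simp: u_def[abs_def]\<close>)
      have "cmod (ft u \<xi>) \<le> C * M * exp (- r * norm \<xi>)" for \<xi>
      proof -
        have "exp (- r * norm (x, \<xi>)) \<le> exp (- r * norm \<xi>)"
          using r norm_snd_le[of \<xi> x] by simp
        then have "C * M * exp (- r * norm (x, \<xi>)) \<le> C * M * exp (- r * norm \<xi>)"
          using M \<open>C > 0\<close> by (intro mult_left_mono) auto
        with C[of "(x, \<xi>)"] show ?thesis unfolding ftu by linarith
      qed
      note ub = this
      show "integrable lborel (ft u)"
        by (rule integrable_exp_bound[OF _ ub r]) (simp add: u_def[abs_def])
    qed
    then have "u t * gauss (t - x) = of_real (fc DIM('a)) * ((LINT \<xi>|lborel. ft u \<xi> * cis (t \<bullet> \<xi>)) * gauss (t - x))"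
      by (simp add: mult.assoc)
    then show ?thesis
      unfolding u_def ftu integral_mult_left_zero[symmetric] by (simp add: atom_def mult.assoc mult.commute[of "cis _"])
  qed
  have "f t = (LINT x|lborel. f t * (gauss (t - x) * gauss (t - x)))"
    unfolding integral_mult_right_zero gauss_L2 by simp
  also have "\<dots> = of_real (fc DIM('a)) * (LINT x|lborel. LINT \<xi>|lborel. stf f (x, \<xi>) * atom (x, \<xi>) t)"
    unfolding x integral_mult_right_zero ..
  also have "(LINT x|lborel. LINT \<xi>|lborel. stf f (x, \<xi>) * atom (x, \<xi>) t) = (LINT z|lborel. stf f z * atom z t)"
    using int lborel_integral_fst[of "\<lambda>x \<xi>. stf f (x, \<xi>) * atom (x, \<xi>) t"] by (simp add: case_prod_beta')
  finally show "f t = of_real (fc DIM('a)) * (LINT z|lborel. stf f z * atom z t)" .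
qed

section \<open>Derivatives of time-frequency shifts of the Gaussian\<close>

lemma gs_norm_leI:
  fixes f :: "'a::euclidean_space \<Rightarrow> complex"
  assumes h: "h > 0" and K: "\<And>\<alpha> bs y. bs \<in> lists Basis \<Longrightarrow> \<bar>mi_power y \<alpha>\<bar> * cmod (partials bs f y) \<le>
    K * (h ^ (mi_abs \<alpha> + length bs) * mi_fact \<alpha> * mi_fact (count_list bs))"
  shows "gs_norm h f \<le> ennreal K"
  unfolding gs_norm_def
proof (intro SUP_least)
  fix \<alpha> :: "'a \<Rightarrow> nat" and bs and x :: 'a assume bs: "bs \<in> lists (Basis :: 'a set)"
  have D: "h ^ (mi_abs \<alpha> + length bs) * mi_fact \<alpha> * mi_fact (count_list bs) > 0" using h by simp
  show "ennreal (cmod (of_real (mi_power x \<alpha>) * partials bs f x) /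
       (h ^ (mi_abs \<alpha> + mi_abs (count_list bs)) * mi_fact \<alpha> * mi_fact (count_list bs))) \<le> ennreal K"
    unfolding mi_abs_count_list[OF bs] norm_mult norm_of_real
    by (intro ennreal_leI) (use K[OF bs, of x \<alpha>] pos_divide_le_eq[OF D] in blast)
qed

text \<open>Products of entire functions of one coordinate each. Partial derivatives then act on
  single factors, and Cauchy's estimate applies to each factor separately.\<close>

definition tens :: "('a::euclidean_space \<Rightarrow> complex \<Rightarrow> complex) \<Rightarrow> 'a \<Rightarrow> complex" where
  "tens g y = (\<Prod>b\<in>Basis. g b (of_real (y \<bullet> b)))"

lemma tens_has_derivative:
  assumes "\<And>b. b \<in> Basis \<Longrightarrow> g b holomorphic_on UNIV"
  shows "(tens g has_derivative
    (\<lambda>h. \<Sum>b\<in>Basis. of_real (h \<bullet> b) * deriv (g b) (of_real (y \<bullet> b)) * (\<Prod>c\<in>Basis - {b}. g c (of_real (y \<bullet> c))))) (at y)"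
  unfolding tens_def
proof (rule has_derivative_prod)
  fix b :: 'a assume b: "b \<in> Basis"
  have "(g b has_field_derivative deriv (g b) (of_real (y \<bullet> b))) (at (of_real (y \<bullet> b)))"
    using assms[OF b] holomorphic_derivI by blast
  then have "(g b has_derivative (*) (deriv (g b) (of_real (y \<bullet> b)))) (at (of_real (y \<bullet> b)))"
    by (simp add: has_field_derivative_def)
  moreover have "((\<lambda>y. complex_of_real (y \<bullet> b)) has_derivative (\<lambda>h. of_real (h \<bullet> b))) (at y)"
    by (auto intro!: derivative_eq_intros)
  ultimately have "((\<lambda>y. g b (of_real (y \<bullet> b))) has_derivative (\<lambda>h. deriv (g b) (of_real (y \<bullet> b)) * of_real (h \<bullet> b))) (at y)"
    by (rule has_derivative_compose[rotated])
  then show "((\<lambda>y. g b (of_real (y \<bullet> b))) has_derivative (\<lambda>h. of_real (h \<bullet> b) * deriv (g b) (of_real (y \<bullet> b)))) (at y)"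
    by (simp only: mult.commute)
qed

lemma partial_eq:
  assumes "(f has_derivative D) (at x)"
  shows "partial b f x = D b"
  using frechet_derivative_at[OF assms] by (simp add: partial_def)

lemma partial_tens:
  assumes "\<And>b. b \<in> Basis \<Longrightarrow> g b holomorphic_on UNIV" and b: "b \<in> Basis"
  shows "partial b (tens g) = tens (g(b := deriv (g b)))"
proof
  fix y
  have "partial b (tens g) y = (\<Sum>c\<in>Basis. of_real (b \<bullet> c) * deriv (g c) (of_real (y \<bullet> c)) * (\<Prod>d\<in>Basis - {c}. g d (of_real (y \<bullet> d))))"
    by (rule partial_eq[OF tens_has_derivative[OF assms(1)]])
  also have "\<dots> = (\<Sum>c\<in>Basis. if c = b then deriv (g b) (of_real (y \<bullet> b)) * (\<Prod>d\<in>Basis - {b}. g d (of_real (y \<bullet> d))) else 0)"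
    by (intro sum.cong) (auto simp: inner_Basis b)
  also have "\<dots> = deriv (g b) (of_real (y \<bullet> b)) * (\<Prod>d\<in>Basis - {b}. g d (of_real (y \<bullet> d)))"
    using b by simp
  also have "\<dots> = tens (g(b := deriv (g b))) y"
    unfolding tens_def prod.remove[OF finite_Basis b] by simp
  finally show "partial b (tens g) y = tens (g(b := deriv (g b))) y" .
qed

lemma partials_tens:
  assumes g: "\<And>b. b \<in> Basis \<Longrightarrow> g b holomorphic_on UNIV" and bs: "bs \<in> lists Basis"
  shows "partials bs (tens g) = tens (\<lambda>b. (deriv ^^ count_list bs b) (g b))"
  using bs
proof (induction bs)
  case Nil
  show ?case by (simp add: partials_def)
next
  case (Cons b bs)
  then have b: "b \<in> Basis" by simp
  have "partials (b # bs) (tens g) = partial b (tens (\<lambda>b. (deriv ^^ count_list bs b) (g b)))"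
    using Cons by (simp add: partials_def)
  also have "\<dots> = tens ((\<lambda>b. (deriv ^^ count_list bs b) (g b))(b := deriv ((deriv ^^ count_list bs b) (g b))))"
    using b by (intro partial_tens holomorphic_higher_deriv g) auto
  also have "(\<lambda>b. (deriv ^^ count_list bs b) (g b))(b := deriv ((deriv ^^ count_list bs b) (g b))) =
    (\<lambda>c. (deriv ^^ count_list (b # bs) c) (g c))"
    by (auto simp: fun_eq_iff)
  finally show ?case .
qed

lemma smooth_tens:
  fixes g :: "'a::euclidean_space \<Rightarrow> complex \<Rightarrow> complex"
  assumes g: "\<And>b. b \<in> Basis \<Longrightarrow> g b holomorphic_on UNIV"
  shows "smooth (tens g)"
  unfolding smooth_def
proof (intro ballI allI)
  fix bs and x :: 'a assume bs: "bs \<in> lists (Basis::'a set)"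
  show "partials bs (tens g) differentiable at x"
  proof -
    have "(tens (\<lambda>b. (deriv ^^ count_list bs b) (g b)) has_derivative
      (\<lambda>h. \<Sum>b\<in>Basis. of_real (h \<bullet> b) * deriv ((deriv ^^ count_list bs b) (g b)) (of_real (x \<bullet> b)) *
        (\<Prod>c\<in>Basis - {b}. (deriv ^^ count_list bs c) (g c) (of_real (x \<bullet> c))))) (at x)"
      by (intro tens_has_derivative holomorphic_higher_deriv g) auto
    then show ?thesis
      using partials_tens[of g bs, OF g bs] unfolding differentiable_def by auto
  qed
qed

text \<open>The one-dimensional factor of \<open>atom\<close>, continued to an entire function; the
  square carries no modulus for this reason.\<close>

definition atom1 :: "real \<Rightarrow> real \<Rightarrow> complex \<Rightarrow> complex" where
  "atom1 x \<xi> w = of_real (pi powr (- 1 / 4)) * exp (- (w - of_real x)\<^sup>2 / 2 + \<i> * w * of_real \<xi>)"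

lemma atom1_holomorphic: "atom1 x \<xi> holomorphic_on S"
  unfolding atom1_def by (intro holomorphic_intros) auto

lemma atom_eq_tens: "atom z = tens (\<lambda>b. atom1 (fst z \<bullet> b) (snd z \<bullet> b))"
proof
  fix y :: 'a
  have 1: "(pi powr (- 1 / 4)) ^ DIM('a) = pi powr (- real DIM('a) / 4)"
    by (simp add: powr_powr flip: powr_realpow)
  have n: "(norm x)\<^sup>2 = (\<Sum>b\<in>Basis. (x \<bullet> b)\<^sup>2)" for x :: 'a
    unfolding power2_norm_eq_inner by (subst euclidean_inner) (simp add: power2_eq_square)
  have e: "exp (- (of_real (y \<bullet> b) - of_real (fst z \<bullet> b))\<^sup>2 / 2 + \<i> * of_real (y \<bullet> b) * of_real (snd z \<bullet> b)) =
    of_real (exp (- ((y - fst z) \<bullet> b)\<^sup>2 / 2)) * cis ((y \<bullet> b) * (snd z \<bullet> b))" for b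
    by (simp add: cis_conv_exp exp_of_real[symmetric] inner_diff_left mult.assoc flip: exp_add)
  have "tens (\<lambda>b. atom1 (fst z \<bullet> b) (snd z \<bullet> b)) y =
    of_real ((pi powr (- 1 / 4)) ^ DIM('a)) * ((\<Prod>b\<in>Basis. of_real (exp (- ((y - fst z) \<bullet> b)\<^sup>2 / 2))) *
      (\<Prod>b\<in>Basis. cis ((y \<bullet> b) * (snd z \<bullet> b))))"
    unfolding tens_def atom1_def e prod.distrib prod_constant by simp
  also have "(\<Prod>b\<in>Basis. cis ((y \<bullet> b) * (snd z \<bullet> b))) = cis (y \<bullet> snd z)"
    by (subst euclidean_inner[of y]) (simp add: cis_sum)
  also have "(\<Prod>b\<in>Basis. complex_of_real (exp (- ((y - fst z) \<bullet> b)\<^sup>2 / 2))) = of_real (exp (- (norm (y - fst z))\<^sup>2 / 2))"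
    unfolding n of_real_prod[symmetric] exp_sum[OF finite_Basis, symmetric] by (simp add: sum_negf sum_divide_distrib)
  finally show "atom z y = tens (\<lambda>b. atom1 (fst z \<bullet> b) (snd z \<bullet> b)) y"
    unfolding 1 atom_def gauss_def by (simp add: mult.assoc)
qed

text \<open>On a circle of radius R around a real point the Gaussian still decays like exp (- R
  |t|), because only the imaginary part, at most R, makes it grow.\<close>

lemma atom1_bound:
  assumes R: "R > 0" and w: "cmod (of_real t - w) = R"
  shows "cmod (atom1 x \<xi> w) \<le> exp (2 * R\<^sup>2 + R * (\<bar>x\<bar> + \<bar>\<xi>\<bar>)) * exp (- R * \<bar>t\<bar>)"
proof -
  have a: "\<bar>Re w - t\<bar> \<le> R" "\<bar>Im w\<bar> \<le> R"
    using abs_Re_le_cmod[of "of_real t - w"] abs_Im_le_cmod[of "of_real t - w"] w by auto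
  then have "(Im w)\<^sup>2 \<le> R\<^sup>2" using R by (metis abs_le_square_iff abs_of_pos)
  moreover have "0 \<le> (\<bar>Re w - x\<bar> - R)\<^sup>2" by simp
  then have "- (Re w - x)\<^sup>2 / 2 \<le> R\<^sup>2 / 2 - R * \<bar>Re w - x\<bar>"
    by (simp add: power2_diff field_simps)
  moreover have "R * (\<bar>t\<bar> - R - \<bar>x\<bar>) \<le> R * \<bar>Re w - x\<bar>"
    using R a by (intro mult_left_mono) auto
  moreover have "- (Im w * \<xi>) \<le> R * \<bar>\<xi>\<bar>"
    using mult_right_mono[OF a(2), of "\<bar>\<xi>\<bar>"] by (simp flip: abs_mult)
  \<comment> \<open>The constant 2 R^2 collects R^2 / 2 from completing the square, R^2 from
    replacing Re w by t, and R^2 / 2 from the imaginary part.\<close>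
  ultimately have "- (Re w - x)\<^sup>2 / 2 + (Im w)\<^sup>2 / 2 - Im w * \<xi> \<le> 2 * R\<^sup>2 + R * (\<bar>x\<bar> + \<bar>\<xi>\<bar>) - R * \<bar>t\<bar>"
    unfolding ring_distribs power2_eq_square[of R] by linarith
  moreover have "Re (- (w - of_real x)\<^sup>2 / 2 + \<i> * w * of_real \<xi>) = - (Re w - x)\<^sup>2 / 2 + (Im w)\<^sup>2 / 2 - Im w * \<xi>"
    by (simp add: power2_eq_square field_simps)
  ultimately have "cmod (exp (- (w - of_real x)\<^sup>2 / 2 + \<i> * w * of_real \<xi>)) \<le> exp (2 * R\<^sup>2 + R * (\<bar>x\<bar> + \<bar>\<xi>\<bar>) - R * \<bar>t\<bar>)"
    by (simp only: norm_exp_eq_Re exp_le_cancel_iff)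
  moreover have "pi powr (- 1 / 4) \<le> pi powr 0" using pi_gt3 by (intro powr_mono) auto
  ultimately have "cmod (atom1 x \<xi> w) \<le> 1 * exp (2 * R\<^sup>2 + R * (\<bar>x\<bar> + \<bar>\<xi>\<bar>) - R * \<bar>t\<bar>)"
    unfolding atom1_def norm_mult by (intro mult_mono) auto
  then show ?thesis by (simp flip: exp_add)
qed

lemma power_mult_exp_le:
  assumes "R > 0" "t \<ge> (0::real)"
  shows "t ^ j * exp (- R * t) \<le> fact j * (1 / R) ^ j"
proof -
  have "(R * t) ^ j / fact j \<le> exp (R * t)"
  proof -
    have s: "(\<lambda>k. (R * t) ^ k / fact k) sums exp (R * t)"
      using exp_converges[of "R * t"] by (simp add: divide_inverse mult.commute)
    have "(\<Sum>k\<in>{j}. (R * t) ^ k / fact k) \<le> (\<Sum>k. (R * t) ^ k / fact k)"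
      using assms s by (intro sum_le_suminf) (auto simp: sums_iff)
    then show ?thesis using s by (simp add: sums_iff)
  qed
  then have "(R * t) ^ j \<le> fact j * exp (R * t)" by (simp add: pos_divide_le_eq mult.commute)
  then have "(R * t) ^ j * exp (- R * t) \<le> fact j * exp (R * t) * exp (- R * t)"
    by (rule mult_right_mono) simp
  also have "\<dots> = fact j" by (simp add: mult.assoc flip: exp_add)
  finally have "R ^ j * (t ^ j * exp (- R * t)) \<le> fact j" by (simp add: power_mult_distrib mult.assoc)
  then show ?thesis using assms by (simp add: power_divide pos_le_divide_eq mult.commute)
qed

text \<open>Cauchy's estimate on circles of radius 1 / h produces k! h^k, and the remaining factor
  exp (- |t| / h) absorbs |t|^j as j! h^j. Both match the denominators of
  \<open>gs_norm h\<close>.\<close>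

lemma atom1_deriv_bound:
  assumes h: "h > 0"
  shows "\<bar>t\<bar> ^ j * cmod ((deriv ^^ k) (atom1 x \<xi>) (of_real t)) \<le>
    exp (2 / h\<^sup>2 + (\<bar>x\<bar> + \<bar>\<xi>\<bar>) / h) * (h ^ j * h ^ k * fact j * fact k)"
proof -
  let ?R = "1 / h"
  have R: "?R > 0" using h by simp
  define E where "E = exp (2 * ?R\<^sup>2 + ?R * (\<bar>x\<bar> + \<bar>\<xi>\<bar>))"
  have "cmod ((deriv ^^ k) (atom1 x \<xi>) (of_real t)) \<le> fact k * (E * exp (- ?R * \<bar>t\<bar>)) / ?R ^ k"
    unfolding E_def
    by (rule Cauchy_inequality[OF atom1_holomorphic _ R atom1_bound[OF R]])
      (auto intro: holomorphic_on_imp_continuous_on atom1_holomorphic)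
  also have "\<dots> = fact k * h ^ k * E * exp (- ?R * \<bar>t\<bar>)"
    using h by (simp add: power_divide)
  finally have "\<bar>t\<bar> ^ j * cmod ((deriv ^^ k) (atom1 x \<xi>) (of_real t)) \<le> \<bar>t\<bar> ^ j * (fact k * h ^ k * E * exp (- ?R * \<bar>t\<bar>))"
    by (rule mult_left_mono) simp
  also have "\<dots> = fact k * h ^ k * E * (\<bar>t\<bar> ^ j * exp (- ?R * \<bar>t\<bar>))" by simp
  also have "\<dots> \<le> fact k * h ^ k * E * (fact j * (1 / ?R) ^ j)"
    using h by (intro mult_left_mono power_mult_exp_le R) (auto simp: E_def)
  also have "\<dots> = exp (2 / h\<^sup>2 + (\<bar>x\<bar> + \<bar>\<xi>\<bar>) / h) * (h ^ j * h ^ k * fact j * fact k)"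
    by (simp add: E_def power_divide)
  finally show ?thesis .
qed

text \<open>For every \<open>h\<close> the seminorm of an atom grows at most exponentially in its
  centre. All absolutely convergent integrals over atoms rest on this.\<close>

lemma atom_bound:
  assumes h: "h > (0::real)"
  obtains C r where "C > 0" "r > 0"
    "\<And>z \<alpha> bs y. bs \<in> lists Basis \<Longrightarrow> \<bar>mi_power y \<alpha>\<bar> * cmod (partials bs (atom z) (y::'a::euclidean_space)) \<le>
      C * exp (r * norm z) * (h ^ (mi_abs \<alpha> + length bs) * mi_fact \<alpha> * mi_fact (count_list bs))"
proof
  let ?C = "exp (2 * DIM('a) / h\<^sup>2)" and ?r = "2 * DIM('a) / h"
  show "?C > 0" "?r > 0" using h by auto
  fix z \<alpha> bs and y :: 'a assume bs: "bs \<in> lists (Basis::'a set)"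
  have "\<bar>mi_power y \<alpha>\<bar> * cmod (partials bs (atom z) y) =
    (\<Prod>b\<in>Basis. \<bar>y \<bullet> b\<bar> ^ \<alpha> b * cmod ((deriv ^^ count_list bs b) (atom1 (fst z \<bullet> b) (snd z \<bullet> b)) (of_real (y \<bullet> b))))"
    unfolding atom_eq_tens partials_tens[OF atom1_holomorphic bs] tens_def
    by (simp add: mi_power_def abs_prod power_abs prod_norm[symmetric] prod.distrib)
  also have "\<dots> \<le> (\<Prod>b\<in>(Basis::'a set). exp (2 / h\<^sup>2 + (\<bar>fst z \<bullet> b\<bar> + \<bar>snd z \<bullet> b\<bar>) / h) * (h ^ \<alpha> b * h ^ count_list bs b * fact (\<alpha> b) * fact (count_list bs b)))"
    by (intro prod_mono conjI atom1_deriv_bound h) auto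
  also have "\<dots> = exp (\<Sum>b\<in>(Basis::'a set). 2 / h\<^sup>2 + (\<bar>fst z \<bullet> b\<bar> + \<bar>snd z \<bullet> b\<bar>) / h) * (h ^ (mi_abs \<alpha> + length bs) * mi_fact \<alpha> * mi_fact (count_list bs))"
    unfolding mi_abs_count_list[OF bs, symmetric]
    by (simp add: exp_sum prod.distrib mi_abs_def mi_fact_def power_add power_sum)
  also have "\<dots> \<le> ?C * exp (?r * norm z) * (h ^ (mi_abs \<alpha> + length bs) * mi_fact \<alpha> * mi_fact (count_list bs))"
  proof (rule mult_right_mono)
    have "\<bar>fst z \<bullet> b\<bar> + \<bar>snd z \<bullet> b\<bar> \<le> 2 * norm z" if "b \<in> Basis" for b
      using Basis_le_norm[OF that, of "fst z"] Basis_le_norm[OF that, of "snd z"] norm_fst_le[of "fst z" "snd z"] norm_snd_le[of "snd z" "fst z"] unfolding prod.collapse by linarith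
    then have "(\<Sum>b\<in>(Basis::'a set). 2 / h\<^sup>2 + (\<bar>fst z \<bullet> b\<bar> + \<bar>snd z \<bullet> b\<bar>) / h) \<le> (\<Sum>b\<in>(Basis::'a set). 2 / h\<^sup>2 + (2 * norm z) / h)"
      using h by (intro sum_mono add_left_mono divide_right_mono) auto
    also have "\<dots> = 2 * DIM('a) / h\<^sup>2 + ?r * norm z"
      by (simp add: distrib_left mult.commute mult.left_commute)
    finally show "exp (\<Sum>b\<in>(Basis::'a set). 2 / h\<^sup>2 + (\<bar>fst z \<bullet> b\<bar> + \<bar>snd z \<bullet> b\<bar>) / h) \<le> ?C * exp (?r * norm z)"
      by (simp flip: exp_add)
  qed (use h in \<open>auto intro!: mult_nonneg_nonneg less_imp_le\<close>)
  finally show "\<bar>mi_power y \<alpha>\<bar> * cmod (partials bs (atom z) y) \<le> ?C * exp (?r * norm z) * (h ^ (mi_abs \<alpha> + length bs) * mi_fact \<alpha> * mi_fact (count_list bs))" .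
qed

lemma smooth_atom: "smooth (atom z)"
  unfolding atom_eq_tens by (intro smooth_tens atom1_holomorphic)

lemma gs_norm_atom:
  assumes h: "h > (0::real)"
  obtains C r where "C > 0" "r > 0" "\<And>z::'a::euclidean_space \<times> 'a. gs_norm h (atom z) \<le> ennreal (C * exp (r * norm z))"
  using atom_bound[OF h, where 'a='a] gs_norm_leI[OF h, where 'a='a] by metis

lemma atom_Sigma1: "atom z \<in> Sigma1"
proof -
  have "gs_norm h (atom z) < top" if "h > 0" for h
    using gs_norm_atom[OF that, where 'a='a] by (metis ennreal_less_top le_less_trans)
  then show ?thesis by (simp add: Sigma1_def smooth_atom)
qed

section \<open>Synthesis of test functions\<close>

text \<open>Differentiation under the integral sign. The bound \<open>B\<close> on the derivatives
  is also a Lipschitz constant, so the error quotient is dominated by 2 B.\<close>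

lemma has_derivative_lebesgue_integral:
  fixes k :: "'z \<Rightarrow> 'a::euclidean_space \<Rightarrow> complex"
  assumes der: "\<And>z y. (k z has_derivative D z y) (at y)"
    and int: "\<And>y. integrable M (\<lambda>z. k z y)"
    and bnd: "\<And>z y h. cmod (D z y h) \<le> B z * norm h" and B: "integrable M B"
    and meas: "\<And>y h. (\<lambda>z. D z y h) \<in> borel_measurable M"
  shows "((\<lambda>y. LINT z|M. k z y) has_derivative (\<lambda>h. LINT z|M. D z y h)) (at y)"
proof -
  have lin: "linear (D z y)" for z using der has_derivative_linear by blast
  have iD: "integrable M (\<lambda>z. D z y h)" for h
    by (rule Bochner_Integration.integrable_bound[OF integrable_mult_left[OF B, of "norm h"] meas])
      (rule AE_I2, use order_trans[OF bnd abs_ge_self] in simp)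
  have "bounded_linear (\<lambda>h. LINT z|M. D z y h)"
  proof (rule bounded_linear_intro[where K="LINT z|M. B z"])
    show "(LINT z|M. D z y (h + h')) = (LINT z|M. D z y h) + (LINT z|M. D z y h')" for h h'
      by (simp add: linear_add[OF lin] iD)
    show "(LINT z|M. D z y (r *\<^sub>R h)) = r *\<^sub>R (LINT z|M. D z y h)" for r h
      by (simp add: linear_scale[OF lin])
    show "norm (LINT z|M. D z y h) \<le> norm h * (LINT z|M. B z)" for h
    proof -
      have "norm (LINT z|M. D z y h) \<le> (LINT z|M. B z * norm h)"
        by (rule order_trans[OF integral_norm_bound], rule integral_mono[OF integrable_norm[OF iD] integrable_mult_left[OF B] bnd])
      then show ?thesis by (simp add: mult.commute)
    qed
  qed
  moreover have "((\<lambda>h. norm ((LINT z|M. k z (y + h)) - (LINT z|M. k z y) - (LINT z|M. D z y h)) / norm h) \<longlongrightarrow> 0) (at 0)"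
    unfolding tendsto_at_iff_sequentially
  proof (intro allI impI)
    fix X :: "nat \<Rightarrow> 'a" assume X: "\<forall>i. X i \<in> UNIV - {0}" and X0: "X \<longlonglongrightarrow> 0"
    have nz: "norm (X i) > 0" for i using X by auto
    define R where "R i z = cmod (k z (y + X i) - k z y - D z y (X i)) / norm (X i)" for i z
    have [measurable]: "(\<lambda>z. k z v) \<in> borel_measurable M" "(\<lambda>z. D z v w) \<in> borel_measurable M" for v w
      using int meas by (auto dest: borel_measurable_integrable)
    have lim: "(\<lambda>i. R i z) \<longlonglongrightarrow> 0" for z
    proof -
      have "((\<lambda>h. norm (k z (y + h) - k z y - D z y h) / norm h) \<longlongrightarrow> 0) (at 0)"
        using der[of z y] by (simp add: has_derivative_at)
      then show ?thesis
        unfolding tendsto_at_iff_sequentially using X X0 by (auto simp: R_def[abs_def] o_def)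
    qed
    have Rb: "norm (R i z) \<le> 2 * B z" for i z
    proof -
      have "norm (k z (y + X i) - k z y) \<le> B z * norm (y + X i - y)"
      proof (rule differentiable_bound[where S=UNIV, OF convex_UNIV der])
        have "0 \<le> B z * norm (X i)" using order_trans[OF norm_ge_zero bnd] .
        then have "0 \<le> B z" using nz[of i] by (simp add: zero_le_mult_iff)
        then show "onorm (D z v) \<le> B z" for v by (intro onorm_bound bnd)
      qed auto
      moreover have "norm (k z (y + X i) - k z y - D z y (X i)) \<le> norm (k z (y + X i) - k z y) + norm (D z y (X i))"
        by (rule norm_triangle_ineq4)
      ultimately have "norm (k z (y + X i) - k z y - D z y (X i)) \<le> 2 * B z * norm (X i)"
        using bnd[of z y "X i"] by simp
      then show ?thesis unfolding R_def using nz[of i] by (simp add: pos_divide_le_eq)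
    qed
    have "(\<lambda>i. LINT z|M. R i z) \<longlonglongrightarrow> (LINT z|M. 0)"
      by (rule integral_dominated_convergence[where w="\<lambda>z. 2 * B z"])
        (use lim Rb B in \<open>auto simp: R_def[abs_def]\<close>)
    then have 0: "(\<lambda>i. LINT z|M. R i z) \<longlonglongrightarrow> 0" by simp
    have le: "norm ((LINT z|M. k z (y + X i)) - (LINT z|M. k z y) - (LINT z|M. D z y (X i))) / norm (X i) \<le> (LINT z|M. R i z)" for i
    proof -
      have "(LINT z|M. k z (y + X i)) - (LINT z|M. k z y) - (LINT z|M. D z y (X i)) =
        (LINT z|M. k z (y + X i) - k z y - D z y (X i))"
        using int iD by simp
      then have "norm ((LINT z|M. k z (y + X i)) - (LINT z|M. k z y) - (LINT z|M. D z y (X i))) \<le>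
        (LINT z|M. cmod (k z (y + X i) - k z y - D z y (X i)))"
        using integral_norm_bound[of M "\<lambda>z. k z (y + X i) - k z y - D z y (X i)"] by simp
      then have "norm ((LINT z|M. k z (y + X i)) - (LINT z|M. k z y) - (LINT z|M. D z y (X i))) / norm (X i) \<le>
        (LINT z|M. cmod (k z (y + X i) - k z y - D z y (X i))) / norm (X i)"
        by (rule divide_right_mono) simp
      then show ?thesis
        unfolding R_def integral_divide_zero .
    qed
    show "((\<lambda>h. norm ((LINT z|M. k z (y + h)) - (LINT z|M. k z y) - (LINT z|M. D z y h)) / norm h) \<circ> X) \<longlonglongrightarrow> 0"
      unfolding o_def by (rule tendsto_sandwich[OF _ _ tendsto_const 0]) (use le in auto)
  qed
  ultimately show ?thesis
    unfolding has_derivative_at by blast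
qed

lemma frechet_derivative_euclidean:
  fixes f :: "'a::euclidean_space \<Rightarrow> complex"
  assumes "f differentiable (at y)"
  shows "frechet_derivative f (at y) h = (\<Sum>b\<in>Basis. of_real (h \<bullet> b) * partial b f y)"
proof -
  have "linear (frechet_derivative f (at y))" using assms by (rule linear_frechet_derivative)
  then have "frechet_derivative f (at y) (\<Sum>b\<in>Basis. (h \<bullet> b) *\<^sub>R b) = (\<Sum>b\<in>Basis. (h \<bullet> b) *\<^sub>R frechet_derivative f (at y) b)"
    by (simp add: linear_sum linear_scale)
  then show ?thesis by (simp add: euclidean_representation partial_def scaleR_conv_of_real)
qed

lemma partials_Cons: "partials (b # bs) f = partial b (partials bs f)"
  by (simp add: partials_def)

lemma partials_atom_differentiable: "bs \<in> lists Basis \<Longrightarrow> partials bs (atom z) differentiable (at y)"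
  using smooth_partials(1)[OF smooth_atom] by blast

text \<open>Measurability in the parameter, not in the point: each derivative is a sequential limit
  of difference quotients of derivatives of lower order.\<close>

lemma partials_atom_measurable [measurable (raw)]:
  assumes bs: "bs \<in> lists Basis" and [measurable]: "\<pi> \<in> borel_measurable M"
  shows "(\<lambda>p. partials bs (atom (\<pi> p)) y) \<in> borel_measurable M"
  using bs
proof (induction bs arbitrary: y)
  case Nil
  then show ?case by (simp add: partials_def)
next
  case (Cons b bs)
  then have bs: "bs \<in> lists Basis" by simp
  have [measurable]: "(\<lambda>p. partials bs (atom (\<pi> p)) y) \<in> borel_measurable M" for y
    using Cons by simp
  have "(partials bs (atom z) has_derivative frechet_derivative (partials bs (atom z)) (at y)) (at y)" for z
    using partials_atom_differentiable[OF bs] frechet_derivative_works by blast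
  from directional_difference_quotient[OF this, where b=b]
  have lim: "(\<lambda>k. real (Suc k) *\<^sub>R (partials bs (atom (\<pi> p)) (y + (1 / real (Suc k)) *\<^sub>R b) - partials bs (atom (\<pi> p)) y))
    \<longlonglongrightarrow> partials (b # bs) (atom (\<pi> p)) y" for p
    unfolding partials_Cons partial_def .
  show ?case
    by (rule borel_measurable_LIMSEQ_metric[OF _ lim]) measurable
qed

text \<open>The index space is kept separate from phase space so that superpositions over a product
  of two phase spaces, with \<pi> a projection, are covered. All exponential moments are required
  because the growth rate of \<open>atom_bound\<close> depends on the seminorm.\<close>

locale synthesis =
  fixes M :: "'p measure" and H :: "'p \<Rightarrow> complex" and \<pi> :: "'p \<Rightarrow> 'a::euclidean_space \<times> 'a"
  assumes H_meas [measurable]: "H \<in> borel_measurable M" and \<pi>_meas [measurable]: "\<pi> \<in> borel_measurable M"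
    and exp_int: "\<And>r. integrable M (\<lambda>p. cmod (H p) * exp (r * norm (\<pi> p)))"
begin

definition syn :: "'a \<Rightarrow> complex" where
  "syn y = (LINT p|M. H p * atom (\<pi> p) y)"

lemma partials_bound:
  assumes "bs \<in> lists (Basis::'a set)"
  obtains C r where "C > 0" "\<And>z y. cmod (partials bs (atom z) (y::'a)) \<le> C * exp (r * norm z)"
proof -
  obtain C r where C: "C > 0" and "\<And>z \<alpha> bs y. bs \<in> lists Basis \<Longrightarrow> \<bar>mi_power y \<alpha>\<bar> * cmod (partials bs (atom z) (y::'a)) \<le>
      C * exp (r * norm z) * (1 ^ (mi_abs \<alpha> + length bs) * mi_fact \<alpha> * mi_fact (count_list bs))"
    by (rule atom_bound[OF zero_less_one]) blast
  from this(2)[OF assms, where \<alpha>="\<lambda>_. 0"] have "cmod (partials bs (atom z) y) \<le> C * mi_fact (count_list bs) * exp (r * norm z)" for z y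
    by (simp add: mi_power_def mi_fact_def mult_ac)
  then show thesis using C by (intro that[of "C * mi_fact (count_list bs)" r]) auto
qed

lemma integrable_partials:
  assumes bs: "bs \<in> lists Basis"
  shows "integrable M (\<lambda>p. H p * partials bs (atom (\<pi> p)) y)"
proof -
  obtain C r where C: "C > 0" and b: "\<And>z y. cmod (partials bs (atom z) (y::'a)) \<le> C * exp (r * norm z)"
    using partials_bound[OF bs] by blast
  note partials_atom_measurable[OF bs, measurable]
  show ?thesis
  proof (rule Bochner_Integration.integrable_bound[OF integrable_mult_right[OF exp_int[of r], of C]])
    show "AE p in M. norm (H p * partials bs (atom (\<pi> p)) y) \<le> norm (C * (cmod (H p) * exp (r * norm (\<pi> p))))"
    proof (rule AE_I2)
      fix p
      show "norm (H p * partials bs (atom (\<pi> p)) y) \<le> norm (C * (cmod (H p) * exp (r * norm (\<pi> p))))"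
        using mult_left_mono[OF b[of "\<pi> p" y] norm_ge_zero[of "H p"]] C
        by (simp add: norm_mult abs_mult mult_ac)
    qed
  qed measurable
qed

lemma syn_partials_has_derivative:
  assumes bs: "bs \<in> lists Basis"
  shows "((\<lambda>y. LINT p|M. H p * partials bs (atom (\<pi> p)) y) has_derivative
    (\<lambda>h. LINT p|M. H p * frechet_derivative (partials bs (atom (\<pi> p))) (at y) h)) (at y)"
proof -
  have "\<exists>C r. C > 0 \<and> (\<forall>z y. cmod (partials (b # bs) (atom z) (y::'a)) \<le> C * exp (r * norm z))" if "b \<in> Basis" for b
    using partials_bound[of "b # bs"] bs that by (metis Cons_in_lists_iff)
  then obtain C r where C: "\<And>b. b \<in> Basis \<Longrightarrow> C b > 0"
    and b: "\<And>b z y. b \<in> Basis \<Longrightarrow> cmod (partials (b # bs) (atom z) (y::'a)) \<le> C b * exp (r b * norm z)"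
    by metis
  note fr = frechet_derivative_euclidean[OF partials_atom_differentiable[OF bs], unfolded partials_Cons[symmetric]]
  define B where "B p = (\<Sum>b\<in>(Basis::'a set). C b * (cmod (H p) * exp (r b * norm (\<pi> p))))" for p
  show ?thesis
  proof (rule has_derivative_lebesgue_integral[where B=B])
    fix p y
    have "(partials bs (atom (\<pi> p)) has_derivative frechet_derivative (partials bs (atom (\<pi> p))) (at y)) (at y)"
      using partials_atom_differentiable[OF bs] frechet_derivative_works by blast
    then show "((\<lambda>y. H p * partials bs (atom (\<pi> p)) y) has_derivative (\<lambda>h. H p * frechet_derivative (partials bs (atom (\<pi> p))) (at y) h)) (at y)"
      by (rule has_derivative_mult_right)
  next
    fix p y h
    have "cmod (of_real (h \<bullet> c) * partials (c # bs) (atom (\<pi> p)) y) \<le> norm h * (C c * exp (r c * norm (\<pi> p)))"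
      if "c \<in> Basis" for c
      unfolding norm_mult norm_of_real by (intro mult_mono Basis_le_norm that b) auto
    then have "cmod (frechet_derivative (partials bs (atom (\<pi> p))) (at y) h) \<le>
      (\<Sum>b\<in>Basis. norm h * (C b * exp (r b * norm (\<pi> p))))"
      unfolding fr
      by (intro sum_norm_le)
    then have "cmod (H p) * cmod (frechet_derivative (partials bs (atom (\<pi> p))) (at y) h) \<le>
      cmod (H p) * (\<Sum>b\<in>Basis. norm h * (C b * exp (r b * norm (\<pi> p))))"
      by (rule mult_left_mono) simp
    also have "\<dots> = B p * norm h"
      by (simp add: B_def sum_distrib_left sum_distrib_right mult_ac)
    finally show "cmod (H p * frechet_derivative (partials bs (atom (\<pi> p))) (at y) h) \<le> B p * norm h"
      by (simp add: norm_mult)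
  next
    show "integrable M B" unfolding B_def
      by (intro Bochner_Integration.integrable_sum integrable_mult_right exp_int)
    show "integrable M (\<lambda>p. H p * partials bs (atom (\<pi> p)) y)" for y
      by (rule integrable_partials[OF bs])
    show "(\<lambda>p. H p * frechet_derivative (partials bs (atom (\<pi> p))) (at y) h) \<in> borel_measurable M" for y h
      unfolding fr using bs
      by (intro borel_measurable_times H_meas borel_measurable_sum borel_measurable_const partials_atom_measurable \<pi>_meas) auto
  qed
qed

lemma partials_syn:
  assumes "bs \<in> lists Basis"
  shows "partials bs syn = (\<lambda>y. LINT p|M. H p * partials bs (atom (\<pi> p)) y)"
  using assms
proof (induction bs)
  case Nil
  show ?case by (simp add: partials_def syn_def fun_eq_iff)
next
  case (Cons b bs)
  then have bs: "bs \<in> lists Basis" by simp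
  show ?case
  proof
    fix y
    show "partials (b # bs) syn y = (LINT p|M. H p * partials (b # bs) (atom (\<pi> p)) y)"
      unfolding partials_Cons Cons.IH partial_eq[OF syn_partials_has_derivative[OF bs]]
      by (simp add: partial_def)
  qed
qed

lemma smooth_syn: "smooth syn"
  unfolding smooth_def
proof (intro ballI allI)
  fix bs and x :: 'a assume bs: "bs \<in> lists (Basis::'a set)"
  show "partials bs syn differentiable at x"
    unfolding partials_syn[OF bs] differentiable_def by (rule exI, rule syn_partials_has_derivative[OF bs])
qed

text \<open>A seminorm of a synthesis is bounded by one exponential moment of its coefficients.
  Convergence in \<open>Sigma1\<close> is thereby reduced to convergence of scalar
  integrals.\<close>

lemma gs_norm_syn:
  assumes h: "h > 0" and C: "C > 0"
    and b: "\<And>z \<alpha> bs y. bs \<in> lists Basis \<Longrightarrow> \<bar>mi_power y \<alpha>\<bar> * cmod (partials bs (atom z) (y::'a)) \<le>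
      C * exp (r * norm z) * (h ^ (mi_abs \<alpha> + length bs) * mi_fact \<alpha> * mi_fact (count_list bs))"
  shows "gs_norm h syn \<le> ennreal (C * (LINT p|M. cmod (H p) * exp (r * norm (\<pi> p))))"
proof (rule gs_norm_leI[OF h])
  fix \<alpha> :: "'a \<Rightarrow> nat" and bs and y :: 'a assume bs: "bs \<in> lists (Basis::'a set)"
  define D where "D = h ^ (mi_abs \<alpha> + length bs) * mi_fact \<alpha> * mi_fact (count_list bs)"
  have "\<bar>mi_power y \<alpha>\<bar> * cmod (partials bs syn y) \<le> \<bar>mi_power y \<alpha>\<bar> * (LINT p|M. cmod (H p * partials bs (atom (\<pi> p)) y))"
    unfolding partials_syn[OF bs] by (intro mult_left_mono integral_norm_bound) simp
  also have "\<dots> = (LINT p|M. cmod (H p) * (\<bar>mi_power y \<alpha>\<bar> * cmod (partials bs (atom (\<pi> p)) y)))"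
    by (simp add: norm_mult mult.left_commute flip: integral_mult_right_zero)
  also have "\<dots> \<le> (LINT p|M. C * D * (cmod (H p) * exp (r * norm (\<pi> p))))"
  proof (rule integral_mono_AE'[OF integrable_mult_right[OF exp_int]])
    show "AE p in M. cmod (H p) * (\<bar>mi_power y \<alpha>\<bar> * cmod (partials bs (atom (\<pi> p)) y)) \<le> C * D * (cmod (H p) * exp (r * norm (\<pi> p)))"
    proof (rule AE_I2)
      fix p show "cmod (H p) * (\<bar>mi_power y \<alpha>\<bar> * cmod (partials bs (atom (\<pi> p)) y)) \<le> C * D * (cmod (H p) * exp (r * norm (\<pi> p)))"
        using mult_left_mono[OF b[OF bs, of y \<alpha> "\<pi> p"] norm_ge_zero[of "H p"]] by (simp add: D_def mult_ac)
    qed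
    have "D > 0" using h by (simp add: D_def)
    then show "AE p in M. 0 \<le> C * D * (cmod (H p) * exp (r * norm (\<pi> p)))"
      using C by simp
  qed
  also have "\<dots> = C * (LINT p|M. cmod (H p) * exp (r * norm (\<pi> p))) * D" by simp
  finally show "\<bar>mi_power y \<alpha>\<bar> * cmod (partials bs syn y) \<le> C * (LINT p|M. cmod (H p) * exp (r * norm (\<pi> p))) *
      (h ^ (mi_abs \<alpha> + length bs) * mi_fact \<alpha> * mi_fact (count_list bs))"
    unfolding D_def .
qed

lemma syn_Sigma1: "syn \<in> Sigma1"
proof -
  have "gs_norm h syn < top" if h: "h > 0" for h
  proof -
    obtain C r where "C > 0" "\<And>z \<alpha> bs y. bs \<in> lists Basis \<Longrightarrow> \<bar>mi_power y \<alpha>\<bar> * cmod (partials bs (atom z) (y::'a)) \<le>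
      C * exp (r * norm z) * (h ^ (mi_abs \<alpha> + length bs) * mi_fact \<alpha> * mi_fact (count_list bs))"
      by (rule atom_bound[OF h]) blast
    from gs_norm_syn[OF h this] show ?thesis using ennreal_less_top le_less_trans by blast
  qed
  then show ?thesis by (simp add: Sigma1_def smooth_syn)
qed

end

lemma synthesis_exp_boundI:
  fixes F :: "'a::euclidean_space \<times> 'a \<Rightarrow> complex"
  assumes [measurable]: "F \<in> borel_measurable borel"
    and F: "\<And>r. r > 0 \<Longrightarrow> \<exists>M. \<forall>z. cmod (F z) \<le> M * exp (- r * norm z)"
  shows "synthesis lborel F (\<lambda>z. z)"
proof
  fix r :: real
  obtain M where M: "\<And>z. cmod (F z) \<le> M * exp (- (\<bar>r\<bar> + 1) * norm z)"
  proof -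
    have "\<bar>r\<bar> + 1 > 0" by simp
    from F[OF this] show thesis using that by blast
  qed
  have M0: "M \<ge> 0" using order_trans[OF norm_ge_zero M[of 0]] by simp
  show "integrable lborel (\<lambda>p. cmod (F p) * exp (r * norm p))"
  proof (rule integrable_exp_bound[where r=1])
    fix z :: "'a \<times> 'a"
    have "cmod (F z) * exp (r * norm z) \<le> M * exp (- (\<bar>r\<bar> + 1) * norm z) * exp (\<bar>r\<bar> * norm z)"
      using M M0 by (intro mult_mono) (auto intro: mult_right_mono)
    also have "\<dots> = M * exp (- 1 * norm z)"
      by (simp only: mult.assoc exp_add[symmetric]) (simp add: algebra_simps)
    finally show "norm (cmod (F z) * exp (r * norm z)) \<le> M * exp (- 1 * norm z)" by simp
  qed auto
qed simp_all

text \<open>Decay makes \<open>stf f\<close> decay at every rate, so \<open>f\<close> is the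
  synthesis of its own short-time Fourier transform, and a synthesis lies in \<open>Sigma1\<close>.
  Smoothness comes from the atoms; \<open>f\<close> itself is assumed only continuous.\<close>

theorem Sigma1I:
  fixes f :: "'a::euclidean_space \<Rightarrow> complex"
  assumes cont: "continuous_on UNIV f"
    and f: "\<And>r. r > 0 \<Longrightarrow> \<exists>M. \<forall>y. cmod (f y) \<le> M * exp (- r * norm y)"
    and g: "\<And>r. r > 0 \<Longrightarrow> \<exists>M. \<forall>y. cmod (ft f y) \<le> M * exp (- r * norm y)"
  shows "f \<in> Sigma1"
proof -
  have [measurable]: "f \<in> borel_measurable borel"
    using cont by (rule borel_measurable_continuous_onI)
  have M: "\<exists>M. (\<forall>y. cmod (f y) \<le> M * exp (- r * norm y)) \<and> (\<forall>y. cmod (ft f y) \<le> M * exp (- r * norm y))" if r: "r > 0" for r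
  proof -
    obtain M1 M2 where "\<And>y. cmod (f y) \<le> M1 * exp (- r * norm y)" "\<And>y. cmod (ft f y) \<le> M2 * exp (- r * norm y)"
      using f[OF r] g[OF r] by auto
    moreover have "M1 * exp (- r * norm y) \<le> max M1 M2 * exp (- r * norm y)" "M2 * exp (- r * norm y) \<le> max M1 M2 * exp (- r * norm y)" for y :: 'a
      by (intro mult_right_mono; simp)+
    ultimately show ?thesis by (intro exI[of _ "max M1 M2"]) (meson order_trans)
  qed
  interpret synthesis lborel "\<lambda>z. of_real (fc DIM('a)) * stf f z" "\<lambda>z. z"
  proof (rule synthesis_exp_boundI)
    fix r :: real assume r: "r > 0"
    then obtain M where M: "\<And>y. cmod (f y) \<le> M * exp (- (2 * r) * norm y)" "\<And>y. cmod (ft f y) \<le> M * exp (- (2 * r) * norm y)"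
      using M[of "2 * r"] by auto
    obtain C where C: "\<And>z. cmod (stf f z) \<le> C * M * exp (- r * norm z)"
      using stf_decay[OF r] M by (metis (no_types, lifting) \<open>f \<in> borel_measurable borel\<close>)
    show "\<exists>M. \<forall>z. cmod (of_real (fc DIM('a)) * stf f z) \<le> M * exp (- r * norm z)"
      by (rule exI[of _ "fc DIM('a) * (C * M)"]) (use C in \<open>auto simp: norm_mult mult.assoc intro!: mult_left_mono\<close>)
  qed measurable
  have "syn = f"
  proof
    fix t
    obtain M where "\<And>y. cmod (f y) \<le> M * exp (- (2 * 1) * norm y)" "\<And>y. cmod (ft f y) \<le> M * exp (- (2 * 1) * norm y)"
      using M[of "2 * 1"] by auto
    from stf_inversion(1)[OF cont zero_less_one this, of t]
    show "syn t = f t" by (simp add: syn_def mult.assoc)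
  qed
  then show ?thesis using syn_Sigma1 by simp
qed

section \<open>Continuous functionals on the Gelfand--Shilov space\<close>

lemma Sigma1_continuous: "f \<in> Sigma1 \<Longrightarrow> continuous_on UNIV f"
  using smooth_partials(2)[OF Sigma1_smooth, of f "[]"] by (simp add: partials_def)

lemma Sigma1_exp_bound:
  fixes f :: "'a::euclidean_space \<Rightarrow> complex"
  assumes f: "f \<in> Sigma1" and r: "r > 0"
  obtains M where "M \<ge> 0" "\<And>y. cmod (f y) \<le> M * exp (- r * norm y)" "\<And>y. cmod (ft f y) \<le> M * exp (- r * norm y)"
proof -
  obtain h C where "C > 0" "\<And>x. cmod (f x) \<le> C * gs_val h f * exp (- r * norm x)"
    "\<And>x. cmod (ft f x) \<le> C * gs_val h f * exp (- r * norm x)"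
    by (rule Sigma1_decay[OF r, where 'a='a]) (use f in blast)
  then show thesis by (intro that[of "C * gs_val h f"]) auto
qed

lemma Sigma1_integrable: "f \<in> Sigma1 \<Longrightarrow> integrable lborel f"
  by (rule Sigma1_exp_bound[OF _ zero_less_one], assumption, rule integrable_exp_bound[OF _ _ zero_less_one])
    (auto intro: Sigma1_borel)

text \<open>Through \<open>Sigma1I\<close>, where linearity of \<open>ft\<close> replaces any
  statement about higher derivatives of sums.\<close>

lemma Sigma1_linear_combination:
  fixes f g :: "'a::euclidean_space \<Rightarrow> complex"
  assumes f: "f \<in> Sigma1" and g: "g \<in> Sigma1"
  shows "(\<lambda>x. a * f x + b * g x) \<in> Sigma1"
proof (rule Sigma1I)
  show "continuous_on UNIV (\<lambda>x. a * f x + b * g x)"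
    by (intro continuous_intros Sigma1_continuous f g)
  have ft: "ft (\<lambda>x. a * f x + b * g x) \<xi> = a * ft f \<xi> + b * ft g \<xi>" for \<xi>
  proof -
    have "integrable lborel (\<lambda>x. f x * cis (- (x \<bullet> \<xi>)))" "integrable lborel (\<lambda>x. g x * cis (- (x \<bullet> \<xi>)))"
      by (intro integrable_mult_cis Sigma1_integrable f g; measurable)+
    note i = this
    have eq: "(\<lambda>x. (a * f x + b * g x) * cis (- (x \<bullet> \<xi>))) =
      (\<lambda>x. a * (f x * cis (- (x \<bullet> \<xi>))) + b * (g x * cis (- (x \<bullet> \<xi>))))"
      by (rule ext) (simp only: distrib_right mult.assoc)
    show ?thesis
      unfolding ft_def eq Bochner_Integration.integral_add[OF integrable_mult_right[OF i(1)] integrable_mult_right[OF i(2)]]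
        integral_mult_right_zero
      by (simp only: distrib_left mult.left_commute)
  qed
  fix r :: real assume r: "r > 0"
  obtain M where M: "\<And>y. cmod (f y) \<le> M * exp (- r * norm y)" "\<And>y. cmod (ft f y) \<le> M * exp (- r * norm y)"
    by (rule Sigma1_exp_bound[OF f r]) (rule that)
  obtain N where N: "\<And>y. cmod (g y) \<le> N * exp (- r * norm y)" "\<And>y. cmod (ft g y) \<le> N * exp (- r * norm y)"
    by (rule Sigma1_exp_bound[OF g r]) (rule that)
  have *: "cmod (a * s + b * t) \<le> (cmod a * M + cmod b * N) * e" if "cmod s \<le> M * e" "cmod t \<le> N * e" for s t e
  proof -
    have "cmod (a * s + b * t) \<le> cmod a * cmod s + cmod b * cmod t"
      by (metis norm_mult norm_triangle_ineq)
    also have "\<dots> \<le> cmod a * (M * e) + cmod b * (N * e)"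
      by (intro add_mono mult_left_mono that) auto
    finally show ?thesis by (simp add: algebra_simps)
  qed
  show "\<exists>M. \<forall>y. cmod (a * f y + b * g y) \<le> M * exp (- r * norm y)"
    using *[OF M(1) N(1)] by blast
  show "\<exists>M. \<forall>y. cmod (ft (\<lambda>x. a * f x + b * g x) y) \<le> M * exp (- r * norm y)"
    unfolding ft using *[OF M(2) N(2)] by blast
qed

lemma Sigma1_zero: "(\<lambda>x. 0) \<in> Sigma1"
  using Sigma1_linear_combination[OF atom_Sigma1 atom_Sigma1, of 0 _ 0] by simp

section \<open>Linearity and boundedness of functionals\<close>

lemma dual_linear_combination:
  assumes u: "u \<in> Sigma1'" and f: "f \<in> Sigma1" and g: "g \<in> Sigma1"
  shows "u (\<lambda>x. a * f x + b * g x) = a * u f + b * u g"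
proof -
  have af: "(\<lambda>x. a * f x) \<in> Sigma1" and bg: "(\<lambda>x. b * g x) \<in> Sigma1"
    using Sigma1_linear_combination[OF f f, of a 0] Sigma1_linear_combination[OF g g, of b 0] by simp_all
  have add: "\<And>f g. f \<in> Sigma1 \<Longrightarrow> g \<in> Sigma1 \<Longrightarrow> u (\<lambda>x. f x + g x) = u f + u g"
    and scale: "\<And>c f. f \<in> Sigma1 \<Longrightarrow> u (\<lambda>x. c * f x) = c * u f"
    using u unfolding Sigma1'_def by blast+
  show ?thesis
    unfolding add[OF af bg] scale[OF f] scale[OF g] ..
qed

lemma dual_zero: "u \<in> Sigma1' \<Longrightarrow> u (\<lambda>x. 0) = 0"
  using dual_linear_combination[OF _ Sigma1_zero Sigma1_zero, of u 0 0] by simp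

lemma dual_diff: "u \<in> Sigma1' \<Longrightarrow> f \<in> Sigma1 \<Longrightarrow> g \<in> Sigma1 \<Longrightarrow> u (\<lambda>x. f x - g x) = u f - u g"
  using dual_linear_combination[of u f g 1 "-1"] by simp

lemma Sigma1_sum:
  assumes "finite A" "\<And>v. v \<in> A \<Longrightarrow> f v \<in> Sigma1"
  shows "(\<lambda>x. \<Sum>v\<in>A. c v * f v x) \<in> Sigma1"
  using assms
proof (induction A rule: finite_induct)
  case (insert v A)
  then show ?case
    using Sigma1_linear_combination[of "f v" "\<lambda>x. \<Sum>v\<in>A. c v * f v x" "c v" 1] by simp
qed (simp add: Sigma1_zero)

lemma dual_sum:
  assumes u: "u \<in> Sigma1'" and "finite A" "\<And>v. v \<in> A \<Longrightarrow> f v \<in> Sigma1"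
  shows "u (\<lambda>x. \<Sum>v\<in>A. c v * f v x) = (\<Sum>v\<in>A. c v * u (f v))"
  using assms(2,3)
proof (induction A rule: finite_induct)
  case (insert v A)
  then show ?case
    using dual_linear_combination[OF u, of "f v" "\<lambda>x. \<Sum>v\<in>A. c v * f v x" "c v" 1] Sigma1_sum[of A f c] by simp
qed (simp add: dual_zero[OF u])

text \<open>Bundles the seminorm that controls \<open>u\<close> with the growth constants of the
  atoms in that same seminorm, since the rate \<open>r\<close> is determined only once
  \<open>h\<close> is known.\<close>

definition dual_bd :: "'a::euclidean_space dual \<Rightarrow> real \<Rightarrow> real \<Rightarrow> real \<Rightarrow> real \<Rightarrow> bool" where
  "dual_bd u h K C r \<longleftrightarrow> h > 0 \<and> K > 0 \<and> C > 0 \<and> r > 0 \<and> (\<forall>f\<in>Sigma1. cmod (u f) \<le> K * gs_val h f) \<and>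
     (\<forall>z \<alpha> bs y. bs \<in> lists Basis \<longrightarrow> \<bar>mi_power y \<alpha>\<bar> * cmod (partials bs (atom z) (y::'a)) \<le>
      C * exp (r * norm z) * (h ^ (mi_abs \<alpha> + length bs) * mi_fact \<alpha> * mi_fact (count_list bs)))"

lemma ex_dual_bd:
  fixes u :: "'a::euclidean_space dual"
  assumes u: "u \<in> Sigma1'"
  obtains h K C r where "dual_bd u h K C r"
proof -
  obtain h K where h: "h > 0" and K: "\<And>f. f \<in> Sigma1 \<Longrightarrow> ennreal (cmod (u f)) \<le> ennreal K * gs_norm h f"
    using u unfolding Sigma1'_def by blast
  have "cmod (u f) \<le> max 1 K * gs_val h f" if f: "f \<in> Sigma1" for f
  proof -
    have "ennreal (cmod (u f)) \<le> ennreal (max 1 K) * ennreal (gs_val h f)"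
      using K[OF f] mult_right_mono[of "ennreal K" "ennreal (max 1 K)" "gs_norm h f"]
      unfolding Sigma1_gs_norm[OF f h, symmetric] by (meson ennreal_leI max.cobounded2 order_trans zero_le)
    then show ?thesis by (simp add: ennreal_mult''[symmetric])
  qed
  moreover obtain C r where "C > 0" "r > 0" "\<And>z \<alpha> bs y. bs \<in> lists Basis \<Longrightarrow> \<bar>mi_power y \<alpha>\<bar> * cmod (partials bs (atom z) (y::'a)) \<le>
      C * exp (r * norm z) * (h ^ (mi_abs \<alpha> + length bs) * mi_fact \<alpha> * mi_fact (count_list bs))"
    by (rule atom_bound[OF h]) blast
  ultimately have "dual_bd u h (max 1 K) C r"
    unfolding dual_bd_def using h by simp
  then show thesis by (rule that)
qed

text \<open>The working form of continuity: the functional applied to a synthesis is bounded by one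
  exponential moment. To show that values of \<open>u\<close> converge it suffices to write the
  error as a synthesis.\<close>

lemma dual_bd_syn:
  assumes b: "dual_bd u h K C r" and s: "synthesis M H \<pi>"
  shows "cmod (u (synthesis.syn M H \<pi>)) \<le> K * C * (LINT p|M. cmod (H p) * exp (r * norm (\<pi> p)))"
proof -
  interpret synthesis M H \<pi> by (rule s)
  have h: "h > 0" and K: "K > 0" and C: "C > 0" using b by (auto simp: dual_bd_def)
  have "gs_norm h syn \<le> ennreal (C * (LINT p|M. cmod (H p) * exp (r * norm (\<pi> p))))"
    by (rule gs_norm_syn[OF h C]) (insert b, unfold dual_bd_def, blast)
  then have "gs_val h syn \<le> C * (LINT p|M. cmod (H p) * exp (r * norm (\<pi> p)))"
    by (intro enn2real_leI) (use C in auto)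
  then have "K * gs_val h syn \<le> K * (C * (LINT p|M. cmod (H p) * exp (r * norm (\<pi> p))))"
    using K by (intro mult_left_mono) auto
  moreover have "cmod (u syn) \<le> K * gs_val h syn"
    using b syn_Sigma1 by (auto simp: dual_bd_def)
  ultimately show ?thesis by (simp add: mult.assoc)
qed

text \<open>Recentring at the midpoint of the two positions merges the two Gaussians into one, by
  the parallelogram law; what is left is a single Gaussian Fourier integral.\<close>

lemma stf_atom:
  fixes z w :: "'a::euclidean_space \<times> 'a"
  shows "stf (atom z) w = of_real (fc DIM('a)) *
    (cis (((fst z + fst w) \<bullet> (snd z - snd w)) / 2) * of_real (exp (- (norm (z - w))\<^sup>2 / 4)))"
proof -
  let ?g = "pi powr (- real DIM('a) / 4)"
  define m where "m = (1 / 2) *\<^sub>R (fst z + fst w)"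
  define x where "x = fst z - fst w"
  define \<xi> where "\<xi> = snd z - snd w"
  have prod: "atom z (m + 1 *\<^sub>R s) * atom (flip w) (m + 1 *\<^sub>R s) =
    of_real (?g * ?g * exp (- (norm x)\<^sup>2 / 4)) * cis (m \<bullet> \<xi>) * (of_real (exp (- 2 * (norm s)\<^sup>2 / 2)) * cis (- (s \<bullet> (- \<xi>))))" for s
  proof -
    have e: "m + 1 *\<^sub>R s - fst z = s - (1/2) *\<^sub>R x" "m + 1 *\<^sub>R s - fst w = s + (1/2) *\<^sub>R x"
      by (simp_all add: m_def x_def algebra_simps flip: scaleR_add_left)
    have n: "(norm (s - (1/2) *\<^sub>R x))\<^sup>2 + (norm (s + (1/2) *\<^sub>R x))\<^sup>2 = 2 * (norm s)\<^sup>2 + (norm x)\<^sup>2 / 2"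
      unfolding power2_norm_eq_inner by (simp add: inner_add_left inner_add_right inner_diff_left inner_diff_right inner_commute)
    have "exp (- (norm (s - (1/2) *\<^sub>R x))\<^sup>2 / 2) * exp (- (norm (s + (1/2) *\<^sub>R x))\<^sup>2 / 2) =
      exp (- (norm x)\<^sup>2 / 4) * exp (- 2 * (norm s)\<^sup>2 / 2)"
      unfolding exp_add[symmetric] using n by (simp add: field_simps)
    then have "gauss (m + 1 *\<^sub>R s - fst z) * gauss (m + 1 *\<^sub>R s - fst w) =
      of_real (?g * ?g * exp (- (norm x)\<^sup>2 / 4)) * of_real (exp (- 2 * (norm s)\<^sup>2 / 2))"
      unfolding e gauss_def by (simp add: mult_ac flip: of_real_mult)
    note 1 = this
    have 2: "cis ((m + 1 *\<^sub>R s) \<bullet> snd z) * cis ((m + 1 *\<^sub>R s) \<bullet> - snd w) = cis (m \<bullet> \<xi>) * cis (- (s \<bullet> (- \<xi>)))"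
      unfolding cis_mult by (simp add: \<xi>_def inner_add_left inner_diff_right algebra_simps)
    have "atom z (m + 1 *\<^sub>R s) * atom (flip w) (m + 1 *\<^sub>R s) =
      (gauss (m + 1 *\<^sub>R s - fst z) * gauss (m + 1 *\<^sub>R s - fst w)) * (cis ((m + 1 *\<^sub>R s) \<bullet> snd z) * cis ((m + 1 *\<^sub>R s) \<bullet> - snd w))"
      unfolding atom_def fst_flip snd_flip by (simp only: mult_ac)
    also have "\<dots> = of_real (?g * ?g * exp (- (norm x)\<^sup>2 / 4)) * cis (m \<bullet> \<xi>) * (of_real (exp (- 2 * (norm s)\<^sup>2 / 2)) * cis (- (s \<bullet> (- \<xi>))))"
      unfolding 1 2 by (simp only: mult_ac)
    finally show ?thesis .
  qed
  have "(LINT y|lborel. atom z y * atom (flip w) y) = (LINT s|lborel. atom z (m + 1 *\<^sub>R s) * atom (flip w) (m + 1 *\<^sub>R s))"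
    by (subst lborel_integral_affine[where c=1 and t=m]) auto
  also have "\<dots> = of_real (?g * ?g * exp (- (norm x)\<^sup>2 / 4)) * cis (m \<bullet> \<xi>) *
    of_real ((2 * pi / 2) powr (DIM('a) / 2) * exp (- (norm (- \<xi>))\<^sup>2 / (2 * 2)))"
    unfolding prod integral_mult_right_zero gaussian_fourier(2)[OF zero_less_numeral] ..
  also have "\<dots> = of_real (?g * ?g * pi powr (DIM('a) / 2)) * (cis (m \<bullet> \<xi>) * of_real (exp (- (norm x)\<^sup>2 / 4) * exp (- (norm \<xi>)\<^sup>2 / 4)))"
    by (simp add: mult_ac)
  also have "?g * ?g * pi powr (DIM('a) / 2) = 1"
    unfolding powr_add[symmetric] by simp
  also have "exp (- (norm x)\<^sup>2 / 4) * exp (- (norm \<xi>)\<^sup>2 / 4) = exp (- (norm (z - w))\<^sup>2 / 4)"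
    unfolding exp_add[symmetric] by (simp add: x_def \<xi>_def norm_prod_def add_divide_distrib)
  finally show ?thesis
    by (simp add: stf_def m_def \<xi>_def)
qed

text \<open>From the square of |z - w| / 2 - r, as for \<open>norm_gauss_le\<close>.\<close>

lemma norm_stf_atom_le:
  fixes z w :: "'a::euclidean_space \<times> 'a"
  shows "cmod (stf (atom z) w) \<le> fc DIM('a) * exp (r\<^sup>2) * exp (- r * norm (z - w))"
proof -
  have "0 \<le> (norm (z - w) / 2 - r)\<^sup>2" by simp
  then have "- (norm (z - w))\<^sup>2 / 4 \<le> r\<^sup>2 + - r * norm (z - w)"
    by (simp add: power2_diff power_divide algebra_simps)
  then have "exp (- (norm (z - w))\<^sup>2 / 4) \<le> exp (r\<^sup>2) * exp (- r * norm (z - w))"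
    by (simp flip: exp_add)
  then show ?thesis
    by (simp add: stf_atom norm_mult mult.assoc mult_left_mono)
qed

lemma stf_Sigma1_decay:
  assumes r: "r > (0::real)"
  obtains h C where "h > 0" "C > 0"
    "\<And>f z. f \<in> (Sigma1 :: ('a::euclidean_space \<Rightarrow> complex) set) \<Longrightarrow> cmod (stf f z) \<le> C * gs_val h f * exp (- r * norm z)"
proof -
  have r2: "2 * r > 0" using r by simp
  obtain h C where h: "h > 0" and C: "C > 0"
    and 1: "\<And>f x. f \<in> (Sigma1 :: ('a \<Rightarrow> complex) set) \<Longrightarrow> cmod (f x) \<le> C * gs_val h f * exp (- (2 * r) * norm x)"
    and 2: "\<And>f x. f \<in> (Sigma1 :: ('a \<Rightarrow> complex) set) \<Longrightarrow> cmod (ft f x) \<le> C * gs_val h f * exp (- (2 * r) * norm x)"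
    by (rule Sigma1_decay[OF r2, where 'a='a]) blast
  obtain D where D: "D > 0" and 3: "\<And>f M z. f \<in> borel_measurable borel \<Longrightarrow>
    (\<And>y::'a. cmod (f y) \<le> M * exp (- (2 * r) * norm y)) \<Longrightarrow>
    (\<And>y. cmod (ft f y) \<le> M * exp (- (2 * r) * norm y)) \<Longrightarrow> cmod (stf f z) \<le> D * M * exp (- r * norm z)"
    by (rule stf_decay[OF r, where 'a='a]) blast
  show thesis
  proof (rule that[of h "D * C"])
    fix f :: "'a \<Rightarrow> complex" and z assume f: "f \<in> Sigma1"
    show "cmod (stf f z) \<le> D * C * gs_val h f * exp (- r * norm z)"
      using 3[OF Sigma1_borel[OF f] 1[OF f] 2[OF f]] by (simp add: mult.assoc)
  qed (use h C D in auto)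
qed

lemma Sigma1_synthesis:
  fixes f :: "'a::euclidean_space \<Rightarrow> complex"
  assumes f: "f \<in> Sigma1"
  shows "synthesis lborel (\<lambda>z. of_real (fc DIM('a)) * stf f z) (\<lambda>z. z)"
    and "f t = of_real (fc DIM('a)) * (LINT z|lborel. stf f z * atom z t)"
    and "integrable lborel (\<lambda>z. stf f z * atom z t)"
    and "synthesis.syn lborel (\<lambda>z. of_real (fc DIM('a)) * stf f z) (\<lambda>z. z) = f"
proof -
  note [measurable] = Sigma1_borel[OF f]
  show s: "synthesis lborel (\<lambda>z. of_real (fc DIM('a)) * stf f z) (\<lambda>z. z)"
  proof (rule synthesis_exp_boundI)
    fix r :: real assume r: "r > 0"
    obtain h C where C: "\<And>z. cmod (stf f z) \<le> C * gs_val h f * exp (- r * norm z)"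
      by (rule stf_Sigma1_decay[OF r, where 'a='a]) (use f in blast)
    have "cmod (of_real (fc DIM('a)) * stf f z) \<le> fc DIM('a) * (C * gs_val h f) * exp (- r * norm z)" for z
      using mult_left_mono[OF C[of z] fc_nonneg[of "DIM('a)"]] by (simp add: norm_mult mult.assoc)
    then show "\<exists>M. \<forall>z. cmod (of_real (fc DIM('a)) * stf f z) \<le> M * exp (- r * norm z)" by blast
  qed measurable
  obtain M where "\<And>y. cmod (f y) \<le> M * exp (- (2 * 1) * norm y)" "\<And>y. cmod (ft f y) \<le> M * exp (- (2 * 1) * norm y)"
    by (rule Sigma1_exp_bound[OF f, of "2 * 1"]) auto
  note inv = stf_inversion[OF Sigma1_continuous[OF f] zero_less_one this]
  show inv1: "f t = of_real (fc DIM('a)) * (LINT z|lborel. stf f z * atom z t)" for t by (rule inv(1))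
  show "integrable lborel (\<lambda>z. stf f z * atom z t)" by (rule inv(2))
  show "synthesis.syn lborel (\<lambda>z. of_real (fc DIM('a)) * stf f z) (\<lambda>z. z) = f"
    by (rule ext) (simp only: synthesis.syn_def[OF s] mult.assoc integral_mult_right_zero inv1[symmetric])
qed

text \<open>The rate r + 1 pays for the moment exp (r |p|) and leaves exp (- |p|), which is
  integrable.\<close>

lemma cmod_le_exp_mult:
  assumes "cmod a \<le> C * exp (- (r + 1) * norm (z - p))" "C \<ge> 0" "r \<ge> (0::real)"
  shows "cmod a * exp (r * norm p) \<le> C * exp ((r + 1) * norm z) * exp (- 1 * norm p)"
proof -
  have "exp (- (r + 1) * norm (z - p)) = exp (- (r + 1) * norm (p + - z))"
    by (simp add: norm_minus_commute)
  also have "\<dots> \<le> exp ((r + 1) * norm (- z)) * exp (- (r + 1) * norm p)"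
    using assms(3) by (intro exp_neg_norm_translate) simp
  finally have "cmod a \<le> C * (exp ((r + 1) * norm z) * exp (- (r + 1) * norm p))"
    using order_trans[OF assms(1) mult_left_mono[OF _ assms(2)]] by simp
  then have "cmod a * exp (r * norm p) \<le> C * (exp ((r + 1) * norm z) * exp (- (r + 1) * norm p)) * exp (r * norm p)"
    by (rule mult_right_mono) simp
  also have "\<dots> = C * exp ((r + 1) * norm z) * exp (- 1 * norm p)"
    by (simp only: mult.assoc exp_add[symmetric]) (simp add: algebra_simps)
  finally show ?thesis .
qed

lemma stf_atom_exp_le:
  fixes z :: "'a::euclidean_space \<times> 'a"
  assumes r: "r \<ge> 0"
  shows "cmod (stf (atom z) p) * exp (r * norm p) \<le> fc DIM('a) * exp ((r + 1)\<^sup>2) * exp ((r + 1) * norm z) * exp (- 1 * norm p)"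
  using norm_stf_atom_le[of z p "r + 1"] by (rule cmod_le_exp_mult) (use r in auto)

lemma stf_atom_measurable [measurable (raw)]:
  assumes [measurable]: "f \<in> borel_measurable M" "g \<in> borel_measurable M"
  shows "(\<lambda>x. stf (atom (f x)) (g x)) \<in> borel_measurable M"
  unfolding stf_atom by measurable

text \<open>Writing the difference of two atoms as a synthesis brings it within reach of
  \<open>dual_bd_syn\<close>, with coefficients that depend continuously on both centres.\<close>

lemma atom_diff_synthesis:
  fixes z w :: "'a::euclidean_space \<times> 'a"
  defines "E \<equiv> \<lambda>p. of_real (fc DIM('a)) * (stf (atom z) p - stf (atom w) p)"
  shows "synthesis lborel E (\<lambda>z. z)" "synthesis.syn lborel E (\<lambda>z. z) = (\<lambda>y. atom z y - atom w y)"
proof -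
  have i: "integrable lborel (\<lambda>p. cmod (stf (atom z) p) * exp (r * norm p))" for z :: "'a \<times> 'a" and r
    using synthesis.exp_int[OF Sigma1_synthesis(1)[OF atom_Sigma1[of z]], of r]
    by (simp add: norm_mult mult.assoc less_imp_neq[OF fc_pos, symmetric])
  show s: "synthesis lborel E (\<lambda>z. z)"
  proof
    fix r
    show "integrable lborel (\<lambda>p. cmod (E p) * exp (r * norm p))"
    proof (rule Bochner_Integration.integrable_bound)
      show "integrable lborel (\<lambda>p. fc DIM('a) * (cmod (stf (atom z) p) * exp (r * norm p) + cmod (stf (atom w) p) * exp (r * norm p)))"
        by (intro integrable_mult_right Bochner_Integration.integrable_add i)
      show "AE p in lborel. norm (cmod (E p) * exp (r * norm p)) \<le> norm (fc DIM('a) * (cmod (stf (atom z) p) * exp (r * norm p) + cmod (stf (atom w) p) * exp (r * norm p)))"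
        by (rule AE_I2) (simp add: E_def norm_mult mult.assoc norm_triangle_ineq4 mult_left_mono flip: distrib_right)
    qed (simp add: E_def)
  qed (simp_all add: E_def)
  show "synthesis.syn lborel E (\<lambda>z. z) = (\<lambda>y. atom z y - atom w y)"
  proof
    fix y
    have "atom z y - atom w y = of_real (fc DIM('a)) * (LINT p|lborel. stf (atom z) p * atom p y - stf (atom w) p * atom p y)"
      unfolding Bochner_Integration.integral_diff[OF Sigma1_synthesis(3)[OF atom_Sigma1] Sigma1_synthesis(3)[OF atom_Sigma1]]
      unfolding right_diff_distrib by (simp only: Sigma1_synthesis(2)[OF atom_Sigma1, symmetric])
    then show "synthesis.syn lborel E (\<lambda>z. z) y = atom z y - atom w y"
      unfolding synthesis.syn_def[OF s] by (simp add: E_def left_diff_distrib mult.assoc)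
  qed
qed

text \<open>Convergent centres stay in a ball, so the moments of \<open>atom_diff_synthesis\<close>
  have a common majorant and tend to 0.\<close>

lemma dual_atom_continuous:
  fixes u :: "'a::euclidean_space dual"
  assumes u: "u \<in> Sigma1'"
  shows "continuous_on UNIV (\<lambda>z. u (atom z))"
  unfolding continuous_on_sequentially
proof (intro allI ballI impI, elim conjE)
  fix x :: "nat \<Rightarrow> 'a \<times> 'a" and a assume lim: "x \<longlonglongrightarrow> a"
  obtain h K C r where b: "dual_bd u h K C r" using ex_dual_bd[OF u] by blast
  then have r: "r \<ge> 0" and KC: "K > 0" "C > 0" by (auto simp: dual_bd_def)
  obtain B where B: "\<And>n. norm (x n) \<le> B"
    using convergent_imp_bounded[OF lim] unfolding bounded_iff by blast
  let ?f = "fc DIM('a)"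
  define E where "E n p = of_real ?f * (stf (atom (x n)) p - stf (atom a) p)" for n p
  define D where "D = ?f * (?f * exp ((r + 1)\<^sup>2) * (exp ((r + 1) * B) + exp ((r + 1) * norm a)))"
  have Eb: "cmod (E n p) * exp (r * norm p) \<le> D * exp (- 1 * norm p)" for n p
  proof -
    have "exp ((r + 1) * norm (x n)) \<le> exp ((r + 1) * B)" using r B by (simp add: mult_left_mono)
    then have "?f * exp ((r + 1)\<^sup>2) * exp ((r + 1) * norm (x n)) * exp (- 1 * norm p) \<le> ?f * exp ((r + 1)\<^sup>2) * exp ((r + 1) * B) * exp (- 1 * norm p)"
      by (intro mult_right_mono mult_left_mono) auto
    then have "cmod (stf (atom (x n)) p) * exp (r * norm p) + cmod (stf (atom a) p) * exp (r * norm p)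
      \<le> ?f * exp ((r + 1)\<^sup>2) * exp ((r + 1) * B) * exp (- 1 * norm p) + ?f * exp ((r + 1)\<^sup>2) * exp ((r + 1) * norm a) * exp (- 1 * norm p)"
      using stf_atom_exp_le[OF r, of "x n" p] stf_atom_exp_le[OF r, of a p] by linarith
    from mult_left_mono[OF this fc_nonneg]
    have "?f * (cmod (stf (atom (x n)) p) * exp (r * norm p) + cmod (stf (atom a) p) * exp (r * norm p)) \<le> D * exp (- 1 * norm p)"
      unfolding D_def by (simp only: distrib_left distrib_right mult.assoc)
    moreover have "cmod (E n p) * exp (r * norm p) \<le> ?f * (cmod (stf (atom (x n)) p) * exp (r * norm p) + cmod (stf (atom a) p) * exp (r * norm p))"
      by (simp add: E_def norm_mult mult.assoc norm_triangle_ineq4 mult_left_mono flip: distrib_right)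
    ultimately show ?thesis by linarith
  qed
  have "(\<lambda>n. LINT p|lborel. cmod (E n p) * exp (r * norm p)) \<longlonglongrightarrow> (LINT p|(lborel :: ('a \<times> 'a) measure). (0::real))"
  proof (rule integral_dominated_convergence[where w="\<lambda>p. D * exp (- 1 * norm p)"])
    show "integrable lborel (\<lambda>p::'a \<times> 'a. D * exp (- 1 * norm p))"
      by (rule integrable_mult_right, rule integrable_exp_neg_norm) simp
    show "AE p in lborel. (\<lambda>n. cmod (E n p) * exp (r * norm p)) \<longlonglongrightarrow> 0"
    proof (rule AE_I2)
      fix p
      have "(\<lambda>n. stf (atom (x n)) p) \<longlonglongrightarrow> stf (atom a) p"
        unfolding stf_atom cis_conv_exp by (intro tendsto_intros lim) auto
      then have "(\<lambda>n. cmod (E n p) * exp (r * norm p)) \<longlonglongrightarrow> cmod (of_real ?f * (stf (atom a) p - stf (atom a) p)) * exp (r * norm p)"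
        unfolding E_def by (intro tendsto_intros)
      then show "(\<lambda>n. cmod (E n p) * exp (r * norm p)) \<longlonglongrightarrow> 0" by simp
    qed
    show "AE p in lborel. norm (cmod (E n p) * exp (r * norm p)) \<le> D * exp (- 1 * norm p)" for n
      using Eb[of n] by (intro AE_I2) simp
  qed (auto simp: E_def)
  then have "(\<lambda>n. K * C * (LINT p|lborel. cmod (E n p) * exp (r * norm p))) \<longlonglongrightarrow> 0"
    by (simp add: tendsto_mult_right_zero)
  moreover have "norm (u (atom (x n)) - u (atom a)) \<le> K * C * (LINT p|lborel. cmod (E n p) * exp (r * norm p))" for n
    using dual_bd_syn[OF b atom_diff_synthesis(1)[of "x n" a]]
    unfolding atom_diff_synthesis(2) dual_diff[OF u atom_Sigma1 atom_Sigma1] E_def .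
  then have "\<forall>\<^sub>F n in sequentially. norm (u (atom (x n)) - u (atom a)) \<le> K * C * (LINT p|lborel. cmod (E n p) * exp (r * norm p))"
    by simp
  ultimately have "(\<lambda>n. u (atom (x n)) - u (atom a)) \<longlonglongrightarrow> 0"
    by (rule Lim_null_comparison[rotated])
  then show "((\<lambda>z. u (atom z)) \<circ> x) \<longlonglongrightarrow> u (atom a)"
    by (simp add: o_def Lim_null[symmetric])
qed

lemma dual_atom_measurable [measurable (raw)]:
  assumes "u \<in> Sigma1'" "f \<in> borel_measurable M"
  shows "(\<lambda>x. u (atom (f x))) \<in> borel_measurable M"
  using measurable_compose[OF assms(2) borel_measurable_continuous_onI[OF dual_atom_continuous[OF assms(1)]]] .

lemma dual_atom_growth:
  fixes u :: "'a::euclidean_space dual"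
  assumes u: "u \<in> Sigma1'"
  obtains C r where "C > 0" "r > 0" "\<And>z. cmod (u (atom z)) \<le> C * exp (r * norm z)"
proof -
  obtain h K C r where b: "dual_bd u h K C r" using ex_dual_bd[OF u] by blast
  then have h: "h > 0" and KC: "K > 0" "C > 0" "r > 0" by (auto simp: dual_bd_def)
  show thesis
  proof (rule that[of "K * C" r])
    fix z :: "'a \<times> 'a"
    have "gs_norm h (atom z) \<le> ennreal (C * exp (r * norm z))"
      by (rule gs_norm_leI[OF h]) (insert b, unfold dual_bd_def, blast)
    then have "gs_val h (atom z) \<le> C * exp (r * norm z)"
      by (intro enn2real_leI) (use KC in auto)
    then have "K * gs_val h (atom z) \<le> K * (C * exp (r * norm z))" using KC by (intro mult_left_mono) auto
    moreover have "cmod (u (atom z)) \<le> K * gs_val h (atom z)"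
      using b atom_Sigma1[of z] unfolding dual_bd_def by blast
    ultimately show "cmod (u (atom z)) \<le> K * C * exp (r * norm z)" by (simp add: mult.assoc)
  qed (use KC in auto)
qed

text \<open>Replacing the centre by a simple function turns the integral into a finite sum. It is
  applied with \<phi> an atom at a fixed point and with \<phi> the value of the functional at an
  atom, so linearity alone matches the two sums.\<close>

lemma integral_simple_function_compose:
  fixes F :: "'z \<Rightarrow> complex" and \<phi> :: "'w \<Rightarrow> complex"
  assumes F: "integrable M F" and S: "simple_function M S"
  shows "(LINT z|M. F z * \<phi> (S z)) = (\<Sum>v\<in>S ` space M. (LINT z|M. F z * indicator (S -` {v} \<inter> space M) z) * \<phi> v)"
proof -
  have fin: "finite (S ` space M)" using S by (rule simple_functionD)
  have m: "S -` {v} \<inter> space M \<in> sets M" for v using S by (rule simple_functionD)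
  have i: "integrable M (\<lambda>z. F z * indicator (S -` {v} \<inter> space M) z)" for v
  proof (rule Bochner_Integration.integrable_bound[OF F])
    show "(\<lambda>z. F z * indicator (S -` {v} \<inter> space M) z) \<in> borel_measurable M"
      using m F by (intro borel_measurable_times borel_measurable_indicator) auto
  qed (auto simp: norm_mult indicator_def)
  have "F z * \<phi> (S z) = (\<Sum>v\<in>S ` space M. (F z * indicator (S -` {v} \<inter> space M) z) * \<phi> v)" if "z \<in> space M" for z
  proof -
    have "(\<Sum>v\<in>S ` space M. (F z * indicator (S -` {v} \<inter> space M) z) * \<phi> v) = (\<Sum>v\<in>S ` space M. if v = S z then F z * \<phi> (S z) else 0)"
      using that by (intro sum.cong) (auto simp: indicator_def)
    then show ?thesis using fin that by simp
  qed
  then have "(LINT z|M. F z * \<phi> (S z)) = (LINT z|M. (\<Sum>v\<in>S ` space M. (F z * indicator (S -` {v} \<inter> space M) z) * \<phi> v))"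
    by (intro Bochner_Integration.integral_cong) auto
  also have "\<dots> = (\<Sum>v\<in>S ` space M. (LINT z|M. F z * indicator (S -` {v} \<inter> space M) z) * \<phi> v)"
    by (subst Bochner_Integration.integral_sum) (auto intro!: integrable_mult_left i)
  finally show ?thesis .
qed

text \<open>
  A continuous functional commutes with the synthesis integral.  No vector-valued integration is
  needed: \<open>z\<close> is approximated by simple functions of \<open>z\<close>, and the error is itself a synthesis, over
  the product of two phase spaces, whose seminorms tend to \<open>0\<close>.
\<close>

theorem dual_syn:
  fixes u :: "'a::euclidean_space dual"
  assumes u: "u \<in> Sigma1'" and s: "synthesis lborel F (\<lambda>z. z)"
  shows "u (synthesis.syn lborel F (\<lambda>z. z)) = (LINT z|lborel. F z * u (atom z))"
    and "integrable lborel (\<lambda>z. F z * u (atom z))"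
proof -
  interpret F: synthesis lborel F "\<lambda>z. z" by (rule s)
  note [measurable] = F.H_meas
  have [measurable]: "F \<in> borel_measurable borel" using F.H_meas by simp
  have [measurable]: "(\<lambda>z. u (atom z)) \<in> borel_measurable borel"
    by (intro dual_atom_measurable u) simp
  have iF: "integrable lborel F"
    using F.exp_int[of 0] by (simp add: integrable_norm_iff)
  obtain h K C r where b: "dual_bd u h K C r" using ex_dual_bd[OF u] by blast
  then have r: "r \<ge> 0" by (auto simp: dual_bd_def)
  obtain C0 r0 where C0: "C0 > 0" and r0: "r0 > 0" and gr: "\<And>z. cmod (u (atom z)) \<le> C0 * exp (r0 * norm z)"
    by (rule dual_atom_growth[OF u]) (rule that)
  \<comment> \<open>The bound by 2 |z| keeps the exponential moments of \<open>F\<close> at the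
    points \<open>S i z\<close> finite, at twice the rate.\<close>
  obtain S where S: "\<And>i. simple_function lborel (S i)" and lim: "\<And>z. (\<lambda>i. S i z) \<longlonglongrightarrow> (z :: 'a \<times> 'a)"
    and Sb: "\<And>i z. norm (S i z) \<le> 2 * norm z"
  proof -
    have "\<exists>S. (\<forall>i. simple_function lborel (S i)) \<and> (\<forall>z\<in>space lborel. (\<lambda>i. S i z) \<longlonglongrightarrow> z) \<and>
      (\<forall>i. \<forall>z\<in>space lborel. dist (S i z) 0 \<le> 2 * dist z (0 :: 'a \<times> 'a))"
      by (rule borel_measurable_implies_sequence_metric) measurable
    then obtain S where S: "(\<forall>i. simple_function lborel (S i)) \<and> (\<forall>z\<in>space lborel. (\<lambda>i. S i z) \<longlonglongrightarrow> z) \<and>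
      (\<forall>i. \<forall>z\<in>space lborel. dist (S i z) 0 \<le> 2 * dist z (0 :: 'a \<times> 'a))" ..
    show thesis
    proof (rule that[of S])
      show "simple_function lborel (S i)" for i using S by blast
      fix z show "(\<lambda>i. S i z) \<longlonglongrightarrow> z" using conjunct1[OF conjunct2[OF S]] by (rule bspec) simp
      fix i show "norm (S i z) \<le> 2 * norm z"
      proof -
        have "z \<in> space lborel" by simp
        from bspec[OF spec[OF conjunct2[OF conjunct2[OF S]]] this, of i] show ?thesis
          unfolding dist_norm diff_zero .
      qed
    qed
  qed
  have S_meas[measurable]: "S i \<in> borel_measurable borel" for i
  proof -
    have "S i \<in> borel_measurable lborel"
      using S[of i] by (rule borel_measurable_simple_function)
    then show ?thesis by (simp only: measurable_lborel2)
  qed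
  have gr2: "cmod (F z * u (atom (S i z))) \<le> C0 * (cmod (F z) * exp (2 * r0 * norm z))" for i z
  proof -
    have "r0 * norm (S i z) \<le> 2 * r0 * norm z" using mult_left_mono[OF Sb[of i z] less_imp_le[OF r0]] by simp
    then have "C0 * exp (r0 * norm (S i z)) \<le> C0 * exp (2 * r0 * norm z)" using C0 by simp
    then have "cmod (u (atom (S i z))) \<le> C0 * exp (2 * r0 * norm z)" using gr[of "S i z"] by linarith
    then have "cmod (F z) * cmod (u (atom (S i z))) \<le> cmod (F z) * (C0 * exp (2 * r0 * norm z))"
      by (rule mult_left_mono) simp
    then show ?thesis
      unfolding norm_mult by (simp only: mult.left_commute)
  qed
  show iu: "integrable lborel (\<lambda>z. F z * u (atom z))"
  proof (rule Bochner_Integration.integrable_bound[OF integrable_mult_right[OF F.exp_int[of r0], of C0]])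
    show "AE z in lborel. norm (F z * u (atom z)) \<le> norm (C0 * (cmod (F z) * exp (r0 * norm z)))"
    proof (rule AE_I2)
      fix z show "norm (F z * u (atom z)) \<le> norm (C0 * (cmod (F z) * exp (r0 * norm z)))"
        using mult_left_mono[OF gr[of z], of "cmod (F z)"] C0 by (simp add: norm_mult abs_mult mult.left_commute)
    qed
  qed measurable
  have lim1: "(\<lambda>i. LINT z|lborel. F z * u (atom (S i z))) \<longlonglongrightarrow> (LINT z|lborel. F z * u (atom z))"
  proof (rule integral_dominated_convergence[where w="\<lambda>z. C0 * (cmod (F z) * exp (2 * r0 * norm z))"])
    show "AE z in lborel. (\<lambda>i. F z * u (atom (S i z))) \<longlonglongrightarrow> F z * u (atom z)"
    proof (rule AE_I2, rule tendsto_mult[OF tendsto_const])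
      fix z
      have "isCont (\<lambda>z. u (atom z)) z"
        using dual_atom_continuous[OF u] unfolding continuous_on_eq_continuous_at[OF open_UNIV] by blast
      then show "(\<lambda>i. u (atom (S i z))) \<longlonglongrightarrow> u (atom z)"
        using lim by (rule isCont_tendsto_compose)
    qed
    show "integrable lborel (\<lambda>z. C0 * (cmod (F z) * exp (2 * r0 * norm z)))"
      by (rule integrable_mult_right, rule F.exp_int)
    show "AE z in lborel. norm (F z * u (atom (S i z))) \<le> C0 * (cmod (F z) * exp (2 * r0 * norm z))" for i
      by (rule AE_I2) (rule gr2)
    show "(\<lambda>z. F z * u (atom (S i z))) \<in> borel_measurable lborel" for i
      by (rule borel_measurable_times[OF F.H_meas dual_atom_measurable[OF u]])
        (simp only: measurable_lborel2 S_meas)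
    show "(\<lambda>z. F z * u (atom z)) \<in> borel_measurable lborel"
      by (rule borel_measurable_times[OF F.H_meas dual_atom_measurable[OF u]]) simp
  qed
  define g where "g i y = (LINT z|lborel. F z * atom (S i z) y)" for i y
  have fin: "finite (S i ` space lborel)" for i using S by (rule simple_functionD)
  have g_eq: "g i = (\<lambda>y. \<Sum>v\<in>S i ` space lborel. (LINT z|lborel. F z * indicator (S i -` {v} \<inter> space lborel) z) * atom v y)" for i
    unfolding g_def by (rule ext) (rule integral_simple_function_compose[OF iF S])
  have g_Sigma1: "g i \<in> Sigma1" for i
    unfolding g_eq by (intro Sigma1_sum fin atom_Sigma1)
  have ug: "u (g i) = (LINT z|lborel. F z * u (atom (S i z)))" for i
    unfolding g_eq by (subst dual_sum[OF u fin atom_Sigma1]) (rule integral_simple_function_compose[OF iF S, symmetric])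
  let ?f = "fc DIM('a)"
  \<comment> \<open>\<open>fst q\<close> is the integration point of the original synthesis;
    \<open>snd q\<close> indexes the atoms into which the difference of \<open>atom (fst q)\<close>
    and \<open>atom (S i (fst q))\<close> is expanded.\<close>
  define H where "H i q = F (fst q) * (of_real ?f * (stf (atom (fst q)) (snd q) - stf (atom (S i (fst q))) (snd q)))" for i q
  have Sq: "(\<lambda>q :: ('a \<times> 'a) \<times> ('a \<times> 'a). S i (fst q)) \<in> borel_measurable borel" for i
    by (rule measurable_compose[OF measurable_fst_borel[OF measurable_ident_sets[OF refl]] S_meas])
  have Fq: "(\<lambda>q :: ('a \<times> 'a) \<times> ('a \<times> 'a). F (fst q)) \<in> borel_measurable borel"
    by (rule measurable_compose[OF measurable_fst_borel[OF measurable_ident_sets[OF refl]] \<open>F \<in> borel_measurable borel\<close>])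
  have H_meas[measurable]: "H i \<in> borel_measurable borel" for i
    unfolding H_def
    by (intro borel_measurable_times borel_measurable_diff borel_measurable_const stf_atom_measurable Fq Sq
        measurable_fst_borel measurable_snd_borel measurable_ident_sets[OF refl])
  \<comment> \<open>A majorant independent of \<open>i\<close>. The second summand, with doubled
    rate, accounts for the atoms centred at \<open>S i (fst q)\<close>.\<close>
  define D where "D \<rho> q = ?f * (?f * exp ((\<bar>\<rho>\<bar> + 1)\<^sup>2)) * ((cmod (F (fst q)) * exp ((\<bar>\<rho>\<bar> + 1) * norm (fst q)) + cmod (F (fst q)) * exp ((2 * (\<bar>\<rho>\<bar> + 1)) * norm (fst q))) * exp (- 1 * norm (snd q)))"
    for \<rho> and q :: "('a \<times> 'a) \<times> ('a \<times> 'a)"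
  have iD: "integrable lborel (D \<rho>)" for \<rho>
  proof -
    have "integrable lborel (\<lambda>(x, y). (cmod (F x) * exp ((\<bar>\<rho>\<bar> + 1) * norm x) + cmod (F x) * exp ((2 * (\<bar>\<rho>\<bar> + 1)) * norm x)) * exp (- 1 * norm (y :: 'a \<times> 'a)))"
      by (intro lborel_integrable_mult_pair Bochner_Integration.integrable_add F.exp_int integrable_exp_neg_norm) simp
    then show ?thesis
      unfolding D_def[abs_def] by (intro integrable_mult_right) (simp add: case_prod_beta')
  qed
  have HD: "cmod (H i q) * exp (\<rho> * norm (snd q)) \<le> D \<rho> q" for i q \<rho>
  proof -
    let ?s = "\<bar>\<rho>\<bar>"
    let ?e = "?f * exp ((?s + 1)\<^sup>2)"
    have s: "?s \<ge> 0" by simp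
    have "(?s + 1) * norm (S i (fst q)) \<le> (2 * (?s + 1)) * norm (fst q)"
      using mult_left_mono[OF Sb[of i "fst q"], of "?s + 1"] by (simp add: algebra_simps)
    then have "exp ((?s + 1) * norm (S i (fst q))) \<le> exp ((2 * (?s + 1)) * norm (fst q))"
      by (simp only: exp_le_cancel_iff)
    then have "?e * exp ((?s + 1) * norm (S i (fst q))) * exp (- 1 * norm (snd q)) \<le> ?e * exp ((2 * (?s + 1)) * norm (fst q)) * exp (- 1 * norm (snd q))"
      by (intro mult_right_mono mult_left_mono) auto
    then have "cmod (stf (atom (fst q)) (snd q)) * exp (?s * norm (snd q)) + cmod (stf (atom (S i (fst q))) (snd q)) * exp (?s * norm (snd q)) \<le>
      ?e * exp ((?s + 1) * norm (fst q)) * exp (- 1 * norm (snd q)) + ?e * exp ((2 * (?s + 1)) * norm (fst q)) * exp (- 1 * norm (snd q))"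
      using stf_atom_exp_le[OF s, of "fst q" "snd q"] stf_atom_exp_le[OF s, of "S i (fst q)" "snd q"] by linarith
    moreover have "cmod (stf (atom (fst q)) (snd q) - stf (atom (S i (fst q))) (snd q)) * exp (\<rho> * norm (snd q)) \<le>
      (cmod (stf (atom (fst q)) (snd q)) + cmod (stf (atom (S i (fst q))) (snd q))) * exp (?s * norm (snd q))"
      by (intro mult_mono norm_triangle_ineq4) (auto intro: mult_right_mono)
    ultimately have "cmod (stf (atom (fst q)) (snd q) - stf (atom (S i (fst q))) (snd q)) * exp (\<rho> * norm (snd q)) \<le>
      ?e * exp ((?s + 1) * norm (fst q)) * exp (- 1 * norm (snd q)) + ?e * exp ((2 * (?s + 1)) * norm (fst q)) * exp (- 1 * norm (snd q))"
      unfolding distrib_right by linarith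
    from mult_left_mono[OF this, of "?f * cmod (F (fst q))"]
    have 1: "?f * cmod (F (fst q)) * (cmod (stf (atom (fst q)) (snd q) - stf (atom (S i (fst q))) (snd q)) * exp (\<rho> * norm (snd q))) \<le>
      ?f * cmod (F (fst q)) * (?e * exp ((?s + 1) * norm (fst q)) * exp (- 1 * norm (snd q)) + ?e * exp ((2 * (?s + 1)) * norm (fst q)) * exp (- 1 * norm (snd q)))"
      by simp
    have 2: "?f * cmod (F (fst q)) * (?e * exp ((?s + 1) * norm (fst q)) * exp (- 1 * norm (snd q)) + ?e * exp ((2 * (?s + 1)) * norm (fst q)) * exp (- 1 * norm (snd q))) = D \<rho> q"
      unfolding D_def by (simp only: distrib_left distrib_right mult.assoc mult.left_commute)
    have 3: "cmod (H i q) * exp (\<rho> * norm (snd q)) = ?f * cmod (F (fst q)) * (cmod (stf (atom (fst q)) (snd q) - stf (atom (S i (fst q))) (snd q)) * exp (\<rho> * norm (snd q)))"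
      unfolding H_def norm_mult norm_of_real abs_of_nonneg[OF fc_nonneg] by (simp only: mult.assoc mult.left_commute)
    show ?thesis using 1 unfolding 2 3 .
  qed
  have sH: "synthesis lborel (H i) snd" for i
  proof
    show "integrable lborel (\<lambda>q. cmod (H i q) * exp (\<rho> * norm (snd q)))" for \<rho>
      by (rule Bochner_Integration.integrable_bound[OF iD[of \<rho>]]) (auto intro!: order_trans[OF HD abs_ge_self])
  qed simp_all
  have synH: "synthesis.syn lborel (H i) snd = (\<lambda>y. F.syn y - g i y)" for i
  proof
    fix y
    interpret H: synthesis lborel "H i" snd by (rule sH)
    have iH: "integrable lborel (\<lambda>q. H i q * atom (snd q) y)"
    proof (rule Bochner_Integration.integrable_bound[OF H.exp_int[of 0]])
      show "AE q in lborel. norm (H i q * atom (snd q) y) \<le> norm (cmod (H i q) * exp (0 * norm (snd q)))"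
        by (rule AE_I2) (simp add: norm_mult norm_atom mult_left_le norm_gauss_le_1)
    qed measurable
    have "H.syn y = (LINT z|lborel. LINT p|lborel. H i (z, p) * atom p y)"
      unfolding H.syn_def using lborel_integral_fst[of "\<lambda>z p. H i (z, p) * atom p y"] iH by (simp add: case_prod_beta')
    also have "\<dots> = (LINT z|lborel. F z * (atom z y - atom (S i z) y))"
    proof (rule Bochner_Integration.integral_cong)
      fix z
      have "(LINT p|lborel. H i (z, p) * atom p y) = F z * (LINT p|lborel. of_real ?f * (stf (atom z) p - stf (atom (S i z)) p) * atom p y)"
        unfolding integral_mult_right_zero[symmetric] by (simp add: H_def mult.assoc)
      also have "(LINT p|lborel. of_real ?f * (stf (atom z) p - stf (atom (S i z)) p) * atom p y) = atom z y - atom (S i z) y"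
        using fun_cong[OF atom_diff_synthesis(2)[of z "S i z"], of y] unfolding synthesis.syn_def[OF atom_diff_synthesis(1)] .
      finally show "(LINT p|lborel. H i (z, p) * atom p y) = F z * (atom z y - atom (S i z) y)" .
    qed simp
    also have "\<dots> = F.syn y - g i y"
    proof -
      have "integrable lborel (\<lambda>z. F z * atom (\<pi> z) y)" if \<pi>: "\<pi> \<in> borel_measurable borel" for \<pi>
      proof (rule Bochner_Integration.integrable_bound[OF iF])
        show "AE z in lborel. norm (F z * atom (\<pi> z) y) \<le> norm (F z)"
          by (rule AE_I2) (simp add: norm_mult norm_atom mult_left_le norm_gauss_le_1)
        show "(\<lambda>z. F z * atom (\<pi> z) y) \<in> borel_measurable lborel"
          by (intro borel_measurable_times F.H_meas atom_measurable borel_measurable_const) (simp only: measurable_lborel2 \<pi>)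
      qed
      from this[of "\<lambda>z. z"] this[OF S_meas] show ?thesis
        unfolding F.syn_def g_def right_diff_distrib by (intro Bochner_Integration.integral_diff) auto
    qed
    finally show "H.syn y = F.syn y - g i y" .
  qed
  have lim2: "(\<lambda>i. K * C * (LINT q|lborel. cmod (H i q) * exp (r * norm (snd q)))) \<longlonglongrightarrow> K * C * (LINT q|(lborel :: (('a \<times> 'a) \<times> ('a \<times> 'a)) measure). (0::real))"
  proof (intro tendsto_mult tendsto_const, rule integral_dominated_convergence[where w="D r"])
    show "AE q in lborel. (\<lambda>i. cmod (H i q) * exp (r * norm (snd q))) \<longlonglongrightarrow> 0"
    proof (rule AE_I2)
      fix q
      have "(\<lambda>i. stf (atom (S i (fst q))) (snd q)) \<longlonglongrightarrow> stf (atom (fst q)) (snd q)"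
        unfolding stf_atom cis_conv_exp by (intro tendsto_intros lim) auto
      then have "(\<lambda>i. cmod (H i q) * exp (r * norm (snd q))) \<longlonglongrightarrow>
        cmod (F (fst q) * (of_real ?f * (stf (atom (fst q)) (snd q) - stf (atom (fst q)) (snd q)))) * exp (r * norm (snd q))"
        unfolding H_def by (intro tendsto_intros)
      then show "(\<lambda>i. cmod (H i q) * exp (r * norm (snd q))) \<longlonglongrightarrow> 0" by simp
    qed
    show "AE q in lborel. norm (cmod (H i q) * exp (r * norm (snd q))) \<le> D r q" for i
      using HD[of i] by (intro AE_I2) simp
  qed (auto simp: iD)
  have "\<forall>\<^sub>F i in sequentially. norm (u (g i) - u F.syn) \<le> K * C * (LINT q|lborel. cmod (H i q) * exp (r * norm (snd q)))"
  proof (intro always_eventually allI)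
    fix i
    have "norm (u F.syn - u (g i)) \<le> K * C * (LINT q|lborel. cmod (H i q) * exp (r * norm (snd q)))"
      using dual_bd_syn[OF b sH[of i]] unfolding synH dual_diff[OF u F.syn_Sigma1 g_Sigma1] .
    then show "norm (u (g i) - u F.syn) \<le> K * C * (LINT q|lborel. cmod (H i q) * exp (r * norm (snd q)))"
      by (simp only: norm_minus_commute)
  qed
  then have "(\<lambda>i. u (g i) - u F.syn) \<longlonglongrightarrow> 0"
    by (rule Lim_null_comparison) (use lim2 in simp)
  then have "(\<lambda>i. u (g i)) \<longlonglongrightarrow> u F.syn"
    by (simp add: Lim_null[symmetric])
  then show "u F.syn = (LINT z|lborel. F z * u (atom z))"
    using lim1 unfolding ug by (rule LIMSEQ_unique)
qed

section \<open>The short-time Fourier transform of functionals\<close>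

lemma lborel_distr_flip: "distr lborel borel flip = (lborel :: ('a::euclidean_space \<times> 'a) measure)"
proof -
  \<comment> \<open>A basis vector of the product has vanishing first component exactly when it
    comes from the second factor, the one to be reflected.\<close>
  let ?c = "\<lambda>j::'a \<times> 'a. if fst j = 0 then - 1 else (1::real)"
  have T: "0 + (\<Sum>j\<in>Basis. (?c j * (x \<bullet> j)) *\<^sub>R j) = flip x" for x :: "'a \<times> 'a"
  proof (rule euclidean_eqI)
    fix b :: "'a \<times> 'a" assume b: "b \<in> Basis"
    then have "(0 + (\<Sum>j\<in>Basis. (?c j * (x \<bullet> j)) *\<^sub>R j)) \<bullet> b = ?c b * (x \<bullet> b)"
      by (simp add: inner_sum_left inner_Basis if_distrib cong: if_cong)
    also have "\<dots> = flip x \<bullet> b"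
      using b by (cases x) (auto simp: Basis_prod_def flip_def)
    finally show "(0 + (\<Sum>j\<in>Basis. (?c j * (x \<bullet> j)) *\<^sub>R j)) \<bullet> b = flip x \<bullet> b" .
  qed
  have "lborel = density (distr lborel borel (\<lambda>x. 0 + (\<Sum>j\<in>Basis. (?c j * (x \<bullet> j)) *\<^sub>R j))) (\<lambda>_. (\<Prod>j\<in>Basis. \<bar>?c j\<bar>))"
    by (rule lborel_affine_euclidean) auto
  also have "(\<Prod>j\<in>Basis. \<bar>?c j\<bar>) = 1" by (intro prod.neutral) auto
  finally show ?thesis unfolding T by (simp add: density_1)
qed

lemma
  fixes f :: "'a::euclidean_space \<times> 'a \<Rightarrow> 'b::{banach, second_countable_topology}"
  assumes [measurable]: "f \<in> borel_measurable borel"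
  shows lborel_integral_flip: "(LINT z|lborel. f (flip z)) = (LINT z|lborel. f z)"
    and lborel_integrable_flip: "integrable lborel (\<lambda>z. f (flip z)) \<longleftrightarrow> integrable lborel f"
proof -
  have [measurable]: "flip \<in> borel_measurable (borel :: ('a \<times> 'a) measure)" by measurable
  show "(LINT z|lborel. f (flip z)) = (LINT z|lborel. f z)"
    by (subst (2) lborel_distr_flip[symmetric]) (simp add: integral_distr)
  show "integrable lborel (\<lambda>z. f (flip z)) \<longleftrightarrow> integrable lborel f"
    by (subst (2) lborel_distr_flip[symmetric]) (simp add: integrable_distr_eq)
qed

definition stv :: "'a::euclidean_space dual \<Rightarrow> 'a \<times> 'a \<Rightarrow> complex" where
  "stv u z = stft u (fst z) (snd z)"

lemma stv_eq: "stv u z = of_real (fc DIM('a)) * u (atom (flip z))"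
  for u :: "'a::euclidean_space dual"
proof -
  have "(\<lambda>y. cnj (gauss (y - fst z)) * exp (- \<i> * of_real (y \<bullet> snd z))) = atom (flip z)"
    by (rule ext) (simp add: atom_def gauss_def cis_conv_exp)
  then show ?thesis by (simp add: stv_def stft_def fc_def)
qed

lemma stv_measurable [measurable (raw)]:
  assumes "u \<in> Sigma1'" and [measurable]: "f \<in> borel_measurable M"
  shows "(\<lambda>x. stv u (f x)) \<in> borel_measurable M"
  unfolding stv_eq by (intro borel_measurable_times borel_measurable_const dual_atom_measurable assms(1)) measurable

lemma stv_growth:
  fixes u :: "'a::euclidean_space dual"
  assumes u: "u \<in> Sigma1'"
  obtains C r where "C > 0" "r > 0" "\<And>z. cmod (stv u z) \<le> C * exp (r * norm z)"
proof -
  obtain C r where C: "C > 0" "r > 0" and b: "\<And>z. cmod (u (atom z)) \<le> C * exp (r * norm z)"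
    by (rule dual_atom_growth[OF u]) (rule that)
  have "cmod (stv u z) \<le> fc DIM('a) * C * exp (r * norm z)" for z
    using mult_left_mono[OF b[of "flip z"] fc_nonneg[of "DIM('a)"]] by (simp add: stv_eq norm_mult mult.assoc)
  then show thesis using C by (intro that[of "fc DIM('a) * C" r]) auto
qed

text \<open>Applying \<open>dual_syn\<close> to the synthesis of \<open>f\<close> shows that a
  functional is determined by its short-time Fourier transform. The reflection appears because the
  pairing is bilinear.\<close>

lemma dual_eq:
  fixes u :: "'a::euclidean_space dual"
  assumes u: "u \<in> Sigma1'" and f: "f \<in> Sigma1"
  shows "u f = (LINT z|lborel. stf f z * stv u (flip z))"
    and "integrable lborel (\<lambda>z. stf f z * stv u (flip z))"
proof -
  have e: "stf f z * stv u (flip z) = of_real (fc DIM('a)) * stf f z * u (atom z)" for z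
    by (simp add: stv_eq)
  show "u f = (LINT z|lborel. stf f z * stv u (flip z))"
    unfolding e using dual_syn(1)[OF u Sigma1_synthesis(1)[OF f]] unfolding Sigma1_synthesis(4)[OF f] .
  show "integrable lborel (\<lambda>z. stf f z * stv u (flip z))"
    unfolding e by (rule dual_syn(2)[OF u Sigma1_synthesis(1)[OF f]])
qed

lemma dual_eq':
  fixes u :: "'a::euclidean_space dual"
  assumes u: "u \<in> Sigma1'" and f: "f \<in> Sigma1"
  shows "u f = (LINT z|lborel. stf f (flip z) * stv u z)"
    and "integrable lborel (\<lambda>z. stf f (flip z) * stv u z)"
proof -
  note [measurable] = Sigma1_borel[OF f]
  have m: "(\<lambda>z. stf f z * stv u (flip z)) \<in> borel_measurable borel"
    by (intro borel_measurable_times stv_measurable u) measurable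
  show "u f = (LINT z|lborel. stf f (flip z) * stv u z)"
    using dual_eq(1)[OF u f] lborel_integral_flip[OF m] by simp
  show "integrable lborel (\<lambda>z. stf f (flip z) * stv u z)"
    using dual_eq(2)[OF u f] lborel_integrable_flip[OF m] by simp
qed

text \<open>The reproducing kernel of the range of the Gaussian short-time Fourier transform. It is
  Hermitian by \<open>cnj_rk\<close> and decays at every rate off the diagonal.\<close>

definition rk :: "'a::euclidean_space \<times> 'a \<Rightarrow> 'a \<times> 'a \<Rightarrow> complex" where
  "rk z p = of_real (fc DIM('a)) * stf (atom p) z"

lemma rk_measurable [measurable (raw)]:
  assumes [measurable]: "f \<in> borel_measurable M" "g \<in> borel_measurable M"
  shows "(\<lambda>x. rk (f x) (g x)) \<in> borel_measurable M"
  unfolding rk_def by measurable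

lemma stf_atom_flip: "stf (atom (flip z)) (flip p) = stf (atom p) z"
  by (simp add: stf_def mult.commute)

lemma cnj_rk: "cnj (rk z p) = rk p z"
proof -
  have "cnj (stf (atom p) z) = stf (atom z) p"
  proof -
    have "- (((fst p + fst z) \<bullet> (snd p - snd z)) / 2) = ((fst z + fst p) \<bullet> (snd z - snd p)) / 2"
      unfolding inner_diff_right inner_add_left minus_divide_left minus_diff_eq by (simp only: add.commute)
    then show ?thesis
      unfolding stf_atom complex_cnj_mult complex_cnj_complex_of_real cis_cnj norm_minus_commute[of p] by (simp only:)
  qed
  then show ?thesis by (simp add: rk_def)
qed

lemma norm_rk_le:
  obtains C where "C > 0" "\<And>z p :: 'a::euclidean_space \<times> 'a. cmod (rk z p) \<le> C * exp (- r * norm (z - p))"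
proof (rule that[of "fc DIM('a) * (fc DIM('a) * exp (r\<^sup>2))"])
  fix z p :: "'a \<times> 'a"
  show "cmod (rk z p) \<le> fc DIM('a) * (fc DIM('a) * exp (r\<^sup>2)) * exp (- r * norm (z - p))"
    using mult_left_mono[OF norm_stf_atom_le[of p z r] fc_nonneg[of "DIM('a)"]]
    by (simp add: rk_def norm_mult mult.assoc norm_minus_commute)
qed simp

text \<open>\<open>dual_eq'\<close> evaluated at an atom.\<close>

lemma stv_reproducing:
  fixes u :: "'a::euclidean_space dual"
  assumes u: "u \<in> Sigma1'"
  shows "stv u z = (LINT p|lborel. rk z p * stv u p)"
proof -
  have "stv u z = of_real (fc DIM('a)) * (LINT p|lborel. stf (atom p) z * stv u p)"
    unfolding stv_eq[of u z] dual_eq'(1)[OF u atom_Sigma1] stf_atom_flip ..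
  then show ?thesis
    by (simp add: rk_def mult.assoc)
qed

lemma dist_of_Sigma1':
  fixes f :: "'a::euclidean_space \<Rightarrow> complex"
  assumes f: "f \<in> Sigma1"
  shows "dist_of f \<in> Sigma1'"
proof -
  note [measurable] = Sigma1_borel[OF f]
  have bound: "cmod (g x) \<le> gs_val 1 g" if g: "g \<in> Sigma1" for g :: "'a \<Rightarrow> complex" and x
    using Sigma1_bound[OF g zero_less_one, of "[]" x "\<lambda>_. 0"] by (simp add: mi_power_def mi_fact_def partials_def)
  have if': "integrable lborel (\<lambda>x. cmod (f x))" using Sigma1_integrable[OF f] by simp
  have b: "cmod (f x * g x) \<le> gs_val 1 g * cmod (f x)" if g: "g \<in> Sigma1" for g x
    using mult_left_mono[OF bound[OF g, of x], of "cmod (f x)"] by (simp add: norm_mult mult.commute)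
  have i: "integrable lborel (\<lambda>x. f x * g x)" if g: "g \<in> Sigma1" for g
  proof -
    note [measurable] = Sigma1_borel[OF g]
    show ?thesis
      by (rule Bochner_Integration.integrable_bound[OF integrable_mult_right[OF if', of "gs_val 1 g"]])
        (use b[OF g] in \<open>auto simp: abs_mult\<close>)
  qed
  have lc: "(\<lambda>x. g x + k x) \<in> Sigma1" "(\<lambda>x. c * g x) \<in> Sigma1" if "g \<in> Sigma1" "k \<in> Sigma1" for g k :: "'a \<Rightarrow> complex" and c
    using Sigma1_linear_combination[OF that, of 1 1] Sigma1_linear_combination[OF that, of c 0] by simp_all
  have bd: "ennreal (cmod (dist_of f g)) \<le> ennreal (LINT x|lborel. cmod (f x)) * gs_norm 1 g" if g: "g \<in> Sigma1" for g
  proof -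
    have "cmod (LINT x|lborel. f x * g x) \<le> (LINT x|lborel. gs_val 1 g * cmod (f x))"
      by (rule order_trans[OF integral_norm_bound], rule integral_mono[OF integrable_norm[OF i[OF g]] integrable_mult_right[OF if'] b[OF g]])
    then have "ennreal (cmod (dist_of f g)) \<le> ennreal (gs_val 1 g * (LINT x|lborel. cmod (f x)))"
      using g by (intro ennreal_leI) (simp add: dist_of_def)
    then show ?thesis
      unfolding ennreal_mult[OF enn2real_nonneg Bochner_Integration.integral_nonneg[OF norm_ge_zero]] Sigma1_gs_norm[OF g zero_less_one, symmetric]
      by (simp add: mult.commute)
  qed
  show ?thesis
    unfolding Sigma1'_def
  proof (intro CollectI conjI ballI allI impI)
    fix g k :: "'a \<Rightarrow> complex" assume g: "g \<in> Sigma1" and k: "k \<in> Sigma1"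
    show "dist_of f (\<lambda>x. g x + k x) = dist_of f g + dist_of f k"
      using i[OF g] i[OF k] by (simp add: dist_of_def g k lc[OF g k] distrib_left)
  next
    fix c and g :: "'a \<Rightarrow> complex" assume g: "g \<in> Sigma1"
    have "(\<lambda>x. f x * (c * g x)) = (\<lambda>x. c * (f x * g x))" by (simp add: fun_eq_iff)
    then show "dist_of f (\<lambda>x. c * g x) = c * dist_of f g"
      by (simp add: dist_of_def g lc[OF g g])
  next
    show "\<exists>h>0. \<exists>C. \<forall>g\<in>Sigma1. ennreal (cmod (dist_of f g)) \<le> ennreal C * gs_norm h g"
      using bd by (intro exI[of _ 1] conjI exI[of _ "LINT x|lborel. cmod (f x)"]) auto
  qed (simp add: dist_of_def)
qed

lemma stv_dist_of: "stv (dist_of f) z = stf f z"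
  by (simp add: stv_eq dist_of_def atom_Sigma1 stf_def)

text \<open>Integration against an atom is itself a continuous functional, so
  \<open>dual_syn\<close> performs the exchange of integrals.\<close>

lemma stf_syn:
  fixes F :: "'a::euclidean_space \<times> 'a \<Rightarrow> complex"
  assumes s: "synthesis lborel F (\<lambda>z. z)"
  shows "stf (synthesis.syn lborel F (\<lambda>z. z)) z = (LINT p|lborel. F p * stf (atom p) z)"
proof -
  have eq: "of_real (fc DIM('a)) * dist_of (atom (flip z)) f = stf f z" if "f \<in> Sigma1" for f
    using that by (simp add: dist_of_def stf_def mult.commute)
  have "stf (synthesis.syn lborel F (\<lambda>z. z)) z = of_real (fc DIM('a)) * (LINT p|lborel. F p * dist_of (atom (flip z)) (atom p))"
    unfolding eq[OF synthesis.syn_Sigma1[OF s], symmetric] dual_syn(1)[OF dist_of_Sigma1'[OF atom_Sigma1] s] ..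
  also have "\<dots> = (LINT p|lborel. F p * (of_real (fc DIM('a)) * dist_of (atom (flip z)) (atom p)))"
    unfolding integral_mult_right_zero[symmetric] by (simp add: mult.left_commute)
  finally show ?thesis unfolding eq[OF atom_Sigma1] .
qed

section \<open>Functionals given by their short-time Fourier transform\<close>

text \<open>The adjoint of the short-time Fourier transform. \<open>W\<close> need not be in the
  range of the transform; by \<open>stv_dsynth\<close> the transform of the result is
  \<open>W\<close> after integration against \<open>rk\<close>.\<close>

definition dsynth :: "('a::euclidean_space \<times> 'a \<Rightarrow> complex) \<Rightarrow> 'a dual" where
  "dsynth W f = (if f \<in> Sigma1 then LINT z|lborel. stf f (flip z) * W z else 0)"

lemma stf_linear_combination:
  assumes f: "f \<in> Sigma1" and g: "g \<in> Sigma1"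
  shows "stf (\<lambda>x. a * f x + b * g x) z = a * stf f z + b * stf g z"
proof -
  have "dist_of (atom (flip z)) \<in> Sigma1'" by (intro dist_of_Sigma1' atom_Sigma1)
  from dual_linear_combination[OF this f g, of a b] show ?thesis
    by (simp add: dist_of_def stf_def f g Sigma1_linear_combination mult.commute[of "atom (flip z) _"])
      (simp only: distrib_left mult.left_commute)
qed

lemma integrable_stf_flip_mult:
  fixes f :: "'a::euclidean_space \<Rightarrow> complex"
  assumes f: "f \<in> Sigma1" and [measurable]: "W \<in> borel_measurable borel"
    and W: "integrable lborel (\<lambda>z. cmod (W z) * exp (- r * norm z))"
  shows "integrable lborel (\<lambda>z. stf f (flip z) * W z)"
proof -
  note [measurable] = Sigma1_borel[OF f]
  obtain h C where hC: "h > 0" "C > 0" and "\<And>f z. f \<in> (Sigma1 :: ('a \<Rightarrow> complex) set) \<Longrightarrow> cmod (stf f z) \<le> C * gs_val h f * exp (- (\<bar>r\<bar> + 1) * norm z)"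
    by (rule stf_Sigma1_decay[of "\<bar>r\<bar> + 1"]) (auto intro: that)
  from this(3)[OF f] have b: "cmod (stf f z) \<le> C * gs_val h f * exp (- (\<bar>r\<bar> + 1) * norm z)" for z .
  show ?thesis
  proof (rule Bochner_Integration.integrable_bound[OF integrable_mult_right[OF W, of "C * gs_val h f"]])
    show "AE z in lborel. norm (stf f (flip z) * W z) \<le> norm (C * gs_val h f * (cmod (W z) * exp (- r * norm z)))"
    proof (rule AE_I2)
      fix z :: "'a \<times> 'a"
      have "exp (- (\<bar>r\<bar> + 1) * norm z) \<le> exp (- r * norm z)"
        by (intro iffD2[OF exp_le_cancel_iff] mult_right_mono) auto
      then have "C * gs_val h f * exp (- (\<bar>r\<bar> + 1) * norm z) \<le> C * gs_val h f * exp (- r * norm z)"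
        using hC by (intro mult_left_mono) auto
      then have "cmod (stf f (flip z)) \<le> C * gs_val h f * exp (- r * norm z)"
        using b[of "flip z"] by simp
      from mult_right_mono[OF this, of "cmod (W z)"]
      show "norm (stf f (flip z) * W z) \<le> norm (C * gs_val h f * (cmod (W z) * exp (- r * norm z)))"
        using hC by (simp add: norm_mult abs_mult mult_ac)
    qed
  qed measurable
qed

text \<open>An exponential moment of \<open>W\<close> against the decay of \<open>stf f\<close>,
  whose constant is linear in a seminorm of \<open>f\<close>. The rate |r| + 1 is positive whatever
  the sign of \<open>r\<close>.\<close>

lemma dsynth_Sigma1':
  fixes W :: "'a::euclidean_space \<times> 'a \<Rightarrow> complex"
  assumes W_meas [measurable]: "W \<in> borel_measurable borel"
    and W: "integrable lborel (\<lambda>z. cmod (W z) * exp (- r * norm z))"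
  shows "dsynth W \<in> Sigma1'"
proof -
  obtain h C where h: "h > 0" and C: "C > 0"
    and dec: "\<And>f z. f \<in> (Sigma1 :: ('a \<Rightarrow> complex) set) \<Longrightarrow> cmod (stf f z) \<le> C * gs_val h f * exp (- (\<bar>r\<bar> + 1) * norm z)"
    by (rule stf_Sigma1_decay[of "\<bar>r\<bar> + 1"]) (auto intro: that)
  let ?I = "LINT z|lborel. cmod (W z) * exp (- r * norm z)"
  have lin: "dsynth W (\<lambda>x. a * g x + b * k x) = a * dsynth W g + b * dsynth W k"
    if g: "g \<in> Sigma1" and k: "k \<in> Sigma1" for g k a b
  proof -
    have "(\<lambda>z. stf (\<lambda>x. a * g x + b * k x) (flip z) * W z) = (\<lambda>z. a * (stf g (flip z) * W z) + b * (stf k (flip z) * W z))"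
      unfolding stf_linear_combination[OF g k] by (rule ext) (simp only: distrib_right mult.assoc)
    then show ?thesis
      using integrable_stf_flip_mult[OF g W_meas W] integrable_stf_flip_mult[OF k W_meas W]
      by (simp add: dsynth_def Sigma1_linear_combination[OF g k] g k)
  qed
  have bd: "ennreal (cmod (dsynth W g)) \<le> ennreal (C * ?I) * gs_norm h g" if g: "g \<in> Sigma1" for g
  proof -
    have b: "cmod (stf g (flip z) * W z) \<le> C * gs_val h g * (cmod (W z) * exp (- r * norm z))" for z
    proof -
      have "exp (- (\<bar>r\<bar> + 1) * norm z) \<le> exp (- r * norm z)"
        by (intro iffD2[OF exp_le_cancel_iff] mult_right_mono) auto
      then have "C * gs_val h g * exp (- (\<bar>r\<bar> + 1) * norm z) \<le> C * gs_val h g * exp (- r * norm z)"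
        using C by (intro mult_left_mono) auto
      then have "cmod (stf g (flip z)) \<le> C * gs_val h g * exp (- r * norm z)"
        using dec[OF g, of "flip z"] by simp
      from mult_right_mono[OF this, of "cmod (W z)"] show ?thesis
        by (simp add: norm_mult mult_ac)
    qed
    have "cmod (LINT z|lborel. stf g (flip z) * W z) \<le> (LINT z|lborel. C * gs_val h g * (cmod (W z) * exp (- r * norm z)))"
      by (rule order_trans[OF integral_norm_bound], rule integral_mono[OF integrable_norm[OF integrable_stf_flip_mult[OF g W_meas W]] integrable_mult_right[OF W] b])
    also have "\<dots> = C * ?I * gs_val h g" by simp
    finally have "ennreal (cmod (dsynth W g)) \<le> ennreal (C * ?I * gs_val h g)"
      using g by (intro ennreal_leI) (simp add: dsynth_def)
    also have "\<dots> = ennreal (C * ?I) * ennreal (gs_val h g)"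
      using C by (intro ennreal_mult mult_nonneg_nonneg Bochner_Integration.integral_nonneg) auto
    also have "ennreal (gs_val h g) = gs_norm h g"
      using Sigma1_gs_norm[OF g h] by (rule sym)
    finally show ?thesis .
  qed
  show ?thesis
    unfolding Sigma1'_def
  proof (intro CollectI conjI ballI allI impI)
    show "dsynth W (\<lambda>x. g x + k x) = dsynth W g + dsynth W k" if "g \<in> Sigma1" "k \<in> Sigma1" for g k
      using lin[OF that, of 1 1] by simp
    show "dsynth W (\<lambda>x. c * g x) = c * dsynth W g" if "g \<in> Sigma1" for c g
      using lin[OF that that, of c 0] by simp
    show "\<exists>h>0. \<exists>C. \<forall>g\<in>Sigma1. ennreal (cmod (dsynth W g)) \<le> ennreal C * gs_norm h g"
      using bd h by blast
  qed (simp add: dsynth_def)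
qed

lemma stv_dsynth:
  fixes W :: "'a::euclidean_space \<times> 'a \<Rightarrow> complex"
  shows "stv (dsynth W) z = (LINT p|lborel. rk z p * W p)"
proof -
  have "stv (dsynth W) z = (LINT p|lborel. of_real (fc DIM('a)) * (stf (atom (flip z)) (flip p) * W p))"
    unfolding stv_eq integral_mult_right_zero by (simp add: dsynth_def atom_Sigma1)
  then show ?thesis unfolding stf_atom_flip by (simp add: rk_def mult.assoc)
qed

section \<open>Lebesgue norms of nonnegative functions\<close>

lemma enn_powr_top [simp]: "enn_powr top r = top"
  and enn_powr_ennreal: "x \<ge> 0 \<Longrightarrow> enn_powr (ennreal x) r = ennreal (x powr r)"
  and enn_powr_0 [simp]: "enn_powr 0 r = 0"
  by (simp_all add: enn_powr_def)

lemma enn_powr_measurable [measurable (raw)]: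
  assumes [measurable]: "f \<in> borel_measurable M"
  shows "(\<lambda>x. enn_powr (f x) r) \<in> borel_measurable M"
  unfolding enn_powr_def by measurable

lemma enn_powr_1 [simp]: "enn_powr t 1 = t"
  by (cases t) (simp_all add: enn_powr_ennreal)

lemma enn_powr_eq_0_iff [simp]: "enn_powr t r = 0 \<longleftrightarrow> t = 0"
  by (cases t) (auto simp: enn_powr_ennreal)

lemma enn_powr_eq_top_iff [simp]: "enn_powr t r = top \<longleftrightarrow> t = top"
  by (cases t) (auto simp: enn_powr_ennreal)

lemma enn_powr_mono: "s \<le> t \<Longrightarrow> r > 0 \<Longrightarrow> enn_powr s r \<le> enn_powr t r"
  by (cases s; cases t) (auto simp: enn_powr_ennreal top_unique intro!: ennreal_leI powr_mono2)

lemma enn_powr_mult: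
  assumes "r > 0"
  shows "enn_powr (s * t) r = enn_powr s r * enn_powr t r"
proof (cases "s = top \<or> t = top")
  case True
  then show ?thesis
    by (cases "s = 0"; cases "t = 0") (auto simp: ennreal_top_mult ennreal_mult_top)
next
  case False
  then obtain a b where ab: "s = ennreal a" "t = ennreal b" "a \<ge> 0" "b \<ge> 0"
    by (cases s; cases t) auto
  then show ?thesis
    by (simp add: enn_powr_ennreal powr_mult flip: ennreal_mult)
qed

lemma enn_powr_powr: "enn_powr (enn_powr t r) s = enn_powr t (r * s)"
  by (cases t) (simp_all add: enn_powr_ennreal powr_powr)

lemma enn_powr_tendsto_0:
  assumes f: "f \<longlonglongrightarrow> (0::ennreal)" and r: "r > 0"
  shows "(\<lambda>n. enn_powr (f n) r) \<longlonglongrightarrow> 0"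
proof -
  have ev: "\<forall>\<^sub>F n in sequentially. f n < top"
    using f by (rule order_tendstoD) simp
  have "(\<lambda>n. enn2real (f n)) \<longlonglongrightarrow> enn2real 0"
    using f by (intro tendsto_enn2real) auto
  then have "(\<lambda>n. enn2real (f n) powr r) \<longlonglongrightarrow> 0 powr r"
    using r by (intro tendsto_powr' tendsto_const) auto
  then have "(\<lambda>n. ennreal (enn2real (f n) powr r)) \<longlonglongrightarrow> ennreal 0"
    by (intro tendsto_ennrealI) simp
  moreover have "\<forall>\<^sub>F n in sequentially. ennreal (enn2real (f n) powr r) = enn_powr (f n) r"
    using ev by eventually_elim (auto simp: enn_powr_def)
  ultimately show ?thesis
    unfolding ennreal_0 by (rule Lim_transform_eventually)
qed

lemma ennreal_exponent_cases [consumes 1, case_names top real]: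
  assumes "1 \<le> (p::ennreal)"
  obtains (top) "p = top" | (real) r where "r \<ge> 1" "p = ennreal r" "p \<noteq> top" "enn2real p = r"
proof (cases p)
  case (real r)
  with assms have "r \<ge> 1" by (simp flip: ennreal_1)
  then show thesis using real that(2)[of r] by simp
qed (use that in simp)

text \<open>Completing the measure does not change the nonnegative integral, so from here on
  everything refers to \<open>lborel\<close>, where product measures are at hand.\<close>

lemma Lp_norm_finite_eq:
  "p \<noteq> top \<Longrightarrow> Lp_norm p g = enn_powr (\<integral>\<^sup>+ x. enn_powr (g x) (enn2real p) \<partial>lborel) (1 / enn2real p)"
  by (simp add: Lp_norm_def nn_integral_completion)

lemma Lp_norm_1: "Lp_norm 1 g = (\<integral>\<^sup>+ x. g x \<partial>lborel)"
  by (simp add: Lp_norm_finite_eq)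

lemma Lp_norm_top_eq: "Lp_norm top g = Inf {c. AE x in lborel. g x \<le> c}"
  by (simp add: Lp_norm_def AE_completion_iff)

lemma Lp_norm_top_AE:
  assumes "g \<in> borel_measurable borel"
  shows "AE x in lborel. g x \<le> Lp_norm top g"
  using esssup_AE[where M=lborel and f=g] esssup_eq_AE[where M=lborel and f=g] assms by (simp add: Lp_norm_top_eq)

lemma Lp_norm_top_le: "AE x in lborel. g x \<le> c \<Longrightarrow> Lp_norm top g \<le> c"
  unfolding Lp_norm_top_eq by (rule Inf_lower) simp

lemma Lp_norm_mono_AE:
  assumes p: "1 \<le> p" and fg: "AE x in lborel. f x \<le> g x"
  shows "Lp_norm p f \<le> Lp_norm p g"
  using p
proof (cases rule: ennreal_exponent_cases)
  case top
  show ?thesis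
    unfolding top Lp_norm_top_eq
  proof (rule Inf_superset_mono, rule subsetI, unfold mem_Collect_eq)
    fix c assume "AE x in lborel. g x \<le> c"
    with fg show "AE x in lborel. f x \<le> c" by eventually_elim (rule order_trans)
  qed
next
  case (real r)
  show ?thesis
    unfolding Lp_norm_finite_eq[OF real(3)] real(4)
    using real(1) fg by (intro enn_powr_mono nn_integral_mono_AE) (auto elim!: eventually_mono intro: enn_powr_mono)
qed

lemma Lp_norm_mono: "1 \<le> p \<Longrightarrow> (\<And>x. f x \<le> g x) \<Longrightarrow> Lp_norm p f \<le> Lp_norm p g"
  by (rule Lp_norm_mono_AE) auto

text \<open>For the essential supremum, lying below \<open>c\<close> means that the section of the
  set where \<open>f\<close> exceeds \<open>c\<close> is null, and the measure of a section depends
  measurably on the parameter.\<close>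

lemma Lp_norm_measurable [measurable (raw)]:
  assumes f [measurable]: "(\<lambda>(x, y). f x y) \<in> borel_measurable (N \<Otimes>\<^sub>M (lborel :: 'a::euclidean_space measure))"
  shows "(\<lambda>x. Lp_norm p (f x)) \<in> borel_measurable N"
proof (cases "p = top")
  case False
  then show ?thesis unfolding Lp_norm_finite_eq[OF False] by measurable
next
  case True
  have fx: "f x \<in> borel_measurable borel" if "x \<in> space N" for x
    using measurable_Pair2[OF f that] by simp
  have iff: "Lp_norm top (f x) \<le> c \<longleftrightarrow> (\<integral>\<^sup>+ y. indicator {y. c < f x y} y \<partial>lborel) = 0" if x: "x \<in> space N" for x c
  proof -
    note [measurable] = fx[OF x]
    have "Lp_norm top (f x) \<le> c \<longleftrightarrow> (AE y in lborel. f x y \<le> c)"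
      using Lp_norm_top_AE[OF fx[OF x]] Lp_norm_top_le[of "f x" c]
      by (auto elim!: eventually_mono intro: order_trans)
    also have "\<dots> \<longleftrightarrow> (AE y in lborel. indicator {y. c < f x y} y = (0::ennreal))"
      by (intro AE_cong) (auto simp: indicator_def not_le)
    also have "\<dots> \<longleftrightarrow> (\<integral>\<^sup>+ y. indicator {y. c < f x y} y \<partial>lborel) = 0"
      by (subst nn_integral_0_iff_AE) auto
    finally show ?thesis .
  qed
  have "(\<lambda>x. Lp_norm top (f x)) \<in> borel_measurable N"
  proof (rule borel_measurableI_le)
    fix c
    have "(\<lambda>x. \<integral>\<^sup>+ y. indicator {y. c < f x y} y \<partial>lborel) \<in> borel_measurable N"
      by measurable
    then have "{x \<in> space N. (\<integral>\<^sup>+ y. indicator {y. c < f x y} y \<partial>lborel) = 0} \<in> sets N"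
      by measurable
    then show "{x \<in> space N. Lp_norm top (f x) \<le> c} \<in> sets N"
      by (simp cong: conj_cong add: iff)
  qed
  then show ?thesis using True by simp
qed

lemma Lp_norm_translate:
  assumes [measurable]: "g \<in> borel_measurable borel"
  shows "Lp_norm p (\<lambda>x. g (t + x)) = Lp_norm p g"
proof (cases "p = top")
  case False
  show ?thesis
    unfolding Lp_norm_finite_eq[OF False]
    using lborel_nn_integral_affine[of "\<lambda>x. enn_powr (g x) (enn2real p)" 1 t] by simp
next
  case True
  have "(AE x in lborel. g (t + x) \<le> c) \<longleftrightarrow> (AE x in lborel. g x \<le> c)" for c
    by (subst (2) lborel_distr_plus[of t, symmetric]) (simp add: AE_distr_iff)
  then show ?thesis unfolding True Lp_norm_top_eq by simp
qed

section \<open>Hoelder's and Minkowski's inequalities\<close>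

lemma ennreal_add_mult:
  assumes "a \<ge> 0" "b \<ge> 0" "x \<ge> 0" "y \<ge> 0"
  shows "ennreal (a * x + b * y) = ennreal a * ennreal x + ennreal b * ennreal y"
  using assms by (simp add: ennreal_plus ennreal_mult)

text \<open>Young's inequality applied to the normalised functions. The degenerate cases come first:
  a vanishing factor makes the product vanish almost everywhere, and an infinite factor makes the
  right-hand side infinite.\<close>

lemma nn_integral_Holder:
  fixes p q :: real
  assumes pq: "p > 1" "q > 1" "1 / p + 1 / q = 1"
    and [measurable]: "f \<in> borel_measurable M" "g \<in> borel_measurable M"
  shows "(\<integral>\<^sup>+ x. f x * g x \<partial>M) \<le>
    enn_powr (\<integral>\<^sup>+ x. enn_powr (f x) p \<partial>M) (1 / p) * enn_powr (\<integral>\<^sup>+ x. enn_powr (g x) q \<partial>M) (1 / q)"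
    (is "_ \<le> enn_powr ?A _ * enn_powr ?B _")
proof -
  have zero: "(\<integral>\<^sup>+ x. f x * g x \<partial>M) = 0" if "?A = 0 \<or> ?B = 0"
  proof -
    have "AE x in M. f x = 0 \<or> g x = 0"
      using that by (auto simp: nn_integral_0_iff_AE elim!: eventually_mono)
    then show ?thesis by (subst nn_integral_0_iff_AE) (auto elim!: eventually_mono)
  qed
  consider "?A = 0 \<or> ?B = 0" | "?A \<noteq> 0" "?B \<noteq> 0" "?A = top \<or> ?B = top" | "?A \<noteq> 0" "?B \<noteq> 0" "?A \<noteq> top" "?B \<noteq> top" by blast
  then show ?thesis
  proof cases
    case 1
    then show ?thesis using zero by simp
  next
    case 2
    then have "enn_powr ?A (1 / p) * enn_powr ?B (1 / q) = top"
      by (auto simp: ennreal_mult_eq_top_iff)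
    then show ?thesis by simp
  next
    case 3
    then obtain a b where a: "?A = ennreal a" "a > 0" and b: "?B = ennreal b" "b > 0"
      by (metis ennreal_cases ennreal_0 order_le_less)
    define \<alpha> \<beta> where "\<alpha> = a powr (1 / p)" and "\<beta> = b powr (1 / q)"
    have \<alpha>: "\<alpha> > 0" "\<alpha> powr p = a" and \<beta>: "\<beta> > 0" "\<beta> powr q = b"
      using a b pq by (auto simp: \<alpha>_def \<beta>_def powr_powr)
    \<comment> \<open>Young's inequality for f / \<alpha> and g / \<beta>, multiplied by \<alpha>
      \<beta>; integrated, the two coefficients add up to \<alpha> \<beta> (1 / p + 1 / q).\<close>
    have pt: "f x * g x \<le> ennreal (\<alpha> * \<beta> / (p * a)) * enn_powr (f x) p + ennreal (\<alpha> * \<beta> / (q * b)) * enn_powr (g x) q" for x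
    proof (cases "f x = top \<or> g x = top")
      case True
      have "ennreal (\<alpha> * \<beta> / (p * a)) \<noteq> 0" "ennreal (\<alpha> * \<beta> / (q * b)) \<noteq> 0"
        using \<alpha> \<beta> a b pq by (auto simp: ennreal_eq_0_iff not_le)
      then have e: "ennreal (\<alpha> * \<beta> / (p * a)) * enn_powr (f x) p + ennreal (\<alpha> * \<beta> / (q * b)) * enn_powr (g x) q = top"
        using True by (auto simp: ennreal_mult_top)
      show ?thesis unfolding e by simp
    next
      case False
      then obtain s t where st: "f x = ennreal s" "g x = ennreal t" "s \<ge> 0" "t \<ge> 0"
        by (cases "f x"; cases "g x") auto
      have "(s / \<alpha>) * (t / \<beta>) \<le> (s / \<alpha>) powr p / p + (t / \<beta>) powr q / q"
        using pq st \<alpha> \<beta> by (intro Youngs_inequality) auto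
      also have "\<dots> = s powr p / (p * a) + t powr q / (q * b)"
        using st \<alpha> \<beta> by (simp add: powr_divide mult.commute)
      finally have "(\<alpha> * \<beta>) * ((s / \<alpha>) * (t / \<beta>)) \<le> (\<alpha> * \<beta>) * (s powr p / (p * a) + t powr q / (q * b))"
        using \<alpha> \<beta> by (intro mult_left_mono) auto
      then have "s * t \<le> \<alpha> * \<beta> / (p * a) * s powr p + \<alpha> * \<beta> / (q * b) * t powr q"
        using \<alpha> \<beta> by (simp add: distrib_left)
      then have "ennreal (s * t) \<le> ennreal (\<alpha> * \<beta> / (p * a) * s powr p + \<alpha> * \<beta> / (q * b) * t powr q)"
        by (rule ennreal_leI)
      also have "\<dots> = ennreal (\<alpha> * \<beta> / (p * a)) * ennreal (s powr p) + ennreal (\<alpha> * \<beta> / (q * b)) * ennreal (t powr q)"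
        by (rule ennreal_add_mult) (use \<alpha> \<beta> a b pq in auto)
      finally show ?thesis
        using st by (simp add: enn_powr_ennreal ennreal_mult)
    qed
    have "(\<integral>\<^sup>+ x. f x * g x \<partial>M) \<le> (\<integral>\<^sup>+ x. ennreal (\<alpha> * \<beta> / (p * a)) * enn_powr (f x) p + ennreal (\<alpha> * \<beta> / (q * b)) * enn_powr (g x) q \<partial>M)"
      by (intro nn_integral_mono pt)
    also have "\<dots> = ennreal (\<alpha> * \<beta> / (p * a)) * ennreal a + ennreal (\<alpha> * \<beta> / (q * b)) * ennreal b"
      by (simp add: nn_integral_add nn_integral_cmult a(1) b(1))
    also have "\<dots> = ennreal (\<alpha> * \<beta> / (p * a) * a + \<alpha> * \<beta> / (q * b) * b)"
      by (rule ennreal_add_mult[symmetric]) (use \<alpha> \<beta> a b pq in auto)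
    also have "\<alpha> * \<beta> / (p * a) * a + \<alpha> * \<beta> / (q * b) * b = \<alpha> * \<beta> * (1 / p + 1 / q)"
      using a b by (simp add: distrib_left)
    also have "\<dots> = \<alpha> * \<beta>" using pq by simp
    finally show ?thesis
      unfolding a(1) b(1) using a(2) b(2) by (simp add: enn_powr_ennreal \<alpha>_def \<beta>_def ennreal_mult)
  qed
qed

text \<open>The relation is read in the extended reals, where 1 / top is 0, so the endpoint pairs
  are included.\<close>

lemma conjugate_exponent_cases [consumes 2, case_names one top real]:
  fixes p p' :: ennreal
  assumes p: "1 \<le> p" and c: "1 / p + 1 / p' = 1"
  obtains (one) "p = 1" "p' = top" | (top) "p = top" "p' = 1"
    | (real) r r' where "r > 1" "r' > 1" "1 / r + 1 / r' = 1" "p = ennreal r" "p' = ennreal r'" "p \<noteq> top" "p' \<noteq> top" "enn2real p = r" "enn2real p' = r'"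
proof -
  have p'0: "p' \<noteq> 0"
    using c by (auto simp: ennreal_divide_zero)
  consider "p = top" | "p = 1" | r where "p = ennreal r" "r > 1"
    using p by (cases p) (auto simp flip: ennreal_1, fastforce)
  then show thesis
  proof cases
    case 1
    with c have "1 / p' = 1" by simp
    then have "p' = 1"
      using p'0 by (cases p') (auto simp: divide_ennreal_def inverse_ennreal)
    with 1 show thesis by (rule that(2))
  next
    case 2
    with c have "1 + 1 / p' = 1 + 0" by (simp add: divide_ennreal_def)
    then have "1 / p' = 0" unfolding ennreal_add_left_cancel by simp
    then have "p' = top" by simp
    with 2 show thesis by (rule that(1))
  next
    case (3 r)
    have "p' \<noteq> top"
    proof
      assume "p' = top"
      with c 3 have "ennreal (1 / r) = ennreal 1" by (simp add: divide_ennreal_def inverse_ennreal)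
      then show False using 3(2) by (simp add: ennreal_inj flip: ennreal_1)
    qed
    then obtain s where s: "p' = ennreal s" "s > 0"
      using p'0 by (cases p') (auto simp: less_le)
    have "ennreal (1 / r + 1 / s) = 1"
      using c 3 s by (simp add: divide_ennreal_def inverse_ennreal ennreal_plus inverse_eq_divide flip: ennreal_plus)
    then have rs: "1 / r + 1 / s = 1" by (simp only: ennreal_eq_1)
    have "1 / s < 1" using rs 3(2) by (smt (verit) zero_less_divide_1_iff)
    then have "s > 1" using s by simp
    then show thesis using that(3)[of r s] 3 s rs by simp
  qed
qed

lemma conjugate_ge_1:
  fixes p p' :: ennreal
  assumes "1 \<le> p" "1 / p + 1 / p' = 1"
  shows "1 \<le> p'"
  using assms by (cases rule: conjugate_exponent_cases) auto

lemma Lp_norm_Holder: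
  fixes f g :: "'a::euclidean_space \<Rightarrow> ennreal"
  assumes p: "1 \<le> p" and c: "1 / p + 1 / p' = 1"
    and [measurable]: "f \<in> borel_measurable borel" "g \<in> borel_measurable borel"
  shows "(\<integral>\<^sup>+ x. f x * g x \<partial>lborel) \<le> Lp_norm p f * Lp_norm p' g"
proof -
  have H: "(\<integral>\<^sup>+ x. f x * g x \<partial>lborel) \<le> Lp_norm top f * Lp_norm 1 g"
    if [measurable]: "f \<in> borel_measurable borel" "g \<in> borel_measurable borel" for f g :: "'a \<Rightarrow> ennreal"
  proof -
    have "(\<integral>\<^sup>+ x. f x * g x \<partial>lborel) \<le> (\<integral>\<^sup>+ x. Lp_norm top f * g x \<partial>lborel)"
      by (intro nn_integral_mono_AE) (use Lp_norm_top_AE[OF that(1)] in \<open>auto elim!: eventually_mono intro: mult_right_mono\<close>)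
    then show ?thesis by (simp add: nn_integral_cmult Lp_norm_1)
  qed
  show ?thesis
    using p c
  proof (cases rule: conjugate_exponent_cases)
    case one
    have "(\<integral>\<^sup>+ x. g x * f x \<partial>lborel) \<le> Lp_norm top g * Lp_norm 1 f" by (rule H) measurable
    then show ?thesis unfolding one by (simp add: mult.commute)
  next
    case top
    show ?thesis unfolding top by (rule H) measurable
  next
    case (real r r')
    show ?thesis
      unfolding Lp_norm_finite_eq[OF real(6)] Lp_norm_finite_eq[OF real(7)] real(8,9)
      by (rule nn_integral_Holder[OF real(1-3)]) auto
  qed
qed

lemma lborel_AE_commute:
  fixes P :: "'a::euclidean_space \<Rightarrow> 'b::euclidean_space \<Rightarrow> bool"
  assumes "Measurable.pred borel (\<lambda>z. P (fst z) (snd z))"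
  shows "(AE x in lborel. AE y in lborel. P x y) \<longleftrightarrow> (AE y in lborel. AE x in lborel. P x y)"
  by (rule lborel_pair.AE_commute) (unfold lborel_prod, use assms in \<open>simp add: pred_def\<close>)

text \<open>For 1 < r < top no duality is used. With n(y) the inner norm and N its integral, f is
  split as (f n^(-1/s)) n^(1/s), with s conjugate to r. Hoelder in y yields N^(1/s) times the r-th
  root of an integral whose integral over x is again N.\<close>

lemma Lp_norm_Minkowski:
  fixes f :: "'a::euclidean_space \<Rightarrow> 'b::euclidean_space \<Rightarrow> ennreal"
  assumes p: "1 \<le> p" and f [measurable]: "(\<lambda>z. f (fst z) (snd z)) \<in> borel_measurable borel"
  shows "Lp_norm p (\<lambda>x. \<integral>\<^sup>+ y. f x y \<partial>lborel) \<le> (\<integral>\<^sup>+ y. Lp_norm p (\<lambda>x. f x y) \<partial>lborel)"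
proof -
  have f1: "(\<lambda>(x, y). f x y) \<in> borel_measurable (lborel \<Otimes>\<^sub>M lborel)"
    using f by (simp add: lborel_prod case_prod_beta')
  have f2: "(\<lambda>(y, x). f x y) \<in> borel_measurable (lborel \<Otimes>\<^sub>M lborel)"
    using measurable_pair_swap[OF f1] by (simp add: case_prod_beta')
  have fx[measurable]: "f x \<in> borel_measurable borel" for x
    using measurable_Pair2[OF f1, of x] by simp
  have fy[measurable]: "(\<lambda>x. f x y) \<in> borel_measurable borel" for y
    using measurable_Pair2[OF f2, of y] by simp
  define n where "n y = Lp_norm p (\<lambda>x. f x y)" for y
  have n_meas[measurable]: "n \<in> borel_measurable borel"
    using Lp_norm_measurable[OF f2, of p] by (simp add: n_def[abs_def])
  consider "p = 1" | "p = top" | r where "r > 1" "p \<noteq> top" "enn2real p = r"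
    using p by (cases rule: ennreal_exponent_cases) (auto simp: order_le_less)
  then show ?thesis
  proof cases
    case 1
    show ?thesis unfolding 1 Lp_norm_1 using lborel_pair.Fubini'[OF f1] by simp
  next
    case 2
    have "AE y in lborel. AE x in lborel. f x y \<le> n y"
      unfolding n_def 2 by (intro AE_I2 Lp_norm_top_AE) measurable
    then have "AE x in lborel. AE y in lborel. f x y \<le> n y"
    proof (rule lborel_AE_commute[THEN iffD2, rotated])
      show "Measurable.pred borel (\<lambda>z. f (fst z) (snd z) \<le> n (snd z))"
        unfolding pred_def
        by (intro borel_measurable_le f measurable_compose[OF measurable_snd_borel[OF measurable_ident_sets[OF refl]] n_meas])
    qed
    then have "AE x in lborel. (\<integral>\<^sup>+ y. f x y \<partial>lborel) \<le> (\<integral>\<^sup>+ y. n y \<partial>lborel)"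
      by eventually_elim (rule nn_integral_mono_AE)
    then show ?thesis unfolding 2 n_def by (rule Lp_norm_top_le)
  next
    case (3 r)
    define s where "s = r / (r - 1)"
    have rs: "r > 1" "s > 1" "1 / r + 1 / s = 1" using 3 by (auto simp: s_def field_simps)
    define N where "N = (\<integral>\<^sup>+ y. n y \<partial>lborel)"
    show ?thesis
    proof (cases "N = top")
      case True
      then show ?thesis by (simp add: N_def n_def)
    next
      case False
      define w where "w y = enn2real (n y)" for y
      have [measurable]: "w \<in> borel_measurable borel" unfolding w_def by measurable
      have w0: "w y \<ge> 0" for y by (simp add: w_def)
      have fin: "AE y in lborel. n y \<noteq> top"
        using nn_integral_PInf_AE[of n lborel] False by (simp add: N_def)
      \<comment> \<open>Only an inequality is asserted, so that it covers n(y) = 0: the weights are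
        then 0, but f( . , y) vanishes almost everywhere.\<close>
      have split: "AE y in lborel. AE x in lborel. f x y \<le> (f x y * ennreal (w y powr (- 1 / s))) * ennreal (w y powr (1 / s))"
        using fin
      proof eventually_elim
        case (elim y)
        show ?case
        proof (cases "n y = 0")
          case True
          then have "AE x in lborel. enn_powr (f x y) r = 0"
            unfolding n_def Lp_norm_finite_eq[OF 3(2)] 3(3) by (simp add: nn_integral_0_iff_AE)
          then show ?thesis by eventually_elim simp
        next
          case False
          then have "w y > 0" using elim by (simp add: w_def enn2real_positive_iff less_top zero_less_iff_neq_zero)
          then have "ennreal (w y powr (- 1 / s)) * ennreal (w y powr (1 / s)) = 1"
            by (simp flip: ennreal_mult powr_add)
          then show ?thesis by (simp add: mult.assoc)
        qed
      qed
      then have split': "AE x in lborel. AE y in lborel. f x y \<le> (f x y * ennreal (w y powr (- 1 / s))) * ennreal (w y powr (1 / s))"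
      proof (rule lborel_AE_commute[THEN iffD2, rotated])
        have ws: "(\<lambda>z :: 'a \<times> 'b. ennreal (w (snd z) powr c)) \<in> borel_measurable borel" for c
          by (rule measurable_compose[OF measurable_snd_borel[OF measurable_ident_sets[OF refl]], of "\<lambda>y. ennreal (w y powr c)"]) measurable
        show "Measurable.pred borel (\<lambda>z. f (fst z) (snd z) \<le> (f (fst z) (snd z) * ennreal (w (snd z) powr (- 1 / s))) * ennreal (w (snd z) powr (1 / s)))"
          unfolding pred_def by (intro borel_measurable_le borel_measurable_times_ennreal f ws)
      qed
      have wN: "(\<integral>\<^sup>+ y. enn_powr (ennreal (w y powr (1 / s))) s \<partial>lborel) = N"
        unfolding N_def using rs fin
        by (intro nn_integral_cong_AE) (auto elim!: eventually_mono simp: enn_powr_ennreal powr_powr w0 w_def less_top)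
      \<comment> \<open>The r-th power of the first Hoelder factor. Its integral over x can be taken
        under the integral over y.\<close>
      define \<Phi> where "\<Phi> x = (\<integral>\<^sup>+ y. enn_powr (f x y) r * ennreal (w y powr (- r / s)) \<partial>lborel)" for x
      have [measurable]: "\<Phi> \<in> borel_measurable borel"
        unfolding \<Phi>_def using f1 by measurable
      have "AE x in lborel. (\<integral>\<^sup>+ y. f x y \<partial>lborel) \<le> enn_powr (\<Phi> x) (1 / r) * enn_powr N (1 / s)"
        using split'
      proof eventually_elim
        case (elim x)
        have "(\<integral>\<^sup>+ y. f x y \<partial>lborel) \<le> (\<integral>\<^sup>+ y. (f x y * ennreal (w y powr (- 1 / s))) * ennreal (w y powr (1 / s)) \<partial>lborel)"
          by (rule nn_integral_mono_AE[OF elim])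
        also have "\<dots> \<le> enn_powr (\<integral>\<^sup>+ y. enn_powr (f x y * ennreal (w y powr (- 1 / s))) r \<partial>lborel) (1 / r) *
            enn_powr (\<integral>\<^sup>+ y. enn_powr (ennreal (w y powr (1 / s))) s \<partial>lborel) (1 / s)"
          by (rule nn_integral_Holder[OF rs]) measurable
        also have "(\<integral>\<^sup>+ y. enn_powr (f x y * ennreal (w y powr (- 1 / s))) r \<partial>lborel) = \<Phi> x"
          unfolding \<Phi>_def using rs by (intro nn_integral_cong) (simp add: enn_powr_mult enn_powr_ennreal powr_powr)
        finally show ?case unfolding wN .
      qed
      then have "Lp_norm p (\<lambda>x. \<integral>\<^sup>+ y. f x y \<partial>lborel) \<le> Lp_norm p (\<lambda>x. enn_powr (\<Phi> x) (1 / r) * enn_powr N (1 / s))"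
        by (rule Lp_norm_mono_AE[OF p])
      also have "\<dots> = enn_powr (\<integral>\<^sup>+ x. \<Phi> x * enn_powr N (r / s) \<partial>lborel) (1 / r)"
        unfolding Lp_norm_finite_eq[OF 3(2)] 3(3) using rs by (simp add: enn_powr_mult enn_powr_powr)
      also have "\<dots> = enn_powr (\<integral>\<^sup>+ x. \<Phi> x \<partial>lborel) (1 / r) * enn_powr N (1 / s)"
        using rs by (simp add: nn_integral_multc enn_powr_mult enn_powr_powr)
      also have "(\<integral>\<^sup>+ x. \<Phi> x \<partial>lborel) = (\<integral>\<^sup>+ y. \<integral>\<^sup>+ x. enn_powr (f x y) r * ennreal (w y powr (- r / s)) \<partial>lborel \<partial>lborel)"
        unfolding \<Phi>_def by (rule lborel_pair.Fubini'[symmetric]) (use f1 in measurable)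
      also have "\<dots> \<le> (\<integral>\<^sup>+ y. n y \<partial>lborel)"
      proof (rule nn_integral_mono_AE)
        show "AE y in lborel. (\<integral>\<^sup>+ x. enn_powr (f x y) r * ennreal (w y powr (- r / s)) \<partial>lborel) \<le> n y"
          using fin
        proof eventually_elim
          case (elim y)
          have "(\<integral>\<^sup>+ x. enn_powr (f x y) r * ennreal (w y powr (- r / s)) \<partial>lborel) = enn_powr (n y) r * ennreal (w y powr (- r / s))"
            using rs unfolding n_def Lp_norm_finite_eq[OF 3(2)] 3(3) by (simp add: nn_integral_multc enn_powr_powr)
          also have "enn_powr (n y) r = ennreal (w y powr r)"
            using elim by (simp add: enn_powr_def w_def)
          also have "ennreal (w y powr r) * ennreal (w y powr (- r / s)) = ennreal (w y powr (r + - r / s))"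
            by (simp flip: ennreal_mult powr_add)
          \<comment> \<open>Conjugacy of \<open>r\<close> and \<open>s\<close> is exactly what
            reduces n^r n^(-r/s) to n.\<close>
          also have "r + - r / s = 1" using rs by (simp add: s_def field_simps)
          also have "ennreal (w y powr 1) = n y" using elim w0[of y] by (simp add: w_def less_top)
          finally show ?case by simp
        qed
      qed
      finally have "Lp_norm p (\<lambda>x. \<integral>\<^sup>+ y. f x y \<partial>lborel) \<le> enn_powr N (1 / r) * enn_powr N (1 / s)"
        unfolding N_def[symmetric] using rs by (meson enn_powr_mono mult_right_mono order_trans zero_le zero_less_divide_1_iff less_trans zero_less_one)
      also have "\<dots> = N"
        using False rs by (cases N) (auto simp: enn_powr_ennreal simp flip: ennreal_mult powr_add)
      finally show ?thesis unfolding N_def n_def .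
    qed
  qed
qed

section \<open>Mixed norms\<close>

lemma borel_compose:
  assumes "g \<in> borel_measurable borel" and "continuous_on UNIV f"
  shows "(\<lambda>x. g (f x)) \<in> borel_measurable borel"
  using measurable_compose[OF borel_measurable_continuous_onI[OF assms(2)] assms(1)] .

lemma Lp_norm_section_measurable:
  fixes f :: "'a::euclidean_space \<times> 'b::euclidean_space \<Rightarrow> ennreal"
  assumes "f \<in> borel_measurable borel"
  shows "(\<lambda>x. Lp_norm p (\<lambda>y. f (x, y))) \<in> borel_measurable borel"
proof -
  have "(\<lambda>(x, y). f (x, y)) \<in> borel_measurable (lborel \<Otimes>\<^sub>M lborel)"
    using assms by (simp add: lborel_prod)
  from Lp_norm_measurable[OF this] show ?thesis by simp
qed

lemma section_measurable:
  fixes f :: "'a::euclidean_space \<times> 'b::euclidean_space \<Rightarrow> 'c::topological_space"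
  assumes "f \<in> borel_measurable borel"
  shows "(\<lambda>y. f (x, y)) \<in> borel_measurable borel"
  by (rule borel_compose[OF assms]) (intro continuous_intros)

lemma lborel_nn_integral_fst:
  fixes f :: "'a::euclidean_space \<times> 'b::euclidean_space \<Rightarrow> ennreal"
  assumes "f \<in> borel_measurable borel"
  shows "(\<integral>\<^sup>+ x. \<integral>\<^sup>+ y. f (x, y) \<partial>lborel \<partial>lborel) = (\<integral>\<^sup>+ z. f z \<partial>lborel)"
proof -
  have "f \<in> borel_measurable (lborel \<Otimes>\<^sub>M lborel)" using assms by (simp add: lborel_prod)
  from lborel.nn_integral_fst[OF this] show ?thesis by (simp add: lborel_prod)
qed

lemma lborel_nn_integral_snd:
  fixes f :: "'a::euclidean_space \<times> 'b::euclidean_space \<Rightarrow> ennreal"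
  assumes "f \<in> borel_measurable borel"
  shows "(\<integral>\<^sup>+ y. \<integral>\<^sup>+ x. f (x, y) \<partial>lborel \<partial>lborel) = (\<integral>\<^sup>+ z. f z \<partial>lborel)"
proof -
  have "(\<lambda>(x, y). f (x, y)) \<in> borel_measurable (lborel \<Otimes>\<^sub>M lborel)" using assms by (simp add: lborel_prod)
  from lborel_pair.nn_integral_snd[OF this] show ?thesis by (simp add: lborel_prod)
qed

lemma Lp_norm_cmult_le:
  assumes p: "1 \<le> p" and [measurable]: "g \<in> borel_measurable borel"
  shows "Lp_norm p (\<lambda>x. c * g x) \<le> c * Lp_norm p g"
  using p
proof (cases rule: ennreal_exponent_cases)
  case top
  show ?thesis unfolding top
    by (rule Lp_norm_top_le) (use Lp_norm_top_AE[OF assms(2)] in \<open>auto elim!: eventually_mono intro: mult_left_mono\<close>)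
next
  case (real r)
  then have r: "r > 0" by simp
  show ?thesis
    unfolding Lp_norm_finite_eq[OF real(3)] real(4) enn_powr_mult[OF r]
    by (subst nn_integral_cmult) (use r in \<open>auto simp: enn_powr_mult enn_powr_powr\<close>)
qed

text \<open>Tonelli for finite exponents. At the endpoint the almost everywhere bound is passed to
  the sections, which gives the one direction that is used.\<close>

lemma Lp_norm_iterated_le:
  fixes f :: "'a::euclidean_space \<times> 'b::euclidean_space \<Rightarrow> ennreal"
  assumes p: "1 \<le> p" and f: "f \<in> borel_measurable borel"
  shows "Lp_norm p (\<lambda>x. Lp_norm p (\<lambda>y. f (x, y))) \<le> Lp_norm p f"
  using p
proof (cases rule: ennreal_exponent_cases)
  case top
  have "AE z in lborel \<Otimes>\<^sub>M lborel. f z \<le> Lp_norm top f"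
    using Lp_norm_top_AE[OF f] unfolding lborel_prod .
  then have "AE x in lborel. AE y in lborel. f (x, y) \<le> Lp_norm top f"
    by (rule lborel_pair.AE_pair)
  then have "AE x in lborel. Lp_norm top (\<lambda>y. f (x, y)) \<le> Lp_norm top f"
    by eventually_elim (rule Lp_norm_top_le)
  then show ?thesis unfolding top by (rule Lp_norm_top_le)
next
  case (real r)
  have m: "(\<lambda>z. enn_powr (f z) r) \<in> borel_measurable borel" using f by measurable
  show ?thesis
    unfolding Lp_norm_finite_eq[OF real(3)] real(4) enn_powr_powr
    using real(1) lborel_nn_integral_fst[OF m] by simp
qed

text \<open>The first component is the outer variable, with the first exponent. W norms are thus
  \<open>mixn p q\<close>, whereas M norms need the variables swapped and become
  \<open>mixn q p\<close>.\<close>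

definition mixn :: "ennreal \<Rightarrow> ennreal \<Rightarrow> ('a::euclidean_space \<times> 'b::euclidean_space \<Rightarrow> ennreal) \<Rightarrow> ennreal" where
  "mixn p q f = Lp_norm p (\<lambda>x. Lp_norm q (\<lambda>y. f (x, y)))"

lemma mixn_mono: "1 \<le> p \<Longrightarrow> 1 \<le> q \<Longrightarrow> (\<And>z. f z \<le> g z) \<Longrightarrow> mixn p q f \<le> mixn p q g"
  unfolding mixn_def by (intro Lp_norm_mono)

lemma mixn_cmult_le:
  assumes p: "1 \<le> p" "1 \<le> q" and f: "f \<in> borel_measurable borel"
  shows "mixn p q (\<lambda>z. c * f z) \<le> c * mixn p q f"
proof -
  have "mixn p q (\<lambda>z. c * f z) \<le> Lp_norm p (\<lambda>x. c * Lp_norm q (\<lambda>y. f (x, y)))"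
    unfolding mixn_def by (intro Lp_norm_mono p Lp_norm_cmult_le section_measurable f)
  also have "\<dots> \<le> c * mixn p q f"
    unfolding mixn_def by (intro p Lp_norm_cmult_le Lp_norm_section_measurable f)
  finally show ?thesis .
qed

lemma mixn_translate:
  assumes f: "f \<in> borel_measurable borel"
  shows "mixn p q (\<lambda>z. f (t + z)) = mixn p q f"
proof -
  have "Lp_norm q (\<lambda>y. f (t + (x, y))) = Lp_norm q (\<lambda>y. f (fst t + x, y))" for x
    using Lp_norm_translate[OF section_measurable[OF f, of "fst t + x"], of q "snd t"]
    by (cases t) simp
  then show ?thesis
    unfolding mixn_def using Lp_norm_translate[OF Lp_norm_section_measurable[OF f], of p q "fst t"] by simp
qed

text \<open>Minkowski's inequality for the inner norm, then for the outer one.\<close>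

lemma mixn_Minkowski:
  fixes f :: "'a::euclidean_space \<times> 'b::euclidean_space \<Rightarrow> 'c::euclidean_space \<Rightarrow> ennreal"
  assumes p: "1 \<le> p" "1 \<le> q" and f: "(\<lambda>w. f (fst w) (snd w)) \<in> borel_measurable borel"
  shows "mixn p q (\<lambda>z. \<integral>\<^sup>+ s. f z s \<partial>lborel) \<le> (\<integral>\<^sup>+ s. mixn p q (\<lambda>z. f z s) \<partial>lborel)"
proof -
  have "mixn p q (\<lambda>z. \<integral>\<^sup>+ s. f z s \<partial>lborel) \<le> Lp_norm p (\<lambda>x. \<integral>\<^sup>+ s. Lp_norm q (\<lambda>y. f (x, y) s) \<partial>lborel)"
    unfolding mixn_def
  proof (intro Lp_norm_mono p Lp_norm_Minkowski)
    fix x show "(\<lambda>z. f (x, fst z) (snd z)) \<in> borel_measurable borel"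
      using borel_compose[OF f, of "\<lambda>z. ((x, fst z), snd z)"] by (simp add: continuous_intros)
  qed
  also have "\<dots> \<le> (\<integral>\<^sup>+ s. Lp_norm p (\<lambda>x. Lp_norm q (\<lambda>y. f (x, y) s)) \<partial>lborel)"
  proof (intro p Lp_norm_Minkowski)
    have "(\<lambda>w. f (fst (fst w), snd w) (snd (fst w))) \<in> borel_measurable (borel :: (('a \<times> 'c) \<times> 'b) measure)"
      using borel_compose[OF f, of "\<lambda>w. ((fst (fst w), snd w), snd (fst w))"] by (simp add: continuous_intros)
    from Lp_norm_section_measurable[OF this, of q]
    show "(\<lambda>z. Lp_norm q (\<lambda>y. f (fst z, y) (snd z))) \<in> borel_measurable borel" by simp
  qed
  finally show ?thesis by (simp add: mixn_def)
qed

lemma mixn_Holder: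
  fixes f g :: "'a::euclidean_space \<times> 'b::euclidean_space \<Rightarrow> ennreal"
  assumes p: "1 \<le> p" "1 / p + 1 / p' = 1" and q: "1 \<le> q" "1 / q + 1 / q' = 1"
    and f: "f \<in> borel_measurable borel" and g: "g \<in> borel_measurable borel"
  shows "(\<integral>\<^sup>+ z. f z * g z \<partial>lborel) \<le> mixn p q f * mixn p' q' g"
proof -
  have "(\<integral>\<^sup>+ z. f z * g z \<partial>lborel) = (\<integral>\<^sup>+ x. \<integral>\<^sup>+ y. f (x, y) * g (x, y) \<partial>lborel \<partial>lborel)"
    by (rule lborel_nn_integral_fst[symmetric]) (use f g in measurable)
  also have "\<dots> \<le> (\<integral>\<^sup>+ x. Lp_norm q (\<lambda>y. f (x, y)) * Lp_norm q' (\<lambda>y. g (x, y)) \<partial>lborel)"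
    by (intro nn_integral_mono Lp_norm_Holder q section_measurable f g)
  also have "\<dots> \<le> mixn p q f * mixn p' q' g"
    unfolding mixn_def by (intro Lp_norm_Holder p Lp_norm_section_measurable f g)
  finally show ?thesis .
qed

text \<open>Dominated convergence for the \<open>r\<close>-th powers. It fails for the essential
  supremum, which is the reason why norm approximation is restricted to finite exponents.\<close>

lemma Lp_norm_tendsto_0:
  assumes p: "1 \<le> p" "p \<noteq> top" and [measurable]: "\<And>k. F k \<in> borel_measurable borel"
    and le: "\<And>k x. F k x \<le> G x" and [measurable]: "G \<in> borel_measurable borel" and G: "Lp_norm p G < top"
    and lim: "AE x in lborel. (\<lambda>k. F k x) \<longlonglongrightarrow> 0"
  shows "(\<lambda>k. Lp_norm p (F k)) \<longlonglongrightarrow> 0"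
  using p(1)
proof (cases rule: ennreal_exponent_cases)
  case (real r)
  have r: "r > 0" using real by simp
  have "(\<lambda>k. \<integral>\<^sup>+ x. enn_powr (F k x) r \<partial>lborel) \<longlonglongrightarrow> (\<integral>\<^sup>+ x. 0 \<partial>(lborel :: 'a measure))"
  proof (rule nn_integral_dominated_convergence[where w="\<lambda>x. enn_powr (G x) r"])
    show "(\<integral>\<^sup>+ x. enn_powr (G x) r \<partial>lborel) < \<infinity>"
      using G unfolding Lp_norm_finite_eq[OF real(3)] real(4) by (simp add: less_top[symmetric])
    show "AE x in lborel. enn_powr (F k x) r \<le> enn_powr (G x) r" for k
      by (intro AE_I2 enn_powr_mono le r)
    show "AE x in lborel. (\<lambda>k. enn_powr (F k x) r) \<longlonglongrightarrow> 0"
      using lim by eventually_elim (rule enn_powr_tendsto_0[OF _ r])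
  qed measurable
  then have "(\<lambda>k. \<integral>\<^sup>+ x. enn_powr (F k x) r \<partial>lborel) \<longlonglongrightarrow> 0" by simp
  then show ?thesis
    unfolding Lp_norm_finite_eq[OF real(3)] real(4) by (rule enn_powr_tendsto_0) (use r in simp)
qed (use p in simp)

lemma Lp_norm_AE_finite:
  assumes p: "1 \<le> p" "p \<noteq> top" and [measurable]: "G \<in> borel_measurable borel" and G: "Lp_norm p G < top"
  shows "AE x in lborel. G x < top"
  using p(1)
proof (cases rule: ennreal_exponent_cases)
  case (real r)
  have "(\<integral>\<^sup>+ x. enn_powr (G x) r \<partial>lborel) \<noteq> \<infinity>"
    using G unfolding Lp_norm_finite_eq[OF real(3)] real(4) by (simp add: less_top[symmetric])
  then have "AE x in lborel. enn_powr (G x) r \<noteq> \<infinity>"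
    by (intro nn_integral_PInf_AE) measurable
  then show ?thesis by (simp add: less_top)
qed (use p in simp)

text \<open>The inner norms converge at those outer points where the inner norm of \<open>G\<close>
  is finite, and finiteness of the mixed norm with \<open>p\<close> finite makes this almost every
  point.\<close>

lemma mixn_tendsto_0:
  fixes G :: "'a::euclidean_space \<times> 'b::euclidean_space \<Rightarrow> ennreal"
  assumes p: "1 \<le> p" "p \<noteq> top" and q: "1 \<le> q" "q \<noteq> top" and F: "\<And>k. F k \<in> borel_measurable borel"
    and le: "\<And>k x. F k x \<le> G x" and Gm: "G \<in> borel_measurable borel" and G: "mixn p q G < top"
    and lim: "\<And>x. (\<lambda>k. F k x) \<longlonglongrightarrow> 0"
  shows "(\<lambda>k. mixn p q (F k)) \<longlonglongrightarrow> 0"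
  unfolding mixn_def
proof (rule Lp_norm_tendsto_0[where G="\<lambda>x. Lp_norm q (\<lambda>y. G (x, y))"])
  show "AE x in lborel. (\<lambda>k. Lp_norm q (\<lambda>y. F k (x, y))) \<longlonglongrightarrow> 0"
    using Lp_norm_AE_finite[OF p Lp_norm_section_measurable[OF Gm] G[unfolded mixn_def]]
  proof eventually_elim
    case (elim x)
    show ?case
      by (rule Lp_norm_tendsto_0[where G="\<lambda>y. G (x, y)"]) (use q le lim F Gm elim in \<open>auto intro: section_measurable\<close>)
  qed
qed (use p q le F Gm G in \<open>auto intro: Lp_norm_section_measurable Lp_norm_mono simp: mixn_def\<close>)

lemma Lp_norm_exp_finite:
  assumes p: "1 \<le> p" and C: "C \<ge> 0" and r: "r > 0"
  shows "Lp_norm p (\<lambda>x::'a::euclidean_space. ennreal (C * exp (- r * norm x))) < top"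
  using p
proof (cases rule: ennreal_exponent_cases)
  case top
  have "Lp_norm top (\<lambda>x::'a. ennreal (C * exp (- r * norm x))) \<le> ennreal C"
    by (rule Lp_norm_top_le) (use C r in \<open>auto intro!: ennreal_leI mult_left_le\<close>)
  then show ?thesis unfolding top using ennreal_less_top le_less_trans by blast
next
  case (real s)
  have "(\<integral>\<^sup>+ x. enn_powr (ennreal (C * exp (- r * norm (x::'a)))) s \<partial>lborel) = (\<integral>\<^sup>+ x. ennreal (C powr s * exp (- (r * s) * norm (x::'a))) \<partial>lborel)"
    using C real by (intro nn_integral_cong) (simp add: enn_powr_ennreal powr_mult exp_powr_real mult_ac)
  also have "\<dots> < top"
  proof -
    have "integrable lborel (\<lambda>x::'a. C powr s * exp (- (r * s) * norm x))"
      by (rule integrable_mult_right, rule integrable_exp_neg_norm) (use r real in auto)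
    from nn_integral_eq_integral[OF this] show ?thesis by simp
  qed
  finally have "enn_powr (\<integral>\<^sup>+ x. enn_powr (ennreal (C * exp (- r * norm (x::'a)))) s \<partial>lborel) (1 / s) \<noteq> top"
    by (simp add: less_top[symmetric])
  then show ?thesis
    unfolding Lp_norm_finite_eq[OF real(3)] real(4) by (simp only: less_top[symmetric] not_False_eq_True)
qed

lemma exp_neg_norm_Pair_le:
  assumes "r \<ge> 0"
  shows "exp (- (2 * r) * norm (x, y)) \<le> exp (- r * norm x) * exp (- r * norm y)"
proof -
  have "r * norm x + r * norm y \<le> r * norm (x, y) + r * norm (x, y)"
    using assms norm_fst_le[of x y] norm_snd_le[of y x] by (intro add_mono mult_left_mono) auto
  then show ?thesis by (simp flip: exp_add)
qed

text \<open>At half the rate the exponential of the norm of a pair is bounded by a product, which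
  separates the two norms.\<close>

lemma mixn_exp_finite:
  fixes f :: "'a::euclidean_space \<times> 'b::euclidean_space \<Rightarrow> real"
  assumes p: "1 \<le> p" and q: "1 \<le> q" and C: "C \<ge> 0" and r: "r > 0" and f: "\<And>z. f z \<le> C * exp (- r * norm z)"
  shows "mixn p q (\<lambda>z. ennreal (f z)) < top"
proof -
  let ?Q = "Lp_norm q (\<lambda>y::'b. ennreal (1 * exp (- (r / 2) * norm y)))"
  have r2: "r / 2 > 0" using r by simp
  have "ennreal (f (x, y)) \<le> ennreal (C * exp (- (r / 2) * norm x)) * ennreal (1 * exp (- (r / 2) * norm y))" for x y
  proof -
    have "f (x, y) \<le> C * (exp (- (r / 2) * norm x) * exp (- (r / 2) * norm y))"
    proof -
      have "r / 2 \<ge> 0" using r by simp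
      from exp_neg_norm_Pair_le[OF this, of x y]
      have "exp (- r * norm (x, y)) \<le> exp (- (r / 2) * norm x) * exp (- (r / 2) * norm y)" by simp
      from order_trans[OF f mult_left_mono[OF this C]] show ?thesis .
    qed
    then show ?thesis using C by (simp add: ennreal_leI mult.assoc flip: ennreal_mult)
  qed
  note pt = this
  have "mixn p q (\<lambda>z. ennreal (f z)) \<le> Lp_norm p (\<lambda>x::'a. Lp_norm q (\<lambda>y::'b. ennreal (C * exp (- (r / 2) * norm x)) * ennreal (1 * exp (- (r / 2) * norm y))))"
    unfolding mixn_def by (intro Lp_norm_mono p q pt)
  also have "\<dots> \<le> Lp_norm p (\<lambda>x::'a. ?Q * ennreal (C * exp (- (r / 2) * norm x)))"
    by (intro Lp_norm_mono p) (subst mult.commute, rule Lp_norm_cmult_le[OF q], measurable)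
  also have "\<dots> \<le> ?Q * Lp_norm p (\<lambda>x::'a. ennreal (C * exp (- (r / 2) * norm x)))"
    by (rule Lp_norm_cmult_le[OF p]) measurable
  also have "\<dots> < top"
    using Lp_norm_exp_finite[OF q zero_le_one r2, where 'a='b] Lp_norm_exp_finite[OF p C r2, where 'a='a]
    by (simp add: ennreal_mult_less_top)
  finally show ?thesis .
qed

text \<open>Young's inequality with an integrable factor, from Minkowski, homogeneity and
  translation invariance alone. It is stated for an abstract \<open>N\<close> so that it serves the
  mixed norm in both orders of the variables.\<close>

lemma convolution_bound:
  fixes N :: "('e::euclidean_space \<Rightarrow> ennreal) \<Rightarrow> ennreal"
  assumes mink: "\<And>F. (\<lambda>w. F (fst w) (snd w)) \<in> borel_measurable (borel :: ('e \<times> 'e) measure) \<Longrightarrow> N (\<lambda>z. \<integral>\<^sup>+ s. F z s \<partial>lborel) \<le> (\<integral>\<^sup>+ s. N (\<lambda>z. F z s) \<partial>lborel)"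
    and cm: "\<And>c F. F \<in> borel_measurable borel \<Longrightarrow> N (\<lambda>z. c * F z) \<le> c * N F"
    and tr: "\<And>t F. F \<in> borel_measurable borel \<Longrightarrow> N (\<lambda>z. F (t + z)) = N F"
    and f: "f \<in> borel_measurable borel"
  shows "N (\<lambda>z. \<integral>\<^sup>+ p. f p * ennreal (exp (- r * norm (z - p))) \<partial>lborel) \<le> (\<integral>\<^sup>+ s. ennreal (exp (- r * norm (s :: 'e))) \<partial>lborel) * N f"
proof -
  have "(\<integral>\<^sup>+ p. f p * ennreal (exp (- r * norm (z - p))) \<partial>lborel) = (\<integral>\<^sup>+ s. ennreal (exp (- r * norm s)) * f (s + z) \<partial>lborel)" for z
    using f lborel_nn_integral_affine[of "\<lambda>p. f p * ennreal (exp (- r * norm (z - p)))" 1 z]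
    by (simp add: mult.commute add.commute)
  then have "N (\<lambda>z. \<integral>\<^sup>+ p. f p * ennreal (exp (- r * norm (z - p))) \<partial>lborel) = N (\<lambda>z. \<integral>\<^sup>+ s. ennreal (exp (- r * norm s)) * f (s + z) \<partial>lborel)"
    by simp
  also have "\<dots> \<le> (\<integral>\<^sup>+ s. N (\<lambda>z. ennreal (exp (- r * norm s)) * f (s + z)) \<partial>lborel)"
  proof (rule mink)
    have "(\<lambda>w::'e \<times> 'e. f (snd w + fst w)) \<in> borel_measurable borel"
      by (rule borel_compose[OF f]) (intro continuous_intros)
    moreover have "(\<lambda>w::'e \<times> 'e. ennreal (exp (- r * norm (snd w)))) \<in> borel_measurable borel"
      by (rule borel_compose[of "\<lambda>s. ennreal (exp (- r * norm s))"]) (measurable, intro continuous_intros)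
    ultimately show "(\<lambda>w::'e \<times> 'e. ennreal (exp (- r * norm (snd w))) * f (snd w + fst w)) \<in> borel_measurable borel"
      by (rule borel_measurable_times_ennreal[rotated])
  qed
  also have "\<dots> \<le> (\<integral>\<^sup>+ s. ennreal (exp (- r * norm s)) * N f \<partial>(lborel :: 'e measure))"
  proof (rule nn_integral_mono)
    fix s :: 'e
    have "N (\<lambda>z. ennreal (exp (- r * norm s)) * f (s + z)) \<le> ennreal (exp (- r * norm s)) * N (\<lambda>z. f (s + z))"
      by (rule cm) (rule borel_compose[OF f], intro continuous_intros)
    then show "N (\<lambda>z. ennreal (exp (- r * norm s)) * f (s + z)) \<le> ennreal (exp (- r * norm s)) * N f"
      unfolding tr[OF f] .
  qed
  also have "\<dots> = (\<integral>\<^sup>+ s. ennreal (exp (- r * norm (s :: 'e))) \<partial>lborel) * N f"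
    by (rule nn_integral_multc) measurable
  finally show ?thesis .
qed

lemma mixn_convolution:
  fixes f :: "'a::euclidean_space \<times> 'b::euclidean_space \<Rightarrow> ennreal"
  assumes p: "1 \<le> p" "1 \<le> q" and f: "f \<in> borel_measurable borel"
  shows "mixn p q (\<lambda>z. \<integral>\<^sup>+ w. f w * ennreal (exp (- r * norm (z - w))) \<partial>lborel) \<le>
    (\<integral>\<^sup>+ s. ennreal (exp (- r * norm (s :: 'a \<times> 'b))) \<partial>lborel) * mixn p q f"
  by (rule convolution_bound) (intro mixn_Minkowski mixn_cmult_le mixn_translate p f; assumption)+

lemma continuous_swap [continuous_intros]:
  "continuous_on S f \<Longrightarrow> continuous_on S (\<lambda>x. prod.swap (f x))"
  unfolding prod.swap_def by (intro continuous_intros)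

lemma mixn_swap_convolution:
  fixes f :: "'a::euclidean_space \<times> 'b::euclidean_space \<Rightarrow> ennreal"
  assumes p: "1 \<le> p" "1 \<le> q" and f: "f \<in> borel_measurable borel"
  shows "mixn p q (\<lambda>z. \<integral>\<^sup>+ w. f w * ennreal (exp (- r * norm (prod.swap z - w))) \<partial>lborel) \<le>
    (\<integral>\<^sup>+ s. ennreal (exp (- r * norm (s :: 'a \<times> 'b))) \<partial>lborel) * mixn p q (\<lambda>z. f (prod.swap z))"
proof (rule convolution_bound[where N="\<lambda>F. mixn p q (\<lambda>z. F (prod.swap z))"])
  fix F :: "'a \<times> 'b \<Rightarrow> 'a \<times> 'b \<Rightarrow> ennreal" assume F: "(\<lambda>w. F (fst w) (snd w)) \<in> borel_measurable borel"
  show "mixn p q (\<lambda>z. \<integral>\<^sup>+ s. F (prod.swap z) s \<partial>lborel) \<le> (\<integral>\<^sup>+ s. mixn p q (\<lambda>z. F (prod.swap z) s) \<partial>lborel)"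
    using borel_compose[OF F, of "\<lambda>w. (prod.swap (fst w), snd w)"]
    by (intro mixn_Minkowski p) (simp add: continuous_intros)
next
  fix c and F :: "'a \<times> 'b \<Rightarrow> ennreal" assume F: "F \<in> borel_measurable borel"
  show "mixn p q (\<lambda>z. c * F (prod.swap z)) \<le> c * mixn p q (\<lambda>z. F (prod.swap z))"
    by (intro mixn_cmult_le p borel_compose[OF F] continuous_intros)
next
  fix t and F :: "'a \<times> 'b \<Rightarrow> ennreal" assume F: "F \<in> borel_measurable borel"
  have "F (t + prod.swap z) = F (prod.swap (prod.swap t + z))" for z
    by (cases t; cases z) simp
  then show "mixn p q (\<lambda>z. F (t + prod.swap z)) = mixn p q (\<lambda>z. F (prod.swap z))"
    using mixn_translate[OF borel_compose[OF F, of prod.swap], of p q "prod.swap t"] by (simp add: continuous_intros)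
qed (rule f)

section \<open>Boundedness of the kernel operators\<close>

context
  fixes p q p' q' :: ennreal and A :: "('a::euclidean_space \<times> 'a) \<times> ('a \<times> 'a) \<Rightarrow> ennreal"
  assumes p: "1 \<le> p" "1 / p + 1 / p' = 1" and q: "1 \<le> q" "1 / q + 1 / q' = 1"
    and A: "A \<in> borel_measurable borel"
begin

text \<open>The symbol variables follow from the two phase space points: position from z, symbol
  frequency from w, and the two differences as dual variables.\<close>

definition kern :: "'a \<times> 'a \<Rightarrow> 'a \<times> 'a \<Rightarrow> ennreal" where
  "kern z w = A ((fst z, snd w), (snd z - snd w, fst w - fst z))"

text \<open>Norm of \<open>A\<close> in the last variable only, which is what remains after Hoelder
  in the position of w.\<close>

private definition a1 :: "'a \<Rightarrow> 'a \<Rightarrow> 'a \<Rightarrow> ennreal" where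
  "a1 x \<eta> \<zeta> = Lp_norm q (\<lambda>y. A ((x, \<eta>), (\<zeta>, y)))"

text \<open>Norm of \<open>A\<close> in both dual variables jointly, that is, the inner norm of the
  W norm of the symbol.\<close>

private definition a2 :: "'a \<Rightarrow> 'a \<Rightarrow> ennreal" where
  "a2 x \<eta> = Lp_norm q (\<lambda>\<Xi>. A ((x, \<eta>), \<Xi>))"

lemma kern_measurable: "continuous_on UNIV f \<Longrightarrow> continuous_on UNIV g \<Longrightarrow> (\<lambda>x. kern (f x) (g x)) \<in> borel_measurable borel"
  unfolding kern_def by (rule borel_compose[OF A]) (intro continuous_intros)

private lemma a1_measurable: "continuous_on UNIV f \<Longrightarrow> continuous_on UNIV g \<Longrightarrow> continuous_on UNIV h \<Longrightarrow>
  (\<lambda>x::'x::euclidean_space. a1 (f x) (g x) (h x)) \<in> borel_measurable borel"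
  unfolding a1_def
  using Lp_norm_section_measurable[OF borel_compose[OF A, of "\<lambda>w::'x \<times> 'a. ((f (fst w), g (fst w)), (h (fst w), snd w))"], of q]
  by (simp add: continuous_intros continuous_on_compose2[of UNIV f UNIV fst] continuous_on_compose2[of UNIV g UNIV fst] continuous_on_compose2[of UNIV h UNIV fst])

private lemma a2_measurable: "(\<lambda>z. a2 (fst z) (snd z)) \<in> borel_measurable borel"
  unfolding a2_def using Lp_norm_section_measurable[OF A, of q] by simp

text \<open>For fixed x the position of w enters the kernel only through a translate.\<close>

private lemma Lp_kern: "Lp_norm q (\<lambda>y. kern (x, \<xi>) (y, \<eta>)) = a1 x \<eta> (\<xi> - \<eta>)"
proof -
  have m: "(\<lambda>y. A ((x, \<eta>), (\<xi> - \<eta>, y))) \<in> borel_measurable borel"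
    by (rule borel_compose[OF A]) (intro continuous_intros)
  show ?thesis
    using Lp_norm_translate[OF m, of q "- x"] by (simp add: kern_def a1_def)
qed

private lemma Lp_a1: "Lp_norm q (\<lambda>\<xi>. a1 x \<eta> (\<xi> - \<eta>)) \<le> a2 x \<eta>"
proof -
  have m: "(\<lambda>\<zeta>. a1 x \<eta> \<zeta>) \<in> borel_measurable borel"
    by (rule a1_measurable) (intro continuous_intros)+
  have "Lp_norm q (\<lambda>\<xi>. a1 x \<eta> (\<xi> - \<eta>)) = Lp_norm q (a1 x \<eta>)"
    using Lp_norm_translate[OF m, of q "- \<eta>"] by simp
  also have "\<dots> \<le> a2 x \<eta>"
    unfolding a1_def a2_def by (rule Lp_norm_iterated_le[OF q(1)]) (rule section_measurable[OF A])
  finally show ?thesis .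
qed

private lemma Lp_a2: "Lp_norm p (\<lambda>x. Lp_norm p (\<lambda>\<eta>. a2 x \<eta>)) \<le> mixn p q A"
  using Lp_norm_iterated_le[OF p(1) a2_measurable] by (simp add: mixn_def a2_def)

text \<open>Hoelder with q, q' in the position y of w, Minkowski in its frequency \<eta> to take the
  L^q norm in \<xi>, Hoelder with p, p' in \<eta>, and last the L^p norm in x. The dual variables of
  the symbol share the exponent q and its base variables share p, so the iterated norms reassemble
  to the joint ones.\<close>

lemma kern_bound:
  assumes F: "F \<in> borel_measurable borel"
  shows "mixn p q (\<lambda>z. \<integral>\<^sup>+ w. kern z w * F w \<partial>lborel) \<le> mixn p q A * mixn p' q' (\<lambda>w. F (prod.swap w))"
proof -
  define \<phi> where "\<phi> \<eta> = Lp_norm q' (\<lambda>y. F (y, \<eta>))" for \<eta>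
  have Fs: "(\<lambda>w. F (prod.swap w)) \<in> borel_measurable borel"
    by (rule borel_compose[OF F]) (intro continuous_intros)
  have \<phi>[measurable]: "\<phi> \<in> borel_measurable borel"
    using Lp_norm_section_measurable[OF Fs, of q'] by (simp add: \<phi>_def[abs_def])
  have 1: "(\<integral>\<^sup>+ w. kern (x, \<xi>) w * F w \<partial>lborel) \<le> (\<integral>\<^sup>+ \<eta>. a1 x \<eta> (\<xi> - \<eta>) * \<phi> \<eta> \<partial>lborel)" for x \<xi>
  proof -
    have "(\<integral>\<^sup>+ w. kern (x, \<xi>) w * F w \<partial>lborel) = (\<integral>\<^sup>+ \<eta>. \<integral>\<^sup>+ y. kern (x, \<xi>) (y, \<eta>) * F (y, \<eta>) \<partial>lborel \<partial>lborel)"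
      by (rule lborel_nn_integral_snd[symmetric]) (intro borel_measurable_times_ennreal F kern_measurable continuous_intros)
    also have "\<dots> \<le> (\<integral>\<^sup>+ \<eta>. Lp_norm q (\<lambda>y. kern (x, \<xi>) (y, \<eta>)) * \<phi> \<eta> \<partial>lborel)"
      unfolding \<phi>_def
      by (intro nn_integral_mono Lp_norm_Holder q kern_measurable borel_compose[OF F] continuous_intros)
    finally show ?thesis unfolding Lp_kern .
  qed
  have 2: "Lp_norm q (\<lambda>\<xi>. \<integral>\<^sup>+ w. kern (x, \<xi>) w * F w \<partial>lborel) \<le> Lp_norm p' \<phi> * Lp_norm p (\<lambda>\<eta>. a2 x \<eta>)" for x
  proof -
    have a2x: "(\<lambda>\<eta>. a2 x \<eta>) \<in> borel_measurable borel"
      using section_measurable[OF a2_measurable, of x] by simp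
    have "Lp_norm q (\<lambda>\<xi>. \<integral>\<^sup>+ w. kern (x, \<xi>) w * F w \<partial>lborel) \<le> Lp_norm q (\<lambda>\<xi>. \<integral>\<^sup>+ \<eta>. a1 x \<eta> (\<xi> - \<eta>) * \<phi> \<eta> \<partial>lborel)"
      by (intro Lp_norm_mono q 1)
    also have "\<dots> \<le> (\<integral>\<^sup>+ \<eta>. Lp_norm q (\<lambda>\<xi>. a1 x \<eta> (\<xi> - \<eta>) * \<phi> \<eta>) \<partial>lborel)"
      by (intro Lp_norm_Minkowski q borel_measurable_times_ennreal a1_measurable borel_compose[OF \<phi>] continuous_intros)
    also have "\<dots> \<le> (\<integral>\<^sup>+ \<eta>. a2 x \<eta> * \<phi> \<eta> \<partial>lborel)"
    proof (rule nn_integral_mono)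
      fix \<eta>
      have "Lp_norm q (\<lambda>\<xi>. \<phi> \<eta> * a1 x \<eta> (\<xi> - \<eta>)) \<le> \<phi> \<eta> * Lp_norm q (\<lambda>\<xi>. a1 x \<eta> (\<xi> - \<eta>))"
        by (intro Lp_norm_cmult_le q a1_measurable continuous_intros)
      also have "\<dots> \<le> \<phi> \<eta> * a2 x \<eta>" by (intro mult_left_mono Lp_a1) simp
      finally show "Lp_norm q (\<lambda>\<xi>. a1 x \<eta> (\<xi> - \<eta>) * \<phi> \<eta>) \<le> a2 x \<eta> * \<phi> \<eta>" by (simp add: mult.commute)
    qed
    also have "\<dots> \<le> Lp_norm p (\<lambda>\<eta>. a2 x \<eta>) * Lp_norm p' \<phi>"
      by (intro Lp_norm_Holder p a2x \<phi>)
    finally show ?thesis by (simp add: mult.commute)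
  qed
  have "mixn p q (\<lambda>z. \<integral>\<^sup>+ w. kern z w * F w \<partial>lborel) \<le> Lp_norm p (\<lambda>x. Lp_norm p' \<phi> * Lp_norm p (\<lambda>\<eta>. a2 x \<eta>))"
    unfolding mixn_def by (intro Lp_norm_mono p 2)
  also have "\<dots> \<le> Lp_norm p' \<phi> * Lp_norm p (\<lambda>x. Lp_norm p (\<lambda>\<eta>. a2 x \<eta>))"
    using Lp_norm_section_measurable[OF a2_measurable, of p] by (intro Lp_norm_cmult_le p) simp
  also have "\<dots> \<le> Lp_norm p' \<phi> * mixn p q A"
    by (intro mult_left_mono Lp_a2) simp
  also have "Lp_norm p' \<phi> = mixn p' q' (\<lambda>w. F (prod.swap w))"
    by (simp add: mixn_def \<phi>_def[abs_def])
  finally show ?thesis by (simp add: mult.commute)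
qed

text \<open>The transposed kernel: now z is integrated out and w carries the mixed norm. Hoelder is
  used in \<xi> and then in x, and Minkowski in z and then in x; the same iterated norm of
  \<open>A\<close> appears at the end.\<close>

lemma kern_dual_bound:
  assumes G: "G \<in> borel_measurable borel"
  shows "mixn p q (\<lambda>w. \<integral>\<^sup>+ z. kern z (prod.swap w) * G z \<partial>lborel) \<le> mixn p q A * mixn p' q' G"
proof -
  define \<gamma> where "\<gamma> x = Lp_norm q' (\<lambda>\<xi>. G (x, \<xi>))" for x
  have \<gamma>: "\<gamma> \<in> borel_measurable borel"
    using Lp_norm_section_measurable[OF G, of q'] by (simp add: \<gamma>_def[abs_def])
  have 1: "Lp_norm q (\<lambda>y. \<integral>\<^sup>+ z. kern z (prod.swap (\<eta>, y)) * G z \<partial>lborel) \<le> (\<integral>\<^sup>+ x. \<gamma> x * a2 x \<eta> \<partial>lborel)" for \<eta>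
  proof -
    have "Lp_norm q (\<lambda>y. \<integral>\<^sup>+ z. kern z (prod.swap (\<eta>, y)) * G z \<partial>lborel) \<le> (\<integral>\<^sup>+ z. Lp_norm q (\<lambda>y. kern z (y, \<eta>) * G z) \<partial>lborel)"
      unfolding swap_simp
      by (intro Lp_norm_Minkowski q borel_measurable_times_ennreal kern_measurable borel_compose[OF G] continuous_intros)
    also have "\<dots> \<le> (\<integral>\<^sup>+ z. a1 (fst z) \<eta> (snd z - \<eta>) * G z \<partial>lborel)"
    proof (rule nn_integral_mono)
      fix z
      have "Lp_norm q (\<lambda>y. G z * kern z (y, \<eta>)) \<le> G z * Lp_norm q (\<lambda>y. kern z (y, \<eta>))"
        by (intro Lp_norm_cmult_le q kern_measurable continuous_intros)
      then show "Lp_norm q (\<lambda>y. kern z (y, \<eta>) * G z) \<le> a1 (fst z) \<eta> (snd z - \<eta>) * G z"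
        using Lp_kern[of "fst z" "snd z" \<eta>] by (simp add: mult.commute)
    qed
    also have "\<dots> = (\<integral>\<^sup>+ x. \<integral>\<^sup>+ \<xi>. a1 x \<eta> (\<xi> - \<eta>) * G (x, \<xi>) \<partial>lborel \<partial>lborel)"
      using lborel_nn_integral_fst[of "\<lambda>z. a1 (fst z) \<eta> (snd z - \<eta>) * G z"]
      by (simp add: borel_measurable_times_ennreal G a1_measurable continuous_intros)
    also have "\<dots> \<le> (\<integral>\<^sup>+ x. \<gamma> x * a2 x \<eta> \<partial>lborel)"
    proof (rule nn_integral_mono)
      fix x
      have "(\<integral>\<^sup>+ \<xi>. a1 x \<eta> (\<xi> - \<eta>) * G (x, \<xi>) \<partial>lborel) \<le> Lp_norm q (\<lambda>\<xi>. a1 x \<eta> (\<xi> - \<eta>)) * \<gamma> x"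
        unfolding \<gamma>_def by (intro Lp_norm_Holder q a1_measurable section_measurable[OF G] continuous_intros)
      also have "\<dots> \<le> a2 x \<eta> * \<gamma> x" by (intro mult_right_mono Lp_a1) simp
      finally show "(\<integral>\<^sup>+ \<xi>. a1 x \<eta> (\<xi> - \<eta>) * G (x, \<xi>) \<partial>lborel) \<le> \<gamma> x * a2 x \<eta>" by (simp add: mult.commute)
    qed
    finally show ?thesis .
  qed
  have a2y: "(\<lambda>\<eta>. a2 x \<eta>) \<in> borel_measurable borel" for x
    using section_measurable[OF a2_measurable, of x] by simp
  have "mixn p q (\<lambda>w. \<integral>\<^sup>+ z. kern z (prod.swap w) * G z \<partial>lborel) \<le> Lp_norm p (\<lambda>\<eta>. \<integral>\<^sup>+ x. \<gamma> x * a2 x \<eta> \<partial>lborel)"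
    unfolding mixn_def by (intro Lp_norm_mono p 1)
  also have "\<dots> \<le> (\<integral>\<^sup>+ x. Lp_norm p (\<lambda>\<eta>. \<gamma> x * a2 x \<eta>) \<partial>lborel)"
  proof (intro Lp_norm_Minkowski p borel_measurable_times_ennreal borel_compose[OF \<gamma>] continuous_intros)
    show "(\<lambda>z. a2 (snd z) (fst z)) \<in> borel_measurable borel"
      using borel_compose[OF a2_measurable, of prod.swap] by (simp add: continuous_intros)
  qed
  also have "\<dots> \<le> (\<integral>\<^sup>+ x. Lp_norm p (\<lambda>\<eta>. a2 x \<eta>) * \<gamma> x \<partial>lborel)"
    by (intro nn_integral_mono) (subst mult.commute, intro Lp_norm_cmult_le p a2y)
  also have "\<dots> \<le> Lp_norm p (\<lambda>x. Lp_norm p (\<lambda>\<eta>. a2 x \<eta>)) * Lp_norm p' \<gamma>"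
    using Lp_norm_section_measurable[OF a2_measurable, of p] by (intro Lp_norm_Holder p \<gamma>) simp
  also have "\<dots> \<le> mixn p q A * mixn p' q' G"
    unfolding \<gamma>_def[abs_def] mixn_def[of p' q'] by (intro mult_right_mono Lp_a2) simp
  finally show ?thesis .
qed

end

section \<open>Moderate weights\<close>

text \<open>
  Every moderate weight is equivalent to a tame one.  This removes all measurability questions:
  tame weights are continuous, whereas moderate weights are only Lebesgue measurable.
\<close>

definition tame_weight :: "real \<Rightarrow> ('a::euclidean_space \<Rightarrow> real) \<Rightarrow> bool" where
  "tame_weight r \<omega> \<longleftrightarrow> r \<ge> 0 \<and> continuous_on UNIV \<omega> \<and> (\<forall>x. 0 < \<omega> x) \<and> (\<forall>x y. \<omega> (x + y) \<le> exp (r * norm y) * \<omega> x)"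

text \<open>Local boundedness of \<open>v\<close> on the unit ball gives a bound D for steps of
  length at most 1. A vector y is divided into floor(|y|) + 1 such steps, and D^k <= D exp (ln D
  |y|).\<close>

lemma moderate_weight_exp:
  fixes \<omega> :: "'a::euclidean_space \<Rightarrow> real"
  assumes "moderate_weight \<omega>"
  obtains D r where "D \<ge> 1" "r \<ge> 0" "\<And>x y. \<omega> (x + y) \<le> D * exp (r * norm y) * \<omega> x"
proof -
  obtain v C where v: "\<And>x. 0 < v x" "\<And>K. compact K \<Longrightarrow> bounded (v ` K)" and C: "1 \<le> C"
    and m: "\<And>x y. \<omega> (x + y) \<le> C * \<omega> x * v y" and pos: "\<And>x. 0 < \<omega> x"
    using assms unfolding moderate_weight_def weight_def by metis
  obtain B where B: "\<And>y. norm y \<le> 1 \<Longrightarrow> norm (v y) \<le> B"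
  proof -
    obtain B where B: "\<forall>t\<in>v ` cball 0 1. norm t \<le> B"
      using v(2)[OF compact_cball[of 0 1]] unfolding bounded_iff by blast
    show thesis by (rule that[of B]) (use B in \<open>auto simp: dist_norm\<close>)
  qed
  define D where "D = C * max 1 B"
  have D: "D \<ge> 1" using C mult_mono[of 1 C 1 "max 1 B"] by (simp add: D_def)
  have step: "\<omega> (x + y) \<le> D * \<omega> x" if "norm y \<le> 1" for x y
  proof -
    have "C * \<omega> x * v y \<le> C * \<omega> x * max 1 B"
      using B[OF that] v(1)[of y] C pos[of x] by (intro mult_left_mono) auto
    then show ?thesis using m[of x y] by (simp add: D_def mult_ac)
  qed
  have iter: "\<omega> (x + real k *\<^sub>R y) \<le> D ^ k * \<omega> x" if "norm y \<le> 1" for x y k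
  proof (induction k)
    case (Suc k)
    have "\<omega> (x + real (Suc k) *\<^sub>R y) = \<omega> ((x + real k *\<^sub>R y) + y)" by (simp add: algebra_simps)
    also have "\<dots> \<le> D * \<omega> (x + real k *\<^sub>R y)" by (rule step[OF that])
    also have "\<dots> \<le> D * (D ^ k * \<omega> x)" using D Suc by (intro mult_left_mono) auto
    finally show ?case by (simp add: mult.assoc)
  qed simp
  show thesis
  proof (rule that[of D "ln D"])
    fix x y :: 'a
    define k where "k = Suc (nat \<lfloor>norm y\<rfloor>)"
    have k: "real k > 0" "norm y \<le> real k" "real k \<le> norm y + 1"
    proof -
      have "real k = 1 + of_int \<lfloor>norm y\<rfloor>" by (simp add: k_def)
      then show "norm y \<le> real k" "real k \<le> norm y + 1" by linarith+
    qed (simp only: k_def of_nat_0_less_iff zero_less_Suc)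
    have "\<omega> (x + y) = \<omega> (x + real k *\<^sub>R ((1 / real k) *\<^sub>R y))" using k by simp
    also have "\<dots> \<le> D ^ k * \<omega> x" using k by (intro iter) (simp add: divide_le_eq)
    also have "D ^ k = exp (ln D * real k)" using D by (simp add: exp_of_nat2_mult)
    also have "\<dots> \<le> exp (ln D * (norm y + 1))" using D k by (intro iffD2[OF exp_le_cancel_iff] mult_left_mono) auto
    also have "\<dots> = D * exp (ln D * norm y)" using D by (simp add: distrib_left exp_add)
    finally show "\<omega> (x + y) \<le> D * exp (ln D * norm y) * \<omega> x" using pos[of x] by (simp add: mult_right_mono)
  qed (use D in auto)
qed

text \<open>Infimal convolution with an exponential. The choice y = x gives the upper bound, the
  exponential moderateness the lower one, and the triangle inequality gives moderateness with
  constant exactly 1. That constant is what forces continuity.\<close>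

lemma moderate_weight_tame:
  fixes \<omega> :: "'a::euclidean_space \<Rightarrow> real"
  assumes \<omega>: "moderate_weight \<omega>"
  obtains D r \<omega>' where "D \<ge> 1" "tame_weight r \<omega>'" "\<And>x. \<omega>' x \<le> \<omega> x" "\<And>x. \<omega> x \<le> D * \<omega>' x"
proof -
  have pos: "0 < \<omega> x" for x using \<omega> by (auto simp: moderate_weight_def weight_def)
  obtain D r where D: "D \<ge> 1" and r: "r \<ge> 0" and m: "\<And>x y. \<omega> (x + y) \<le> D * exp (r * norm y) * \<omega> x"
    using moderate_weight_exp[OF \<omega>] by metis
  define \<omega>' where "\<omega>' x = (INF y. \<omega> y * exp (r * norm (x - y)))" for x
  have bdd: "bdd_below (range (\<lambda>y. \<omega> y * exp (r * norm (x - y))))" for x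
    using pos by (intro bdd_belowI2[of _ 0]) (simp add: less_imp_le)
  have le: "\<omega>' x \<le> \<omega> y * exp (r * norm (x - y))" for x y
    unfolding \<omega>'_def by (rule cINF_lower[OF bdd]) simp
  have ge: "\<omega> x / D \<le> \<omega>' x" for x
    unfolding \<omega>'_def
  proof (rule cINF_greatest)
    fix y show "\<omega> x / D \<le> \<omega> y * exp (r * norm (x - y))"
      using m[of y "x - y"] D by (simp add: pos_divide_le_eq mult_ac)
  qed simp
  have pos': "0 < \<omega>' x" for x
    using ge[of x] pos[of x] D by (auto intro: less_le_trans[of _ "\<omega> x / D"])
  have mod: "\<omega>' (x + h) \<le> exp (r * norm h) * \<omega>' x" for x h
  proof -
    have "\<omega>' (x + h) / exp (r * norm h) \<le> \<omega>' x"
      unfolding \<omega>'_def[of x]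
    proof (rule cINF_greatest)
      fix y
      have "r * norm (x + h - y) \<le> r * norm (x - y) + r * norm h"
        using mult_left_mono[OF norm_triangle_ineq[of "x - y" h] r] by (simp add: algebra_simps)
      then have "exp (r * norm (x + h - y)) \<le> exp (r * norm (x - y)) * exp (r * norm h)"
        by (simp flip: exp_add)
      then have "\<omega>' (x + h) \<le> \<omega> y * (exp (r * norm (x - y)) * exp (r * norm h))"
        using le[of "x + h" y] pos[of y] by (meson mult_left_mono less_imp_le order_trans)
      then show "\<omega>' (x + h) / exp (r * norm h) \<le> \<omega> y * exp (r * norm (x - y))"
        by (simp add: pos_divide_le_eq mult.assoc)
    qed simp
    then show ?thesis by (simp add: pos_divide_le_eq mult.commute)
  qed
  \<comment> \<open>With constant 1 both moderateness bounds converge to the value at x as y tends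
    to x.\<close>
  have "isCont \<omega>' x" for x
    unfolding isCont_def
  proof (rule tendsto_sandwich)
    show "\<forall>\<^sub>F y in at x. exp (- (r * norm (y - x))) * \<omega>' x \<le> \<omega>' y"
    proof (rule always_eventually, rule allI)
      fix y
      have "\<omega>' x \<le> exp (r * norm (y - x)) * \<omega>' y" using mod[of y "x - y"] by (simp add: norm_minus_commute)
      then have "exp (- (r * norm (y - x))) * \<omega>' x \<le> exp (- (r * norm (y - x))) * (exp (r * norm (y - x)) * \<omega>' y)"
        by (intro mult_left_mono) auto
      then show "exp (- (r * norm (y - x))) * \<omega>' x \<le> \<omega>' y" by (simp add: mult.assoc[symmetric] flip: exp_add)
    qed
    show "\<forall>\<^sub>F y in at x. \<omega>' y \<le> exp (r * norm (y - x)) * \<omega>' x"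
      using mod[of x] by (intro always_eventually allI) (metis add.commute diff_add_cancel)
    have "((\<lambda>y. exp (- (r * norm (y - x))) * \<omega>' x) \<longlongrightarrow> exp (- (r * norm (x - x))) * \<omega>' x) (at x)"
      by (intro tendsto_intros)
    then show "((\<lambda>y. exp (- (r * norm (y - x))) * \<omega>' x) \<longlongrightarrow> \<omega>' x) (at x)" by simp
    have "((\<lambda>y. exp (r * norm (y - x)) * \<omega>' x) \<longlongrightarrow> exp (r * norm (x - x)) * \<omega>' x) (at x)"
      by (intro tendsto_intros)
    then show "((\<lambda>y. exp (r * norm (y - x)) * \<omega>' x) \<longlongrightarrow> \<omega>' x) (at x)" by simp
  qed
  then have "tame_weight r \<omega>'"
    unfolding tame_weight_def using r pos' mod by (auto intro: continuous_at_imp_continuous_on)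
  moreover have "\<omega>' x \<le> \<omega> x" for x using le[of x x] by simp
  moreover have "\<omega> x \<le> D * \<omega>' x" for x using ge[of x] D by (simp add: pos_divide_le_eq mult.commute)
  ultimately show thesis using D that by blast
qed

section \<open>The operator with a given symbol on test functions\<close>

lemma Sigma1'I:
  fixes u :: "'a::euclidean_space dual"
  assumes lin: "\<And>f g a b. f \<in> Sigma1 \<Longrightarrow> g \<in> Sigma1 \<Longrightarrow> u (\<lambda>x. a * f x + b * g x) = a * u f + b * u g"
    and h: "h > 0" and bd: "\<And>f. f \<in> Sigma1 \<Longrightarrow> cmod (u f) \<le> C * gs_val h f"
    and z: "\<And>f. f \<notin> Sigma1 \<Longrightarrow> u f = 0"
  shows "u \<in> Sigma1'"
  unfolding Sigma1'_def
proof (intro CollectI conjI ballI allI impI)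
  show "u (\<lambda>x. f x + g x) = u f + u g" if "f \<in> Sigma1" "g \<in> Sigma1" for f g
    using lin[OF that, of 1 1] by simp
  show "u (\<lambda>x. c * f x) = c * u f" if "f \<in> Sigma1" for c f
    using lin[OF that that, of c 0] by simp
  have "ennreal (cmod (u f)) \<le> ennreal (max 0 C) * gs_norm h f" if f: "f \<in> Sigma1" for f
  proof -
    have "cmod (u f) \<le> max 0 C * gs_val h f"
      using bd[OF f] by (rule order_trans) (intro mult_right_mono, auto)
    then have "ennreal (cmod (u f)) \<le> ennreal (max 0 C * gs_val h f)" by (rule ennreal_leI)
    also have "\<dots> = ennreal (max 0 C) * ennreal (gs_val h f)" by (intro ennreal_mult) auto
    also have "ennreal (gs_val h f) = gs_norm h f" using Sigma1_gs_norm[OF f h] by (rule sym)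
    finally show ?thesis .
  qed
  then show "\<exists>h>0. \<exists>C. \<forall>f\<in>Sigma1. ennreal (cmod (u f)) \<le> ennreal C * gs_norm h f"
    using h by blast
qed (rule z)

section \<open>Fourier transforms of test functions on product spaces\<close>

lemma ft_linear_combination:
  fixes f g :: "'a::euclidean_space \<Rightarrow> complex"
  assumes f: "f \<in> Sigma1" and g: "g \<in> Sigma1"
  shows "ft (\<lambda>x. a * f x + b * g x) \<xi> = a * ft f \<xi> + b * ft g \<xi>"
proof -
  have i: "integrable lborel (\<lambda>x. f x * cis (- (x \<bullet> \<xi>)))" "integrable lborel (\<lambda>x. g x * cis (- (x \<bullet> \<xi>)))"
    by (intro integrable_mult_cis Sigma1_integrable f g; measurable)+
  have eq: "(\<lambda>x. (a * f x + b * g x) * cis (- (x \<bullet> \<xi>))) =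
      (\<lambda>x. a * (f x * cis (- (x \<bullet> \<xi>))) + b * (g x * cis (- (x \<bullet> \<xi>))))"
    by (rule ext) (simp only: distrib_right mult.assoc)
  show ?thesis
    unfolding ft_def eq Bochner_Integration.integral_add[OF integrable_mult_right[OF i(1)] integrable_mult_right[OF i(2)]]
        integral_mult_right_zero
    by (simp only: distrib_left mult.left_commute)
qed

lemma continuous_ft:
  fixes f :: "'a::euclidean_space \<Rightarrow> complex"
  assumes f: "integrable lborel f"
  shows "continuous_on UNIV (ft f)"
  unfolding continuous_on_sequentially
proof (intro allI ballI impI, elim conjE)
  fix x :: "nat \<Rightarrow> 'a" and a assume lim: "x \<longlonglongrightarrow> a"
  have [measurable]: "f \<in> borel_measurable borel" using f by (auto dest: borel_measurable_integrable)
  have "(\<lambda>n. LINT y|lborel. f y * cis (- (y \<bullet> x n))) \<longlonglongrightarrow> (LINT y|lborel. f y * cis (- (y \<bullet> a)))"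
  proof (rule integral_dominated_convergence[where w="\<lambda>y. cmod (f y)"])
    show "AE y in lborel. (\<lambda>n. f y * cis (- (y \<bullet> x n))) \<longlonglongrightarrow> f y * cis (- (y \<bullet> a))"
      unfolding cis_conv_exp by (intro AE_I2 tendsto_intros lim)
  qed (use f in \<open>auto simp: norm_mult\<close>)
  then show "(ft f \<circ> x) \<longlonglongrightarrow> ft f a"
    unfolding o_def ft_def by (intro tendsto_intros)
qed

lemma fourier_inversion_Sigma1:
  fixes f :: "'a::euclidean_space \<Rightarrow> complex"
  assumes f: "f \<in> Sigma1"
  shows "f t = of_real (fc DIM('a)) * (LINT \<xi>|lborel. ft f \<xi> * cis (t \<bullet> \<xi>))" "integrable lborel (ft f)"
proof -
  obtain M where M: "M \<ge> 0" "\<And>y. cmod (f y) \<le> M * exp (- 1 * norm y)" "\<And>y. cmod (ft f y) \<le> M * exp (- 1 * norm y)"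
    by (rule Sigma1_exp_bound[OF f zero_less_one]) (rule that)
  note [measurable] = Sigma1_borel[OF f]
  show i: "integrable lborel (ft f)"
    by (rule integrable_exp_bound[OF _ M(3) zero_less_one]) measurable
  have "cmod (f y) \<le> M" for y
    using M(2)[of y] mult_left_le[of "exp (- 1 * norm y)" M] M(1) by simp
  then show "f t = of_real (fc DIM('a)) * (LINT \<xi>|lborel. ft f \<xi> * cis (t \<bullet> \<xi>))"
    by (rule fourier_inversion[OF Sigma1_continuous[OF f] _ Sigma1_integrable[OF f] i])
qed

lemma ft_Pair:
  fixes F :: "'a::euclidean_space \<times> 'a \<Rightarrow> complex"
  assumes F: "integrable lborel F"
  shows "ft F (\<xi>, \<eta>) = of_real (fc DIM('a) * fc DIM('a)) * (LINT x|lborel. LINT y|lborel. F (x, y) * cis (- (y \<bullet> \<eta>)) * cis (- (x \<bullet> \<xi>)))"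
    and "ft F (\<xi>, \<eta>) = of_real (fc DIM('a) * fc DIM('a)) * (LINT y|lborel. LINT x|lborel. F (x, y) * cis (- (x \<bullet> \<xi>)) * cis (- (y \<bullet> \<eta>)))"
proof -
  have i: "integrable lborel (\<lambda>z. F z * cis (- (z \<bullet> (\<xi>, \<eta>))))"
    by (intro integrable_mult_cis F) measurable
  have c: "cis (- ((x, y) \<bullet> (\<xi>, \<eta>))) = cis (- (y \<bullet> \<eta>)) * cis (- (x \<bullet> \<xi>))" for x y
    unfolding cis_mult by (simp add: algebra_simps)
  have d: "fc DIM('a \<times> 'a) = fc DIM('a) * fc DIM('a)" by (simp add: fc_double)
  have c': "cis (- ((x, y) \<bullet> (\<xi>, \<eta>))) = cis (- (x \<bullet> \<xi>)) * cis (- (y \<bullet> \<eta>))" for x y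
    unfolding cis_mult by simp
  have 1: "(LINT z|lborel. F z * cis (- (z \<bullet> (\<xi>, \<eta>)))) = (LINT x|lborel. LINT y|lborel. F (x, y) * cis (- ((x, y) \<bullet> (\<xi>, \<eta>))))"
    using lborel_integral_fst[of "\<lambda>x y. F (x, y) * cis (- ((x, y) \<bullet> (\<xi>, \<eta>)))"] i
    by (simp add: case_prod_beta' del: inner_Pair)
  have 2: "(LINT z|lborel. F z * cis (- (z \<bullet> (\<xi>, \<eta>)))) = (LINT y|lborel. LINT x|lborel. F (x, y) * cis (- ((x, y) \<bullet> (\<xi>, \<eta>))))"
    using lborel_integral_snd[of "\<lambda>x y. F (x, y) * cis (- ((x, y) \<bullet> (\<xi>, \<eta>)))"] i
    by (simp add: case_prod_beta' del: inner_Pair)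
  show "ft F (\<xi>, \<eta>) = of_real (fc DIM('a) * fc DIM('a)) * (LINT x|lborel. LINT y|lborel. F (x, y) * cis (- (y \<bullet> \<eta>)) * cis (- (x \<bullet> \<xi>)))"
    unfolding ft_def d 1 c by (simp only: mult.assoc)
  show "ft F (\<xi>, \<eta>) = of_real (fc DIM('a) * fc DIM('a)) * (LINT y|lborel. LINT x|lborel. F (x, y) * cis (- (x \<bullet> \<xi>)) * cis (- (y \<bullet> \<eta>)))"
    unfolding ft_def d 2 c' by (simp only: mult.assoc)
qed

lemma exp_neg_norm_combine:
  assumes "a \<le> K * exp (- (2 * r) * norm x)" "a \<le> L * exp (- (2 * r) * norm y)" "r \<ge> (0::real)" "K \<ge> 0" "L \<ge> 0"
  shows "a \<le> max K L * exp (- r * norm (x, y))"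
proof -
  have "norm (x, y) \<le> norm x + norm y" by (rule norm_Pair_le)
  then consider "norm (x, y) \<le> 2 * norm x" | "norm (x, y) \<le> 2 * norm y" by linarith
  then show ?thesis
  proof cases
    case 1
    have "r * norm (x, y) \<le> (2 * r) * norm x" using mult_left_mono[OF 1 assms(3)] by simp
    then have "exp (- (2 * r) * norm x) \<le> exp (- r * norm (x, y))" by simp
    then have "K * exp (- (2 * r) * norm x) \<le> max K L * exp (- r * norm (x, y))"
      using assms by (intro mult_mono) auto
    then show ?thesis using assms(1) by linarith
  next
    case 2
    have "r * norm (x, y) \<le> (2 * r) * norm y" using mult_left_mono[OF 2 assms(3)] by simp
    then have "exp (- (2 * r) * norm y) \<le> exp (- r * norm (x, y))" by simp
    then have "L * exp (- (2 * r) * norm y) \<le> max K L * exp (- r * norm (x, y))"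
      using assms by (intro mult_mono) auto
    then show ?thesis using assms(2) by linarith
  qed
qed

text \<open>Decay of a convolution: one factor needs the rate 2 r, of which r transfers decay to
  \<eta> and r keeps the integral convergent.\<close>

lemma norm_integral_conv_le:
  fixes u v :: "'a::euclidean_space \<Rightarrow> complex"
  assumes r: "r > 0" and u: "\<And>s. cmod (u s) \<le> M * exp (- (2 * r) * norm s)" and v: "\<And>s. cmod (v s) \<le> N * exp (- r * norm (\<eta> - s))"
  shows "cmod (LINT s|lborel. u s * v s) \<le> M * N * (LINT s|lborel. exp (- r * norm (s::'a))) * exp (- r * norm \<eta>)"
proof -
  have M: "M \<ge> 0" "N \<ge> 0" using order_trans[OF norm_ge_zero u[of 0]] order_trans[OF norm_ge_zero v[of \<eta>]] by simp_all
  have b: "cmod (u s * v s) \<le> M * N * exp (- r * norm \<eta>) * exp (- r * norm s)" for s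
  proof -
    have "r * norm \<eta> + r * norm s \<le> (2 * r) * norm s + r * norm (\<eta> - s)"
      using mult_left_mono[OF norm_triangle_ineq[of "\<eta> - s" s], of r] r by (simp add: algebra_simps)
    then have "exp (- (2 * r) * norm s) * exp (- r * norm (\<eta> - s)) \<le> exp (- r * norm \<eta>) * exp (- r * norm s)"
      by (simp flip: exp_add)
    then have "M * N * (exp (- (2 * r) * norm s) * exp (- r * norm (\<eta> - s))) \<le> M * N * (exp (- r * norm \<eta>) * exp (- r * norm s))"
      using M by (intro mult_left_mono) auto
    moreover have "cmod (u s * v s) \<le> (M * exp (- (2 * r) * norm s)) * (N * exp (- r * norm (\<eta> - s)))"
      unfolding norm_mult using M by (intro mult_mono u v) auto
    ultimately show ?thesis by (simp add: mult_ac)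
  qed
  have "(LINT s|lborel. cmod (u s * v s)) \<le> (LINT s|lborel. M * N * exp (- r * norm \<eta>) * exp (- r * norm (s::'a)))"
    by (intro integral_mono_AE' integrable_mult_right integrable_exp_neg_norm r AE_I2 b) (use M in auto)
  also have "\<dots> = M * N * (LINT s|lborel. exp (- r * norm (s::'a))) * exp (- r * norm \<eta>)" by simp
  finally show ?thesis by (rule order_trans[OF integral_norm_bound])
qed

text \<open>\<open>Op_kernel\<close> applies the partial transform to the sheared tensor product,
  and \<open>dist_pft2_inv\<close> is nonzero only on \<open>Sigma1\<close>, so this membership has
  to be known. The Fourier transform is a sheared product of the same kind.\<close>

lemma shear_Sigma1:
  fixes f g :: "'a::euclidean_space \<Rightarrow> complex"
  assumes f: "f \<in> Sigma1" and g: "g \<in> Sigma1"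
  shows "(\<lambda>z. g (fst z) * f (fst z - snd z)) \<in> Sigma1"
proof (rule Sigma1I)
  let ?F = "\<lambda>z. g (fst z) * f (fst z - snd z)"
  show cont: "continuous_on UNIV ?F"
    by (intro continuous_intros continuous_on_compose2[OF Sigma1_continuous[OF g]] continuous_on_compose2[OF Sigma1_continuous[OF f]]) auto
  have dec: "\<exists>M. \<forall>z. cmod (?F z) \<le> M * exp (- r * norm z)" if r: "r > 0" for r
  proof -
    obtain M where M: "M \<ge> 0" "\<And>y. cmod (g y) \<le> M * exp (- (2 * r) * norm y)"
      by (rule Sigma1_exp_bound[OF g, of "2 * r"]) (use r in \<open>auto intro: that\<close>)
    obtain N where N: "N \<ge> 0" "\<And>y. cmod (f y) \<le> N * exp (- r * norm y)"
      by (rule Sigma1_exp_bound[OF f r]) (rule that)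
    have "cmod (?F z) \<le> M * N * exp (- r * norm z)" for z :: "'a \<times> 'a"
    proof -
      have "norm z \<le> norm (fst z) + norm (snd z)" using norm_Pair_le[of "fst z" "snd z"] by simp
      moreover have "norm (snd z) \<le> norm (fst z) + norm (fst z - snd z)"
        using norm_triangle_sub[of "snd z" "fst z"] by (simp add: norm_minus_commute)
      ultimately have "norm z \<le> 2 * norm (fst z) + norm (fst z - snd z)" by linarith
      then have "r * norm z \<le> r * (2 * norm (fst z) + norm (fst z - snd z))" using r by (intro mult_left_mono) auto
      then have "exp (- (2 * r) * norm (fst z)) * exp (- r * norm (fst z - snd z)) \<le> exp (- r * norm z)"
        by (simp add: algebra_simps flip: exp_add)
      then have "M * N * (exp (- (2 * r) * norm (fst z)) * exp (- r * norm (fst z - snd z))) \<le> M * N * exp (- r * norm z)"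
        using M N by (intro mult_left_mono) auto
      moreover have "cmod (?F z) \<le> (M * exp (- (2 * r) * norm (fst z))) * (N * exp (- r * norm (fst z - snd z)))"
        unfolding norm_mult using M N by (intro mult_mono) auto
      ultimately show ?thesis by (simp add: mult_ac)
    qed
    then show ?thesis by blast
  qed
  then show "\<exists>M. \<forall>z. cmod (?F z) \<le> M * exp (- r * norm z)" if "r > 0" for r using that .
  have Fm: "?F \<in> borel_measurable borel" using cont by (rule borel_measurable_continuous_onI)
  have iF: "integrable lborel ?F"
  proof -
    obtain M where M: "\<And>z. cmod (?F z) \<le> M * exp (- 1 * norm z)" using dec[OF zero_less_one] by blast
    show ?thesis by (rule integrable_exp_bound[OF Fm M zero_less_one])
  qed
  note [measurable] = Sigma1_borel[OF f] Sigma1_borel[OF g]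
  have ft: "ft ?F (\<xi>, \<eta>) = ft g (\<xi> + \<eta>) * ft f (- \<eta>)" for \<xi> \<eta>
  proof -
    have inner: "(LINT y|lborel. f (x - y) * cis (- (y \<bullet> \<eta>))) = cis (- (x \<bullet> \<eta>)) * (LINT w|lborel. f w * cis (- (w \<bullet> - \<eta>)))" for x
    proof -
      have "(LINT y|lborel. f (x - y) * cis (- (y \<bullet> \<eta>))) = (LINT w|lborel. f (x - (x + (- 1) *\<^sub>R w)) * cis (- ((x + (- 1) *\<^sub>R w) \<bullet> \<eta>)))"
        by (subst lborel_integral_affine[where c="-1" and t=x]) auto
      also have "(\<lambda>w. f (x - (x + (- 1) *\<^sub>R w)) * cis (- ((x + (- 1) *\<^sub>R w) \<bullet> \<eta>))) = (\<lambda>w. cis (- (x \<bullet> \<eta>)) * (f w * cis (- (w \<bullet> - \<eta>))))"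
      proof
        fix w
        have "cis (- ((x + (- 1) *\<^sub>R w) \<bullet> \<eta>)) = cis (- (x \<bullet> \<eta>)) * cis (- (w \<bullet> - \<eta>))"
          unfolding cis_mult by (simp add: inner_diff_left)
        then show "f (x - (x + (- 1) *\<^sub>R w)) * cis (- ((x + (- 1) *\<^sub>R w) \<bullet> \<eta>)) = cis (- (x \<bullet> \<eta>)) * (f w * cis (- (w \<bullet> - \<eta>)))"
          by (simp add: mult.left_commute)
      qed
      finally show ?thesis by simp
    qed
    have key: "(LINT y|lborel. ?F (x, y) * cis (- (y \<bullet> \<eta>)) * cis (- (x \<bullet> \<xi>))) =
      g x * cis (- (x \<bullet> (\<xi> + \<eta>))) * (LINT w|lborel. f w * cis (- (w \<bullet> - \<eta>)))" for x
    proof -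
      have "(LINT y|lborel. ?F (x, y) * cis (- (y \<bullet> \<eta>)) * cis (- (x \<bullet> \<xi>))) = g x * cis (- (x \<bullet> \<xi>)) * (LINT y|lborel. f (x - y) * cis (- (y \<bullet> \<eta>)))"
        unfolding integral_mult_right_zero[symmetric] by (simp add: mult_ac)
      moreover have "cis (- (x \<bullet> \<eta>)) * cis (- (x \<bullet> \<xi>)) = cis (- (x \<bullet> (\<xi> + \<eta>)))"
        unfolding cis_mult by (simp add: inner_add_right algebra_simps)
      ultimately show ?thesis unfolding inner by (simp add: mult.assoc[symmetric])
    qed
    show ?thesis
      unfolding ft_Pair(1)[OF iF] key unfolding integral_mult_left_zero by (simp add: ft_def[of f] ft_def[of g] mult_ac)
  qed
  show "\<exists>M. \<forall>z. cmod (ft ?F z) \<le> M * exp (- r * norm z)" if r: "r > 0" for r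
  proof -
    obtain M where M: "M \<ge> 0" "\<And>y. cmod (ft g y) \<le> M * exp (- r * norm y)"
      by (rule Sigma1_exp_bound[OF g r]) (rule that)
    obtain N where N: "N \<ge> 0" "\<And>y. cmod (ft f y) \<le> N * exp (- (2 * r) * norm y)"
      by (rule Sigma1_exp_bound[OF f, of "2 * r"]) (use r in \<open>auto intro: that\<close>)
    have "cmod (ft ?F (\<xi>, \<eta>)) \<le> M * N * exp (- r * norm (\<xi>, \<eta>))" for \<xi> \<eta>
    proof -
      have "norm (\<xi>, \<eta>) \<le> norm \<xi> + norm \<eta>" by (rule norm_Pair_le)
      moreover have "norm \<xi> \<le> norm (\<xi> + \<eta>) + norm \<eta>"
        using norm_triangle_ineq4[of "\<xi> + \<eta>" \<eta>] by simp
      ultimately have "norm (\<xi>, \<eta>) \<le> norm (\<xi> + \<eta>) + 2 * norm \<eta>" by linarith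
      then have "r * norm (\<xi>, \<eta>) \<le> r * (norm (\<xi> + \<eta>) + 2 * norm \<eta>)" using r by (intro mult_left_mono) auto
      then have "exp (- r * norm (\<xi> + \<eta>)) * exp (- (2 * r) * norm (- \<eta>)) \<le> exp (- r * norm (\<xi>, \<eta>))"
        by (simp add: algebra_simps flip: exp_add)
      then have "M * N * (exp (- r * norm (\<xi> + \<eta>)) * exp (- (2 * r) * norm (- \<eta>))) \<le> M * N * exp (- r * norm (\<xi>, \<eta>))"
        using M N by (intro mult_left_mono) auto
      moreover have "cmod (ft ?F (\<xi>, \<eta>)) \<le> (M * exp (- r * norm (\<xi> + \<eta>))) * (N * exp (- (2 * r) * norm (- \<eta>)))"
        unfolding ft norm_mult using M N(1) N(2)[of "- \<eta>"] by (intro mult_mono) auto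
      ultimately show ?thesis by (simp add: mult_ac)
    qed
    then show ?thesis by (intro exI[of _ "M * N"]) auto
  qed
qed

text \<open>The Rihaczek distribution of \<open>f\<close> and \<open>g\<close>; up to a constant, the symbol pairs with it.\<close>

definition rih :: "('a::euclidean_space \<Rightarrow> complex) \<Rightarrow> ('a \<Rightarrow> complex) \<Rightarrow> 'a \<times> 'a \<Rightarrow> complex" where
  "rih g f z = g (fst z) * ft f (snd z) * cis (fst z \<bullet> snd z)"

text \<open>Substituting v = x - y in the partial inverse transform of the sheared product produces
  \<open>ft f\<close> and the character of the Rihaczek distribution.\<close>

lemma Op_eq_rih:
  fixes f g :: "'a::euclidean_space \<Rightarrow> complex"
  assumes f: "f \<in> Sigma1" and g: "g \<in> Sigma1"
  shows "Op a f g = of_real (fc DIM('a)) * a (rih g f)"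
proof -
  note [measurable] = Sigma1_borel[OF f] Sigma1_borel[OF g]
  have S: "(\<lambda>(x, y). (\<lambda>(x, y). g x * f y) (x, x - y)) = (\<lambda>z. g (fst z) * f (fst z - snd z))"
    by (auto simp: fun_eq_iff)
  have "pft2_inv (\<lambda>z. g (fst z) * f (fst z - snd z)) = rih g f"
  proof
    fix w :: "'a \<times> 'a"
    obtain x z where w: "w = (x, z)" by (cases w)
    have "(LINT \<xi>|lborel. g x * f (x - \<xi>) * cis (z \<bullet> \<xi>)) = (LINT v|lborel. g x * f (x - (x + (- 1) *\<^sub>R v)) * cis (z \<bullet> (x + (- 1) *\<^sub>R v)))"
      by (subst lborel_integral_affine[where c="-1" and t=x]) auto
    also have "(\<lambda>v. g x * f (x - (x + (- 1) *\<^sub>R v)) * cis (z \<bullet> (x + (- 1) *\<^sub>R v))) = (\<lambda>v. (g x * cis (x \<bullet> z)) * (f v * cis (- (v \<bullet> z))))"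
    proof
      fix v
      have "cis (z \<bullet> (x + (- 1) *\<^sub>R v)) = cis (x \<bullet> z) * cis (- (v \<bullet> z))"
        unfolding cis_mult by (simp add: inner_diff_right inner_commute)
      then show "g x * f (x - (x + (- 1) *\<^sub>R v)) * cis (z \<bullet> (x + (- 1) *\<^sub>R v)) = (g x * cis (x \<bullet> z)) * (f v * cis (- (v \<bullet> z)))"
        by (simp add: mult_ac)
    qed
    finally have "(LINT \<xi>|lborel. g x * f (x - \<xi>) * cis (z \<bullet> \<xi>)) = (g x * cis (x \<bullet> z)) * (LINT v|lborel. f v * cis (- (v \<bullet> z)))"
      by simp
    then show "pft2_inv (\<lambda>z. g (fst z) * f (fst z - snd z)) w = rih g f w"
      unfolding w by (simp add: pft2_inv_def rih_def ft_def fc_def cis_conv_exp mult_ac)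
  qed
  then show ?thesis
    unfolding Op_def Op_kernel_def dist_pft2_inv_def S using g shear_Sigma1[OF f g] by (simp add: fc_def)
qed

lemma rih_continuous:
  fixes f g :: "'a::euclidean_space \<Rightarrow> complex"
  assumes f: "f \<in> Sigma1" and g: "g \<in> Sigma1"
  shows "continuous_on UNIV (rih g f)"
proof -
  have cft: "continuous_on UNIV (ft f)" by (intro continuous_ft Sigma1_integrable f)
  show ?thesis
    unfolding rih_def cis_conv_exp
    by (intro continuous_intros continuous_on_compose2[OF Sigma1_continuous[OF g]] continuous_on_compose2[OF cft]) auto
qed

text \<open>The Fourier transform is computed in both orders of integration. One gives a convolution
  of the transforms of f and g, decaying in \<eta>; the other, after Fourier inversion, a
  correlation of f and g, decaying in y. The rate 4 r loses one factor 2 in each convolution and one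
  in combining the two variables.\<close>

lemma rih_decay:
  fixes f g :: "'a::euclidean_space \<Rightarrow> complex"
  assumes f: "f \<in> Sigma1" and g: "g \<in> Sigma1" and r: "r > 0"
    and M: "M \<ge> 0" "\<And>y. cmod (g y) \<le> M * exp (- (2 * (2 * r)) * norm y)" "\<And>y. cmod (ft g y) \<le> M * exp (- (2 * (2 * r)) * norm y)"
    and N: "N \<ge> 0" "\<And>y. cmod (f y) \<le> N * exp (- (2 * (2 * r)) * norm y)" "\<And>y. cmod (ft f y) \<le> N * exp (- (2 * (2 * r)) * norm y)"
  shows "cmod (rih g f z) \<le> M * N * exp (- r * norm z)"
    and "cmod (ft (rih g f) z) \<le> fc DIM('a) * (M * N * (LINT s|lborel. exp (- (2 * r) * norm (s::'a)))) * exp (- r * norm z)"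
proof -
  have dec: "cmod (rih g f z) \<le> M * N * exp (- r * norm z)" for z
  proof -
    have w: "K * exp (- (2 * (2 * r)) * t) \<le> K * exp (- r * t)" if "K \<ge> 0" "t \<ge> 0" for K t :: real
      using that r by (intro mult_left_mono) auto
    have g1: "cmod (g (fst z)) \<le> M * exp (- r * norm (fst z))"
      using M(2)[of "fst z"] w[OF M(1) norm_ge_zero[of "fst z"]] by (rule order_trans)
    have f1: "cmod (ft f (snd z)) \<le> N * exp (- r * norm (snd z))"
      using N(3)[of "snd z"] w[OF N(1) norm_ge_zero[of "snd z"]] by (rule order_trans)
    have "norm z \<le> norm (fst z) + norm (snd z)" using norm_Pair_le[of "fst z" "snd z"] by simp
    then have "r * norm z \<le> r * (norm (fst z) + norm (snd z))" using r by (intro mult_left_mono) auto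
    then have "exp (- r * norm (fst z)) * exp (- r * norm (snd z)) \<le> exp (- r * norm z)"
      by (simp add: algebra_simps flip: exp_add)
    then have "M * N * (exp (- r * norm (fst z)) * exp (- r * norm (snd z))) \<le> M * N * exp (- r * norm z)"
      using M N by (intro mult_left_mono) auto
    moreover have "cmod (rih g f z) \<le> (M * exp (- r * norm (fst z))) * (N * exp (- r * norm (snd z)))"
      unfolding rih_def norm_mult norm_cis mult_1_right using M(1) N(1) by (intro mult_mono g1 f1) auto
    ultimately show ?thesis by (simp add: mult_ac)
  qed
  then show "cmod (rih g f z) \<le> M * N * exp (- r * norm z)" .
  have Fm: "rih g f \<in> borel_measurable borel" by (intro borel_measurable_continuous_onI rih_continuous f g)
  have iF: "integrable lborel (rih g f)"
    by (rule integrable_exp_bound[OF Fm dec r])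
  let ?c = "of_real (fc DIM('a)) :: complex"
  have pull: "A * (?c * I * B) = ?c * (A * B * I)" for A B I :: complex
    by (simp only: mult_ac)
  have ft1: "ft (rih g f) (\<eta>, y) = ?c * (LINT s|lborel. ft f s * (ft g (\<eta> - s) * cis (- (s \<bullet> y))))" for \<eta> y
  proof -
    have key: "(LINT x|lborel. rih g f (x, s) * cis (- (x \<bullet> \<eta>)) * cis (- (s \<bullet> y))) =
      ft f s * cis (- (s \<bullet> y)) * (LINT x|lborel. g x * cis (- (x \<bullet> (\<eta> - s))))" for s
    proof -
      have c: "cis (x \<bullet> s) * cis (- (x \<bullet> \<eta>)) = cis (- (x \<bullet> (\<eta> - s)))" for x
        unfolding cis_mult by (simp add: inner_diff_right)
      have "rih g f (x, s) * cis (- (x \<bullet> \<eta>)) * cis (- (s \<bullet> y)) = ft f s * cis (- (s \<bullet> y)) * (g x * cis (- (x \<bullet> (\<eta> - s))))" for x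
        unfolding rih_def fst_conv snd_conv c[symmetric] by (simp only: mult_ac)
      then show ?thesis by simp
    qed
    show ?thesis
      unfolding ft_Pair(2)[OF iF] key ft_def[of g] pull integral_mult_right_zero
      by (simp only: mult.assoc of_real_mult)
  qed
  have ft2: "ft (rih g f) (\<eta>, y) = ?c * (LINT s|lborel. g s * (f (s - y) * cis (- (s \<bullet> \<eta>))))" for \<eta> y
  proof -
    have key: "(LINT t|lborel. rih g f (s, t) * cis (- (t \<bullet> y)) * cis (- (s \<bullet> \<eta>))) =
      g s * cis (- (s \<bullet> \<eta>)) * (LINT t|lborel. ft f t * cis ((s - y) \<bullet> t))" for s
    proof -
      have c: "cis (s \<bullet> t) * cis (- (t \<bullet> y)) = cis ((s - y) \<bullet> t)" for t
        unfolding cis_mult by (simp add: inner_diff_left inner_commute[of t y])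
      have "rih g f (s, t) * cis (- (t \<bullet> y)) * cis (- (s \<bullet> \<eta>)) = g s * cis (- (s \<bullet> \<eta>)) * (ft f t * cis ((s - y) \<bullet> t))" for t
        unfolding rih_def fst_conv snd_conv c[symmetric] by (simp only: mult_ac)
      then show ?thesis by simp
    qed
    have inv: "f (s - y) = ?c * (LINT \<xi>|lborel. ft f \<xi> * cis ((s - y) \<bullet> \<xi>))" for s
      by (rule fourier_inversion_Sigma1(1)[OF f])
    show ?thesis
      unfolding ft_Pair(1)[OF iF] key inv pull integral_mult_right_zero
      by (simp only: mult.assoc of_real_mult)
  qed
  have w: "K * exp (- (2 * (2 * r)) * t) \<le> K * exp (- (2 * r) * t)" if "K \<ge> 0" "t \<ge> 0" for K t :: real
    using that r by (intro mult_left_mono) auto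
  have Mb: "cmod (ft g y) \<le> M * exp (- (2 * r) * norm y)" for y
    using M(3)[of y] w[OF M(1) norm_ge_zero[of y]] by (rule order_trans)
  have Nb: "cmod (f y) \<le> N * exp (- (2 * r) * norm y)" for y
    using N(2)[of y] w[OF N(1) norm_ge_zero[of y]] by (rule order_trans)
  have r2: "2 * r > 0" using r by simp
  let ?K = "fc DIM('a) * (M * N * (LINT s|lborel. exp (- (2 * r) * norm (s::'a))))"
  have "cmod (ft (rih g f) (\<eta>, y)) \<le> max ?K ?K * exp (- r * norm (\<eta>, y))" for \<eta> y
  proof (rule exp_neg_norm_combine)
    have "cmod (LINT s|lborel. ft f s * (ft g (\<eta> - s) * cis (- (s \<bullet> y)))) \<le> N * M * (LINT s|lborel. exp (- (2 * r) * norm (s::'a))) * exp (- (2 * r) * norm \<eta>)"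
      by (rule norm_integral_conv_le[OF r2 N(3)]) (use Mb in \<open>auto simp: norm_mult\<close>)
    from mult_left_mono[OF this fc_nonneg]
    show "cmod (ft (rih g f) (\<eta>, y)) \<le> ?K * exp (- (2 * r) * norm \<eta>)"
      unfolding ft1 by (simp add: norm_mult mult_ac)
    have "cmod (LINT s|lborel. g s * (f (s - y) * cis (- (s \<bullet> \<eta>)))) \<le> M * N * (LINT s|lborel. exp (- (2 * r) * norm (s::'a))) * exp (- (2 * r) * norm y)"
      by (rule norm_integral_conv_le[OF r2 M(2)]) (use Nb[of "_ - y"] in \<open>auto simp: norm_mult norm_minus_commute[of y]\<close>)
    from mult_left_mono[OF this fc_nonneg]
    show "cmod (ft (rih g f) (\<eta>, y)) \<le> ?K * exp (- (2 * r) * norm y)"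
      unfolding ft2 by (simp add: norm_mult mult_ac)
  qed (use M(1) N(1) r in auto)
  then show "cmod (ft (rih g f) z) \<le> ?K * exp (- r * norm z)"
    by (cases z) simp
qed

lemma rih_Sigma1:
  fixes f g :: "'a::euclidean_space \<Rightarrow> complex"
  assumes f: "f \<in> Sigma1" and g: "g \<in> Sigma1"
  shows "rih g f \<in> Sigma1"
proof (rule Sigma1I)
  show "continuous_on UNIV (rih g f)" by (rule rih_continuous[OF f g])
  fix r :: real assume r: "r > 0"
  then have r4: "2 * (2 * r) > 0" by simp
  obtain M where M: "M \<ge> 0" "\<And>y. cmod (g y) \<le> M * exp (- (2 * (2 * r)) * norm y)" "\<And>y. cmod (ft g y) \<le> M * exp (- (2 * (2 * r)) * norm y)"
    by (rule Sigma1_exp_bound[OF g r4]) (rule that)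
  obtain N where N: "N \<ge> 0" "\<And>y. cmod (f y) \<le> N * exp (- (2 * (2 * r)) * norm y)" "\<And>y. cmod (ft f y) \<le> N * exp (- (2 * (2 * r)) * norm y)"
    by (rule Sigma1_exp_bound[OF f r4]) (rule that)
  show "\<exists>M. \<forall>z. cmod (rih g f z) \<le> M * exp (- r * norm z)" "\<exists>M. \<forall>z. cmod (ft (rih g f) z) \<le> M * exp (- r * norm z)"
    using rih_decay[OF f g r M N] by blast+
qed

section \<open>The phase space matrix of the operator\<close>

lemma rih_linear_combination:
  assumes "f \<in> Sigma1" "f' \<in> Sigma1"
  shows "rih g (\<lambda>x. a * f x + b * f' x) = (\<lambda>z. a * rih g f z + b * rih g f' z)"
    and "rih (\<lambda>x. a * g x + b * g' x) f = (\<lambda>z. a * rih g f z + b * rih g' f z)"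
  unfolding rih_def fun_eq_iff ft_linear_combination[OF assms] by (simp_all add: algebra_simps)

text \<open>The seminorms of f and g enter as a product, so freezing either function leaves a bound
  linear in a seminorm of the other.\<close>

lemma stf_rih_decay:
  assumes r: "r > (0::real)"
  obtains h C where "h > 0" "C > 0"
    "\<And>f g Z. f \<in> Sigma1 \<Longrightarrow> g \<in> Sigma1 \<Longrightarrow>
      cmod (stf (rih g (f :: 'a::euclidean_space \<Rightarrow> complex)) Z) \<le> C * (gs_val h g * gs_val h f) * exp (- r * norm Z)"
proof -
  obtain C1 where C1: "C1 > 0" "\<forall>F M Z. F \<in> borel_measurable borel \<longrightarrow>
    (\<forall>y::'a \<times> 'a. cmod (F y) \<le> M * exp (- (2 * r) * norm y)) \<longrightarrow>
    (\<forall>y. cmod (ft F y) \<le> M * exp (- (2 * r) * norm y)) \<longrightarrow> cmod (stf F Z) \<le> C1 * M * exp (- r * norm Z)"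
    by (rule stf_decay[OF r, where 'a="'a \<times> 'a"]) (rule that, assumption, blast)
  \<comment> \<open>The rate 8 r is forced by \<open>rih_decay\<close> at 2 r, and 2 r by
    \<open>stf_decay\<close> at r.\<close>
  have r2: "2 * r > 0" and r8: "2 * (2 * (2 * r)) > 0" using r by auto
  obtain h C2 where h: "h > 0" and C2: "C2 > 0" and dec:
    "\<And>f x. f \<in> (Sigma1 :: ('a \<Rightarrow> complex) set) \<Longrightarrow> cmod (f x) \<le> C2 * gs_val h f * exp (- (2 * (2 * (2 * r))) * norm x)"
    "\<And>f x. f \<in> (Sigma1 :: ('a \<Rightarrow> complex) set) \<Longrightarrow> cmod (ft f x) \<le> C2 * gs_val h f * exp (- (2 * (2 * (2 * r))) * norm x)"
    by (rule Sigma1_decay[OF r8, where 'a='a]) (rule that)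
  define I where "I = fc DIM('a) * (LINT s|lborel. exp (- (2 * (2 * r)) * norm (s::'a)))"
  have I0: "I \<ge> 0" unfolding I_def by (intro mult_nonneg_nonneg fc_nonneg integral_nonneg_AE) auto
  show thesis
  proof (rule that)
    show "h > 0" by (rule h)
    show "C1 * ((1 + I) * (C2 * C2)) > 0" using C1(1) C2 I0 by (intro mult_pos_pos) auto
    fix f g :: "'a \<Rightarrow> complex" and Z
    assume f: "f \<in> Sigma1" and g: "g \<in> Sigma1"
    define M where "M = C2 * gs_val h g"
    define N where "N = C2 * gs_val h f"
    have MN: "M \<ge> 0" "N \<ge> 0" unfolding M_def N_def using C2 by auto
    note d = rih_decay[OF f g r2 MN(1) dec(1)[OF g, folded M_def] dec(2)[OF g, folded M_def] MN(2) dec(1)[OF f, folded N_def] dec(2)[OF f, folded N_def]]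
    have "cmod (rih g f y) \<le> (1 + I) * (M * N) * exp (- (2 * r) * norm y)" for y
    proof -
      have "M * N * exp (- (2 * r) * norm y) \<le> (1 + I) * (M * N) * exp (- (2 * r) * norm y)"
        using MN I0 mult_right_mono[of 1 "1 + I" "M * N"] by (intro mult_right_mono) auto
      with d(1)[of y] show ?thesis by (rule order_trans)
    qed
    moreover have "cmod (ft (rih g f) y) \<le> (1 + I) * (M * N) * exp (- (2 * r) * norm y)" for y
    proof -
      have "fc DIM('a) * (M * N * (LINT s|lborel. exp (- (2 * (2 * r)) * norm (s::'a)))) = I * (M * N)"
        unfolding I_def by (simp only: mult_ac)
      moreover have "I * (M * N) * exp (- (2 * r) * norm y) \<le> (1 + I) * (M * N) * exp (- (2 * r) * norm y)"
        using MN by (intro mult_right_mono) auto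
      ultimately show ?thesis using d(2)[of y] by (simp only:)
    qed
    ultimately have "cmod (stf (rih g f) Z) \<le> C1 * ((1 + I) * (M * N)) * exp (- r * norm Z)"
      by (intro C1(2)[rule_format] Sigma1_borel rih_Sigma1 f g)
    also have "C1 * ((1 + I) * (M * N)) = C1 * ((1 + I) * (C2 * C2)) * (gs_val h g * gs_val h f)"
      unfolding M_def N_def by (simp only: mult_ac)
    finally show "cmod (stf (rih g f) Z) \<le> C1 * ((1 + I) * (C2 * C2)) * (gs_val h g * gs_val h f) * exp (- r * norm Z)" .
  qed
qed

lemma dual_rih_bound:
  fixes a :: "('a::euclidean_space \<times> 'a) dual"
  assumes a: "a \<in> Sigma1'"
  obtains h K where "h > 0" "\<And>f g. f \<in> Sigma1 \<Longrightarrow> g \<in> Sigma1 \<Longrightarrow> cmod (a (rih g f)) \<le> K * (gs_val h g * gs_val h f)"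
proof -
  obtain Ca ra where Ca: "Ca > 0" "ra > 0" "\<And>Z. cmod (stv a Z) \<le> Ca * exp (ra * norm Z)"
    by (rule stv_growth[OF a]) (rule that)
  then have r: "ra + 1 > 0" by simp
  obtain h C where h: "h > 0" and C: "C > 0" "\<And>f g Z. f \<in> Sigma1 \<Longrightarrow> g \<in> Sigma1 \<Longrightarrow>
      cmod (stf (rih g (f :: 'a \<Rightarrow> complex)) Z) \<le> C * (gs_val h g * gs_val h f) * exp (- (ra + 1) * norm Z)"
    by (rule stf_rih_decay[OF r, where 'a='a]) (rule that)
  let ?I = "LINT Z|lborel. exp (- 1 * norm (Z :: ('a \<times> 'a) \<times> ('a \<times> 'a)))"
  show thesis
  proof (rule that[OF h])
    fix f g :: "'a \<Rightarrow> complex" assume f: "f \<in> Sigma1" and g: "g \<in> Sigma1"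
    let ?k = "gs_val h g * gs_val h f"
    have b: "cmod (stf (rih g f) (flip Z) * stv a Z) \<le> C * ?k * Ca * exp (- 1 * norm Z)" for Z
    proof -
      have "cmod (stf (rih g f) (flip Z) * stv a Z) \<le> (C * ?k * exp (- (ra + 1) * norm Z)) * (Ca * exp (ra * norm Z))"
        unfolding norm_mult using C(2)[OF f g, of "flip Z"] Ca(3)[of Z] C(1) by (intro mult_mono) auto
      also have "\<dots> = C * ?k * Ca * (exp (- (ra + 1) * norm Z) * exp (ra * norm Z))" by (simp only: mult_ac)
      also have "exp (- (ra + 1) * norm Z) * exp (ra * norm Z) = exp (- 1 * norm Z)"
        by (simp add: algebra_simps flip: exp_add)
      finally show ?thesis .
    qed
    have "cmod (a (rih g f)) \<le> (LINT Z|lborel. C * ?k * Ca * exp (- 1 * norm (Z :: ('a \<times> 'a) \<times> ('a \<times> 'a))))"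
      unfolding dual_eq'(1)[OF a rih_Sigma1[OF f g]]
      by (intro Bochner_Integration.integral_norm_bound_integral dual_eq'(2)[OF a rih_Sigma1[OF f g]] b integrable_mult_right integrable_exp_neg_norm) auto
    also have "\<dots> = C * ?k * Ca * ?I" by simp
    also have "\<dots> = C * Ca * ?I * ?k" by (simp only: mult_ac)
    finally show "cmod (a (rih g f)) \<le> C * Ca * ?I * ?k" .
  qed
qed

text \<open>Each partial map is a continuous functional, so the representation of functionals by
  their short-time Fourier transform can be applied in one variable at a time.\<close>

lemma dual_rih_Sigma1':
  fixes a :: "('a::euclidean_space \<times> 'a) dual"
  assumes a: "a \<in> Sigma1'"
  shows "f \<in> Sigma1 \<Longrightarrow> (\<lambda>g. if g \<in> Sigma1 then a (rih g f) else 0) \<in> Sigma1'"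
    and "g \<in> Sigma1 \<Longrightarrow> (\<lambda>f. if f \<in> Sigma1 then a (rih g f) else 0) \<in> Sigma1'"
proof -
  obtain h K where h: "h > 0" and K: "\<And>f g. f \<in> Sigma1 \<Longrightarrow> g \<in> Sigma1 \<Longrightarrow> cmod (a (rih g f)) \<le> K * (gs_val h g * gs_val h f)"
    by (rule dual_rih_bound[OF a]) (rule that)
  show "(\<lambda>g. if g \<in> Sigma1 then a (rih g f) else 0) \<in> Sigma1'" if f: "f \<in> Sigma1"
  proof (rule Sigma1'I[OF _ h])
    show "cmod (if g \<in> Sigma1 then a (rih g f) else 0) \<le> (K * gs_val h f) * gs_val h g" if g: "g \<in> Sigma1" for g
      using K[OF f g] g by (simp only: if_True mult_ac)
    show "(if (\<lambda>x. s * g x + t * g' x) \<in> Sigma1 then a (rih (\<lambda>x. s * g x + t * g' x) f) else 0) =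
      s * (if g \<in> Sigma1 then a (rih g f) else 0) + t * (if g' \<in> Sigma1 then a (rih g' f) else 0)"
      if g: "g \<in> Sigma1" "g' \<in> Sigma1" for g g' s t
      unfolding rih_linear_combination(2)[OF f f] if_P[OF g(1)] if_P[OF g(2)] if_P[OF Sigma1_linear_combination[OF g, of s t]]
      by (rule dual_linear_combination[OF a rih_Sigma1[OF f g(1)] rih_Sigma1[OF f g(2)]])
  qed simp
  show "(\<lambda>f. if f \<in> Sigma1 then a (rih g f) else 0) \<in> Sigma1'" if g: "g \<in> Sigma1"
  proof (rule Sigma1'I[OF _ h])
    show "cmod (if f \<in> Sigma1 then a (rih g f) else 0) \<le> (K * gs_val h g) * gs_val h f" if f: "f \<in> Sigma1" for f
      using K[OF f g] f by (simp only: if_True mult_ac)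
    show "(if (\<lambda>x. s * f x + t * f' x) \<in> Sigma1 then a (rih g (\<lambda>x. s * f x + t * f' x)) else 0) =
      s * (if f \<in> Sigma1 then a (rih g f) else 0) + t * (if f' \<in> Sigma1 then a (rih g f') else 0)"
      if f: "f \<in> Sigma1" "f' \<in> Sigma1" for f f' s t
      unfolding rih_linear_combination(1)[OF f] if_P[OF f(1)] if_P[OF f(2)] if_P[OF Sigma1_linear_combination[OF f, of s t]]
      by (rule dual_linear_combination[OF a rih_Sigma1[OF f(1) g] rih_Sigma1[OF f(2) g]])
  qed simp
qed

text \<open>The three constants come from \<open>Op_eq_rih\<close> and from one short-time Fourier
  transform in each variable. The reflection of \<open>z\<close> conjugates the atom on the side of
  the test function.\<close>

definition op_matrix :: "('a::euclidean_space \<times> 'a) dual \<Rightarrow> 'a \<times> 'a \<Rightarrow> 'a \<times> 'a \<Rightarrow> complex" where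
  "op_matrix a z w = of_real (fc DIM('a) ^ 3) * a (rih (atom (flip z)) (atom w))"

text \<open>\<open>dual_eq\<close> expands f in atoms for each fixed atom on the other side, and
  \<open>dual_eq'\<close> then expands g.\<close>

lemma Op_eq_J:
  fixes a :: "('a::euclidean_space \<times> 'a) dual"
  assumes a: "a \<in> Sigma1'" and f: "f \<in> Sigma1" and g: "g \<in> Sigma1"
  shows "Op a f g = (LINT z|lborel. stf g (flip z) * (LINT w|lborel. op_matrix a z w * stf f w))"
proof -
  let ?c = "of_real (fc DIM('a)) :: complex"
  let ?U = "\<lambda>g. if g \<in> Sigma1 then a (rih g f) else 0"
  let ?V = "\<lambda>z f. if f \<in> Sigma1 then a (rih (atom (flip z)) f) else 0"
  have V: "stv (?V z) (flip w) = ?c * a (rih (atom (flip z)) (atom w))" for z w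
    unfolding stv_eq by (simp add: atom_Sigma1)
  have U: "stv ?U z = ?c * (LINT w|lborel. stf f w * (?c * a (rih (atom (flip z)) (atom w))))" for z
  proof -
    have "?V z f = (LINT w|lborel. stf f w * stv (?V z) (flip w))"
      by (rule dual_eq(1)[OF dual_rih_Sigma1'(2)[OF a atom_Sigma1] f])
    then have "a (rih (atom (flip z)) f) = (LINT w|lborel. stf f w * stv (?V z) (flip w))"
      using f by (simp only: if_True)
    then have "a (rih (atom (flip z)) f) = (LINT w|lborel. stf f w * (?c * a (rih (atom (flip z)) (atom w))))"
      unfolding V .
    then show ?thesis unfolding stv_eq by (simp add: atom_Sigma1)
  qed
  have p: "?c * (x * (?c * (y * (?c * t)))) = x * (of_real (fc DIM('a) ^ 3) * t * y)" for x y t :: complex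
    by (simp add: power3_eq_cube mult_ac)
  have "?U g = (LINT z|lborel. stf g (flip z) * stv ?U z)"
    by (rule dual_eq'(1)[OF dual_rih_Sigma1'(1)[OF a f] g])
  then have "a (rih g f) = (LINT z|lborel. stf g (flip z) * stv ?U z)" using g by (simp only: if_True)
  then have "Op a f g = (LINT z|lborel. ?c * (stf g (flip z) * stv ?U z))"
    unfolding Op_eq_rih[OF f g] by (simp only: integral_mult_right_zero)
  also have "\<dots> = (LINT z|lborel. (LINT w|lborel. ?c * (stf g (flip z) * (?c * (stf f w * (?c * a (rih (atom (flip z)) (atom w))))))))"
    unfolding U by (simp only: integral_mult_right_zero)
  also have "\<dots> = (LINT z|lborel. stf g (flip z) * (LINT w|lborel. op_matrix a z w * stf f w))"
    unfolding p op_matrix_def by (simp only: integral_mult_right_zero)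
  finally show ?thesis .
qed

text \<open>The phase space point around which the Rihaczek distribution of \<open>atom z\<close>
  and \<open>atom w\<close> is concentrated: position of z, frequency of w, and the two frequencies
  contributed by the atoms together with the character.\<close>

definition center :: "'a::euclidean_space \<times> 'a \<Rightarrow> 'a \<times> 'a \<Rightarrow> ('a \<times> 'a) \<times> ('a \<times> 'a)" where
  "center z w = ((fst z, snd w), (snd z + snd w, fst z - fst w))"

text \<open>
  The short-time Fourier transform of the Rihaczek distribution of \<open>atom (flip z)\<close> and \<open>atom w\<close> is
  concentrated, up to \<open>flip\<close>, at \<open>kap z w\<close>.  Solving \<open>kap z w = ((x, \<xi>), (\<eta>, y))\<close> gives
  \<open>z = (x, \<xi> + \<eta>)\<close> and \<open>w = (x + y, \<xi>)\<close>, the points in the hypothesis on the weights.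
\<close>

definition kap :: "'a::euclidean_space \<times> 'a \<Rightarrow> 'a \<times> 'a \<Rightarrow> ('a \<times> 'a) \<times> ('a \<times> 'a)" where
  "kap z w = ((fst z, snd w), (snd z - snd w, fst w - fst z))"

lemma flip_center: "flip Z - center (flip z) w = flip (Z - kap z w)"
  by (auto simp: prod_eq_iff center_def kap_def)

text \<open>Up to a constant phase, the distribution is the one of two unshifted Gaussians,
  translated by the base part of \<open>center\<close> and modulated by its frequency part.\<close>

lemma rih_atom:
  "rih (atom z) (atom w) (fst (center z w) + S) =
     cis (fst z \<bullet> (snd z + snd w)) * (rih (atom 0) (atom 0) S * cis (S \<bullet> snd (center z w)))"
proof -
  obtain z1 z2 where z: "z = (z1, z2)" by (cases z)
  obtain w1 w2 where w: "w = (w1, w2)" by (cases w)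
  obtain s t where S: "S = (s, t)" by (cases S)
  have c: "cis ((z1 + s) \<bullet> z2) * cis (w1 \<bullet> (w2 - (w2 + t))) * cis ((z1 + s) \<bullet> (w2 + t)) =
    cis (z1 \<bullet> (z2 + w2)) * (cis (s \<bullet> t) * cis (s \<bullet> (z2 + w2) + t \<bullet> (z1 - w1)))"
    unfolding cis_mult by (simp add: algebra_simps inner_commute[of t])
  have "rih (atom z) (atom w) (fst (center z w) + S) = gauss s * gauss t *
    (cis ((z1 + s) \<bullet> z2) * cis (w1 \<bullet> (w2 - (w2 + t))) * cis ((z1 + s) \<bullet> (w2 + t)))"
    unfolding rih_def ft_atom atom_def z w S center_def by (simp add: mult_ac)
  also have "\<dots> = cis (fst z \<bullet> (snd z + snd w)) * (rih (atom 0) (atom 0) S * cis (S \<bullet> snd (center z w)))"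
    unfolding c unfolding rih_def ft_atom atom_def z w S center_def by (simp add: mult_ac)
  finally show ?thesis .
qed

text \<open>Covariance of the short-time Fourier transform under the shift found in
  \<open>rih_atom\<close>. All matrix entries thus refer to one fixed test function.\<close>

lemma stf_rih_atom:
  fixes z w :: "'a::euclidean_space \<times> 'a"
  shows "stf (rih (atom z) (atom w)) Z =
    cis (fst z \<bullet> (snd z + snd w) - fst (center z w) \<bullet> snd Z) * stf (rih (atom 0) (atom 0)) (Z - center z w)"
proof -
  let ?C = "fst (center z w)"
  let ?R = "rih (atom 0) (atom 0) :: 'a \<times> 'a \<Rightarrow> complex"
  let ?k = "cis (fst z \<bullet> (snd z + snd w) - ?C \<bullet> snd Z)"
  have [measurable]: "rih (atom z) (atom w) \<in> borel_measurable borel"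
    by (intro Sigma1_borel rih_Sigma1 atom_Sigma1)
  have "(LINT Y|lborel. rih (atom z) (atom w) Y * atom (flip Z) Y) =
    (LINT S|lborel. rih (atom z) (atom w) (?C + 1 *\<^sub>R S) * atom (flip Z) (?C + 1 *\<^sub>R S))"
    by (subst lborel_integral_affine[where c=1 and t="?C"]) auto
  also have "\<dots> = (LINT S|lborel. ?k * (?R S * atom (flip (Z - center z w)) S))"
  proof (rule Bochner_Integration.integral_cong[OF refl])
    fix S
    have pull: "P * (R * Q) * (G' * W) = K * (R * (G * L))" if "P * Q * W = K * L" "G' = G" for P Q R G G' W K L :: complex
    proof -
      have "P * (R * Q) * (G' * W) = (P * Q * W) * (R * G')" by (simp only: mult_ac)
      also have "\<dots> = (K * L) * (R * G)" unfolding that ..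
      finally show ?thesis by (simp only: mult_ac)
    qed
    have "cis (fst z \<bullet> (snd z + snd w)) * cis (S \<bullet> snd (center z w)) * cis ((?C + S) \<bullet> - snd Z) =
      ?k * cis (S \<bullet> - snd (Z - center z w))"
      unfolding cis_mult by (intro arg_cong[where f=cis]) (simp add: inner_diff_right inner_add_left del: inner_Pair inner_Pair_0)
    moreover have "gauss (?C + S - fst Z) = gauss (S - fst (Z - center z w))" by (simp add: algebra_simps)
    ultimately show "rih (atom z) (atom w) (?C + 1 *\<^sub>R S) * atom (flip Z) (?C + 1 *\<^sub>R S) = ?k * (?R S * atom (flip (Z - center z w)) S)"
      unfolding scaleR_one rih_atom atom_def[of "flip Z"] atom_def[of "flip (Z - center z w)"] fst_flip snd_flip
      by (rule pull)
  qed
  also have "\<dots> = ?k * (LINT S|lborel. ?R S * atom (flip (Z - center z w)) S)"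
    by (rule integral_mult_right_zero)
  finally have e: "(LINT Y|lborel. rih (atom z) (atom w) Y * atom (flip Z) Y) = ?k * (LINT S|lborel. ?R S * atom (flip (Z - center z w)) S)" .
  show ?thesis unfolding stf_def e by (rule mult.left_commute)
qed

text \<open>If \<open>f\<close> is not integrable the left-hand side is 0, so the bound may be used
  before integrability is known.\<close>

lemma ennreal_cmod_integral_le:
  fixes f :: "'b \<Rightarrow> complex"
  shows "ennreal (cmod (LINT x|M. f x)) \<le> (\<integral>\<^sup>+ x. ennreal (cmod (f x)) \<partial>M)"
proof (cases "integrable M f")
  case True
  then show ?thesis by (rule integral_norm_bound_ennreal)
qed (simp add: not_integrable_integral_eq)

text \<open>The phases are kept, not only the moduli: joint measurability of the matrix is read off
  from this formula.\<close>

lemma op_matrix_eq: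
  fixes a :: "('a::euclidean_space \<times> 'a) dual"
  assumes a: "a \<in> Sigma1'"
  shows "op_matrix a z w = of_real (fc DIM('a) ^ 3) * (LINT Z|lborel.
    cis (fst z \<bullet> (snd w - snd z) + fst (kap z w) \<bullet> snd Z) * stf (rih (atom 0) (atom 0)) (flip (Z - kap z w)) * stv a Z)"
proof -
  have "fst (center (flip z) w) = fst (kap z w)" by (simp add: center_def kap_def)
  then show ?thesis
    unfolding op_matrix_def dual_eq'(1)[OF a rih_Sigma1[OF atom_Sigma1 atom_Sigma1]] stf_rih_atom[of "flip z" w] flip_center by simp
qed

lemma op_matrix_measurable [measurable (raw)]:
  fixes a :: "('a::euclidean_space \<times> 'a) dual"
  assumes a: "a \<in> Sigma1'" and [measurable]: "f \<in> borel_measurable M" "g \<in> borel_measurable M"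
  shows "(\<lambda>x. op_matrix a (f x) (g x)) \<in> borel_measurable M"
proof -
  note R = Sigma1_borel[OF rih_Sigma1[OF atom_Sigma1 atom_Sigma1]]
  have [measurable]: "(\<lambda>x. fst (f (fst x))) \<in> borel_measurable (M \<Otimes>\<^sub>M (lborel :: (('a \<times> 'a) \<times> ('a \<times> 'a)) measure))"
    "(\<lambda>x. snd (f (fst x))) \<in> borel_measurable (M \<Otimes>\<^sub>M (lborel :: (('a \<times> 'a) \<times> ('a \<times> 'a)) measure))"
    "(\<lambda>x. fst (g (fst x))) \<in> borel_measurable (M \<Otimes>\<^sub>M (lborel :: (('a \<times> 'a) \<times> ('a \<times> 'a)) measure))"
    "(\<lambda>x. snd (g (fst x))) \<in> borel_measurable (M \<Otimes>\<^sub>M (lborel :: (('a \<times> 'a) \<times> ('a \<times> 'a)) measure))"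
    by (intro measurable_fst_borel measurable_snd_borel; measurable)+
  have [measurable]: "(\<lambda>x. snd (snd x)) \<in> borel_measurable (M \<Otimes>\<^sub>M (lborel :: (('a \<times> 'a) \<times> ('a \<times> 'a)) measure))"
    by (intro measurable_snd_borel) measurable
  have k1: "(\<lambda>x. fst (kap (f (fst x)) (g (fst x)))) \<in> borel_measurable (M \<Otimes>\<^sub>M (lborel :: (('a \<times> 'a) \<times> ('a \<times> 'a)) measure))"
    unfolding kap_def fst_conv by (intro borel_measurable_Pair) measurable
  have k2: "(\<lambda>x. kap (f (fst x)) (g (fst x))) \<in> borel_measurable (M \<Otimes>\<^sub>M (lborel :: (('a \<times> 'a) \<times> ('a \<times> 'a)) measure))"
    unfolding kap_def by (intro borel_measurable_Pair borel_measurable_diff) measurable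
  have "(\<lambda>x. stf (rih (atom 0) (atom 0)) (flip (snd x - kap (f (fst x)) (g (fst x))))) \<in> borel_measurable (M \<Otimes>\<^sub>M (lborel :: (('a \<times> 'a) \<times> ('a \<times> 'a)) measure))"
    by (intro measurable_compose[OF _ stf_measurable[OF R]] flip_measurable borel_measurable_diff k2) measurable
  moreover have "(\<lambda>x. cis (fst (f (fst x)) \<bullet> (snd (g (fst x)) - snd (f (fst x))) + fst (kap (f (fst x)) (g (fst x))) \<bullet> snd (snd x))) \<in> borel_measurable (M \<Otimes>\<^sub>M (lborel :: (('a \<times> 'a) \<times> ('a \<times> 'a)) measure))"
    using k1 by measurable
  moreover have "(\<lambda>x. stv a (snd x)) \<in> borel_measurable (M \<Otimes>\<^sub>M (lborel :: (('a \<times> 'a) \<times> ('a \<times> 'a)) measure))"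
    by (intro stv_measurable a) measurable
  ultimately have "(\<lambda>x. LINT Z|lborel. cis (fst (f x) \<bullet> (snd (g x) - snd (f x)) + fst (kap (f x) (g x)) \<bullet> snd Z) * stf (rih (atom 0) (atom 0)) (flip (Z - kap (f x) (g x))) * stv a Z) \<in> borel_measurable M"
    by (intro lborel.borel_measurable_lebesgue_integral) (unfold case_prod_beta', intro borel_measurable_times)
  then show ?thesis unfolding op_matrix_eq[OF a] by (intro borel_measurable_times borel_measurable_const)
qed

text \<open>Decay of the fixed function \<open>rih (atom 0) (atom 0)\<close> at the chosen rate.
  \<open>C\<close> depends on that rate but not on the symbol.\<close>

lemma op_matrix_bound:
  assumes r: "r > (0::real)"
  obtains C where "C > 0" "\<And>a z w. a \<in> Sigma1' \<Longrightarrow> ennreal (cmod (op_matrix a z (w :: 'a::euclidean_space \<times> 'a))) \<le>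
    (\<integral>\<^sup>+ Z. ennreal (C * (exp (- r * norm (kap z w - Z)) * cmod (stv a Z))) \<partial>lborel)"
proof -
  obtain h C where hC: "h > 0" "C > 0" "\<And>f Z. f \<in> (Sigma1 :: ('a \<times> 'a \<Rightarrow> complex) set) \<Longrightarrow> cmod (stf f Z) \<le> C * gs_val h f * exp (- r * norm Z)"
    by (rule stf_Sigma1_decay[OF r, where 'a="'a \<times> 'a"]) (rule that)
  let ?R = "rih (atom 0) (atom 0) :: 'a \<times> 'a \<Rightarrow> complex"
  define K where "K = C * (1 + gs_val h ?R)"
  have K0: "K > 0" unfolding K_def using hC(2) enn2real_nonneg[of "gs_norm h ?R"] by (intro mult_pos_pos) linarith+
  have K: "cmod (stf ?R Z) \<le> K * exp (- r * norm Z)" for Z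
  proof -
    have "C * gs_val h ?R * exp (- r * norm Z) \<le> K * exp (- r * norm Z)"
      unfolding K_def using hC(2) by (intro mult_right_mono mult_left_mono) auto
    with hC(3)[OF rih_Sigma1[OF atom_Sigma1 atom_Sigma1]] show ?thesis by (rule order_trans)
  qed
  let ?c = "fc DIM('a) ^ 3"
  have c: "?c > 0" using fc_pos[of "DIM('a)"] by simp
  show thesis
  proof (rule that)
    show "?c * K > 0" using c K0 by simp
    fix a :: "('a \<times> 'a) dual" and z w :: "'a \<times> 'a" assume a: "a \<in> Sigma1'"
    have eq: "op_matrix a z w = (LINT Z|lborel. of_real ?c * (cis (fst z \<bullet> (snd w - snd z) + fst (kap z w) \<bullet> snd Z) * stf ?R (flip (Z - kap z w)) * stv a Z))"
      unfolding op_matrix_eq[OF a] by (simp only: integral_mult_right_zero)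
    have "ennreal (cmod (op_matrix a z w)) \<le> (\<integral>\<^sup>+ Z. ennreal (cmod (of_real ?c * (cis (fst z \<bullet> (snd w - snd z) + fst (kap z w) \<bullet> snd Z) * stf ?R (flip (Z - kap z w)) * stv a Z))) \<partial>lborel)"
      unfolding eq by (rule ennreal_cmod_integral_le)
    also have "\<dots> \<le> (\<integral>\<^sup>+ Z. ennreal (?c * K * (exp (- r * norm (kap z w - Z)) * cmod (stv a Z))) \<partial>lborel)"
    proof (intro nn_integral_mono ennreal_leI)
      fix Z
      have "cmod (stf ?R (flip (Z - kap z w))) \<le> K * exp (- r * norm (kap z w - Z))"
        using K[of "flip (Z - kap z w)"] by (simp add: norm_minus_commute)
      then have "?c * (cmod (stf ?R (flip (Z - kap z w))) * cmod (stv a Z)) \<le> ?c * (K * exp (- r * norm (kap z w - Z)) * cmod (stv a Z))"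
        using c by (intro mult_left_mono mult_right_mono) auto
      then show "cmod (of_real ?c * (cis (fst z \<bullet> (snd w - snd z) + fst (kap z w) \<bullet> snd Z) * stf ?R (flip (Z - kap z w)) * stv a Z)) \<le> ?c * K * (exp (- r * norm (kap z w - Z)) * cmod (stv a Z))"
        using c by (simp only: norm_mult norm_cis norm_of_real abs_of_pos mult_1_left mult_ac)
    qed
    finally show "ennreal (cmod (op_matrix a z w)) \<le> (\<integral>\<^sup>+ Z. ennreal (?c * K * (exp (- r * norm (kap z w - Z)) * cmod (stv a Z))) \<partial>lborel)" .
  qed
qed

section \<open>Weighted estimates\<close>

declare op_matrix_measurable [measurable del] stv_measurable [measurable del] dual_atom_measurable [measurable del]

text \<open>The frequency is the outer variable of this norm, hence the swap.\<close>

lemma M_norm_eq: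
  assumes "\<And>z. 0 \<le> \<omega> z"
  shows "M_norm p q \<omega> u = mixn q p (\<lambda>z. ennreal (\<omega> (prod.swap z)) * ennreal (cmod (stv u (prod.swap z))))"
  using assms unfolding M_norm_def mixn_def stv_def by (simp add: ennreal_mult mult.commute)

lemma W_norm_eq:
  assumes "\<And>z. 0 \<le> \<omega> z"
  shows "W_norm p q \<omega> u = mixn p q (\<lambda>z. ennreal (\<omega> z) * ennreal (cmod (stv u z)))"
  using assms unfolding W_norm_def mixn_def stv_def by (simp add: ennreal_mult mult.commute)

lemma swap_measurable [measurable (raw)]:
  fixes f :: "'c \<Rightarrow> 'a::euclidean_space \<times> 'b::euclidean_space"
  assumes [measurable]: "f \<in> borel_measurable M"
  shows "(\<lambda>x. prod.swap (f x)) \<in> borel_measurable M"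
  unfolding prod.swap_def by measurable

lemma tame_weight_measurable:
  assumes "tame_weight r w" "f \<in> borel_measurable M"
  shows "(\<lambda>x. w (f x)) \<in> borel_measurable M"
  using assms(1) by (intro measurable_compose[OF assms(2)] borel_measurable_continuous_onI) (simp add: tame_weight_def)

lemma tame_weight_pos: "tame_weight r w \<Longrightarrow> 0 < w x"
  unfolding tame_weight_def by blast

lemma tame_weight_le:
  assumes "tame_weight r w"
  shows "w p \<le> exp (r * norm (z - p)) * w z"
proof -
  have "w (z + (p - z)) \<le> exp (r * norm (p - z)) * w z" using assms unfolding tame_weight_def by blast
  then show ?thesis by (simp add: norm_minus_commute)
qed

lemma tame_weight_inverse:
  assumes w: "tame_weight r w"
  shows "tame_weight r (\<lambda>z. 1 / w z)"
proof -
  have pos: "w x > 0" for x by (rule tame_weight_pos[OF w])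
  have "1 / w (x + y) \<le> exp (r * norm y) * (1 / w x)" for x y
    using tame_weight_le[OF w, of x "x + y"] pos[of x] pos[of "x + y"] by (simp add: field_simps)
  moreover have "continuous_on UNIV (\<lambda>z. 1 / w z)"
    using w pos by (intro continuous_intros) (auto simp: tame_weight_def less_imp_neq[symmetric])
  ultimately show ?thesis using w by (simp add: tame_weight_def)
qed

lemma norm_swap [simp]: "norm (prod.swap z) = norm z"
  by (cases z) (simp add: norm_Pair add.commute)

lemma tame_weight_swap:
  fixes w :: "'a::euclidean_space \<times> 'a \<Rightarrow> real"
  assumes w: "tame_weight r w"
  shows "tame_weight r (\<lambda>z. w (prod.swap z))"
  unfolding tame_weight_def
proof (intro conjI allI)
  show "continuous_on UNIV (\<lambda>z. w (prod.swap z))"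
    by (rule continuous_on_compose2[of UNIV w, OF _ continuous_swap[OF continuous_on_id] subset_UNIV])
      (use w in \<open>simp only: tame_weight_def\<close>)
  show "w (prod.swap (x + y)) \<le> exp (r * norm y) * w (prod.swap x)" for x y
  proof -
    have "prod.swap x - prod.swap (x + y) = - prod.swap y" by (simp add: prod_eq_iff)
    then have "norm (prod.swap x - prod.swap (x + y)) = norm y" by (simp only: norm_minus_cancel norm_swap)
    with tame_weight_le[OF w, of "prod.swap (x + y)" "prod.swap x"] show ?thesis by (simp only:)
  qed
  show "0 < w (prod.swap x)" for x by (rule tame_weight_pos[OF w])
  show "0 \<le> r" using w by (simp only: tame_weight_def)
qed

lemma lborel_nn_integral_swap:
  fixes f :: "'a::euclidean_space \<times> 'b::euclidean_space \<Rightarrow> ennreal"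
  assumes [measurable]: "f \<in> borel_measurable borel"
  shows "(\<integral>\<^sup>+ z. f (prod.swap z) \<partial>lborel) = (\<integral>\<^sup>+ z. f z \<partial>lborel)"
proof -
  have m: "(\<lambda>z. f (prod.swap z)) \<in> borel_measurable borel" by measurable
  show ?thesis
    using lborel_nn_integral_fst[OF m] lborel_nn_integral_snd[OF assms] by simp
qed

lemma
  fixes f :: "'a::euclidean_space \<Rightarrow> 'b::euclidean_space \<Rightarrow> ennreal" and h :: "'a \<Rightarrow> 'b \<Rightarrow> complex"
  shows nn_integral_section_measurable: "(\<lambda>x. f (fst x) (snd x)) \<in> borel_measurable borel \<Longrightarrow> (\<lambda>x. \<integral>\<^sup>+ y. f x y \<partial>lborel) \<in> borel_measurable borel"
    and integral_section_measurable: "(\<lambda>x. h (fst x) (snd x)) \<in> borel_measurable borel \<Longrightarrow> (\<lambda>x. LINT y|lborel. h x y) \<in> borel_measurable borel"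
proof -
  have "sets (borel \<Otimes>\<^sub>M lborel) = sets (borel :: ('a \<times> 'b) measure)"
    unfolding borel_prod[symmetric] by (rule sets_pair_measure_cong) auto
  then have e: "borel_measurable (borel \<Otimes>\<^sub>M lborel) = (borel_measurable (borel :: ('a \<times> 'b) measure) :: ('a \<times> 'b \<Rightarrow> 'c::topological_space) set)"
    by (rule measurable_cong_sets) rule
  show "(\<lambda>x. \<integral>\<^sup>+ y. f x y \<partial>lborel) \<in> borel_measurable borel" if "(\<lambda>x. f (fst x) (snd x)) \<in> borel_measurable borel"
    using that by (intro lborel.borel_measurable_nn_integral) (simp add: e case_prod_beta')
  show "(\<lambda>x. LINT y|lborel. h x y) \<in> borel_measurable borel" if "(\<lambda>x. h (fst x) (snd x)) \<in> borel_measurable borel"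
    using that by (intro lborel.borel_measurable_lebesgue_integral) (simp add: e case_prod_beta')
qed

lemma exp_integral_finite:
  assumes "r > (0::real)"
  shows "(\<integral>\<^sup>+ s. ennreal (exp (- r * norm (s::'a::euclidean_space))) \<partial>lborel) < top"
  using integrable_exp_neg_norm[OF assms, where 'a='a] by (subst nn_integral_eq_integral) auto

lemma lborel_Fubini:
  fixes f :: "'a::euclidean_space \<Rightarrow> 'b::euclidean_space \<Rightarrow> complex"
  assumes "integrable lborel (\<lambda>x. f (fst x) (snd x))"
  shows "(LINT x|lborel. LINT y|lborel. f x y) = (LINT x|lborel. f (fst x) (snd x))"
    and "(LINT y|lborel. LINT x|lborel. f x y) = (LINT x|lborel. f (fst x) (snd x))"
  using lborel_integral_fst[of f] lborel_integral_snd[of f] assms by (simp_all add: case_prod_beta')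

text \<open>Hoelder against exp (- (r + 1) |z|) / w. A tame weight is bounded below by w(0) exp (- r
  |z|), so this factor is at most a multiple of exp (- |z|) and has finite conjugate norm.\<close>

lemma tame_exp_integral_finite:
  fixes w :: "'a::euclidean_space \<times> 'a \<Rightarrow> real"
  assumes w: "tame_weight r w" and p: "1 \<le> p" "1 / p + 1 / p' = 1" and q: "1 \<le> q" "1 / q + 1 / q' = 1"
    and F [measurable]: "F \<in> borel_measurable borel" and fin: "mixn p q (\<lambda>z. ennreal (w z) * F z) < top"
  shows "(\<integral>\<^sup>+ z. ennreal (exp (- (r + 1) * norm z)) * F z \<partial>lborel) < top"
proof -
  have pos: "w x > 0" for x by (rule tame_weight_pos[OF w])
  have [measurable]: "w \<in> borel_measurable borel"
    by (rule tame_weight_measurable[OF w measurable_ident_sets[OF refl]])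
  let ?g = "\<lambda>z. exp (- (r + 1) * norm z) / w z"
  have g: "?g z \<le> (1 / w 0) * exp (- 1 * norm z)" for z
  proof -
    have "w 0 \<le> exp (r * norm z) * w z" using tame_weight_le[OF w, of 0 z] by simp
    then have "exp (- (r + 1) * norm z) * w 0 \<le> exp (- (r + 1) * norm z) * (exp (r * norm z) * w z)"
      by (intro mult_left_mono) auto
    also have "\<dots> = exp (- 1 * norm z) * w z" by (simp add: algebra_simps flip: exp_add)
    finally show ?thesis using pos[of 0] pos[of z] by (simp add: field_simps)
  qed
  have "mixn p' q' (\<lambda>z. ennreal (?g z)) < top"
    by (rule mixn_exp_finite[OF conjugate_ge_1[OF p] conjugate_ge_1[OF q] _ zero_less_one g]) (use pos[of 0] in auto)
  moreover have "(\<integral>\<^sup>+ z. (ennreal (w z) * F z) * ennreal (?g z) \<partial>lborel) \<le> mixn p q (\<lambda>z. ennreal (w z) * F z) * mixn p' q' (\<lambda>z. ennreal (?g z))"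
    by (intro mixn_Holder p q) measurable
  ultimately have "(\<integral>\<^sup>+ z. (ennreal (w z) * F z) * ennreal (?g z) \<partial>lborel) < top"
    using fin by (meson ennreal_mult_less_top order_le_less_trans)
  moreover have "(ennreal (w z) * F z) * ennreal (?g z) = ennreal (exp (- (r + 1) * norm z)) * F z" for z
  proof -
    have "ennreal (w z) * ennreal (?g z) = ennreal (exp (- (r + 1) * norm z))"
      using pos[of z] by (simp flip: ennreal_mult)
    then show ?thesis by (metis mult.assoc mult.commute)
  qed
  ultimately show ?thesis by simp
qed

lemma tame_exp_integral_finite_swap:
  fixes w :: "'a::euclidean_space \<times> 'a \<Rightarrow> real"
  assumes w: "tame_weight r w" and p: "1 \<le> p" "1 / p + 1 / p' = 1" and q: "1 \<le> q" "1 / q + 1 / q' = 1"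
    and F [measurable]: "F \<in> borel_measurable borel" and fin: "mixn p q (\<lambda>z. ennreal (w (prod.swap z)) * F (prod.swap z)) < top"
  shows "(\<integral>\<^sup>+ z. ennreal (exp (- (r + 1) * norm z)) * F z \<partial>lborel) < top"
proof -
  have "(\<integral>\<^sup>+ z. ennreal (exp (- (r + 1) * norm z)) * F (prod.swap z) \<partial>lborel) < top"
    by (rule tame_exp_integral_finite[OF tame_weight_swap[OF w] p q _ fin]) measurable
  moreover have "(\<integral>\<^sup>+ z. ennreal (exp (- (r + 1) * norm (prod.swap z))) * F (prod.swap z) \<partial>lborel) = (\<integral>\<^sup>+ z. ennreal (exp (- (r + 1) * norm z)) * F z \<partial>lborel)"
    by (rule lborel_nn_integral_swap) measurable
  ultimately show ?thesis by simp
qed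

text \<open>The weight is moved from z to x at the cost exp (r |z - x|), which the kernel pays out
  of its rate r + 1. What is left is a convolution.\<close>

lemma rk_conv_pointwise:
  fixes w :: "'a::euclidean_space \<times> 'a \<Rightarrow> real"
  assumes w: "tame_weight r w"
  obtains C where "C > 0" "\<And>V z. V \<in> borel_measurable borel \<Longrightarrow>
    ennreal (w z) * (\<integral>\<^sup>+ x. ennreal (cmod (rk z x)) * V x \<partial>lborel) \<le>
    ennreal C * (\<integral>\<^sup>+ x. (ennreal (w x) * V x) * ennreal (exp (- 1 * norm (z - x))) \<partial>lborel)"
proof -
  have pos: "w x > 0" for x by (rule tame_weight_pos[OF w])
  have [measurable]: "w \<in> borel_measurable borel"
    by (rule tame_weight_measurable[OF w measurable_ident_sets[OF refl]])
  obtain C where C: "C > 0" "\<And>z p :: 'a \<times> 'a. cmod (rk z p) \<le> C * exp (- (r + 1) * norm (z - p))"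
    by (rule norm_rk_le[where r="r + 1" and 'a='a]) (rule that)
  have "ennreal (w z) * (\<integral>\<^sup>+ x. ennreal (cmod (rk z x)) * V x \<partial>lborel) \<le>
    ennreal C * (\<integral>\<^sup>+ x. (ennreal (w x) * V x) * ennreal (exp (- 1 * norm (z - x))) \<partial>lborel)"
    if [measurable]: "V \<in> borel_measurable borel" for V z
  proof -
    have b: "ennreal (w z) * (ennreal (cmod (rk z x)) * V x) \<le> ennreal C * ((ennreal (w x) * V x) * ennreal (exp (- 1 * norm (z - x))))" for x
    proof -
      have "w z * cmod (rk z x) \<le> (exp (r * norm (x - z)) * w x) * (C * exp (- (r + 1) * norm (z - x)))"
        using tame_weight_le[OF w, of z x] C(2)[of z x] pos[of x] by (intro mult_mono) auto
      also have "\<dots> = C * (w x * (exp (r * norm (z - x)) * exp (- (r + 1) * norm (z - x))))"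
        by (simp only: mult_ac norm_minus_commute[of x])
      also have "exp (r * norm (z - x)) * exp (- (r + 1) * norm (z - x)) = exp (- 1 * norm (z - x))"
        by (simp add: algebra_simps flip: exp_add)
      finally have "ennreal (w z * cmod (rk z x)) \<le> ennreal (C * (w x * exp (- 1 * norm (z - x))))" by (rule ennreal_leI)
      then have "ennreal (w z) * ennreal (cmod (rk z x)) \<le> ennreal C * (ennreal (w x) * ennreal (exp (- 1 * norm (z - x))))"
        using C(1) pos[of z] pos[of x] by (simp add: ennreal_mult)
      from mult_right_mono[OF this, of "V x"] show ?thesis by (simp add: mult_ac)
    qed
    have "ennreal (w z) * (\<integral>\<^sup>+ x. ennreal (cmod (rk z x)) * V x \<partial>lborel) = (\<integral>\<^sup>+ x. ennreal (w z) * (ennreal (cmod (rk z x)) * V x) \<partial>lborel)"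
      by (rule nn_integral_cmult[symmetric]) measurable
    also have "\<dots> \<le> (\<integral>\<^sup>+ x. ennreal C * ((ennreal (w x) * V x) * ennreal (exp (- 1 * norm (z - x)))) \<partial>lborel)"
      by (intro nn_integral_mono b)
    also have "\<dots> = ennreal C * (\<integral>\<^sup>+ x. (ennreal (w x) * V x) * ennreal (exp (- 1 * norm (z - x))) \<partial>lborel)"
      by (rule nn_integral_cmult) measurable
    finally show ?thesis .
  qed
  with C(1) show thesis by (rule that)
qed

text \<open>Integration against \<open>rk\<close> is bounded on every tamely weighted mixed norm, in
  both orders of the variables: the W order serves the target space, the swapped order the domain
  and its dual.\<close>

lemma rk_conv:
  fixes w :: "'a::euclidean_space \<times> 'a \<Rightarrow> real"
  assumes w: "tame_weight r w" and p: "1 \<le> p" "1 \<le> q"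
  obtains C where "C > 0" "\<And>V. V \<in> borel_measurable borel \<Longrightarrow>
      mixn p q (\<lambda>z. ennreal (w z) * (\<integral>\<^sup>+ x. ennreal (cmod (rk z x)) * V x \<partial>lborel)) \<le> ennreal C * mixn p q (\<lambda>z. ennreal (w z) * V z)"
    "\<And>V. V \<in> borel_measurable borel \<Longrightarrow>
      mixn p q (\<lambda>z. ennreal (w (prod.swap z)) * (\<integral>\<^sup>+ x. ennreal (cmod (rk (prod.swap z) x)) * V x \<partial>lborel)) \<le>
      ennreal C * mixn p q (\<lambda>z. ennreal (w (prod.swap z)) * V (prod.swap z))"
proof -
  have [measurable]: "w \<in> borel_measurable borel"
    by (rule tame_weight_measurable[OF w measurable_ident_sets[OF refl]])
  obtain C where C: "C > 0" "\<And>V z. V \<in> borel_measurable borel \<Longrightarrow>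
    ennreal (w z) * (\<integral>\<^sup>+ x. ennreal (cmod (rk z x)) * V x \<partial>lborel) \<le>
    ennreal C * (\<integral>\<^sup>+ x. (ennreal (w x) * V x) * ennreal (exp (- 1 * norm (z - x))) \<partial>lborel)"
    by (rule rk_conv_pointwise[OF w]) (rule that)
  let ?I = "\<integral>\<^sup>+ s. ennreal (exp (- 1 * norm (s :: 'a \<times> 'a))) \<partial>lborel"
  have I: "?I < top" by (rule exp_integral_finite) simp
  define K where "K = C * enn2real ?I + 1"
  have K: "ennreal C * (?I * t) \<le> ennreal K * t" for t
  proof -
    have "ennreal C * ?I = ennreal (C * enn2real ?I)" using I C(1) by (simp add: ennreal_mult)
    also have "\<dots> \<le> ennreal K" unfolding K_def by (intro ennreal_leI) simp
    finally show ?thesis unfolding mult.assoc[symmetric] by (intro mult_right_mono) auto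
  qed
  have K0: "K > 0" unfolding K_def using C(1) by (simp add: add_nonneg_pos)
  show thesis
  proof (rule that[OF K0])
    fix V :: "'a \<times> 'a \<Rightarrow> ennreal" assume V [measurable]: "V \<in> borel_measurable borel"
    let ?f = "\<lambda>x. ennreal (w x) * V x"
    let ?c = "\<lambda>z. \<integral>\<^sup>+ x. ?f x * ennreal (exp (- 1 * norm (z - x))) \<partial>lborel"
    have c [measurable]: "?c \<in> borel_measurable borel" by measurable
    have "mixn p q (\<lambda>z. ennreal (w z) * (\<integral>\<^sup>+ x. ennreal (cmod (rk z x)) * V x \<partial>lborel)) \<le> mixn p q (\<lambda>z. ennreal C * ?c z)"
      by (intro mixn_mono p C(2) V)
    also have "\<dots> \<le> ennreal C * mixn p q ?c" by (intro mixn_cmult_le p c)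
    also have "\<dots> \<le> ennreal C * (?I * mixn p q ?f)" by (intro mult_left_mono mixn_convolution p) auto
    also have "\<dots> \<le> ennreal K * mixn p q ?f" by (rule K)
    finally show "mixn p q (\<lambda>z. ennreal (w z) * (\<integral>\<^sup>+ x. ennreal (cmod (rk z x)) * V x \<partial>lborel)) \<le> ennreal K * mixn p q ?f" .
    have "mixn p q (\<lambda>z. ennreal (w (prod.swap z)) * (\<integral>\<^sup>+ x. ennreal (cmod (rk (prod.swap z) x)) * V x \<partial>lborel)) \<le> mixn p q (\<lambda>z. ennreal C * ?c (prod.swap z))"
      by (intro mixn_mono p C(2) V)
    also have "\<dots> \<le> ennreal C * mixn p q (\<lambda>z. ?c (prod.swap z))" by (intro mixn_cmult_le p) measurable
    also have "\<dots> \<le> ennreal C * (?I * mixn p q (\<lambda>z. ?f (prod.swap z)))" by (intro mult_left_mono mixn_swap_convolution p) auto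
    also have "\<dots> \<le> ennreal K * mixn p q (\<lambda>z. ?f (prod.swap z))" by (rule K)
    finally show "mixn p q (\<lambda>z. ennreal (w (prod.swap z)) * (\<integral>\<^sup>+ x. ennreal (cmod (rk (prod.swap z) x)) * V x \<partial>lborel)) \<le> ennreal K * mixn p q (\<lambda>z. ?f (prod.swap z))" .
  qed
qed

text \<open>The setting with tame weights. \<open>w2_le\<close> is the hypothesis on the weights
  with the denominator cleared and the four variables expressed by the two phase space
  points.\<close>

locale pdo =
  fixes p q p' q' :: ennreal
    and w0 :: "('a::euclidean_space \<times> 'a) \<times> ('a \<times> 'a) \<Rightarrow> real" and w1 w2 :: "'a \<times> 'a \<Rightarrow> real" and r0 r1 r2 C0 :: real
  assumes p: "1 \<le> p" "1 / p + 1 / p' = 1" and q: "1 \<le> q" "1 / q + 1 / q' = 1"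
    and t0: "tame_weight r0 w0" and t1: "tame_weight r1 w1" and t2: "tame_weight r2 w2"
    and C0: "C0 > 0" and w2_le: "\<And>z w. w2 z \<le> C0 * (w0 (kap z w) * w1 w)"
begin

lemma p': "1 \<le> p'" and q': "1 \<le> q'"
  by (rule conjugate_ge_1[OF p]) (rule conjugate_ge_1[OF q])

lemma pc': "1 / p' + 1 / p = 1" "1 / q' + 1 / q = 1"
  using p(2) q(2) by (simp_all add: add.commute)

lemma pos: "w0 Z > 0" "w1 z > 0" "w2 z > 0"
  by (rule tame_weight_pos[OF t0] tame_weight_pos[OF t1] tame_weight_pos[OF t2])+

lemmas w_measurable [measurable] =
  tame_weight_measurable[OF t0 measurable_ident_sets[OF refl]]
  tame_weight_measurable[OF t1 measurable_ident_sets[OF refl]]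
  tame_weight_measurable[OF t2 measurable_ident_sets[OF refl]]

text \<open>The weighted symbol after convolution with an exponential. It is the nonnegative
  function that \<open>kern\<close> turns into a majorant of the matrix.\<close>

definition At :: "('a \<times> 'a) dual \<Rightarrow> ('a \<times> 'a) \<times> ('a \<times> 'a) \<Rightarrow> ennreal" where
  "At a Z0 = (\<integral>\<^sup>+ Z. (ennreal (w0 Z) * ennreal (cmod (stv a Z))) * ennreal (exp (- 1 * norm (Z0 - Z))) \<partial>lborel)"

lemma At_measurable:
  assumes a: "a \<in> Sigma1'"
  shows "At a \<in> borel_measurable borel"
proof -
  have [measurable]: "stv a \<in> borel_measurable borel" using stv_measurable[OF a, of "\<lambda>x. x" borel] by simp
  show ?thesis unfolding At_def by measurable
qed

lemma At_bound:
  assumes a: "a \<in> Sigma1'"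
  shows "mixn p q (At a) \<le> (\<integral>\<^sup>+ s. ennreal (exp (- 1 * norm (s :: ('a \<times> 'a) \<times> ('a \<times> 'a)))) \<partial>lborel) * W_norm p q w0 a"
proof -
  have [measurable]: "stv a \<in> borel_measurable borel" using stv_measurable[OF a, of "\<lambda>x. x" borel] by simp
  show ?thesis
    unfolding At_def W_norm_eq[OF less_imp_le[OF pos(1)]] by (intro mixn_convolution p q) measurable
qed

text \<open>Of the rate r0 + 1, the part r0 moves \<open>w0\<close> from \<open>kap z w\<close> to
  the integration point and the remaining 1 is the convolution in \<open>At\<close>.\<close>

lemma op_matrix_weight_bound:
  obtains C where "C > 0" "\<And>a z w. a \<in> Sigma1' \<Longrightarrow>
    ennreal (w2 z) * ennreal (cmod (op_matrix a z w)) \<le> ennreal C * (kern (At a) z w * ennreal (w1 w))"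
proof -
  have r: "r0 + 1 > 0" using t0 by (simp add: tame_weight_def add_nonneg_pos)
  obtain C where C: "C > 0" "\<And>a z w. a \<in> Sigma1' \<Longrightarrow> ennreal (cmod (op_matrix a z (w :: 'a \<times> 'a))) \<le>
    (\<integral>\<^sup>+ Z. ennreal (C * (exp (- (r0 + 1) * norm (kap z w - Z)) * cmod (stv a Z))) \<partial>lborel)"
    by (rule op_matrix_bound[OF r, where 'a='a]) (rule that)
  show thesis
  proof (rule that)
    show "C * C0 > 0" using C(1) C0 by simp
    fix a :: "('a \<times> 'a) dual" and z w assume a: "a \<in> Sigma1'"
    have [measurable]: "stv a \<in> borel_measurable borel" using stv_measurable[OF a, of "\<lambda>x. x" borel] by simp
    have b: "w2 z * (C * (exp (- (r0 + 1) * norm (kap z w - Z)) * cmod (stv a Z))) \<le>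
      (C * C0 * w1 w) * (w0 Z * cmod (stv a Z) * exp (- 1 * norm (kap z w - Z)))" for Z
    proof -
      have "w0 (kap z w) \<le> exp (r0 * norm (kap z w - Z)) * w0 Z"
        using tame_weight_le[OF t0, of "kap z w" Z] by (simp add: norm_minus_commute)
      then have "C0 * (w0 (kap z w) * w1 w) \<le> C0 * ((exp (r0 * norm (kap z w - Z)) * w0 Z) * w1 w)"
        using C0 pos(2)[of w] by (intro mult_left_mono mult_right_mono) (simp_all only: less_imp_le)
      with w2_le[of z w] have "w2 z \<le> C0 * ((exp (r0 * norm (kap z w - Z)) * w0 Z) * w1 w)" by (rule order_trans)
      then have "w2 z * (C * (exp (- (r0 + 1) * norm (kap z w - Z)) * cmod (stv a Z))) \<le>
        C0 * ((exp (r0 * norm (kap z w - Z)) * w0 Z) * w1 w) * (C * (exp (- (r0 + 1) * norm (kap z w - Z)) * cmod (stv a Z)))"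
        using C(1) by (intro mult_right_mono) auto
      also have "\<dots> = (C * C0 * w1 w) * (w0 Z * cmod (stv a Z) * (exp (r0 * norm (kap z w - Z)) * exp (- (r0 + 1) * norm (kap z w - Z))))"
        by (simp only: mult_ac)
      also have "exp (r0 * norm (kap z w - Z)) * exp (- (r0 + 1) * norm (kap z w - Z)) = exp (- 1 * norm (kap z w - Z))"
        by (simp add: algebra_simps flip: exp_add)
      finally show ?thesis .
    qed
    have "ennreal (w2 z) * ennreal (cmod (op_matrix a z w)) \<le> ennreal (w2 z) * (\<integral>\<^sup>+ Z. ennreal (C * (exp (- (r0 + 1) * norm (kap z w - Z)) * cmod (stv a Z))) \<partial>lborel)"
      by (intro mult_left_mono C(2) a) auto
    also have "\<dots> = (\<integral>\<^sup>+ Z. ennreal (w2 z) * ennreal (C * (exp (- (r0 + 1) * norm (kap z w - Z)) * cmod (stv a Z))) \<partial>lborel)"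
      by (rule nn_integral_cmult[symmetric]) measurable
    also have "\<dots> \<le> (\<integral>\<^sup>+ Z. ennreal (C * C0 * w1 w) * ((ennreal (w0 Z) * ennreal (cmod (stv a Z))) * ennreal (exp (- 1 * norm (kap z w - Z)))) \<partial>lborel)"
    proof (rule nn_integral_mono)
      fix Z
      have "ennreal (w2 z) * ennreal (C * (exp (- (r0 + 1) * norm (kap z w - Z)) * cmod (stv a Z))) =
        ennreal (w2 z * (C * (exp (- (r0 + 1) * norm (kap z w - Z)) * cmod (stv a Z))))"
        using C(1) pos(3)[of z] by (intro ennreal_mult[symmetric]) auto
      also have "\<dots> \<le> ennreal ((C * C0 * w1 w) * (w0 Z * cmod (stv a Z) * exp (- 1 * norm (kap z w - Z))))"
        by (rule ennreal_leI[OF b])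
      also have "\<dots> = ennreal (C * C0 * w1 w) * ((ennreal (w0 Z) * ennreal (cmod (stv a Z))) * ennreal (exp (- 1 * norm (kap z w - Z))))"
        using C(1) C0 pos(1)[of Z] pos(2)[of w] by (simp add: ennreal_mult)
      finally show "ennreal (w2 z) * ennreal (C * (exp (- (r0 + 1) * norm (kap z w - Z)) * cmod (stv a Z))) \<le>
        ennreal (C * C0 * w1 w) * ((ennreal (w0 Z) * ennreal (cmod (stv a Z))) * ennreal (exp (- 1 * norm (kap z w - Z))))" .
    qed
    also have "\<dots> = ennreal (C * C0 * w1 w) * At a (kap z w)"
      unfolding At_def by (rule nn_integral_cmult) measurable
    also have "\<dots> = ennreal (C * C0) * (kern (At a) z w * ennreal (w1 w))"
      unfolding kern_def[OF p q At_measurable[OF a]] kap_def using C(1) C0 pos(2)[of w] by (simp add: ennreal_mult mult_ac)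
    finally show "ennreal (w2 z) * ennreal (cmod (op_matrix a z w)) \<le> ennreal (C * C0) * (kern (At a) z w * ennreal (w1 w))" .
  qed
qed

definition N1 :: "'a dual \<Rightarrow> ennreal" where
  "N1 u = mixn p' q' (\<lambda>z. ennreal (w1 (prod.swap z)) * ennreal (cmod (stv u (prod.swap z))))"

text \<open>The operator with all moduli inside the integral. Its finiteness is established first,
  and it justifies every later use of Fubini's theorem.\<close>

definition habs :: "('a \<times> 'a) dual \<Rightarrow> 'a dual \<Rightarrow> 'a \<times> 'a \<Rightarrow> ennreal" where
  "habs a u z = (\<integral>\<^sup>+ w. ennreal (cmod (op_matrix a z w)) * ennreal (cmod (stv u w)) \<partial>lborel)"

lemma habs_measurable:
  assumes a: "a \<in> Sigma1'" and u: "u \<in> Sigma1'"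
  shows "habs a u \<in> borel_measurable borel"
  unfolding habs_def
  by (intro nn_integral_section_measurable borel_measurable_times_ennreal
      measurable_compose[OF measurable_compose[OF op_matrix_measurable[OF a] borel_measurable_norm] measurable_ennreal]
      measurable_compose[OF measurable_compose[OF stv_measurable[OF u] borel_measurable_norm] measurable_ennreal]
      measurable_fst_borel measurable_snd_borel measurable_ident_sets[OF refl])

lemma habs_bound:
  obtains C where "C > 0" "\<And>a u. a \<in> Sigma1' \<Longrightarrow> u \<in> Sigma1' \<Longrightarrow>
    mixn p q (\<lambda>z. ennreal (w2 z) * habs a u z) \<le> ennreal C * (mixn p q (At a) * N1 u)"
proof -
  obtain C where C: "C > 0" "\<And>a z w. a \<in> Sigma1' \<Longrightarrow>
    ennreal (w2 z) * ennreal (cmod (op_matrix a z w)) \<le> ennreal C * (kern (At a) z w * ennreal (w1 w))"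
    by (rule op_matrix_weight_bound) (rule that)
  show thesis
  proof (rule that[OF C(1)])
    fix a :: "('a \<times> 'a) dual" and u :: "'a dual" assume a: "a \<in> Sigma1'" and u: "u \<in> Sigma1'"
    note A = At_measurable[OF a]
    have [measurable]: "stv u \<in> borel_measurable borel" using stv_measurable[OF u, of "\<lambda>x. x" borel] by simp
    have J1 [measurable]: "(\<lambda>w. op_matrix a z w) \<in> borel_measurable borel" for z by (rule op_matrix_measurable[OF a(1) borel_measurable_const measurable_ident_sets[OF refl]])
    have k1 [measurable]: "(\<lambda>w. kern (At a) z w) \<in> borel_measurable borel" for z
      by (intro kern_measurable[OF p q A] continuous_intros)
    let ?F = "\<lambda>w. ennreal (w1 w) * ennreal (cmod (stv u w))"
    let ?K = "\<lambda>z. \<integral>\<^sup>+ w. kern (At a) z w * ?F w \<partial>lborel"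
    have km: "?K \<in> borel_measurable borel"
      by (intro nn_integral_section_measurable borel_measurable_times_ennreal kern_measurable[OF p q A] continuous_intros) measurable
    have "mixn p q (\<lambda>z. ennreal (w2 z) * habs a u z) \<le> mixn p q (\<lambda>z. ennreal C * ?K z)"
    proof (intro mixn_mono p(1) q(1))
      fix z
      have "ennreal (w2 z) * habs a u z = (\<integral>\<^sup>+ w. ennreal (w2 z) * (ennreal (cmod (op_matrix a z w)) * ennreal (cmod (stv u w))) \<partial>lborel)"
        unfolding habs_def by (rule nn_integral_cmult[symmetric]) measurable
      also have "\<dots> \<le> (\<integral>\<^sup>+ w. ennreal C * (kern (At a) z w * ?F w) \<partial>lborel)"
        using mult_right_mono[OF C(2)[OF a, of z], of "ennreal (cmod (stv u _))"] by (intro nn_integral_mono) (simp add: mult.assoc)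
      also have "\<dots> = ennreal C * ?K z" by (rule nn_integral_cmult) measurable
      finally show "ennreal (w2 z) * habs a u z \<le> ennreal C * ?K z" .
    qed
    also have "\<dots> \<le> ennreal C * mixn p q ?K" by (intro mixn_cmult_le p q km)
    also have "\<dots> \<le> ennreal C * (mixn p q (At a) * N1 u)"
      unfolding N1_def by (intro mult_left_mono kern_bound[OF p q A]) auto
    finally show "mixn p q (\<lambda>z. ennreal (w2 z) * habs a u z) \<le> ennreal C * (mixn p q (At a) * N1 u)" .
  qed
qed

definition admissible :: "('a \<times> 'a) dual \<Rightarrow> 'a dual \<Rightarrow> bool" where
  "admissible a u \<longleftrightarrow> a \<in> Sigma1' \<and> W_norm p q w0 a < top \<and> u \<in> Sigma1' \<and> N1 u < top"

lemma At_finite: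
  assumes "a \<in> Sigma1'" "W_norm p q w0 a < top"
  shows "mixn p q (At a) < top"
  using At_bound[OF assms(1)] exp_integral_finite[OF zero_less_one, where 'a="('a \<times> 'a) \<times> ('a \<times> 'a)"] assms(2)
  by (meson ennreal_mult_less_top order_le_less_trans)

lemma habs_exp_finite:
  assumes "admissible a u"
  shows "(\<integral>\<^sup>+ z. ennreal (exp (- (r2 + 1) * norm z)) * habs a u z \<partial>lborel) < top"
proof -
  have a: "a \<in> Sigma1'" "W_norm p q w0 a < top" and u: "u \<in> Sigma1'" "N1 u < top"
    using assms by (auto simp: admissible_def)
  obtain C where C: "C > 0" "\<And>a u. a \<in> Sigma1' \<Longrightarrow> u \<in> Sigma1' \<Longrightarrow>
    mixn p q (\<lambda>z. ennreal (w2 z) * habs a u z) \<le> ennreal C * (mixn p q (At a) * N1 u)"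
    by (rule habs_bound) (rule that)
  have "ennreal C * (mixn p q (At a) * N1 u) < top"
    using At_finite[OF a] u(2) by (simp add: ennreal_mult_less_top)
  then have "mixn p q (\<lambda>z. ennreal (w2 z) * habs a u z) < top"
    using C(2)[OF a(1) u(1)] by (rule order_le_less_trans[rotated])
  then show ?thesis by (intro tame_exp_integral_finite[OF t2 p q] habs_measurable a u)
qed

lemma op_matrix_pair_measurable:
  fixes g :: "'a \<Rightarrow> complex"
  assumes a: "a \<in> Sigma1'" and u: "u \<in> Sigma1'" and g: "g \<in> Sigma1"
  shows "(\<lambda>x. stf g (flip (fst x)) * op_matrix a (fst x) (snd x) * stv u (snd x)) \<in> borel_measurable borel"
proof -
  have 1: "(\<lambda>x. stf g (flip (fst x))) \<in> borel_measurable (borel :: (('a \<times> 'a) \<times> ('a \<times> 'a)) measure)"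
    by (intro measurable_compose[OF _ stf_measurable[OF Sigma1_borel[OF g]]] flip_measurable measurable_fst_borel) measurable
  show ?thesis
    by (intro borel_measurable_times 1 op_matrix_measurable[OF a] stv_measurable[OF u] measurable_fst_borel measurable_snd_borel) measurable
qed

text \<open>Tonelli reduces the double integral to \<open>habs\<close>, and the decay of
  \<open>stf g\<close> at the rate r2 + 1 meets \<open>habs_exp_finite\<close>.\<close>

lemma op_matrix_pair_integrable:
  fixes g :: "'a \<Rightarrow> complex"
  assumes adm: "admissible a u" and g: "g \<in> Sigma1"
  shows "integrable lborel (\<lambda>x. stf g (flip (fst x)) * op_matrix a (fst x) (snd x) * stv u (snd x))"
proof (rule integrableI_bounded)
  have a: "a \<in> Sigma1'" "W_norm p q w0 a < top" and u: "u \<in> Sigma1'" "N1 u < top"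
    using adm by (auto simp: admissible_def)
  note m = op_matrix_pair_measurable[OF a(1) u(1) g]
  then show "(\<lambda>x. stf g (flip (fst x)) * op_matrix a (fst x) (snd x) * stv u (snd x)) \<in> borel_measurable lborel" by simp
  have [measurable]: "stv u \<in> borel_measurable borel" using stv_measurable[OF u(1), of "\<lambda>x. x" borel] by simp
  have J1 [measurable]: "(\<lambda>w. op_matrix a z w) \<in> borel_measurable borel" for z by (rule op_matrix_measurable[OF a(1) borel_measurable_const measurable_ident_sets[OF refl]])
  have r: "r2 + 1 > 0" using t2 by (simp add: tame_weight_def add_nonneg_pos)
  obtain h C where hC: "h > 0" "C > 0" "\<And>f z. f \<in> (Sigma1 :: ('a \<Rightarrow> complex) set) \<Longrightarrow> cmod (stf f z) \<le> C * gs_val h f * exp (- (r2 + 1) * norm z)"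
    by (rule stf_Sigma1_decay[OF r, where 'a='a]) (rule that)
  have [measurable]: "habs a u \<in> borel_measurable borel" by (intro habs_measurable a u)
  have "(\<integral>\<^sup>+ x. ennreal (norm (stf g (flip (fst x)) * op_matrix a (fst x) (snd x) * stv u (snd x))) \<partial>lborel) =
    (\<integral>\<^sup>+ z. \<integral>\<^sup>+ w. ennreal (norm (stf g (flip z) * op_matrix a z w * stv u w)) \<partial>lborel \<partial>lborel)"
    using lborel_nn_integral_fst[OF measurable_compose[OF measurable_compose[OF m borel_measurable_norm] measurable_ennreal]] by simp
  also have "\<dots> = (\<integral>\<^sup>+ z. ennreal (cmod (stf g (flip z))) * habs a u z \<partial>lborel)"
  proof (intro nn_integral_cong)
    fix z
    have "(\<integral>\<^sup>+ w. ennreal (norm (stf g (flip z) * op_matrix a z w * stv u w)) \<partial>lborel) =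
      (\<integral>\<^sup>+ w. ennreal (cmod (stf g (flip z))) * (ennreal (cmod (op_matrix a z w)) * ennreal (cmod (stv u w))) \<partial>lborel)"
      by (simp add: norm_mult ennreal_mult mult.assoc)
    also have "\<dots> = ennreal (cmod (stf g (flip z))) * habs a u z"
      unfolding habs_def by (rule nn_integral_cmult) measurable
    finally show "(\<integral>\<^sup>+ w. ennreal (norm (stf g (flip z) * op_matrix a z w * stv u w)) \<partial>lborel) = ennreal (cmod (stf g (flip z))) * habs a u z" .
  qed
  also have "\<dots> \<le> (\<integral>\<^sup>+ z. ennreal (C * gs_val h g) * (ennreal (exp (- (r2 + 1) * norm z)) * habs a u z) \<partial>lborel)"
  proof (intro nn_integral_mono)
    fix z
    have "ennreal (cmod (stf g (flip z))) \<le> ennreal (C * gs_val h g * exp (- (r2 + 1) * norm z))"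
      using hC(3)[OF g, of "flip z"] by (intro ennreal_leI) simp
    also have "\<dots> = ennreal (C * gs_val h g) * ennreal (exp (- (r2 + 1) * norm z))"
      using hC(2) by (intro ennreal_mult) auto
    finally show "ennreal (cmod (stf g (flip z))) * habs a u z \<le> ennreal (C * gs_val h g) * (ennreal (exp (- (r2 + 1) * norm z)) * habs a u z)"
      unfolding mult.assoc[symmetric] by (intro mult_right_mono) auto
  qed
  also have "\<dots> = ennreal (C * gs_val h g) * (\<integral>\<^sup>+ z. ennreal (exp (- (r2 + 1) * norm z)) * habs a u z \<partial>lborel)"
    by (rule nn_integral_cmult) measurable
  also have "\<dots> < top" using habs_exp_finite[OF adm] by (simp add: ennreal_mult_less_top)
  finally show "(\<integral>\<^sup>+ x. ennreal (norm (stf g (flip (fst x)) * op_matrix a (fst x) (snd x) * stv u (snd x))) \<partial>lborel) < \<infinity>" by simp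
qed

text \<open>The extension, given by a formula on the whole space. It is written as one integral over
  the product, so that both orders of integration are available.\<close>

definition T :: "('a \<times> 'a) dual \<Rightarrow> 'a dual \<Rightarrow> 'a dual" where
  "T a u g = (if g \<in> Sigma1 then LINT x|lborel. stf g (flip (fst x)) * op_matrix a (fst x) (snd x) * stv u (snd x) else 0)"

definition H :: "('a \<times> 'a) dual \<Rightarrow> 'a dual \<Rightarrow> 'a \<times> 'a \<Rightarrow> complex" where
  "H a u z = (LINT w|lborel. op_matrix a z w * stv u w)"

lemma norm_H_le: "ennreal (cmod (H a u z)) \<le> habs a u z"
  unfolding H_def habs_def
  using ennreal_cmod_integral_le[of lborel "\<lambda>w. op_matrix a z w * stv u w"] by (simp add: norm_mult ennreal_mult)

lemma H_measurable:
  assumes a: "a \<in> Sigma1'" and u: "u \<in> Sigma1'"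
  shows "H a u \<in> borel_measurable borel"
  unfolding H_def
  by (intro integral_section_measurable borel_measurable_times op_matrix_measurable[OF a] stv_measurable[OF u]
      measurable_fst_borel measurable_snd_borel measurable_ident_sets[OF refl])

lemma H_integrable:
  assumes adm: "admissible a u"
  shows "integrable lborel (\<lambda>z. cmod (H a u z) * exp (- (r2 + 1) * norm z))"
proof (rule integrableI_bounded)
  have a: "a \<in> Sigma1'" and u: "u \<in> Sigma1'"
    using adm by (auto simp: admissible_def)
  have [measurable]: "H a u \<in> borel_measurable borel" by (rule H_measurable[OF a u])
  show "(\<lambda>z. cmod (H a u z) * exp (- (r2 + 1) * norm z)) \<in> borel_measurable lborel" by measurable
  have "(\<integral>\<^sup>+ z. ennreal (norm (cmod (H a u z) * exp (- (r2 + 1) * norm z))) \<partial>lborel) \<le>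
    (\<integral>\<^sup>+ z. ennreal (exp (- (r2 + 1) * norm z)) * habs a u z \<partial>lborel)"
  proof (intro nn_integral_mono)
    fix z
    have "ennreal (norm (cmod (H a u z) * exp (- (r2 + 1) * norm z))) = ennreal (exp (- (r2 + 1) * norm z)) * ennreal (cmod (H a u z))"
      by (subst ennreal_mult[symmetric]) (auto simp: abs_mult mult.commute)
    then show "ennreal (norm (cmod (H a u z) * exp (- (r2 + 1) * norm z))) \<le> ennreal (exp (- (r2 + 1) * norm z)) * habs a u z"
      by (simp only:) (intro mult_left_mono norm_H_le, simp)
  qed
  also note habs_exp_finite[OF adm]
  finally show "(\<integral>\<^sup>+ z. ennreal (norm (cmod (H a u z) * exp (- (r2 + 1) * norm z))) \<partial>lborel) < \<infinity>" by simp
qed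

text \<open>Integrating in w first shows that \<open>T a u\<close> is synthesised from
  \<open>H a u\<close>. This gives both membership in the dual and, via \<open>stv_dsynth\<close>,
  the transform.\<close>

lemma T_eq_dsynth:
  assumes adm: "admissible a u"
  shows "T a u = dsynth (H a u)"
proof
  fix g
  show "T a u g = dsynth (H a u) g"
  proof (cases "g \<in> Sigma1")
    case True
    have "(LINT z|lborel. LINT w|lborel. stf g (flip z) * op_matrix a z w * stv u w) = T a u g"
      unfolding T_def if_P[OF True] by (rule lborel_Fubini(1)[OF op_matrix_pair_integrable[OF adm True]])
    then show ?thesis unfolding dsynth_def H_def if_P[OF True]
      by (simp only: mult.assoc integral_mult_right_zero)
  qed (simp add: T_def dsynth_def)
qed

lemma T_Sigma1':
  assumes adm: "admissible a u"
  shows "T a u \<in> Sigma1'"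
proof -
  have "H a u \<in> borel_measurable borel" using adm by (intro H_measurable) (auto simp: admissible_def)
  then show ?thesis unfolding T_eq_dsynth[OF adm] by (rule dsynth_Sigma1'[OF _ H_integrable[OF adm]])
qed

text \<open>The transform of \<open>T a u\<close> is \<open>H a u\<close> after integration against
  \<open>rk\<close>, so the estimates for \<open>habs\<close> and \<open>rk\<close> are
  composed.\<close>

lemma T_bound:
  obtains C where "C > 0" "\<And>a u. admissible a u \<Longrightarrow> W_norm p q w2 (T a u) \<le> ennreal C * W_norm p q w0 a * N1 u"
proof -
  obtain C1 where C1: "C1 > 0" "\<And>a u. a \<in> Sigma1' \<Longrightarrow> u \<in> Sigma1' \<Longrightarrow>
    mixn p q (\<lambda>z. ennreal (w2 z) * habs a u z) \<le> ennreal C1 * (mixn p q (At a) * N1 u)"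
    by (rule habs_bound) (rule that)
  obtain C2 where C2: "C2 > 0" "\<And>V. V \<in> borel_measurable borel \<Longrightarrow>
      mixn p q (\<lambda>z. ennreal (w2 z) * (\<integral>\<^sup>+ x. ennreal (cmod (rk z x)) * V x \<partial>lborel)) \<le> ennreal C2 * mixn p q (\<lambda>z. ennreal (w2 z) * V z)"
    by (rule rk_conv[OF t2 p(1) q(1)]) (rule that)
  let ?I = "\<integral>\<^sup>+ s. ennreal (exp (- 1 * norm (s :: ('a \<times> 'a) \<times> ('a \<times> 'a)))) \<partial>lborel"
  have I: "?I = ennreal (enn2real ?I)"
    using exp_integral_finite[OF zero_less_one, where 'a="('a \<times> 'a) \<times> ('a \<times> 'a)"] by simp
  define K where "K = C2 * C1 * (enn2real ?I + 1)"
  show thesis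
  proof (rule that)
    show "K > 0" unfolding K_def using C1(1) C2(1) by (intro mult_pos_pos) (auto simp: add_nonneg_pos)
    fix a :: "('a \<times> 'a) dual" and u :: "'a dual" assume adm: "admissible a u"
    have a: "a \<in> Sigma1'" and u: "u \<in> Sigma1'"
      using adm by (auto simp: admissible_def)
    note hm = habs_measurable[OF a u]
    have "W_norm p q w2 (T a u) = mixn p q (\<lambda>z. ennreal (w2 z) * ennreal (cmod (stv (T a u) z)))"
      by (rule W_norm_eq[OF less_imp_le[OF pos(3)]])
    also have "\<dots> \<le> mixn p q (\<lambda>z. ennreal (w2 z) * (\<integral>\<^sup>+ x. ennreal (cmod (rk z x)) * habs a u x \<partial>lborel))"
    proof (intro mixn_mono p q mult_left_mono)
      fix z
      have "ennreal (cmod (stv (T a u) z)) \<le> (\<integral>\<^sup>+ x. ennreal (cmod (rk z x * H a u x)) \<partial>lborel)"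
        unfolding T_eq_dsynth[OF adm] stv_dsynth by (rule ennreal_cmod_integral_le)
      also have "\<dots> \<le> (\<integral>\<^sup>+ x. ennreal (cmod (rk z x)) * habs a u x \<partial>lborel)"
        by (intro nn_integral_mono) (simp add: norm_mult ennreal_mult mult_left_mono norm_H_le)
      finally show "ennreal (cmod (stv (T a u) z)) \<le> (\<integral>\<^sup>+ x. ennreal (cmod (rk z x)) * habs a u x \<partial>lborel)" .
    qed simp
    also have "\<dots> \<le> ennreal C2 * mixn p q (\<lambda>z. ennreal (w2 z) * habs a u z)" by (rule C2(2)[OF hm])
    also have "\<dots> \<le> ennreal C2 * (ennreal C1 * ((?I * W_norm p q w0 a) * N1 u))"
      by (intro mult_left_mono order_trans[OF C1(2)[OF a u]] mult_right_mono At_bound a) auto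
    also have "\<dots> = (ennreal C2 * ennreal C1 * ?I) * W_norm p q w0 a * N1 u" by (simp only: mult_ac)
    also have "\<dots> \<le> ennreal K * W_norm p q w0 a * N1 u"
    proof (intro mult_right_mono)
      have "ennreal C2 * ennreal C1 * ?I = ennreal (C2 * C1 * enn2real ?I)"
        by (subst I) (use C1(1) C2(1) in \<open>simp add: ennreal_mult\<close>)
      also have "\<dots> \<le> ennreal K" unfolding K_def using C1(1) C2(1) by (intro ennreal_leI mult_left_mono) auto
      finally show "ennreal C2 * ennreal C1 * ?I \<le> ennreal K" .
    qed auto
    finally show "W_norm p q w2 (T a u) \<le> ennreal K * W_norm p q w0 a * N1 u" .
  qed
qed

end

section \<open>Truncated synthesis\<close>

definition cutoff :: "'a::euclidean_space dual \<Rightarrow> nat \<Rightarrow> 'a \<times> 'a \<Rightarrow> complex" where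
  "cutoff u k p = (if norm p \<le> real k then stv u p else 0)"

definition trunc :: "'a::euclidean_space dual \<Rightarrow> nat \<Rightarrow> 'a \<Rightarrow> complex" where
  "trunc u k = synthesis.syn lborel (\<lambda>p. of_real (fc DIM('a)) * cutoff u k p) (\<lambda>z. z)"

lemma stv_borel: "u \<in> Sigma1' \<Longrightarrow> stv u \<in> borel_measurable borel"
  using stv_measurable[of u "\<lambda>x. x" borel] by simp

lemma cutoff_measurable:
  assumes u: "u \<in> Sigma1'"
  shows "cutoff u k \<in> borel_measurable borel"
proof -
  note [measurable] = stv_borel[OF u]
  show ?thesis unfolding cutoff_def by measurable
qed

text \<open>On the ball of radius k growth can be traded for decay: exp (s |z|) <= exp ((s + r) k)
  exp (- r |z|).\<close>

lemma trunc_synthesis: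
  fixes u :: "'a::euclidean_space dual"
  assumes u: "u \<in> Sigma1'"
  shows "synthesis lborel (\<lambda>p. of_real (fc DIM('a)) * cutoff u k p) (\<lambda>z. z)"
proof (rule synthesis_exp_boundI)
  note [measurable] = cutoff_measurable[OF u]
  show "(\<lambda>p. of_real (fc DIM('a)) * cutoff u k p) \<in> borel_measurable borel" by measurable
  fix r :: real assume r: "r > 0"
  obtain C s where C: "C > 0" "s > 0" "\<And>z. cmod (stv u z) \<le> C * exp (s * norm z)"
    by (rule stv_growth[OF u]) (rule that)
  have "cmod (of_real (fc DIM('a)) * cutoff u k z) \<le> fc DIM('a) * (C * exp ((s + r) * real k)) * exp (- r * norm z)" for z
  proof (cases "norm z \<le> real k")
    case True
    have "s * norm z \<le> (s + r) * real k + - r * norm z"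
      using mult_left_mono[OF True, of "s + r"] C(2) r by (simp add: algebra_simps)
    then have "exp (s * norm z) \<le> exp ((s + r) * real k) * exp (- r * norm z)" by (simp flip: exp_add)
    then have "C * exp (s * norm z) \<le> C * (exp ((s + r) * real k) * exp (- r * norm z))" using C(1) by (intro mult_left_mono) auto
    with C(3)[of z] have "cmod (stv u z) \<le> C * (exp ((s + r) * real k) * exp (- r * norm z))" by (rule order_trans)
    from mult_left_mono[OF this fc_nonneg[of "DIM('a)"]] show ?thesis
      using True fc_nonneg[of "DIM('a)"] by (simp add: cutoff_def norm_mult mult_ac)
  next
    case False
    then show ?thesis using C(1) fc_nonneg[of "DIM('a)"] by (simp add: cutoff_def)
  qed
  then show "\<exists>M. \<forall>z. cmod (of_real (fc DIM('a)) * cutoff u k z) \<le> M * exp (- r * norm z)" by blast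
qed

lemma trunc_Sigma1: "u \<in> Sigma1' \<Longrightarrow> trunc u k \<in> Sigma1"
  unfolding trunc_def by (intro synthesis.syn_Sigma1 trunc_synthesis)

lemma stf_trunc:
  assumes u: "u \<in> Sigma1'"
  shows "stf (trunc u k) z = (LINT p|lborel. rk z p * cutoff u k p)"
  unfolding trunc_def stf_syn[OF trunc_synthesis[OF u]] rk_def by (simp only: mult_ac)

lemma rk_integrable:
  fixes u :: "'a::euclidean_space dual"
  assumes u: "u \<in> Sigma1'"
  shows "integrable lborel (\<lambda>p. rk z p * stv u p)"
proof -
  have "integrable lborel (\<lambda>p. stf (atom p) z * stv u p)"
    using dual_eq'(2)[OF u atom_Sigma1[of "flip z"]] unfolding stf_atom_flip .
  from integrable_mult_right[OF this, of "of_real (fc DIM('a))"] show ?thesis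
    unfolding rk_def by (simp only: mult.assoc)
qed

lemma norm_cutoff_le: "cmod (cutoff u k p) \<le> cmod (stv u p)"
  by (simp add: cutoff_def)

lemma rk_cutoff_integrable:
  assumes u: "u \<in> Sigma1'"
  shows "integrable lborel (\<lambda>p. rk z p * cutoff u k p)"
proof (rule Bochner_Integration.integrable_bound[OF rk_integrable[OF u]])
  note [measurable] = cutoff_measurable[OF u]
  show "(\<lambda>p. rk z p * cutoff u k p) \<in> borel_measurable lborel" by measurable
  show "AE p in lborel. norm (rk z p * cutoff u k p) \<le> norm (rk z p * stv u p)"
    by (simp add: norm_mult mult_left_mono norm_cutoff_le)
qed

lemma cutoff_tendsto: "(\<lambda>k. cutoff u k p) \<longlonglongrightarrow> stv u p"
proof (rule tendsto_eventually)
  have "\<forall>\<^sub>F k in sequentially. norm p \<le> real k"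
    using eventually_ge_at_top[of "nat \<lceil>norm p\<rceil>"] by eventually_elim linarith
  then show "\<forall>\<^sub>F k in sequentially. cutoff u k p = stv u p"
    by eventually_elim (simp add: cutoff_def)
qed

section \<open>The L2 form and approximation by truncations\<close>

lemma cnj_measurable:
  assumes "f \<in> borel_measurable M"
  shows "(\<lambda>z. cnj (f z)) \<in> borel_measurable M"
  by (rule measurable_compose[OF assms borel_measurable_continuous_onI[OF continuous_on_cnj[OF continuous_on_id]]])

lemma stv_linear:
  "stv (\<lambda>g. u g + v g) z = stv u z + stv v z" "stv (\<lambda>g. u g - v g) z = stv u z - stv v z" "stv (\<lambda>g. c * u g) z = c * stv u z"
  by (simp_all add: stv_eq algebra_simps)

lemma L2_form_eq: "L2_form u v = (LINT z|lborel. stv u z * cnj (stv v z))"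
  unfolding L2_form_def stv_def case_prod_beta' ..

lemma stf_tame_bound:
  fixes w :: "'a::euclidean_space \<times> 'a \<Rightarrow> real"
  assumes w: "tame_weight r w" and g: "g \<in> Sigma1"
  obtains K where "K \<ge> 0" "\<And>z. w z * cmod (stf g z) \<le> K * exp (- 1 * norm z)"
proof -
  have r: "r + 1 > 0" using w by (simp add: tame_weight_def add_nonneg_pos)
  obtain h C where hC: "h > 0" "C > 0" "\<And>f z. f \<in> (Sigma1 :: ('a \<Rightarrow> complex) set) \<Longrightarrow> cmod (stf f z) \<le> C * gs_val h f * exp (- (r + 1) * norm z)"
    by (rule stf_Sigma1_decay[OF r, where 'a='a]) (rule that)
  show thesis
  proof (rule that)
    show "w 0 * (C * gs_val h g) \<ge> 0" using hC(2) tame_weight_pos[OF w, of 0] by simp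
    fix z
    have "w z * cmod (stf g z) \<le> (exp (r * norm z) * w 0) * (C * gs_val h g * exp (- (r + 1) * norm z))"
      using tame_weight_le[OF w, of z 0] hC(3)[OF g, of z] tame_weight_pos[OF w, of 0] by (intro mult_mono) auto
    also have "\<dots> = w 0 * (C * gs_val h g) * (exp (r * norm z) * exp (- (r + 1) * norm z))" by (simp only: mult_ac)
    also have "exp (r * norm z) * exp (- (r + 1) * norm z) = exp (- 1 * norm z)"
      by (simp add: algebra_simps flip: exp_add)
    finally show "w z * cmod (stf g z) \<le> w 0 * (C * gs_val h g) * exp (- 1 * norm z)" .
  qed
qed

context pdo
begin

text \<open>The norm of the space paired with the domain under the L2 form, in the swapped order
  used for M norms.\<close>

definition N1d :: "'a dual \<Rightarrow> ennreal" where
  "N1d v = mixn p q (\<lambda>z. ennreal (1 / w1 (prod.swap z)) * ennreal (cmod (stv v (prod.swap z))))"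

lemma ennreal_w_inverse: "ennreal (w1 z) * ennreal (1 / w1 z) = 1" "ennreal (w2 z) * ennreal (1 / w2 z) = 1"
  using pos(2)[of z] pos(3)[of z] by (simp_all add: less_imp_neq[symmetric] flip: ennreal_mult)

text \<open>\<open>rk\<close> is absorbed on the side of \<open>V\<close> by \<open>rk_conv\<close>,
  and then \<open>U\<close> and \<open>V\<close> are paired by Hoelder with the weights
  \<open>w1\<close> and \<open>1 / w1\<close>.\<close>

lemma rk_pair_integrable:
  fixes U V :: "'a \<times> 'a \<Rightarrow> complex"
  assumes Um [measurable]: "U \<in> borel_measurable borel" and Vm [measurable]: "V \<in> borel_measurable borel"
    and U: "mixn p' q' (\<lambda>z. ennreal (w1 (prod.swap z)) * ennreal (cmod (U (prod.swap z)))) < top"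
    and V: "mixn p q (\<lambda>z. ennreal (1 / w1 (prod.swap z)) * ennreal (cmod (V (prod.swap z)))) < top"
  shows "integrable lborel (\<lambda>x. U (fst x) * rk (snd x) (fst x) * V (snd x))"
proof (rule integrableI_bounded)
  have m: "(\<lambda>x. U (fst x) * rk (snd x) (fst x) * V (snd x)) \<in> borel_measurable borel"
    by (intro borel_measurable_times rk_measurable measurable_compose[OF _ Um] measurable_compose[OF _ Vm]
        measurable_fst_borel measurable_snd_borel measurable_ident_sets[OF refl])
  then show "(\<lambda>x. U (fst x) * rk (snd x) (fst x) * V (snd x)) \<in> borel_measurable lborel" by simp
  define D where "D z = (\<integral>\<^sup>+ x. ennreal (cmod (rk z x)) * ennreal (cmod (V x)) \<partial>lborel)" for z
  have Dm [measurable]: "D \<in> borel_measurable borel" unfolding D_def by measurable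
  obtain C where C: "C > 0" "\<And>V. V \<in> borel_measurable borel \<Longrightarrow>
      mixn p q (\<lambda>z. ennreal (1 / w1 (prod.swap z)) * (\<integral>\<^sup>+ x. ennreal (cmod (rk (prod.swap z) x)) * V x \<partial>lborel)) \<le>
      ennreal C * mixn p q (\<lambda>z. ennreal (1 / w1 (prod.swap z)) * V (prod.swap z))"
    by (rule rk_conv[OF tame_weight_inverse[OF t1] p(1) q(1)]) (rule that)
  have "mixn p q (\<lambda>z. ennreal (1 / w1 (prod.swap z)) * D (prod.swap z)) \<le>
    ennreal C * mixn p q (\<lambda>z. ennreal (1 / w1 (prod.swap z)) * ennreal (cmod (V (prod.swap z))))"
    unfolding D_def by (rule C(2)) measurable
  also have "\<dots> < top" using V by (simp add: ennreal_mult_less_top)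
  finally have D: "mixn p q (\<lambda>z. ennreal (1 / w1 (prod.swap z)) * D (prod.swap z)) < top" .
  have "(\<integral>\<^sup>+ x. ennreal (norm (U (fst x) * rk (snd x) (fst x) * V (snd x))) \<partial>lborel) =
    (\<integral>\<^sup>+ z. \<integral>\<^sup>+ y. ennreal (norm (U z * rk y z * V y)) \<partial>lborel \<partial>lborel)"
    using lborel_nn_integral_fst[OF measurable_compose[OF measurable_compose[OF m borel_measurable_norm] measurable_ennreal]] by simp
  also have "\<dots> = (\<integral>\<^sup>+ z. (ennreal (w1 z) * ennreal (cmod (U z))) * (ennreal (1 / w1 z) * D z) \<partial>lborel)"
  proof (intro nn_integral_cong)
    fix z :: "'a \<times> 'a"
    have "cmod (rk y z) = cmod (rk z y)" for y using cnj_rk[of z y] complex_mod_cnj[of "rk z y"] by simp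
    then have "(\<integral>\<^sup>+ y. ennreal (norm (U z * rk y z * V y)) \<partial>lborel) = (\<integral>\<^sup>+ y. ennreal (cmod (U z)) * (ennreal (cmod (rk z y)) * ennreal (cmod (V y))) \<partial>lborel)"
      by (simp add: norm_mult ennreal_mult mult.assoc)
    also have "\<dots> = ennreal (cmod (U z)) * D z"
      unfolding D_def by (rule nn_integral_cmult) measurable
    also have "\<dots> = (ennreal (w1 z) * ennreal (1 / w1 z)) * (ennreal (cmod (U z)) * D z)"
      unfolding ennreal_w_inverse by simp
    finally show "(\<integral>\<^sup>+ y. ennreal (norm (U z * rk y z * V y)) \<partial>lborel) = (ennreal (w1 z) * ennreal (cmod (U z))) * (ennreal (1 / w1 z) * D z)"
      by (simp only: mult_ac)
  qed
  also have "\<dots> = (\<integral>\<^sup>+ z. (ennreal (w1 (prod.swap z)) * ennreal (cmod (U (prod.swap z)))) * (ennreal (1 / w1 (prod.swap z)) * D (prod.swap z)) \<partial>lborel)"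
    by (rule lborel_nn_integral_swap[symmetric]) measurable
  also have "\<dots> \<le> mixn p' q' (\<lambda>z. ennreal (w1 (prod.swap z)) * ennreal (cmod (U (prod.swap z)))) * mixn p q (\<lambda>z. ennreal (1 / w1 (prod.swap z)) * D (prod.swap z))"
    by (intro mixn_Holder p' q' pc') measurable
  also have "\<dots> < top" using U D by (simp add: ennreal_mult_less_top)
  finally show "(\<integral>\<^sup>+ x. ennreal (norm (U (fst x) * rk (snd x) (fst x) * V (snd x))) \<partial>lborel) < \<infinity>" by simp
qed

text \<open>Inserting the reproducing formula for \<open>u\<close> exposes \<open>stv u\<close> as a
  factor of an absolutely convergent double integral, precisely where truncation acts.\<close>

lemma L2_form_pair:
  assumes u: "u \<in> Sigma1'" "N1 u < top" and v: "v \<in> Sigma1'" "N1d v < top"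
  shows "integrable lborel (\<lambda>x. stv u (fst x) * rk (snd x) (fst x) * cnj (stv v (snd x)))"
    and "L2_form u v = (LINT x|lborel. stv u (fst x) * rk (snd x) (fst x) * cnj (stv v (snd x)))"
proof -
  have [measurable]: "stv v \<in> borel_measurable borel" by (rule stv_borel[OF v(1)])
  show i: "integrable lborel (\<lambda>x. stv u (fst x) * rk (snd x) (fst x) * cnj (stv v (snd x)))"
    by (rule rk_pair_integrable[where V="\<lambda>z. cnj (stv v z)"])
      (use u v stv_borel[OF u(1)] cnj_measurable[OF stv_borel[OF v(1)]] in \<open>simp_all add: N1_def N1d_def\<close>)
  have "L2_form u v = (LINT z|lborel. LINT y|lborel. stv u y * rk z y * cnj (stv v z))"
    unfolding L2_form_eq
  proof (rule Bochner_Integration.integral_cong[OF refl])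
    fix z
    have "stv u z = (LINT y|lborel. stv u y * rk z y)" by (subst stv_reproducing[OF u(1)]) (simp only: mult.commute)
    then show "stv u z * cnj (stv v z) = (LINT y|lborel. stv u y * rk z y * cnj (stv v z))"
      by (simp only: integral_mult_left_zero)
  qed
  also have "\<dots> = (LINT x|lborel. stv u (fst x) * rk (snd x) (fst x) * cnj (stv v (snd x)))"
    by (rule lborel_Fubini(2)[OF i])
  finally show "L2_form u v = (LINT x|lborel. stv u (fst x) * rk (snd x) (fst x) * cnj (stv v (snd x)))" .
qed

text \<open>Truncation replaces \<open>stv u\<close> by \<open>cutoff u k\<close> in the integral of
  \<open>L2_form_pair\<close>. The untruncated integrand is the majorant, so infinite exponents
  cause no difficulty.\<close>

lemma trunc_weak:
  assumes u: "u \<in> Sigma1'" "N1 u < top" and v: "v \<in> Sigma1'" "N1d v < top"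
  shows "(\<lambda>k. L2_form (dist_of (trunc u k)) v) \<longlonglongrightarrow> L2_form u v"
proof -
  let ?Q = "\<lambda>k x. cutoff u k (fst x) * rk (snd x) (fst x) * cnj (stv v (snd x))"
  note i = L2_form_pair(1)[OF u v]
  have vm: "stv v \<in> borel_measurable borel" by (rule stv_borel[OF v(1)])
  have m: "?Q k \<in> borel_measurable lborel" for k
  proof -
    have "(\<lambda>x. cnj (stv v (snd x))) \<in> borel_measurable (borel :: (('a \<times> 'a) \<times> ('a \<times> 'a)) measure)"
      by (rule cnj_measurable[OF measurable_compose[OF measurable_snd_borel[OF measurable_ident_sets[OF refl]] vm]])
    then have "?Q k \<in> borel_measurable borel"
      by (intro borel_measurable_times rk_measurable measurable_compose[OF _ cutoff_measurable[OF u(1)]]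
        measurable_fst_borel measurable_snd_borel measurable_ident_sets[OF refl])
    then show ?thesis by simp
  qed
  have le: "norm (?Q k x) \<le> norm (stv u (fst x) * rk (snd x) (fst x) * cnj (stv v (snd x)))" for k x
    unfolding norm_mult by (intro mult_right_mono norm_cutoff_le norm_ge_zero)
  have iQ: "integrable lborel (?Q k)" for k
    by (rule Bochner_Integration.integrable_bound[OF i m]) (simp only: le AE_I2)
  have "L2_form (dist_of (trunc u k)) v = (LINT x|lborel. ?Q k x)" for k
  proof -
    have "L2_form (dist_of (trunc u k)) v = (LINT z|lborel. LINT y|lborel. cutoff u k y * rk z y * cnj (stv v z))"
      unfolding L2_form_eq stv_dist_of stf_trunc[OF u(1)] integral_mult_left_zero by (simp only: mult.commute)
    also have "\<dots> = (LINT x|lborel. ?Q k x)" by (rule lborel_Fubini(2)[OF iQ])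
    finally show ?thesis .
  qed
  moreover have "(\<lambda>k. LINT x|lborel. ?Q k x) \<longlonglongrightarrow> (LINT x|lborel. stv u (fst x) * rk (snd x) (fst x) * cnj (stv v (snd x)))"
    by (rule integral_dominated_convergence[OF borel_measurable_integrable[OF i] m integrable_norm[OF i]])
      (intro AE_I2 tendsto_intros cutoff_tendsto le)+
  ultimately show ?thesis unfolding L2_form_pair(2)[OF u v] by simp
qed

text \<open>By the reproducing formula the error is \<open>rk\<close> applied to the part of
  \<open>stv u\<close> outside the ball, and dominated convergence in the mixed norm needs both
  exponents finite.\<close>

lemma trunc_norm:
  assumes u: "u \<in> Sigma1'" "N1 u < top" and f: "p' \<noteq> top" "q' \<noteq> top"
  shows "(\<lambda>k. N1 (\<lambda>g. dist_of (trunc u k) g - u g)) \<longlonglongrightarrow> 0"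
proof -
  have [measurable]: "stv u \<in> borel_measurable borel" by (rule stv_borel[OF u(1)])
  define V where "V k x = ennreal (cmod (cutoff u k x - stv u x))" for k x
  have [measurable]: "cutoff u k \<in> borel_measurable borel" for k by (rule cutoff_measurable[OF u(1)])
  have Vm [measurable]: "V k \<in> borel_measurable borel" for k unfolding V_def by measurable
  obtain C where C: "C > 0" "\<And>V. V \<in> borel_measurable borel \<Longrightarrow>
      mixn p' q' (\<lambda>z. ennreal (w1 (prod.swap z)) * (\<integral>\<^sup>+ x. ennreal (cmod (rk (prod.swap z) x)) * V x \<partial>lborel)) \<le>
      ennreal C * mixn p' q' (\<lambda>z. ennreal (w1 (prod.swap z)) * V (prod.swap z))"
    by (rule rk_conv[OF t1 p' q']) (rule that)
  have b: "N1 (\<lambda>g. dist_of (trunc u k) g - u g) \<le> ennreal C * mixn p' q' (\<lambda>z. ennreal (w1 (prod.swap z)) * V k (prod.swap z))" for k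
  proof -
    have "ennreal (cmod (stv (\<lambda>g. dist_of (trunc u k) g - u g) z)) \<le> (\<integral>\<^sup>+ x. ennreal (cmod (rk z x)) * V k x \<partial>lborel)" for z
    proof -
      have "stv (\<lambda>g. dist_of (trunc u k) g - u g) z = (LINT y|lborel. rk z y * cutoff u k y) - (LINT y|lborel. rk z y * stv u y)"
        unfolding stv_linear stv_dist_of stf_trunc[OF u(1)] by (subst stv_reproducing[OF u(1)]) (rule refl)
      also have "\<dots> = (LINT y|lborel. rk z y * cutoff u k y - rk z y * stv u y)"
        by (rule Bochner_Integration.integral_diff[symmetric, OF rk_cutoff_integrable[OF u(1)] rk_integrable[OF u(1)]])
      finally have e: "stv (\<lambda>g. dist_of (trunc u k) g - u g) z = (LINT y|lborel. rk z y * cutoff u k y - rk z y * stv u y)" .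
      have "ennreal (cmod (rk z y * cutoff u k y - rk z y * stv u y)) = ennreal (cmod (rk z y)) * V k y" for y
        unfolding V_def by (simp add: norm_mult ennreal_mult flip: right_diff_distrib)
      then show ?thesis using ennreal_cmod_integral_le[of lborel "\<lambda>y. rk z y * cutoff u k y - rk z y * stv u y"] unfolding e by (simp only:)
    qed
    then have "N1 (\<lambda>g. dist_of (trunc u k) g - u g) \<le> mixn p' q' (\<lambda>z. ennreal (w1 (prod.swap z)) * (\<integral>\<^sup>+ x. ennreal (cmod (rk (prod.swap z) x)) * V k x \<partial>lborel))"
      unfolding N1_def by (intro mixn_mono p' q' mult_left_mono) auto
    also note C(2)[OF Vm]
    finally show ?thesis .
  qed
  have "(\<lambda>k. mixn p' q' (\<lambda>z. ennreal (w1 (prod.swap z)) * V k (prod.swap z))) \<longlonglongrightarrow> 0"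
  proof (rule mixn_tendsto_0[OF p' f(1) q' f(2), where G="\<lambda>z. ennreal (w1 (prod.swap z)) * ennreal (cmod (stv u (prod.swap z)))"])
    show "ennreal (w1 (prod.swap z)) * V k (prod.swap z) \<le> ennreal (w1 (prod.swap z)) * ennreal (cmod (stv u (prod.swap z)))" for k z
      unfolding V_def by (intro mult_left_mono ennreal_leI) (simp_all add: cutoff_def)
    show "mixn p' q' (\<lambda>z. ennreal (w1 (prod.swap z)) * ennreal (cmod (stv u (prod.swap z)))) < top"
      using u(2) unfolding N1_def .
    show "(\<lambda>k. ennreal (w1 (prod.swap z)) * V k (prod.swap z)) \<longlonglongrightarrow> 0" for z
    proof (rule tendsto_eventually)
      have "\<forall>\<^sub>F k in sequentially. norm (prod.swap z) \<le> real k"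
        using eventually_ge_at_top[of "nat \<lceil>norm (prod.swap z)\<rceil>"] by eventually_elim linarith
      then show "\<forall>\<^sub>F k in sequentially. ennreal (w1 (prod.swap z)) * V k (prod.swap z) = 0"
        by eventually_elim (simp add: V_def cutoff_def)
    qed
  qed measurable
  then have "(\<lambda>k. ennreal C * mixn p' q' (\<lambda>z. ennreal (w1 (prod.swap z)) * V k (prod.swap z))) \<longlonglongrightarrow> ennreal C * 0"
    by (intro ennreal_tendsto_cmult) auto
  then have "(\<lambda>k. ennreal C * mixn p' q' (\<lambda>z. ennreal (w1 (prod.swap z)) * V k (prod.swap z))) \<longlonglongrightarrow> 0" by simp
  then show ?thesis
    by (rule tendsto_sandwich[OF _ _ tendsto_const, rotated 2]) (simp_all add: b)
qed

section \<open>Values of the extension on test functions\<close>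

lemma N1_dist_of:
  assumes f: "f \<in> Sigma1"
  shows "N1 (dist_of f) < top"
proof -
  obtain K where K: "K \<ge> 0" "\<And>z. w1 z * cmod (stf f z) \<le> K * exp (- 1 * norm z)"
    by (rule stf_tame_bound[OF t1 f]) (rule that)
  have "mixn p' q' (\<lambda>z. ennreal (w1 (prod.swap z) * cmod (stf f (prod.swap z)))) < top"
    by (rule mixn_exp_finite[OF p' q' K(1) zero_less_one]) (use K(2)[of "prod.swap _"] in simp)
  then show ?thesis unfolding N1_def stv_dist_of using less_imp_le[OF pos(2)] by (simp add: ennreal_mult)
qed

text \<open>For a test function the transform in the definition of \<open>T\<close> is
  \<open>stf f\<close>, and the iterated integral is the expansion of
  \<open>Op_eq_J\<close>.\<close>

lemma T_dist_of:
  assumes a: "a \<in> Sigma1'" "W_norm p q w0 a < top" and f: "f \<in> Sigma1"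
  shows "T a (dist_of f) = Op a f"
proof
  fix g
  have adm: "admissible a (dist_of f)"
    using a f dist_of_Sigma1' N1_dist_of by (simp add: admissible_def)
  show "T a (dist_of f) g = Op a f g"
  proof (cases "g \<in> Sigma1")
    case True
    show ?thesis unfolding T_eq_dsynth[OF adm] dsynth_def H_def stv_dist_of if_P[OF True] Op_eq_J[OF a(1) f True] ..
  qed (simp add: T_def Op_def)
qed

lemma stf_w2_finite:
  assumes g: "g \<in> Sigma1"
  shows "mixn p' q' (\<lambda>z. ennreal (1 / w2 z) * ennreal (cmod (stf g (flip z)))) < top"
proof -
  obtain K where K: "K \<ge> 0" "\<And>z. (1 / w2 (flip z)) * cmod (stf g z) \<le> K * exp (- 1 * norm z)"
  proof -
    \<comment> \<open>Reflection preserves norms and is additive, so the reflected reciprocal weight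
      is tame with the same rate.\<close>
    have t: "tame_weight r2 (\<lambda>z. 1 / w2 (flip z))"
      unfolding tame_weight_def
    proof (intro conjI allI)
      show "continuous_on UNIV (\<lambda>z. 1 / w2 (flip z))"
      proof (rule continuous_on_compose2[of UNIV "\<lambda>z. 1 / w2 z"])
        show "continuous_on UNIV (\<lambda>z. 1 / w2 z)" using tame_weight_inverse[OF t2] unfolding tame_weight_def by blast
        show "continuous_on UNIV (flip :: 'a \<times> 'a \<Rightarrow> _)" unfolding flip_def by (intro continuous_intros)
      qed simp
      have "flip (x + y) = flip x + flip y" for x y :: "'a \<times> 'a" by (simp add: prod_eq_iff)
      moreover have "1 / w2 (flip x + flip y) \<le> exp (r2 * norm (flip y)) * (1 / w2 (flip x))" for x y
        using tame_weight_inverse[OF t2] unfolding tame_weight_def by blast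
      ultimately show "1 / w2 (flip (x + y)) \<le> exp (r2 * norm y) * (1 / w2 (flip x))" for x y by (simp only: norm_flip)
      show "0 < 1 / w2 (flip x)" for x using pos(3) by simp
      show "0 \<le> r2" using t2 unfolding tame_weight_def by blast
    qed
    show thesis by (rule stf_tame_bound[OF t g]) (rule that)
  qed
  have "mixn p' q' (\<lambda>z. ennreal ((1 / w2 z) * cmod (stf g (flip z)))) < top"
    by (rule mixn_exp_finite[OF p' q' K(1) zero_less_one]) (use K(2)[of "flip _"] in simp)
  moreover have "ennreal ((1 / w2 z) * cmod (stf g (flip z))) = ennreal (1 / w2 z) * ennreal (cmod (stf g (flip z)))" for z
    using pos(3)[of z] by (intro ennreal_mult) auto
  ultimately show ?thesis by simp
qed

lemma stf_flip_measurable: "g \<in> Sigma1 \<Longrightarrow> (\<lambda>z. stf g (flip z)) \<in> borel_measurable borel"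
  by (rule measurable_compose[OF flip_measurable[OF measurable_ident_sets[OF refl]] stf_measurable[OF Sigma1_borel]])

text \<open>The W norm dominates each evaluation at a test function, so norm convergence can be
  tested against single test functions.\<close>

lemma evaluation_bound:
  assumes g: "g \<in> Sigma1"
  obtains K where "K \<ge> 0" "\<And>v. v \<in> Sigma1' \<Longrightarrow> ennreal (cmod (v g)) \<le> ennreal K * W_norm p q w2 v"
proof -
  let ?G = "\<lambda>z. ennreal (1 / w2 z) * ennreal (cmod (stf g (flip z)))"
  have [measurable]: "(\<lambda>z. stf g (flip z)) \<in> borel_measurable borel" by (rule stf_flip_measurable[OF g])
  have "ennreal (cmod (v g)) \<le> ennreal (enn2real (mixn p' q' ?G)) * W_norm p q w2 v" if v: "v \<in> Sigma1'" for v
  proof -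
    have [measurable]: "stv v \<in> borel_measurable borel" by (rule stv_borel[OF v])
    have "ennreal (cmod (v g)) \<le> (\<integral>\<^sup>+ z. ennreal (cmod (stf g (flip z) * stv v z)) \<partial>lborel)"
      unfolding dual_eq'(1)[OF v g] by (rule ennreal_cmod_integral_le)
    also have "\<dots> = (\<integral>\<^sup>+ z. (ennreal (w2 z) * ennreal (cmod (stv v z))) * ?G z \<partial>lborel)"
    proof (rule nn_integral_cong)
      fix z
      have "ennreal (cmod (stf g (flip z) * stv v z)) = (ennreal (w2 z) * ennreal (1 / w2 z)) * (ennreal (cmod (stf g (flip z))) * ennreal (cmod (stv v z)))"
        unfolding ennreal_w_inverse by (simp add: norm_mult ennreal_mult)
      then show "ennreal (cmod (stf g (flip z) * stv v z)) = (ennreal (w2 z) * ennreal (cmod (stv v z))) * ?G z"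
        by (simp only: mult_ac)
    qed
    also have "\<dots> \<le> mixn p q (\<lambda>z. ennreal (w2 z) * ennreal (cmod (stv v z))) * mixn p' q' ?G"
      by (intro mixn_Holder p q) measurable
    also have "mixn p' q' ?G = ennreal (enn2real (mixn p' q' ?G))" using stf_w2_finite[OF g] by simp
    finally show ?thesis unfolding W_norm_eq[OF less_imp_le[OF pos(3)]] by (simp only: mult.commute)
  qed
  then show thesis by (rule that[OF enn2real_nonneg])
qed

lemma T_linear:
  assumes "admissible a u" "admissible a v"
  shows "T a (\<lambda>g. u g + v g) = (\<lambda>g. T a u g + T a v g)" "T a (\<lambda>g. c * u g) = (\<lambda>g. c * T a u g)"
proof -
  show "T a (\<lambda>g. u g + v g) = (\<lambda>g. T a u g + T a v g)"
  proof
    fix g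
    show "T a (\<lambda>g. u g + v g) g = T a u g + T a v g"
    proof (cases "g \<in> Sigma1")
      case True
      show ?thesis unfolding T_def if_P[OF True] stv_linear ring_distribs
        by (rule Bochner_Integration.integral_add[OF op_matrix_pair_integrable[OF assms(1) True] op_matrix_pair_integrable[OF assms(2) True]])
    qed (simp add: T_def)
  qed
  show "T a (\<lambda>g. c * u g) = (\<lambda>g. c * T a u g)"
    unfolding T_def stv_linear mult.left_commute[of _ c] integral_mult_right_zero by auto
qed

text \<open>The transposed matrix applied to the transform of the test function.\<close>

definition Vg :: "('a \<times> 'a) dual \<Rightarrow> ('a \<Rightarrow> complex) \<Rightarrow> 'a \<times> 'a \<Rightarrow> complex" where
  "Vg a g w = (LINT z|lborel. stf g (flip z) * op_matrix a z w)"

definition Vabs :: "('a \<times> 'a) dual \<Rightarrow> ('a \<Rightarrow> complex) \<Rightarrow> 'a \<times> 'a \<Rightarrow> ennreal" where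
  "Vabs a g w = (\<integral>\<^sup>+ z. ennreal (cmod (op_matrix a z w)) * ennreal (cmod (stf g (flip z))) \<partial>lborel)"

lemma V_measurable:
  assumes a: "a \<in> Sigma1'" and g: "g \<in> Sigma1"
  shows "Vg a g \<in> borel_measurable borel" "Vabs a g \<in> borel_measurable borel"
  unfolding Vg_def Vabs_def
  by (intro integral_section_measurable nn_integral_section_measurable borel_measurable_times borel_measurable_times_ennreal
      measurable_compose[OF measurable_compose[OF op_matrix_measurable[OF a] borel_measurable_norm] measurable_ennreal] op_matrix_measurable[OF a]
      measurable_compose[OF measurable_compose[OF measurable_compose[OF _ stf_flip_measurable[OF g]] borel_measurable_norm] measurable_ennreal]
      measurable_compose[OF _ stf_flip_measurable[OF g]]
      measurable_fst_borel measurable_snd_borel measurable_ident_sets[OF refl])+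

lemma norm_Vg_le: "ennreal (cmod (Vg a g w)) \<le> Vabs a g w"
  unfolding Vg_def Vabs_def
  using ennreal_cmod_integral_le[of lborel "\<lambda>z. stf g (flip z) * op_matrix a z w"] by (simp add: norm_mult ennreal_mult mult.commute)

text \<open>The weighted matrix bound, read from the side of w, turns the reciprocal weight on
  \<open>w2\<close> into the one on \<open>w1\<close>; then \<open>kern_dual_bound\<close>
  applies.\<close>

lemma Vabs_finite:
  assumes a: "a \<in> Sigma1'" "W_norm p q w0 a < top" and g: "g \<in> Sigma1"
  shows "mixn p q (\<lambda>z. ennreal (1 / w1 (prod.swap z)) * Vabs a g (prod.swap z)) < top"
proof -
  note A = At_measurable[OF a(1)]
  obtain C where C: "C > 0" "\<And>a z w. a \<in> Sigma1' \<Longrightarrow>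
    ennreal (w2 z) * ennreal (cmod (op_matrix a z w)) \<le> ennreal C * (kern (At a) z w * ennreal (w1 w))"
    by (rule op_matrix_weight_bound) (rule that)
  let ?G = "\<lambda>z. ennreal (1 / w2 z) * ennreal (cmod (stf g (flip z)))"
  let ?K = "\<lambda>w. \<integral>\<^sup>+ z. kern (At a) z (prod.swap w) * ?G z \<partial>lborel"
  have sm [measurable]: "(\<lambda>z. stf g (flip z)) \<in> borel_measurable borel" by (rule stf_flip_measurable[OF g])
  have J1 [measurable]: "(\<lambda>z. op_matrix a z w) \<in> borel_measurable borel" for w
    by (rule op_matrix_measurable[OF a(1) measurable_ident_sets[OF refl] borel_measurable_const])
  have k1 [measurable]: "(\<lambda>z. kern (At a) z w) \<in> borel_measurable borel" for w
    by (intro kern_measurable[OF p q A] continuous_intros)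
  have Gm: "?G \<in> borel_measurable borel" by measurable
  have "(\<lambda>x. kern (At a) (snd x) (prod.swap (fst x))) \<in> borel_measurable borel"
    by (intro kern_measurable[OF p q A] continuous_intros)
  then have km: "?K \<in> borel_measurable borel"
    by (intro nn_integral_section_measurable borel_measurable_times_ennreal
      measurable_compose[OF _ Gm] measurable_snd_borel measurable_ident_sets[OF refl])
  have "mixn p q (\<lambda>z. ennreal (1 / w1 (prod.swap z)) * Vabs a g (prod.swap z)) \<le> mixn p q (\<lambda>z. ennreal C * ?K z)"
  proof (intro mixn_mono p(1) q(1))
    fix s :: "'a \<times> 'a"
    define w where "w = prod.swap s"
    have b: "ennreal (1 / w1 w) * (ennreal (cmod (op_matrix a z w)) * ennreal (cmod (stf g (flip z)))) \<le> ennreal C * (kern (At a) z w * ?G z)" for z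
    proof -
      have "ennreal (1 / w1 w) * (ennreal (cmod (op_matrix a z w)) * ennreal (cmod (stf g (flip z)))) =
        (ennreal (w2 z) * ennreal (1 / w2 z)) * (ennreal (1 / w1 w) * (ennreal (cmod (op_matrix a z w)) * ennreal (cmod (stf g (flip z)))))"
        unfolding ennreal_w_inverse by simp
      also have "\<dots> = (ennreal (w2 z) * ennreal (cmod (op_matrix a z w))) * (ennreal (1 / w1 w) * ?G z)" by (simp only: mult_ac)
      also have "\<dots> \<le> (ennreal C * (kern (At a) z w * ennreal (w1 w))) * (ennreal (1 / w1 w) * ?G z)"
        by (intro mult_right_mono C(2) a) auto
      also have "\<dots> = (ennreal (w1 w) * ennreal (1 / w1 w)) * (ennreal C * (kern (At a) z w * ?G z))" by (simp only: mult_ac)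
      finally show ?thesis unfolding ennreal_w_inverse by simp
    qed
    have "ennreal (1 / w1 w) * Vabs a g w = (\<integral>\<^sup>+ z. ennreal (1 / w1 w) * (ennreal (cmod (op_matrix a z w)) * ennreal (cmod (stf g (flip z)))) \<partial>lborel)"
      unfolding Vabs_def by (rule nn_integral_cmult[symmetric]) measurable
    also have "\<dots> \<le> (\<integral>\<^sup>+ z. ennreal C * (kern (At a) z w * ?G z) \<partial>lborel)" by (intro nn_integral_mono b)
    also have "\<dots> = ennreal C * ?K s" unfolding w_def[symmetric] by (rule nn_integral_cmult) measurable
    finally show "ennreal (1 / w1 (prod.swap s)) * Vabs a g (prod.swap s) \<le> ennreal C * ?K s" unfolding w_def .
  qed
  also have "\<dots> \<le> ennreal C * mixn p q ?K" by (intro mixn_cmult_le p q km)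
  also have "\<dots> \<le> ennreal C * (mixn p q (At a) * mixn p' q' ?G)"
    by (intro mult_left_mono kern_dual_bound[OF p q A] Gm) auto
  also have "\<dots> < top" using At_finite[OF a] stf_w2_finite[OF g] by (simp add: ennreal_mult_less_top)
  finally show ?thesis .
qed

text \<open>
  The element of \<open>M_space q p (1 / w1)\<close> whose \<open>L\<^sup>2\<close> form with \<open>u\<close> is \<open>T a u g\<close>; its existence is
  what makes \<open>T a\<close> weakly continuous.
\<close>

definition vdual :: "('a \<times> 'a) dual \<Rightarrow> ('a \<Rightarrow> complex) \<Rightarrow> 'a dual" where
  "vdual a g = dsynth (\<lambda>w. cnj (Vg a g w))"

lemma vdual_Sigma1':
  assumes a: "a \<in> Sigma1'" "W_norm p q w0 a < top" and g: "g \<in> Sigma1"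
  shows "vdual a g \<in> Sigma1'"
  unfolding vdual_def
proof (rule dsynth_Sigma1')
  note [measurable] = V_measurable[OF a(1) g]
  show m: "(\<lambda>w. cnj (Vg a g w)) \<in> borel_measurable borel" by (rule cnj_measurable[OF V_measurable(1)[OF a(1) g]])
  show "integrable lborel (\<lambda>z. cmod (cnj (Vg a g z)) * exp (- (r1 + 1) * norm z))"
  proof (rule integrableI_bounded)
    show "(\<lambda>z. cmod (cnj (Vg a g z)) * exp (- (r1 + 1) * norm z)) \<in> borel_measurable lborel" using m by measurable
    have "(\<integral>\<^sup>+ z. ennreal (norm (cmod (cnj (Vg a g z)) * exp (- (r1 + 1) * norm z))) \<partial>lborel) \<le>
      (\<integral>\<^sup>+ z. ennreal (exp (- (r1 + 1) * norm z)) * Vabs a g z \<partial>lborel)"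
    proof (intro nn_integral_mono)
      fix z
      have "ennreal (norm (cmod (cnj (Vg a g z)) * exp (- (r1 + 1) * norm z))) = ennreal (exp (- (r1 + 1) * norm z)) * ennreal (cmod (Vg a g z))"
        by (subst ennreal_mult[symmetric]) (auto simp: abs_mult mult.commute)
      then show "ennreal (norm (cmod (cnj (Vg a g z)) * exp (- (r1 + 1) * norm z))) \<le> ennreal (exp (- (r1 + 1) * norm z)) * Vabs a g z"
        by (simp only:) (intro mult_left_mono norm_Vg_le, simp)
    qed
    also have "\<dots> < top"
      by (rule tame_exp_integral_finite_swap[OF tame_weight_inverse[OF t1] p q V_measurable(2)[OF a(1) g] Vabs_finite[OF a g]])
    finally show "(\<integral>\<^sup>+ z. ennreal (norm (cmod (cnj (Vg a g z)) * exp (- (r1 + 1) * norm z))) \<partial>lborel) < \<infinity>" by simp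
  qed
qed

lemma N1d_vdual:
  assumes a: "a \<in> Sigma1'" "W_norm p q w0 a < top" and g: "g \<in> Sigma1"
  shows "N1d (vdual a g) < top"
proof -
  obtain C where C: "C > 0" "\<And>V. V \<in> borel_measurable borel \<Longrightarrow>
      mixn p q (\<lambda>z. ennreal (1 / w1 (prod.swap z)) * (\<integral>\<^sup>+ x. ennreal (cmod (rk (prod.swap z) x)) * V x \<partial>lborel)) \<le>
      ennreal C * mixn p q (\<lambda>z. ennreal (1 / w1 (prod.swap z)) * V (prod.swap z))"
    by (rule rk_conv[OF tame_weight_inverse[OF t1] p(1) q(1)]) (rule that)
  have "ennreal (cmod (stv (vdual a g) z)) \<le> (\<integral>\<^sup>+ x. ennreal (cmod (rk z x)) * Vabs a g x \<partial>lborel)" for z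
  proof -
    have "ennreal (cmod (stv (vdual a g) z)) \<le> (\<integral>\<^sup>+ x. ennreal (cmod (rk z x * cnj (Vg a g x))) \<partial>lborel)"
      unfolding vdual_def stv_dsynth by (rule ennreal_cmod_integral_le)
    also have "\<dots> \<le> (\<integral>\<^sup>+ x. ennreal (cmod (rk z x)) * Vabs a g x \<partial>lborel)"
      by (intro nn_integral_mono) (simp add: norm_mult ennreal_mult mult_left_mono norm_Vg_le)
    finally show ?thesis .
  qed
  then have "N1d (vdual a g) \<le> mixn p q (\<lambda>z. ennreal (1 / w1 (prod.swap z)) * (\<integral>\<^sup>+ x. ennreal (cmod (rk (prod.swap z) x)) * Vabs a g x \<partial>lborel))"
    unfolding N1d_def by (intro mixn_mono p(1) q(1) mult_left_mono) auto
  also have "\<dots> \<le> ennreal C * mixn p q (\<lambda>z. ennreal (1 / w1 (prod.swap z)) * Vabs a g (prod.swap z))"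
    by (rule C(2)[OF V_measurable(2)[OF a(1) g]])
  also have "\<dots> < top" using Vabs_finite[OF a g] by (simp add: ennreal_mult_less_top)
  finally show ?thesis .
qed

text \<open>The conjugates in \<open>vdual\<close> and in the L2 form cancel, leaving
  \<open>rk\<close> between \<open>stv u\<close> and \<open>Vg\<close>. Hermitian symmetry and the
  reproducing formula for \<open>u\<close> remove it, and Fubini restores the integral defining
  \<open>T\<close>.\<close>

lemma T_eq_L2_form:
  assumes adm: "admissible a u" and g: "g \<in> Sigma1"
  shows "T a u g = L2_form u (vdual a g)"
proof -
  have a: "a \<in> Sigma1'" "W_norm p q w0 a < top" and u: "u \<in> Sigma1'" "N1 u < top"
    using adm by (auto simp: admissible_def)
  have "mixn p q (\<lambda>z. ennreal (1 / w1 (prod.swap z)) * ennreal (cmod (Vg a g (prod.swap z)))) \<le>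
    mixn p q (\<lambda>z. ennreal (1 / w1 (prod.swap z)) * Vabs a g (prod.swap z))"
    by (intro mixn_mono p(1) q(1) mult_left_mono norm_Vg_le) auto
  then have V: "mixn p q (\<lambda>z. ennreal (1 / w1 (prod.swap z)) * ennreal (cmod (Vg a g (prod.swap z)))) < top"
    using Vabs_finite[OF a g] by (rule order_le_less_trans)
  have i: "integrable lborel (\<lambda>x. stv u (fst x) * rk (snd x) (fst x) * Vg a g (snd x))"
    by (rule rk_pair_integrable[OF stv_borel[OF u(1)] V_measurable(1)[OF a(1) g] u(2)[unfolded N1_def] V])
  have "L2_form u (vdual a g) = (LINT z|lborel. LINT y|lborel. stv u z * rk y z * Vg a g y)"
    unfolding L2_form_eq
  proof (rule Bochner_Integration.integral_cong[OF refl])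
    fix z
    have "cnj (stv (vdual a g) z) = (LINT y|lborel. cnj (rk z y * cnj (Vg a g y)))"
      unfolding vdual_def stv_dsynth by (rule Bochner_Integration.integral_cnj[symmetric])
    also have "\<dots> = (LINT y|lborel. rk y z * Vg a g y)" by (simp add: cnj_rk)
    finally show "stv u z * cnj (stv (vdual a g) z) = (LINT y|lborel. stv u z * rk y z * Vg a g y)"
      by (simp only: mult.assoc integral_mult_right_zero)
  qed
  also have "\<dots> = (LINT x|lborel. stv u (fst x) * rk (snd x) (fst x) * Vg a g (snd x))"
    by (rule lborel_Fubini(1)[OF i])
  also have "\<dots> = (LINT y|lborel. LINT z|lborel. stv u z * rk y z * Vg a g y)"
    by (rule lborel_Fubini(2)[OF i, symmetric])
  also have "\<dots> = (LINT y|lborel. Vg a g y * stv u y)"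
  proof (rule Bochner_Integration.integral_cong[OF refl])
    fix y
    have e: "(LINT z|lborel. stv u z * rk y z) = stv u y" by (subst stv_reproducing[OF u(1), of y]) (simp only: mult.commute)
    show "(LINT z|lborel. stv u z * rk y z * Vg a g y) = Vg a g y * stv u y"
      unfolding integral_mult_left_zero e by (rule mult.commute)
  qed
  also have "\<dots> = (LINT y|lborel. LINT z|lborel. stf g (flip z) * op_matrix a z y * stv u y)"
    unfolding Vg_def by (simp only: integral_mult_left_zero)
  also have "\<dots> = T a u g"
    unfolding T_def if_P[OF g] by (rule lborel_Fubini(2)[OF op_matrix_pair_integrable[OF adm g]])
  finally show ?thesis ..
qed

end

section \<open>Weak topologies\<close>

lemma topspace_weak_topology [simp]: "topspace (weak_topology X Y B) = X"
  by (auto simp: weak_topology_def topspace_pullback_topology)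

lemma continuous_map_weak_evaluation:
  assumes "w \<in> Y"
  shows "continuous_map (weak_topology X Y B) euclidean (\<lambda>u. B u w)"
proof -
  have "continuous_map (weak_topology X Y B) euclidean ((\<lambda>h. h w) \<circ> (\<lambda>u. \<lambda>w\<in>Y. B u w))"
    unfolding weak_topology_def using assms by (intro continuous_map_pullback continuous_map_product_projection)
  then show ?thesis using assms by (simp add: o_def)
qed

text \<open>The universal property of the initial topology: continuity is checked on each pairing
  separately.\<close>

lemma continuous_map_weakI:
  assumes "\<And>u. u \<in> topspace T \<Longrightarrow> S u \<in> X" and "\<And>w. w \<in> Y \<Longrightarrow> continuous_map T euclidean (\<lambda>u. B (S u) w)"
  shows "continuous_map T (weak_topology X Y B) S"
  unfolding weak_topology_def
proof (rule continuous_map_pullback')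
  show "continuous_map T (product_topology (\<lambda>_. euclidean) Y) ((\<lambda>u. \<lambda>w\<in>Y. B u w) \<circ> S)"
    using assms(2) by (auto simp: continuous_map_componentwise o_def)
qed (use assms(1) in auto)

text \<open>Sequences are enough here because the approximation of a given element by truncations is
  a sequence.\<close>

lemma limitin_weak_topology:
  assumes l: "l \<in> X" and f: "\<And>k. f k \<in> X" and lim: "\<And>w. w \<in> Y \<Longrightarrow> (\<lambda>k. B (f k) w) \<longlonglongrightarrow> B l w"
  shows "limitin (weak_topology X Y B) f l sequentially"
  unfolding limitin_def
proof (intro conjI allI impI)
  show "l \<in> topspace (weak_topology X Y B)" using l by simp
  fix U assume U: "openin (weak_topology X Y B) U \<and> l \<in> U"
  then obtain V where V: "openin (product_topology (\<lambda>_. euclidean) Y) V" "U = (\<lambda>u. \<lambda>w\<in>Y. B u w) -` V \<inter> X"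
    unfolding weak_topology_def openin_pullback_topology by blast
  have "limitin (product_topology (\<lambda>_. euclidean) Y) (\<lambda>k. \<lambda>w\<in>Y. B (f k) w) (\<lambda>w\<in>Y. B l w) sequentially"
    unfolding limitin_componentwise using lim by auto
  moreover have "(\<lambda>w\<in>Y. B l w) \<in> V" using U V by auto
  ultimately have "\<forall>\<^sub>F k in sequentially. (\<lambda>w\<in>Y. B (f k) w) \<in> V" using V(1) unfolding limitin_def by blast
  then show "\<forall>\<^sub>F k in sequentially. f k \<in> U" by eventually_elim (use V f in auto)
qed

lemma stv_exp_integrable:
  assumes u: "u \<in> Sigma1'"
  shows "\<exists>r>0. integrable lborel (\<lambda>z. cmod (stv u z) * exp (- r * norm z))"
proof -
  obtain C r where C: "C > 0" "r > 0" "\<And>z. cmod (stv u z) \<le> C * exp (r * norm z)"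
    by (rule stv_growth[OF u]) (rule that)
  have [measurable]: "stv u \<in> borel_measurable borel" by (rule stv_borel[OF u])
  have "norm (cmod (stv u z) * exp (- (r + 1) * norm z)) \<le> C * exp (- 1 * norm z)" for z
  proof -
    have "cmod (stv u z) * exp (- (r + 1) * norm z) \<le> (C * exp (r * norm z)) * exp (- (r + 1) * norm z)"
      by (intro mult_right_mono C) auto
    also have "\<dots> = C * exp (- 1 * norm z)" by (simp add: algebra_simps flip: exp_add)
    finally show ?thesis by simp
  qed
  then have "integrable lborel (\<lambda>z. cmod (stv u z) * exp (- (r + 1) * norm z))"
    by (intro integrable_exp_bound[OF _ _ zero_less_one]) measurable
  then show ?thesis using C(2) by (intro exI[of _ "r + 1"]) auto
qed

text \<open>Through \<open>dsynth\<close> of the difference of the transforms. Two exponential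
  moments are easily brought to a common rate, which replaces a comparison of \<open>gs_norm\<close>
  at two values of \<open>h\<close>.\<close>

lemma Sigma1'_diff:
  assumes u: "u \<in> Sigma1'" and v: "v \<in> Sigma1'"
  shows "(\<lambda>g. u g - v g) \<in> Sigma1'"
proof -
  obtain r s where r: "r > 0" "integrable lborel (\<lambda>z. cmod (stv u z) * exp (- r * norm z))"
      "s > 0" "integrable lborel (\<lambda>z. cmod (stv v z) * exp (- s * norm z))"
    using stv_exp_integrable[OF u] stv_exp_integrable[OF v] by blast
  define t where "t = max r s"
  have le: "integrable lborel (\<lambda>z. cmod (stv w z) * exp (- t * norm z))"
    if i: "integrable lborel (\<lambda>z. cmod (stv w z) * exp (- c * norm z))" and w: "w \<in> Sigma1'" and c: "c \<le> t" for w c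
  proof (rule Bochner_Integration.integrable_bound[OF i])
    have [measurable]: "stv w \<in> borel_measurable borel" by (rule stv_borel[OF w])
    show "(\<lambda>z. cmod (stv w z) * exp (- t * norm z)) \<in> borel_measurable lborel" by measurable
    show "AE z in lborel. norm (cmod (stv w z) * exp (- t * norm z)) \<le> norm (cmod (stv w z) * exp (- c * norm z))"
      using c by (intro AE_I2) (simp add: abs_mult mult_left_mono mult_right_mono)
  qed
  have iu: "integrable lborel (\<lambda>z. cmod (stv u z) * exp (- t * norm z))" by (rule le[OF r(2) u]) (simp add: t_def)
  have iv: "integrable lborel (\<lambda>z. cmod (stv v z) * exp (- t * norm z))" by (rule le[OF r(4) v]) (simp add: t_def)
  have [measurable]: "stv u \<in> borel_measurable borel" "stv v \<in> borel_measurable borel" by (rule stv_borel[OF u], rule stv_borel[OF v])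
  have i: "integrable lborel (\<lambda>z. cmod (stv u z - stv v z) * exp (- t * norm z))"
  proof (rule Bochner_Integration.integrable_bound[OF Bochner_Integration.integrable_add[OF iu iv]])
    show "(\<lambda>z. cmod (stv u z - stv v z) * exp (- t * norm z)) \<in> borel_measurable lborel" by measurable
    show "AE z in lborel. norm (cmod (stv u z - stv v z) * exp (- t * norm z)) \<le> norm (cmod (stv u z) * exp (- t * norm z) + cmod (stv v z) * exp (- t * norm z))"
      by (intro AE_I2) (simp add: abs_mult norm_triangle_ineq4 flip: distrib_right)
  qed
  have "(\<lambda>g. u g - v g) = dsynth (\<lambda>z. stv u z - stv v z)"
  proof
    fix g
    show "u g - v g = dsynth (\<lambda>z. stv u z - stv v z) g"
    proof (cases "g \<in> Sigma1")
      case True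
      then show ?thesis
        unfolding dsynth_def if_P[OF True] right_diff_distrib
        by (subst Bochner_Integration.integral_diff[OF dual_eq'(2)[OF u True] dual_eq'(2)[OF v True]])
          (simp only: dual_eq'(1)[OF u True, symmetric] dual_eq'(1)[OF v True, symmetric])
    next
      case False
      then show ?thesis using u v by (simp add: Sigma1'_def dsynth_def)
    qed
  qed
  then show ?thesis using dsynth_Sigma1'[OF _ i] by simp
qed

section \<open>Extension of the operator\<close>

lemma M_norm_mono:
  assumes "1 \<le> p" "1 \<le> q" and "\<And>z. \<omega> z \<le> \<omega>' z"
  shows "M_norm p q \<omega> u \<le> M_norm p q \<omega>' u"
  unfolding M_norm_def using assms by (intro Lp_norm_mono ennreal_leI mult_left_mono) auto

lemma W_norm_mono:
  assumes "1 \<le> p" "1 \<le> q" and "\<And>z. \<omega> z \<le> \<omega>' z"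
  shows "W_norm p q \<omega> u \<le> W_norm p q \<omega>' u"
  unfolding W_norm_def using assms by (intro Lp_norm_mono ennreal_leI mult_left_mono) auto

lemma
  fixes w :: "'a::euclidean_space \<times> 'a \<Rightarrow> real"
  assumes p: "1 \<le> p" "1 \<le> q" and w [measurable]: "w \<in> borel_measurable borel" "\<And>z. 0 \<le> w z" and D: "D > 0" and u: "u \<in> Sigma1'"
  shows M_norm_cmult_le: "M_norm p q (\<lambda>z. D * w z) u \<le> ennreal D * M_norm p q w u"
    and W_norm_cmult_le: "W_norm p q (\<lambda>z. D * w z) u \<le> ennreal D * W_norm p q w u"
proof -
  have [measurable]: "stv u \<in> borel_measurable borel" by (rule stv_borel[OF u])
  have D0: "D * w z \<ge> 0" for z using D w(2)[of z] by simp
  have m: "ennreal (D * w z) = ennreal D * ennreal (w z)" for z using D w(2) by (intro ennreal_mult) auto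
  show "M_norm p q (\<lambda>z. D * w z) u \<le> ennreal D * M_norm p q w u"
    unfolding M_norm_eq[of "\<lambda>z. D * w z", OF D0] M_norm_eq[OF w(2)] m mult.assoc
    by (intro mixn_cmult_le p) measurable
  show "W_norm p q (\<lambda>z. D * w z) u \<le> ennreal D * W_norm p q w u"
    unfolding W_norm_eq[of "\<lambda>z. D * w z", OF D0] W_norm_eq[OF w(2)] m mult.assoc
    by (intro mixn_cmult_le p) measurable
qed

text \<open>Homogeneity is applied to the Borel measurable \<open>w / D\<close>; the other weight
  enters through monotonicity alone.\<close>

lemma M_norm_le_cmult:
  fixes w :: "'a::euclidean_space \<times> 'a \<Rightarrow> real"
  assumes p: "1 \<le> p" "1 \<le> q" and w [measurable]: "w \<in> borel_measurable borel" "\<And>z. 0 \<le> w z" and D: "D > 0" and u: "u \<in> Sigma1'"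
    and le: "\<And>z. w z \<le> D * \<omega> z"
  shows "M_norm p q w u \<le> ennreal D * M_norm p q \<omega> u"
proof -
  have "M_norm p q w u = M_norm p q (\<lambda>z. D * (w z / D)) u" using D by simp
  also have "\<dots> \<le> ennreal D * M_norm p q (\<lambda>z. w z / D) u"
    using D w(2) by (intro M_norm_cmult_le p u) (auto intro!: divide_nonneg_pos)
  also have "\<dots> \<le> ennreal D * M_norm p q \<omega> u"
    using D le by (intro mult_left_mono M_norm_mono p) (auto simp: field_simps)
  finally show ?thesis .
qed

context pdo
begin

lemma T_diff:
  assumes "admissible a u" "admissible a v"
  shows "T a (\<lambda>g. u g - v g) = (\<lambda>g. T a u g - T a v g)"
proof
  fix g
  show "T a (\<lambda>g. u g - v g) g = T a u g - T a v g"
  proof (cases "g \<in> Sigma1")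
    case True
    show ?thesis unfolding T_def if_P[OF True] stv_linear right_diff_distrib
      by (rule Bochner_Integration.integral_diff[OF op_matrix_pair_integrable[OF assms(1) True] op_matrix_pair_integrable[OF assms(2) True]])
  qed (simp add: T_def)
qed

lemma N1_eq: "N1 u = M_norm q' p' w1 u"
  unfolding N1_def by (rule M_norm_eq[OF less_imp_le[OF pos(2)], symmetric])

lemma N1d_eq: "N1d v = M_norm q p (\<lambda>z. 1 / w1 z) v"
  unfolding N1d_def by (rule M_norm_eq[symmetric]) (use pos(2) in \<open>simp add: less_imp_le\<close>)

text \<open>Transfer from the tame weights of the locale to equivalent ones. The given weights are
  only compared monotonically, while every integral estimate takes place with the tame ones.\<close>

theorem extension:
  fixes \<omega>0 :: "('a \<times> 'a) \<times> ('a \<times> 'a) \<Rightarrow> real" and \<omega>1 \<omega>2 :: "'a \<times> 'a \<Rightarrow> real"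
  assumes e0: "\<And>z. w0 z \<le> \<omega>0 z" and D1: "D1 > 0" and e1: "\<And>z. w1 z \<le> \<omega>1 z" "\<And>z. \<omega>1 z \<le> D1 * w1 z"
    and D2: "D2 > 0" and e2: "\<And>z. w2 z \<le> \<omega>2 z" "\<And>z. \<omega>2 z \<le> D2 * w2 z"
  shows "\<exists>C>0. \<forall>a \<in> W_space p q \<omega>0. \<exists>T.
    linear_op (M_space q' p' \<omega>1) T \<and>
    extends_Sigma1 (M_space q' p' \<omega>1) (Op a) T \<and>
    norm_continuous (M_space q' p' \<omega>1) (M_norm q' p' \<omega>1) (W_space p q \<omega>2) (W_norm p q \<omega>2) T \<and>
    (\<forall>f \<in> M_space q' p' \<omega>1.
       W_norm p q \<omega>2 (T f) \<le> ennreal C * W_norm p q \<omega>0 a * M_norm q' p' \<omega>1 f) \<and>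
    (1 < p \<and> 1 < q \<longrightarrow>
       (\<forall>S. extends_Sigma1 (M_space q' p' \<omega>1) (Op a) S \<and>
            norm_continuous (M_space q' p' \<omega>1) (M_norm q' p' \<omega>1)
              (W_space p q \<omega>2) (W_norm p q \<omega>2) S \<longrightarrow>
            (\<forall>f \<in> M_space q' p' \<omega>1. S f = T f))) \<and>
    continuous_map
      (weak_topology (M_space q' p' \<omega>1) (M_space q p (\<lambda>z. 1 / \<omega>1 z)) L2_form)
      (weak_topology (W_space p q \<omega>2) Sigma1 (\<lambda>u g. u g)) T \<and>
    (\<forall>S. extends_Sigma1 (M_space q' p' \<omega>1) (Op a) S \<and>
         continuous_map
           (weak_topology (M_space q' p' \<omega>1) (M_space q p (\<lambda>z. 1 / \<omega>1 z)) L2_form)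
           (weak_topology (W_space p q \<omega>2) Sigma1 (\<lambda>u g. u g)) S \<longrightarrow>
         (\<forall>f \<in> M_space q' p' \<omega>1. S f = T f))"
proof -
  let ?X = "M_space q' p' \<omega>1" and ?Z = "M_space q p (\<lambda>z. 1 / \<omega>1 z)" and ?Y = "W_space p q \<omega>2"
  have pos1: "\<omega>1 z > 0" for z using pos(2)[of z] e1(1)[of z] by linarith
  have N1_le: "N1 u \<le> M_norm q' p' \<omega>1 u" for u
    unfolding N1_eq by (intro M_norm_mono p' q' e1)
  have N1_ge: "M_norm q' p' \<omega>1 u \<le> ennreal D1 * N1 u" if "u \<in> Sigma1'" for u
  proof -
    have "M_norm q' p' \<omega>1 u \<le> M_norm q' p' (\<lambda>z. D1 * w1 z) u" by (intro M_norm_mono p' q' e1)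
    also have "\<dots> \<le> ennreal D1 * M_norm q' p' w1 u"
      by (intro M_norm_cmult_le q' p' less_imp_le[OF pos(2)] D1 that) measurable
    finally show ?thesis unfolding N1_eq .
  qed
  have W2: "W_norm p q \<omega>2 u \<le> ennreal D2 * W_norm p q w2 u" if "u \<in> Sigma1'" for u
  proof -
    have "W_norm p q \<omega>2 u \<le> W_norm p q (\<lambda>z. D2 * w2 z) u" by (intro W_norm_mono p(1) q(1) e2)
    also have "\<dots> \<le> ennreal D2 * W_norm p q w2 u"
      by (intro W_norm_cmult_le q(1) p(1) less_imp_le[OF pos(3)] D2 that) measurable
    finally show ?thesis .
  qed
  \<comment> \<open>Both inequalities between the weights are used: equivalent weights give the same
    space, with comparable norms.\<close>
  have X: "u \<in> ?X \<longleftrightarrow> u \<in> Sigma1' \<and> N1 u < top" for u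
  proof -
    have "ennreal D1 * N1 u < top" if "N1 u < top" using that by (simp add: ennreal_mult_less_top)
    then show ?thesis
      unfolding M_space_def using N1_le[of u] N1_ge[of u] by (auto intro: order_le_less_trans)
  qed
  \<comment> \<open>Passing to reciprocals reverses the inequalities, so the roles of the two bounds
    are exchanged.\<close>
  have Z: "v \<in> ?Z \<longleftrightarrow> v \<in> Sigma1' \<and> N1d v < top" for v
  proof -
    have "M_norm q p (\<lambda>z. 1 / \<omega>1 z) v \<le> N1d v"
      unfolding N1d_eq using e1(1) pos(2) pos1 by (intro M_norm_mono p(1) q(1)) (simp add: frac_le)
    moreover have "N1d v \<le> ennreal D1 * M_norm q p (\<lambda>z. 1 / \<omega>1 z) v" if "v \<in> Sigma1'"
      unfolding N1d_eq
    proof (rule M_norm_le_cmult[OF q(1) p(1) _ _ D1 that])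
      show "1 / w1 z \<le> D1 * (1 / \<omega>1 z)" for z using e1(2)[of z] pos(2)[of z] pos1[of z] by (simp add: field_simps)
      show "0 \<le> 1 / w1 z" for z using pos(2)[of z] by simp
    qed measurable
    moreover have "ennreal D1 * M_norm q p (\<lambda>z. 1 / \<omega>1 z) v < top" if "M_norm q p (\<lambda>z. 1 / \<omega>1 z) v < top"
      using that by (simp add: ennreal_mult_less_top)
    ultimately show ?thesis unfolding M_space_def by (auto intro: order_le_less_trans)
  qed
  obtain C where C: "C > 0" "\<And>a u. admissible a u \<Longrightarrow> W_norm p q w2 (T a u) \<le> ennreal C * W_norm p q w0 a * N1 u"
    by (rule T_bound) (rule that)
  show ?thesis
  proof (intro exI[of _ "D2 * C"] conjI ballI)
    show "D2 * C > 0" using D2 C(1) by simp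
    fix a assume aW: "a \<in> W_space p q \<omega>0"
    have W0: "W_norm p q w0 a \<le> W_norm p q \<omega>0 a" by (intro W_norm_mono p(1) q(1) e0)
    have a: "a \<in> Sigma1'" "W_norm p q \<omega>0 a < top" "W_norm p q w0 a < top"
      using aW W0 unfolding W_space_def by (auto intro: order_le_less_trans)
    have adm: "admissible a u" if "u \<in> ?X" for u using that a unfolding X admissible_def by blast
    have bound: "W_norm p q \<omega>2 (T a u) \<le> ennreal (D2 * C) * W_norm p q \<omega>0 a * M_norm q' p' \<omega>1 u" if u: "admissible a u" for u
    proof -
      have "W_norm p q \<omega>2 (T a u) \<le> ennreal D2 * W_norm p q w2 (T a u)" by (rule W2[OF T_Sigma1'[OF u]])
      also have "\<dots> \<le> ennreal D2 * (ennreal C * W_norm p q \<omega>0 a * M_norm q' p' \<omega>1 u)"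
        by (intro mult_left_mono order_trans[OF C(2)[OF u]] mult_mono W0 N1_le) auto
      also have "\<dots> = ennreal (D2 * C) * W_norm p q \<omega>0 a * M_norm q' p' \<omega>1 u"
        using D2 C(1) by (simp add: ennreal_mult mult.assoc)
      finally show ?thesis .
    qed
    have fin: "ennreal (D2 * C) * W_norm p q \<omega>0 a < top" using a(2) by (simp add: ennreal_mult_less_top)
    have TY: "T a u \<in> ?Y" if u: "u \<in> ?X" for u
    proof -
      have "M_norm q' p' \<omega>1 u < top" using u unfolding M_space_def by simp
      then have "ennreal (D2 * C) * W_norm p q \<omega>0 a * M_norm q' p' \<omega>1 u < top" using fin by (simp add: ennreal_mult_less_top)
      then show ?thesis
        unfolding W_space_def using T_Sigma1'[OF adm[OF u]] bound[OF adm[OF u]] by (auto intro: order_le_less_trans)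
    qed
    have dX: "dist_of f \<in> ?X" if "f \<in> Sigma1" for f unfolding X using dist_of_Sigma1'[OF that] N1_dist_of[OF that] by blast
    have tX: "dist_of (trunc u k) \<in> ?X" if "u \<in> ?X" for u k
      using that by (intro dX trunc_Sigma1) (simp add: X)
    have extT: "extends_Sigma1 ?X (Op a) (T a)"
      unfolding extends_Sigma1_def using dX T_dist_of[OF a(1,3)] by blast
    have cont: "norm_continuous ?X (M_norm q' p' \<omega>1) ?Y (W_norm p q \<omega>2) (T a)"
      unfolding norm_continuous_def
    proof (intro conjI ballI allI impI)
      show "T a ` ?X \<subseteq> ?Y" using TY by blast
      fix u and \<epsilon> :: real assume u: "u \<in> ?X" and \<epsilon>: "\<epsilon> > 0"
      \<comment> \<open>Finite since \<open>a\<close> has finite norm. Dividing by K + 1 below keeps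
        the quotient defined and the final inequality strict even if K = 0.\<close>
      define K where "K = enn2real (ennreal (D2 * C) * W_norm p q \<omega>0 a)"
      have K: "ennreal (D2 * C) * W_norm p q \<omega>0 a = ennreal K" "K \<ge> 0" unfolding K_def using fin by auto
      show "\<exists>\<delta>>0. \<forall>w\<in>?X. M_norm q' p' \<omega>1 (\<lambda>g. w g - u g) < ennreal \<delta> \<longrightarrow> W_norm p q \<omega>2 (\<lambda>g. T a w g - T a u g) < ennreal \<epsilon>"
      proof (intro exI[of _ "\<epsilon> / (K + 1)"] conjI ballI impI)
        show "\<epsilon> / (K + 1) > 0" using \<epsilon> K(2) by simp
        fix w assume w: "w \<in> ?X" and lt: "M_norm q' p' \<omega>1 (\<lambda>g. w g - u g) < ennreal (\<epsilon> / (K + 1))"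
        have "(\<lambda>g. w g - u g) \<in> Sigma1'" using u w by (intro Sigma1'_diff) (simp_all add: X)
        moreover have "N1 (\<lambda>g. w g - u g) < top"
          using N1_le[of "\<lambda>g. w g - u g"] lt by (meson ennreal_less_top order_le_less_trans order_less_trans)
        ultimately have d: "admissible a (\<lambda>g. w g - u g)" using a unfolding admissible_def by blast
        have "W_norm p q \<omega>2 (\<lambda>g. T a w g - T a u g) \<le> ennreal K * M_norm q' p' \<omega>1 (\<lambda>g. w g - u g)"
          using bound[OF d] unfolding T_diff[OF adm[OF w] adm[OF u]] K(1) .
        also have "\<dots> \<le> ennreal K * ennreal (\<epsilon> / (K + 1))" using lt by (intro mult_left_mono) auto
        also have "\<dots> = ennreal (K * (\<epsilon> / (K + 1)))" using K(2) \<epsilon> by (intro ennreal_mult[symmetric]) auto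
        also have "\<dots> < ennreal \<epsilon>" using K(2) \<epsilon> by (intro ennreal_lessI) (auto simp: field_simps)
        finally show "W_norm p q \<omega>2 (\<lambda>g. T a w g - T a u g) < ennreal \<epsilon>" .
      qed
    qed
    \<comment> \<open>The common end of both uniqueness proofs. The two extensions agree on every
      truncation, so equality at f follows from convergence against each test function; outside
      \<open>Sigma1\<close> both functionals vanish by convention.\<close>
    have eqI: "S f = T a f" if S: "extends_Sigma1 ?X (Op a) S" and f: "f \<in> ?X" and SY: "S f \<in> ?Y"
      and limS: "\<And>g. g \<in> Sigma1 \<Longrightarrow> (\<lambda>k. S (dist_of (trunc f k)) g) \<longlonglongrightarrow> S f g"
      and limT: "\<And>g. g \<in> Sigma1 \<Longrightarrow> (\<lambda>k. T a (dist_of (trunc f k)) g) \<longlonglongrightarrow> T a f g" for S f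
    proof
      fix g
      show "S f g = T a f g"
      proof (cases "g \<in> Sigma1")
        case True
        have fS: "trunc f k \<in> Sigma1" for k using f by (intro trunc_Sigma1) (simp add: X)
        have e: "S (dist_of (trunc f k)) = T a (dist_of (trunc f k))" for k
          using conjunct2[OF bspec[OF S[unfolded extends_Sigma1_def] fS]] conjunct2[OF bspec[OF extT[unfolded extends_Sigma1_def] fS]]
          by (simp only:)
        show ?thesis by (rule LIMSEQ_unique[OF limS[OF True] limT[OF True, folded e]])
      next
        case False
        then show ?thesis using SY TY[OF f] unfolding W_space_def Sigma1'_def by simp
      qed
    qed
    \<comment> \<open>Norm approximation by truncations, norm continuity of \<open>R\<close>, and
      \<open>evaluation_bound\<close> to descend to a single test function.\<close>
    have norm_lim: "(\<lambda>k. R (dist_of (trunc f k)) g) \<longlonglongrightarrow> R f g"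
      if R: "norm_continuous ?X (M_norm q' p' \<omega>1) ?Y (W_norm p q \<omega>2) R" and f: "f \<in> ?X" and g: "g \<in> Sigma1" and fp: "p' \<noteq> top" "q' \<noteq> top" for R f g
    proof -
      let ?f = "\<lambda>k. dist_of (trunc f k)"
      have fS: "f \<in> Sigma1'" "N1 f < top" using f by (simp_all add: X)
      have RY: "R u \<in> Sigma1'" if "u \<in> ?X" for u using conjunct1[OF R[unfolded norm_continuous_def]] that unfolding W_space_def by blast
      have dS: "(\<lambda>h. ?f k h - f h) \<in> Sigma1'" for k
        using tX[OF f, of k] fS by (intro Sigma1'_diff) (simp_all add: X)
      have "(\<lambda>k. ennreal D1 * N1 (\<lambda>h. ?f k h - f h)) \<longlonglongrightarrow> ennreal D1 * 0"
        by (intro ennreal_tendsto_cmult trunc_norm fS fp) auto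
      then have l1: "(\<lambda>k. ennreal D1 * N1 (\<lambda>h. ?f k h - f h)) \<longlonglongrightarrow> 0" by simp
      have l2: "(\<lambda>k. M_norm q' p' \<omega>1 (\<lambda>h. ?f k h - f h)) \<longlonglongrightarrow> 0"
        by (rule tendsto_sandwich[OF _ _ tendsto_const l1]) (simp_all add: N1_ge dS)
      obtain K where K: "K \<ge> 0" "\<And>v. v \<in> Sigma1' \<Longrightarrow> ennreal (cmod (v g)) \<le> ennreal K * W_norm p q w2 v"
        by (rule evaluation_bound[OF g]) (rule that)
      show ?thesis
      proof (rule LIMSEQ_I)
        fix r :: real assume r: "r > 0"
        define \<epsilon> where "\<epsilon> = r / (K + 1)"
        have \<epsilon>: "\<epsilon> > 0" unfolding \<epsilon>_def using r K(1) by simp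
        obtain \<delta> where \<delta>: "\<delta> > 0" "\<And>w. w \<in> ?X \<Longrightarrow> M_norm q' p' \<omega>1 (\<lambda>g. w g - f g) < ennreal \<delta> \<Longrightarrow> W_norm p q \<omega>2 (\<lambda>g. R w g - R f g) < ennreal \<epsilon>"
          using conjunct2[OF R[unfolded norm_continuous_def]] f \<epsilon> by meson
        have "\<forall>\<^sub>F k in sequentially. M_norm q' p' \<omega>1 (\<lambda>h. ?f k h - f h) < ennreal \<delta>"
          using l2 \<delta>(1) by (intro order_tendstoD) auto
        then obtain N where N: "\<And>k. k \<ge> N \<Longrightarrow> M_norm q' p' \<omega>1 (\<lambda>h. ?f k h - f h) < ennreal \<delta>"
          unfolding eventually_sequentially by blast
        have "norm (R (?f k) g - R f g) < r" if k: "k \<ge> N" for k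
        proof -
          have "W_norm p q w2 (\<lambda>g. R (?f k) g - R f g) \<le> W_norm p q \<omega>2 (\<lambda>g. R (?f k) g - R f g)"
            by (intro W_norm_mono p(1) q(1) e2)
          also have "\<dots> \<le> ennreal \<epsilon>" using \<delta>(2)[OF tX[OF f] N[OF k]] by simp
          finally have "ennreal K * W_norm p q w2 (\<lambda>g. R (?f k) g - R f g) \<le> ennreal K * ennreal \<epsilon>" by (intro mult_left_mono) auto
          with K(2)[OF Sigma1'_diff[OF RY[OF tX[OF f]] RY[OF f]]]
          have "ennreal (cmod (R (?f k) g - R f g)) \<le> ennreal K * ennreal \<epsilon>" by (rule order_trans)
          also have "\<dots> = ennreal (K * \<epsilon>)" using K(1) \<epsilon> by (simp add: ennreal_mult)
          finally have "cmod (R (?f k) g - R f g) \<le> K * \<epsilon>" using K(1) \<epsilon> by (subst (asm) ennreal_le_iff) auto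
          also have "\<dots> < r" unfolding \<epsilon>_def using r K(1) by (simp add: field_simps)
          finally show ?thesis .
        qed
        then show "\<exists>N. \<forall>k\<ge>N. norm (R (?f k) g - R f g) < r" by blast
      qed
    qed
    let ?TX = "weak_topology ?X ?Z L2_form" and ?TY = "weak_topology ?Y Sigma1 (\<lambda>u g. u g)"
    have weak: "continuous_map ?TX ?TY (T a)"
    proof (rule continuous_map_weakI)
      show "T a u \<in> ?Y" if "u \<in> topspace ?TX" for u using that TY by simp
      fix g :: "'a \<Rightarrow> complex" assume g: "g \<in> Sigma1"
      have "vdual a g \<in> ?Z" unfolding Z using vdual_Sigma1'[OF a(1,3) g] N1d_vdual[OF a(1,3) g] by blast
      then show "continuous_map ?TX euclidean (\<lambda>u. T a u g)"
        by (rule continuous_map_eq[OF continuous_map_weak_evaluation]) (use adm in \<open>simp add: T_eq_L2_form[OF _ g]\<close>)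
    qed
    \<comment> \<open>Truncations converge in the weak topology for all exponents, and evaluation at
      a test function is continuous on the target by construction.\<close>
    have weak_lim: "(\<lambda>k. R (dist_of (trunc f k)) g) \<longlonglongrightarrow> R f g"
      if R: "continuous_map ?TX ?TY R" and f: "f \<in> ?X" and g: "g \<in> Sigma1" for R f g
    proof -
      have "limitin ?TX (\<lambda>k. dist_of (trunc f k)) f sequentially"
        by (rule limitin_weak_topology[OF f tX[OF f]]) (use f trunc_weak in \<open>simp add: X Z\<close>)
      from continuous_map_limit[OF continuous_map_compose[OF R continuous_map_weak_evaluation[OF g]] this]
      show ?thesis by (simp add: o_def)
    qed
    show "\<exists>T. linear_op ?X T \<and> extends_Sigma1 ?X (Op a) T \<and>
      norm_continuous ?X (M_norm q' p' \<omega>1) ?Y (W_norm p q \<omega>2) T \<and>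
      (\<forall>f \<in> ?X. W_norm p q \<omega>2 (T f) \<le> ennreal (D2 * C) * W_norm p q \<omega>0 a * M_norm q' p' \<omega>1 f) \<and>
      (1 < p \<and> 1 < q \<longrightarrow> (\<forall>S. extends_Sigma1 ?X (Op a) S \<and>
        norm_continuous ?X (M_norm q' p' \<omega>1) ?Y (W_norm p q \<omega>2) S \<longrightarrow> (\<forall>f \<in> ?X. S f = T f))) \<and>
      continuous_map ?TX ?TY T \<and>
      (\<forall>S. extends_Sigma1 ?X (Op a) S \<and> continuous_map ?TX ?TY S \<longrightarrow> (\<forall>f \<in> ?X. S f = T f))"
    proof (intro exI[of _ "T a"] conjI allI impI extT cont weak)
      show "linear_op ?X (T a)"
        unfolding linear_op_def
      proof (intro conjI ballI allI)
        show "T a (\<lambda>g. u g + v g) = (\<lambda>g. T a u g + T a v g)" if "u \<in> ?X" "v \<in> ?X" for u v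
          by (rule T_linear(1)[OF adm[OF that(1)] adm[OF that(2)]])
        show "T a (\<lambda>g. c * u g) = (\<lambda>g. c * T a u g)" if "u \<in> ?X" for c u
          by (rule T_linear(2)[OF adm[OF that] adm[OF that]])
      qed
      show "\<forall>f\<in>?X. W_norm p q \<omega>2 (T a f) \<le> ennreal (D2 * C) * W_norm p q \<omega>0 a * M_norm q' p' \<omega>1 f"
        by (intro ballI bound adm)
    next
      fix S assume pq: "1 < p \<and> 1 < q"
        and S: "extends_Sigma1 ?X (Op a) S \<and> norm_continuous ?X (M_norm q' p' \<omega>1) ?Y (W_norm p q \<omega>2) S"
      \<comment> \<open>The conjugate exponent is infinite only for p = 1, which the assumption of
        this clause excludes.\<close>
      have p1: "p' \<noteq> top" using p
      proof (cases rule: conjugate_exponent_cases)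
        case one
        then show ?thesis using pq by simp
      next
        case (real r r')
        show ?thesis by (rule real(7))
      qed simp
      have q1: "q' \<noteq> top" using q
      proof (cases rule: conjugate_exponent_cases)
        case one
        then show ?thesis using pq by simp
      next
        case (real r r')
        show ?thesis by (rule real(7))
      qed simp
      show "\<forall>f\<in>?X. S f = T a f"
      proof
        fix f assume f: "f \<in> ?X"
        have SY: "S f \<in> ?Y" by (rule subsetD[OF conjunct1[OF conjunct2[OF S, unfolded norm_continuous_def]] imageI[OF f]])
        show "S f = T a f"
        proof (rule eqI[where S=S and f=f, OF conjunct1[OF S] f SY])
          show "(\<lambda>k. S (dist_of (trunc f k)) g) \<longlonglongrightarrow> S f g" if "g \<in> Sigma1" for g
            by (rule norm_lim[where R=S and f=f and g=g, OF conjunct2[OF S] f that p1 q1])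
          show "(\<lambda>k. T a (dist_of (trunc f k)) g) \<longlonglongrightarrow> T a f g" if "g \<in> Sigma1" for g
            by (rule norm_lim[where R="T a" and f=f and g=g, OF cont f that p1 q1])
        qed
      qed
    next
      fix S assume S: "extends_Sigma1 ?X (Op a) S \<and> continuous_map ?TX ?TY S"
      show "\<forall>f\<in>?X. S f = T a f"
      proof
        fix f assume f: "f \<in> ?X"
        have SY: "S f \<in> ?Y" by (rule subsetD[OF continuous_map_image_subset_topspace[OF conjunct2[OF S], unfolded topspace_weak_topology] imageI[OF f]])
        show "S f = T a f"
        proof (rule eqI[where S=S and f=f, OF conjunct1[OF S] f SY])
          show "(\<lambda>k. S (dist_of (trunc f k)) g) \<longlonglongrightarrow> S f g" if "g \<in> Sigma1" for g
            by (rule weak_lim[where R=S and f=f and g=g, OF conjunct2[OF S] f that])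
          show "(\<lambda>k. T a (dist_of (trunc f k)) g) \<longlonglongrightarrow> T a f g" if "g \<in> Sigma1" for g
            by (rule weak_lim[where R="T a" and f=f and g=g, OF weak f that])
        qed
      qed
    qed
  qed
qed

end

text \<open>The constant is quantified before the symbol because the estimate is to be uniform in
  \<open>a\<close>. Norm uniqueness is asserted where p' and q' are finite and test functions are
  norm dense; for all exponents uniqueness holds in the weak topology, and the same extension is
  continuous in both senses.\<close>

theorem theorem4p9:
  fixes \<omega>1 \<omega>2 :: "(real ^ 'd) \<times> (real ^ 'd) \<Rightarrow> real"
    and \<omega>0 :: "((real ^ 'd) \<times> (real ^ 'd)) \<times> ((real ^ 'd) \<times> (real ^ 'd)) \<Rightarrow> real"
    and p q p' q' :: ennreal
  assumes "moderate_weight \<omega>1" and "moderate_weight \<omega>2" and "moderate_weight \<omega>0"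
    and "\<exists>C>0. \<forall>x y \<xi> \<eta>. \<omega>2 (x, \<xi> + \<eta>) / \<omega>1 (x + y, \<xi>) \<le> C * \<omega>0 ((x, \<xi>), (\<eta>, y))"
    and "1 \<le> p" and "1 \<le> q"
    and "1 / p + 1 / p' = 1" and "1 / q + 1 / q' = 1"
  shows "\<exists>C>0. \<forall>a \<in> W_space p q \<omega>0. \<exists>T.
    linear_op (M_space q' p' \<omega>1) T \<and>
    extends_Sigma1 (M_space q' p' \<omega>1) (Op a) T \<and>
    norm_continuous (M_space q' p' \<omega>1) (M_norm q' p' \<omega>1) (W_space p q \<omega>2) (W_norm p q \<omega>2) T \<and>
    (\<forall>f \<in> M_space q' p' \<omega>1.
       W_norm p q \<omega>2 (T f) \<le> ennreal C * W_norm p q \<omega>0 a * M_norm q' p' \<omega>1 f) \<and>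
    (1 < p \<and> 1 < q \<longrightarrow>
       (\<forall>S. extends_Sigma1 (M_space q' p' \<omega>1) (Op a) S \<and>
            norm_continuous (M_space q' p' \<omega>1) (M_norm q' p' \<omega>1)
              (W_space p q \<omega>2) (W_norm p q \<omega>2) S \<longrightarrow>
            (\<forall>f \<in> M_space q' p' \<omega>1. S f = T f))) \<and>
    continuous_map
      (weak_topology (M_space q' p' \<omega>1) (M_space q p (\<lambda>z. 1 / \<omega>1 z)) L2_form)
      (weak_topology (W_space p q \<omega>2) Sigma1 (\<lambda>u g. u g)) T \<and>
    (\<forall>S. extends_Sigma1 (M_space q' p' \<omega>1) (Op a) S \<and>
         continuous_map
           (weak_topology (M_space q' p' \<omega>1) (M_space q p (\<lambda>z. 1 / \<omega>1 z)) L2_form)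
           (weak_topology (W_space p q \<omega>2) Sigma1 (\<lambda>u g. u g)) S \<longrightarrow>
         (\<forall>f \<in> M_space q' p' \<omega>1. S f = T f))"
proof -
  obtain D1 r1 w1 where 1: "D1 \<ge> 1" "tame_weight r1 w1" "\<And>x. w1 x \<le> \<omega>1 x" "\<And>x. \<omega>1 x \<le> D1 * w1 x"
    by (rule moderate_weight_tame[OF assms(1)]) (rule that)
  obtain D2 r2 w2 where 2: "D2 \<ge> 1" "tame_weight r2 w2" "\<And>x. w2 x \<le> \<omega>2 x" "\<And>x. \<omega>2 x \<le> D2 * w2 x"
    by (rule moderate_weight_tame[OF assms(2)]) (rule that)
  obtain D0 r0 w0 where 0: "D0 \<ge> 1" "tame_weight r0 w0" "\<And>x. w0 x \<le> \<omega>0 x" "\<And>x. \<omega>0 x \<le> D0 * w0 x"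
    by (rule moderate_weight_tame[OF assms(3)]) (rule that)
  obtain C where C: "C > 0" "\<And>x y \<xi> \<eta>. \<omega>2 (x, \<xi> + \<eta>) / \<omega>1 (x + y, \<xi>) \<le> C * \<omega>0 ((x, \<xi>), (\<eta>, y))"
    using assms(4) by blast
  have pos: "w0 Z > 0" "w1 z > 0" for Z z
    by (rule tame_weight_pos[OF 0(2)], rule tame_weight_pos[OF 1(2)])
  \<comment> \<open>Passing to tame minorants costs D0 for \<open>w0\<close> and D1 for
    \<open>w1\<close> on the right-hand side; on the left \<open>w2\<close> lies below the given
    weight, so D2 does not enter.\<close>
  interpret pdo p q p' q' w0 w1 w2 r0 r1 r2 "C * D0 * D1"
  proof
    show "C * D0 * D1 > 0" using C(1) 0(1) 1(1) by simp
    fix z w :: "(real ^ 'd) \<times> (real ^ 'd)"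
    have pw: "\<omega>1 w > 0" using pos(2)[of w] 1(3)[of w] by linarith
    have "\<omega>2 z / \<omega>1 w \<le> C * \<omega>0 (kap z w)"
      using C(2)[of "fst z" "snd w" "snd z - snd w" "fst w - fst z"] by (simp add: kap_def)
    then have "\<omega>2 z \<le> C * \<omega>0 (kap z w) * \<omega>1 w" using pw by (simp add: field_simps)
    also have "\<dots> \<le> C * (D0 * w0 (kap z w)) * (D1 * w1 w)"
      using C(1) 0(1) 1(1) pos(1)[of "kap z w"] pos(2)[of w] pw 0(3,4)[of "kap z w"] 1(4)[of w]
      by (intro mult_mono) auto
    finally show "w2 z \<le> C * D0 * D1 * (w0 (kap z w) * w1 w)"
      using 2(3)[of z] by (simp add: mult_ac)
  qed (fact assms 0 1 2)+
  show ?thesis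
    by (rule extension[OF 0(3) _ 1(3,4) _ 2(3,4)]) (use 1(1) 2(1) in auto)
qed

end
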